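(* Let $(I\times F,g^f=-d\tau^2+f^2g)$ be a GRW spacetime with strongly convex fiber $(F,g)$. Then: (i) Each two causally related points can be joined with exactly one geodesic (up to reparametrization), and this geodesic is necessarily non-spacelike. (ii) The GRW spacetime is geodesically connected (i.e. each two of its points can be joined by a geodesic) if and only if either Condition (C) or Condition (R) holds.
   Context: **GRW spacetime.** $(F,g)$ is a connected Riemannian manifold with distance $d$ and diameter $\mathrm{diam}(F)\in(0,\infty]$; $I=(a,b)\subseteq\mathbb{R}$ is an open interval, $-\infty\le a<b\le\infty$; $f:I\to(0,\infty)$ is smooth. The GRW spacetime is $I\times F$ with the Lorentz metric $g^f=-d\tau^2+f(\tau)^2g$, time-oriented by $\partial/\partial\tau$. $(F,g)$ is *strongly convex* if any two of its points can be joined by a geodesic which minimizes the distance and this geodesic is the only one which joins the two points. A vector $X$ is timelike, lightlike, causal (= non-spacelike), spacelike if $g^f(X,X)<0$, $=0$, $\le0$, $>0$ respectively. Two points $z,z'$ are *causally related* if they can be joined ($z$ with $z'$ or vice versa) by a future-pointing non-spacelike piecewise smooth curve. **Turning points.** For a base point $\tau_0\in I$ and $D\in\mathbb{R}$ with $1/f^2(\tau_0)\ge D$ put $A_+=\{\tau\in(a,b):\tau\ge\tau_0,\ 1/f^2(\tau)=D\}\cup\{b\}$ and $A_-=\{\tau\in(a,b):\tau\le\tau_0,\ 1/f^2(\tau)=D\}\cup\{a\}$. Define $a_*=a_*(D)$, $b_*=b_*(D)$ as follows: if $\frac{d}{d\tau}\frac1{f^2}(\tau_0)>0$, $b_*=\min(A_+\setminus\{\tau_0\})$,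 $a_*=\max A_-$; if it is $<0$, $b_*=\min A_+$, $a_*=\max(A_-\setminus\{\tau_0\})$; if it is $0$, $b_*=\min A_+$, $a_*=\max A_-$. **Relative minima at the extremes.** Put $m_b=\liminf_{\tau\to b}1/f^2(\tau)$, $m_a=\liminf_{\tau\to a}1/f^2(\tau)$, $m=\inf_{(a,b)}1/f^2$. The function $1/f^2$ *reaches a relative minimum at $b$* if: when $b<\infty$, there is $\epsilon>0$ with $1/f^2(b-\epsilon')>m_b$ for all $0<\epsilon'<\epsilon$; when $b=\infty$, there is $M>0$ with $1/f^2(M')>m_b$ for all $M'>M$. Analogously at $a$ (with $a+\epsilon'$, resp. $-M'$, and $m_a$). A point $c$ is *close to* $b$ if $c\in(b-\epsilon,b)$ (resp. $c>M$) with such $\epsilon$, $M$; analogously for $a$. **The numbers $d_b,d_a$.** If $1/f^2$ reaches a relative minimum at $b$ and $\int_c^b f^{-2}(\frac1{f^2}-m_b)^{-1/2}d\tau<\infty$ for some $c$ close to $b$, define $$d_b=\limsup_{D\to m_b}\Big(\int_c^{b_*(D)}f^{-2}\big(\tfrac1{f^2}-D\big)^{-1/2}d\tau\Big)-\int_c^bf^{-2}\big(\tfrac1{f^2}-m_b\big)^{-1/2}d\tau\in[0,\infty]$$ ($b_*(D)$ taken with base point $c$; this is independent of $c$). Analogously, when $1/f^2$ reaches a relative minimum at $a$ and $\int_a^cf^{-2}(\frac1{f^2}-m_a)^{-1/2}<\infty$, $d_a=\limsup_{D\to m_a}\big(\int_{a_*(D)}^{c}f^{-2}(\frac1{f^2}-D)^{-1/2}\big)-\int_a^cf^{-2}(\frac1{f^2}-m_a)^{-1/2}$.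 **The numbers $i_b,i_a$.** If moreover $2d_b<\mathrm{diam}(F)$ and $m<m_b$, define $i_b=\inf_{D\in(m,m_b]}\int_{a_*(D)}^{b}f^{-2}(\frac1{f^2}-D)^{-1/2}d\tau$, with $a_*(D)$ taken with a base point $\tau_0$ close to $b$ (independent of the choice). Analogously, if $2d_a<\mathrm{diam}(F)$ and $m<m_a$, $i_a=\inf_{D\in(m,m_a]}\int_a^{b_*(D)}f^{-2}(\frac1{f^2}-D)^{-1/2}d\tau$ with base point close to $a$. **Condition (C)** holds if, at the extreme $b$, one of the following holds: $1/f^2$ does not reach a relative minimum at $b$; or $\int_c^bf^{-2}(\frac1{f^2}-m_b)^{-1/2}=\infty$ for some $c$ close to $b$; or $2d_b\ge\mathrm{diam}(F)$; or $i_b$ is defined and $d_b\ge i_b$; and the analogous alternative holds at $a$ (with $\int_a^c f^{-2}(\frac1{f^2}-m_a)^{-1/2}$, $d_a$, $i_a$). **Condition (R).** Suppose $1/f^2>m$ on $(a,b)$ and $m_a=m_b=m$. For $\tau_0\in I$ and $D>m$ near $m$, with $a_*,b_*$ computed from base point $\tau_0$ and $h=f^{-2}(\frac1{f^2}-D)^{-1/2}$, put $R=\int_{\tau_0}^{b_*}h$, $\Lambda=\int_{a_*}^{\tau_0}h$, $W=\Lambda+R$. For $n\ge0$, let $E_n=R$ if $n$ is even and $E_n=\Lambda$ if $n$ is odd; let $G_n=\Lambda$ if $n$ is even and $G_n=R$ if $n$ is odd. For $n\ge1$ define $r_i^n(\tau_0)=\lim_{\epsilon\searrow0}\liminf_{D\searrow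 m}\{E_n+(n-1)W+\int_{a_*}^{b-\epsilon}h\}$ and $l_i^n(\tau_0)=\lim_{\epsilon\searrow0}\liminf_{D\searrow m}\{G_n+(n-1)W+\int_{a+\epsilon}^{b_*}h\}$; put $r_i^0(\tau_0)=\lim_{\epsilon\searrow0}\liminf_{D\searrow m}\int_{\tau_0}^{b-\epsilon}h$ and $l_i^0(\tau_0)=\lim_{\epsilon\searrow0}\liminf_{D\searrow m}\int_{a+\epsilon}^{\tau_0}h$; and for $n\ge0$ $r_s^n(\tau_0)=\lim_{\epsilon\searrow0}\limsup_{D\searrow m}\{E_n+nW+\int_{b-\epsilon}^{b_*}h\}$, $l_s^n(\tau_0)=\lim_{\epsilon\searrow0}\limsup_{D\searrow m}\{G_n+nW+\int_{a_*}^{a+\epsilon}h\}$. (If $b=\infty$, resp. $a=-\infty$, replace $b-\epsilon$ by $M$, resp. $a+\epsilon$ by $-M$, and $\epsilon\searrow0$ by $M\to\infty$.) Condition (R) holds if $1/f^2>m$ on $(a,b)$, $m_a=m_b=m$ and, for every $\tau_0\in I$, $$[r_i^0(\tau_0),\mathrm{diam}(F)]\subseteq\bigcup_{n\ge0}[r_i^n(\tau_0),r_s^n(\tau_0)],\qquad [l_i^0(\tau_0),\mathrm{diam}(F)]\subseteq\bigcup_{n\ge0}[l_i^n(\tau_0),l_s^n(\tau_0)],$$ where the intervals are sets of (finite) real numbers and an interval is empty if its left end exceeds its right end. *)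

theory Defs
  imports "HOL-Analysis.Analysis"
begin

section \<open>Smooth maps\<close>

text \<open>
  Derivatives are taken within \<open>S\<close>. In use, \<open>S\<close> is open or a relatively open subset of a
  nondegenerate compact interval (one-sided derivatives at the end points), so they are unique.
\<close>

primrec Ck_on :: "nat \<Rightarrow> ('a::euclidean_space \<Rightarrow> 'b::real_normed_vector) \<Rightarrow> 'a set \<Rightarrow> bool" where
  "Ck_on 0 f S = continuous_on S f"
| "Ck_on (Suc k) f S =
    (\<exists>f'. (\<forall>x\<in>S. (f has_derivative f' x) (at x within S)) \<and> (\<forall>v. Ck_on k (\<lambda>x. f' x v) S))"

definition smooth_on :: "('a::euclidean_space \<Rightarrow> 'b::real_normed_vector) \<Rightarrow> 'a set \<Rightarrow> bool" where
  "smooth_on f S \<longleftrightarrow> (\<forall>k. Ck_on k f S)"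


section \<open>Semi-Riemannian manifolds\<close>

text \<open>
  A manifold is a subset \<open>pts\<close> of a topological space with an indexed atlas: chart \<open>i\<close> is the map
  \<open>crd i\<close> on \<open>cdom i\<close>. A tangent vector is given by its components in a chart, and
  \<open>met i x u v\<close> is the metric, in chart \<open>i\<close>, at the point with coordinates \<open>x\<close>, applied to the
  vectors with components \<open>u\<close> and \<open>v\<close>.
\<close>

record ('i, 'm, 'e) srmfd =
  pts :: "'m set"
  ind :: "'i set"
  cdom :: "'i \<Rightarrow> 'm set"
  crd :: "'i \<Rightarrow> 'm \<Rightarrow> 'e"
  met :: "'i \<Rightarrow> 'e \<Rightarrow> 'e \<Rightarrow> 'e \<Rightarrow> real"

definition transition :: "('i, 'm, 'e) srmfd \<Rightarrow> 'i \<Rightarrow> 'i \<Rightarrow> 'e \<Rightarrow> 'e" where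
  "transition X i j = crd X j \<circ> inv_into (cdom X i) (crd X i)"

definition smooth_manifold ::
    "('i, 'm::{t2_space, second_countable_topology}, 'e::euclidean_space) srmfd \<Rightarrow> bool" where
  "smooth_manifold X \<longleftrightarrow>
    pts X = (\<Union>i\<in>ind X. cdom X i) \<and>
    (\<forall>i\<in>ind X.
      openin (top_of_set (pts X)) (cdom X i) \<and>
      open (crd X i ` cdom X i) \<and>
      homeomorphism (cdom X i) (crd X i ` cdom X i) (crd X i) (inv_into (cdom X i) (crd X i))) \<and>
    (\<forall>i\<in>ind X. \<forall>j\<in>ind X. smooth_on (transition X i j) (crd X i ` (cdom X i \<inter> cdom X j)))"

definition semi_riemannian_manifold ::
    "('i, 'm::{t2_space, second_countable_topology}, 'e::euclidean_space) srmfd \<Rightarrow> bool" where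
  "semi_riemannian_manifold X \<longleftrightarrow>
    smooth_manifold X \<and>
    (\<forall>i\<in>ind X. \<forall>x\<in>crd X i ` cdom X i.
      bilinear (met X i x) \<and>
      (\<forall>u v. met X i x u v = met X i x v u) \<and>
      (\<forall>u. (\<forall>v. met X i x u v = 0) \<longrightarrow> u = 0)) \<and>
    (\<forall>i\<in>ind X. \<forall>u v. smooth_on (\<lambda>x. met X i x u v) (crd X i ` cdom X i)) \<and>
    (\<forall>i\<in>ind X. \<forall>j\<in>ind X. \<forall>p\<in>cdom X i \<inter> cdom X j. \<forall>u v.
      met X i (crd X i p) u v =
      met X j (crd X j p)
        (frechet_derivative (transition X i j) (at (crd X i p)) u)
        (frechet_derivative (transition X i j) (at (crd X i p)) v))"

definition riemannian_manifold ::
    "('i, 'm::{t2_space, second_countable_topology}, 'e::euclidean_space) srmfd \<Rightarrow> bool" where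
  "riemannian_manifold X \<longleftrightarrow>
    semi_riemannian_manifold X \<and>
    (\<forall>i\<in>ind X. \<forall>x\<in>crd X i ` cdom X i. \<forall>u. u \<noteq> 0 \<longrightarrow> met X i x u u > 0)"


section \<open>Curves and geodesics\<close>

definition smooth_curve ::
    "('i, 'm::topological_space, 'e::euclidean_space) srmfd \<Rightarrow> real set \<Rightarrow> (real \<Rightarrow> 'm) \<Rightarrow> bool" where
  "smooth_curve X S \<gamma> \<longleftrightarrow>
    \<gamma> ` S \<subseteq> pts X \<and> continuous_on S \<gamma> \<and>
    (\<forall>i\<in>ind X. smooth_on (crd X i \<circ> \<gamma>) {t\<in>S. \<gamma> t \<in> cdom X i})"

definition velocity ::
    "('i, 'm, 'e::real_normed_vector) srmfd \<Rightarrow> 'i \<Rightarrow> (real \<Rightarrow> 'm) \<Rightarrow> real set \<Rightarrow> real \<Rightarrow> 'e" where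
  "velocity X i \<gamma> S t = vector_derivative (\<lambda>s. crd X i (\<gamma> s)) (at t within S)"

text \<open>
  A chart around a point; the quantities below that are computed in it do not depend on the choice.
\<close>

definition chart_at :: "('i, 'm, 'e) srmfd \<Rightarrow> 'm \<Rightarrow> 'i" where
  "chart_at X p = (SOME i. i \<in> ind X \<and> p \<in> cdom X i)"

definition velocity_sq ::
    "('i, 'm, 'e::real_normed_vector) srmfd \<Rightarrow> (real \<Rightarrow> 'm) \<Rightarrow> real set \<Rightarrow> real \<Rightarrow> real" where
  "velocity_sq X \<gamma> S t =
    (let i = chart_at X (\<gamma> t)
     in met X i (crd X i (\<gamma> t)) (velocity X i \<gamma> S t) (velocity X i \<gamma> S t))"

text \<open>
  The components in chart \<open>i\<close> of the Levi-Civita derivative \<open>\<nabla>\<^sub>u v\<close> of a field with constant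
  components \<open>v\<close>, characterized by the Koszul formula; unique because \<open>met\<close> is nondegenerate.
\<close>

definition christoffel ::
    "('i, 'm, 'e::real_normed_vector) srmfd \<Rightarrow> 'i \<Rightarrow> 'e \<Rightarrow> 'e \<Rightarrow> 'e \<Rightarrow> 'e" where
  "christoffel X i x u v =
    (THE z. \<forall>w. met X i x z w =
      (frechet_derivative (\<lambda>y. met X i y v w) (at x) u
       + frechet_derivative (\<lambda>y. met X i y u w) (at x) v
       - frechet_derivative (\<lambda>y. met X i y u v) (at x) w) / 2)"

definition geodesic ::
    "('i, 'm::topological_space, 'e::euclidean_space) srmfd \<Rightarrow> real set \<Rightarrow> (real \<Rightarrow> 'm) \<Rightarrow> bool" where
  "geodesic X S \<gamma> \<longleftrightarrow>
    smooth_curve X S \<gamma> \<and>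
    (\<forall>i\<in>ind X. \<forall>t\<in>S. \<gamma> t \<in> cdom X i \<longrightarrow>
      vector_derivative (velocity X i \<gamma> S) (at t within S)
      + christoffel X i (crd X i (\<gamma> t)) (velocity X i \<gamma> S t) (velocity X i \<gamma> S t) = 0)"

text \<open>
  Geodesics satisfy the affinely parametrized equation, so normalizing the parameter interval to
  \<open>{0..1}\<close> leaves exactly one representative of each class of geodesics from \<open>p\<close> to \<open>q\<close>
  modulo reparametrization. A constant curve is a geodesic from \<open>p\<close> to \<open>p\<close>.
\<close>

definition geodesic_joins ::
    "('i, 'm::topological_space, 'e::euclidean_space) srmfd \<Rightarrow> (real \<Rightarrow> 'm) \<Rightarrow> 'm \<Rightarrow> 'm \<Rightarrow> bool" where
  "geodesic_joins X \<gamma> p q \<longleftrightarrow> geodesic X {0..1} \<gamma> \<and> \<gamma> 0 = p \<and> \<gamma> 1 = q"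

definition only_geodesic_joining ::
    "('i, 'm::topological_space, 'e::euclidean_space) srmfd \<Rightarrow> (real \<Rightarrow> 'm) \<Rightarrow> 'm \<Rightarrow> 'm \<Rightarrow> bool" where
  "only_geodesic_joining X \<gamma> p q \<longleftrightarrow>
    geodesic_joins X \<gamma> p q \<and>
    (\<forall>\<sigma>. geodesic_joins X \<sigma> p q \<longrightarrow> (\<forall>t\<in>{0..1}. \<sigma> t = \<gamma> t))"

definition geodesically_connected ::
    "('i, 'm::topological_space, 'e::euclidean_space) srmfd \<Rightarrow> bool" where
  "geodesically_connected X \<longleftrightarrow> (\<forall>p\<in>pts X. \<forall>q\<in>pts X. \<exists>\<gamma>. geodesic_joins X \<gamma> p q)"

definition piecewise :: "(real set \<Rightarrow> bool) \<Rightarrow> bool" where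
  "piecewise Q \<longleftrightarrow>
    (\<exists>P. finite P \<and> {0, 1} \<subseteq> P \<and> P \<subseteq> {0..1} \<and>
      (\<forall>s\<in>P. \<forall>t\<in>P. s < t \<and> P \<inter> {s<..<t} = {} \<longrightarrow> Q {s..t}))"


section \<open>Riemannian distance and strong convexity\<close>

definition curve_length :: "('i, 'm, 'e::real_normed_vector) srmfd \<Rightarrow> (real \<Rightarrow> 'm) \<Rightarrow> real" where
  "curve_length X \<gamma> = integral {0..1} (\<lambda>t. sqrt (velocity_sq X \<gamma> {0..1} t))"

definition riemannian_dist ::
    "('i, 'm::topological_space, 'e::euclidean_space) srmfd \<Rightarrow> 'm \<Rightarrow> 'm \<Rightarrow> real" where
  "riemannian_dist X p q =
    Inf {curve_length X \<gamma> | \<gamma>. piecewise (\<lambda>S. smooth_curve X S \<gamma>) \<and> \<gamma> 0 = p \<and> \<gamma> 1 = q}"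

definition riemannian_diam ::
    "('i, 'm::topological_space, 'e::euclidean_space) srmfd \<Rightarrow> ereal" where
  "riemannian_diam X = (SUP p\<in>pts X. SUP q\<in>pts X. ereal (riemannian_dist X p q))"

definition strongly_convex ::
    "('i, 'm::topological_space, 'e::euclidean_space) srmfd \<Rightarrow> bool" where
  "strongly_convex X \<longleftrightarrow>
    (\<forall>p\<in>pts X. \<forall>q\<in>pts X. \<exists>\<gamma>.
      only_geodesic_joining X \<gamma> p q \<and> curve_length X \<gamma> = riemannian_dist X p q)"


section \<open>GRW spacetimes and causality\<close>

definition base_interval :: "ereal \<Rightarrow> ereal \<Rightarrow> real set" where
  "base_interval a b = {t. a < ereal t \<and> ereal t < b}"

definition grw ::
    "ereal \<Rightarrow> ereal \<Rightarrow> (real \<Rightarrow> real) \<Rightarrow> ('i, 'm, 'e) srmfd \<Rightarrow> ('i, real \<times> 'm, real \<times> 'e) srmfd" where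
  "grw a b f X = \<lparr>
    pts = base_interval a b \<times> pts X,
    ind = ind X,
    cdom = (\<lambda>i. base_interval a b \<times> cdom X i),
    crd = (\<lambda>i (\<tau>, p). (\<tau>, crd X i p)),
    met = (\<lambda>i (\<tau>, x) (\<alpha>, u) (\<beta>, v). - (\<alpha> * \<beta>) + (f \<tau>)\<^sup>2 * met X i x u v)\<rparr>"

definition non_spacelike_on ::
    "('i, 'm, 'e::real_normed_vector) srmfd \<Rightarrow> real set \<Rightarrow> (real \<Rightarrow> 'm) \<Rightarrow> bool" where
  "non_spacelike_on X S \<gamma> \<longleftrightarrow> (\<forall>t\<in>S. velocity_sq X \<gamma> S t \<le> 0)"

text \<open>
  In the charts of a product with a line, \<open>(1, 0)\<close> are the components of \<open>\<partial>/\<partial>\<tau>\<close>. A future-pointing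
  velocity is in particular nonzero.
\<close>

definition future_pointing_on ::
    "('i, real \<times> 'm, real \<times> 'e::real_normed_vector) srmfd \<Rightarrow> real set \<Rightarrow> (real \<Rightarrow> real \<times> 'm) \<Rightarrow> bool"
  where
  "future_pointing_on X S \<gamma> \<longleftrightarrow>
    (\<forall>t\<in>S. let i = chart_at X (\<gamma> t)
      in met X i (crd X i (\<gamma> t)) (velocity X i \<gamma> S t) (1, 0) < 0)"

definition future_causal_curve ::
    "('i, real \<times> 'm::topological_space, real \<times> 'e::euclidean_space) srmfd
      \<Rightarrow> (real \<Rightarrow> real \<times> 'm) \<Rightarrow> bool" where
  "future_causal_curve X \<gamma> \<longleftrightarrow>
    piecewise (\<lambda>S. smooth_curve X S \<gamma> \<and> non_spacelike_on X S \<gamma> \<and> future_pointing_on X S \<gamma>)"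

definition causally_related ::
    "('i, real \<times> 'm::topological_space, real \<times> 'e::euclidean_space) srmfd
      \<Rightarrow> real \<times> 'm \<Rightarrow> real \<times> 'm \<Rightarrow> bool" where
  "causally_related X z z' \<longleftrightarrow>
    (\<exists>\<gamma>. future_causal_curve X \<gamma> \<and> ((\<gamma> 0 = z \<and> \<gamma> 1 = z') \<or> (\<gamma> 0 = z' \<and> \<gamma> 1 = z)))"


section \<open>Turning points and extremes of the warping function\<close>

definition invsq :: "(real \<Rightarrow> real) \<Rightarrow> real \<Rightarrow> real" where
  "invsq f \<tau> = 1 / (f \<tau>)\<^sup>2"

text \<open>
  The infima and suprema below are attained whenever \<open>D \<le> invsq f \<tau>\<^sub>0\<close>.
\<close>

definition b_star :: "ereal \<Rightarrow> ereal \<Rightarrow> (real \<Rightarrow> real) \<Rightarrow> real \<Rightarrow> real \<Rightarrow> ereal" where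
  "b_star a b f \<tau>\<^sub>0 D =
    (let A = ereal ` {\<tau>\<in>base_interval a b. \<tau>\<^sub>0 \<le> \<tau> \<and> invsq f \<tau> = D} \<union> {b}
     in if deriv (invsq f) \<tau>\<^sub>0 > 0 then Inf (A - {ereal \<tau>\<^sub>0}) else Inf A)"

definition a_star :: "ereal \<Rightarrow> ereal \<Rightarrow> (real \<Rightarrow> real) \<Rightarrow> real \<Rightarrow> real \<Rightarrow> ereal" where
  "a_star a b f \<tau>\<^sub>0 D =
    (let A = ereal ` {\<tau>\<in>base_interval a b. \<tau> \<le> \<tau>\<^sub>0 \<and> invsq f \<tau> = D} \<union> {a}
     in if deriv (invsq f) \<tau>\<^sub>0 < 0 then Sup (A - {ereal \<tau>\<^sub>0}) else Sup A)"

text \<open>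
  The integral of \<open>f\<^sup>-\<^sup>2 (1/f\<^sup>2 - D)\<^sup>-\<^sup>1\<^sup>/\<^sup>2\<close> from \<open>lo\<close> to \<open>hi\<close>, with values in \<open>[0, \<infinity>]\<close>. It is only
  used where \<open>D < invsq f\<close> on the open interval.
\<close>

definition hint :: "(real \<Rightarrow> real) \<Rightarrow> real \<Rightarrow> ereal \<Rightarrow> ereal \<Rightarrow> ereal" where
  "hint f D lo hi =
    enn2ereal (\<integral>\<^sup>+\<tau>\<in>base_interval lo hi. ennreal (1 / ((f \<tau>)\<^sup>2 * sqrt (invsq f \<tau> - D))) \<partial>lborel)"

definition to_upper :: "ereal \<Rightarrow> real filter" where
  "to_upper b = (if b = \<infinity> then at_top else at_left (real_of_ereal b))"

definition to_lower :: "ereal \<Rightarrow> real filter" where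
  "to_lower a = (if a = -\<infinity> then at_bot else at_right (real_of_ereal a))"

definition m_b :: "ereal \<Rightarrow> (real \<Rightarrow> real) \<Rightarrow> ereal" where
  "m_b b f = Liminf (to_upper b) (\<lambda>\<tau>. ereal (invsq f \<tau>))"

definition m_a :: "ereal \<Rightarrow> (real \<Rightarrow> real) \<Rightarrow> ereal" where
  "m_a a f = Liminf (to_lower a) (\<lambda>\<tau>. ereal (invsq f \<tau>))"

definition m_inf :: "ereal \<Rightarrow> ereal \<Rightarrow> (real \<Rightarrow> real) \<Rightarrow> ereal" where
  "m_inf a b f = (INF \<tau>\<in>base_interval a b. ereal (invsq f \<tau>))"

text \<open>
  The real number \<open>s\<close> plays the role of \<open>b - \<epsilon>\<close> when \<open>b < \<infinity>\<close> and of \<open>M\<close> when \<open>b = \<infinity>\<close>.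
\<close>

definition rel_min_b :: "ereal \<Rightarrow> ereal \<Rightarrow> (real \<Rightarrow> real) \<Rightarrow> bool" where
  "rel_min_b a b f \<longleftrightarrow>
    (\<exists>s::real. ereal s < b \<and> (\<forall>\<tau>\<in>base_interval a b. s < \<tau> \<longrightarrow> m_b b f < ereal (invsq f \<tau>)))"

definition rel_min_a :: "ereal \<Rightarrow> ereal \<Rightarrow> (real \<Rightarrow> real) \<Rightarrow> bool" where
  "rel_min_a a b f \<longleftrightarrow>
    (\<exists>s::real. a < ereal s \<and> (\<forall>\<tau>\<in>base_interval a b. \<tau> < s \<longrightarrow> m_a a f < ereal (invsq f \<tau>)))"

definition close_b :: "ereal \<Rightarrow> ereal \<Rightarrow> (real \<Rightarrow> real) \<Rightarrow> real \<Rightarrow> bool" where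
  "close_b a b f c \<longleftrightarrow>
    c \<in> base_interval a b \<and>
    (\<exists>s<c. \<forall>\<tau>\<in>base_interval a b. s < \<tau> \<longrightarrow> m_b b f < ereal (invsq f \<tau>))"

definition close_a :: "ereal \<Rightarrow> ereal \<Rightarrow> (real \<Rightarrow> real) \<Rightarrow> real \<Rightarrow> bool" where
  "close_a a b f c \<longleftrightarrow>
    c \<in> base_interval a b \<and>
    (\<exists>s>c. \<forall>\<tau>\<in>base_interval a b. \<tau> < s \<longrightarrow> m_a a f < ereal (invsq f \<tau>))"


section \<open>Condition (C)\<close>

text \<open>
  If the function reaches a relative minimum at \<open>b\<close>, then \<open>m_b\<close> is finite; \<open>d_b\<close> and \<open>i_b\<close>
  do not depend on the chosen point close to \<open>b\<close>, and are meaningful only under the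
  hypotheses made explicit in \<open>condition_C\<close>. The same holds at \<open>a\<close>.
\<close>

definition d_b :: "ereal \<Rightarrow> ereal \<Rightarrow> (real \<Rightarrow> real) \<Rightarrow> ereal" where
  "d_b a b f =
    (let c = SOME c. close_b a b f c; \<mu> = real_of_ereal (m_b b f)
     in Limsup (at \<mu>) (\<lambda>D. hint f D c (b_star a b f c D)) - hint f \<mu> c b)"

definition d_a :: "ereal \<Rightarrow> ereal \<Rightarrow> (real \<Rightarrow> real) \<Rightarrow> ereal" where
  "d_a a b f =
    (let c = SOME c. close_a a b f c; \<mu> = real_of_ereal (m_a a f)
     in Limsup (at \<mu>) (\<lambda>D. hint f D (a_star a b f c D) c) - hint f \<mu> a c)"

definition i_b :: "ereal \<Rightarrow> ereal \<Rightarrow> (real \<Rightarrow> real) \<Rightarrow> ereal" where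
  "i_b a b f =
    (let \<tau>\<^sub>0 = SOME \<tau>. close_b a b f \<tau>
     in INF D\<in>{D. m_inf a b f < ereal D \<and> ereal D \<le> m_b b f}. hint f D (a_star a b f \<tau>\<^sub>0 D) b)"

definition i_a :: "ereal \<Rightarrow> ereal \<Rightarrow> (real \<Rightarrow> real) \<Rightarrow> ereal" where
  "i_a a b f =
    (let \<tau>\<^sub>0 = SOME \<tau>. close_a a b f \<tau>
     in INF D\<in>{D. m_inf a b f < ereal D \<and> ereal D \<le> m_a a f}. hint f D a (b_star a b f \<tau>\<^sub>0 D))"

definition condition_C :: "ereal \<Rightarrow> ereal \<Rightarrow> (real \<Rightarrow> real) \<Rightarrow> ereal \<Rightarrow> bool" where
  "condition_C a b f diam \<longleftrightarrow>
    (\<not> rel_min_b a b f \<or>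
     (\<exists>c. close_b a b f c \<and> hint f (real_of_ereal (m_b b f)) c b = \<infinity>) \<or>
     2 * d_b a b f \<ge> diam \<or>
     (2 * d_b a b f < diam \<and> m_inf a b f < m_b b f \<and> d_b a b f \<ge> i_b a b f)) \<and>
    (\<not> rel_min_a a b f \<or>
     (\<exists>c. close_a a b f c \<and> hint f (real_of_ereal (m_a a f)) a c = \<infinity>) \<or>
     2 * d_a a b f \<ge> diam \<or>
     (2 * d_a a b f < diam \<and> m_inf a b f < m_a a f \<and> d_a a b f \<ge> i_a a b f))"


section \<open>Condition (R)\<close>

definition R_int :: "ereal \<Rightarrow> ereal \<Rightarrow> (real \<Rightarrow> real) \<Rightarrow> real \<Rightarrow> real \<Rightarrow> ereal" where
  "R_int a b f \<tau>\<^sub>0 D = hint f D \<tau>\<^sub>0 (b_star a b f \<tau>\<^sub>0 D)"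

definition L_int :: "ereal \<Rightarrow> ereal \<Rightarrow> (real \<Rightarrow> real) \<Rightarrow> real \<Rightarrow> real \<Rightarrow> ereal" where
  "L_int a b f \<tau>\<^sub>0 D = hint f D (a_star a b f \<tau>\<^sub>0 D) \<tau>\<^sub>0"

definition W_int :: "ereal \<Rightarrow> ereal \<Rightarrow> (real \<Rightarrow> real) \<Rightarrow> real \<Rightarrow> real \<Rightarrow> ereal" where
  "W_int a b f \<tau>\<^sub>0 D = L_int a b f \<tau>\<^sub>0 D + R_int a b f \<tau>\<^sub>0 D"

definition E_int :: "ereal \<Rightarrow> ereal \<Rightarrow> (real \<Rightarrow> real) \<Rightarrow> real \<Rightarrow> nat \<Rightarrow> real \<Rightarrow> ereal" where
  "E_int a b f \<tau>\<^sub>0 n D = (if even n then R_int a b f \<tau>\<^sub>0 D else L_int a b f \<tau>\<^sub>0 D)"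

definition G_int :: "ereal \<Rightarrow> ereal \<Rightarrow> (real \<Rightarrow> real) \<Rightarrow> real \<Rightarrow> nat \<Rightarrow> real \<Rightarrow> ereal" where
  "G_int a b f \<tau>\<^sub>0 n D = (if even n then L_int a b f \<tau>\<^sub>0 D else R_int a b f \<tau>\<^sub>0 D)"

text \<open>
  Here \<open>s\<close> is \<open>b - \<epsilon>\<close> or \<open>M\<close> for the numbers \<open>r\<close>, and \<open>a + \<epsilon>\<close> or \<open>- M\<close> for the numbers \<open>l\<close>.
  The outer limits exist because the quantities are monotone in \<open>s\<close>.
\<close>

definition r_i :: "ereal \<Rightarrow> ereal \<Rightarrow> (real \<Rightarrow> real) \<Rightarrow> real \<Rightarrow> nat \<Rightarrow> ereal" where
  "r_i a b f \<tau>\<^sub>0 n =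
    Lim (to_upper b) (\<lambda>s. Liminf (at_right (real_of_ereal (m_inf a b f))) (\<lambda>D.
      if n = 0 then hint f D \<tau>\<^sub>0 s
      else E_int a b f \<tau>\<^sub>0 n D + ereal (real n - 1) * W_int a b f \<tau>\<^sub>0 D
           + hint f D (a_star a b f \<tau>\<^sub>0 D) s))"

definition l_i :: "ereal \<Rightarrow> ereal \<Rightarrow> (real \<Rightarrow> real) \<Rightarrow> real \<Rightarrow> nat \<Rightarrow> ereal" where
  "l_i a b f \<tau>\<^sub>0 n =
    Lim (to_lower a) (\<lambda>s. Liminf (at_right (real_of_ereal (m_inf a b f))) (\<lambda>D.
      if n = 0 then hint f D s \<tau>\<^sub>0
      else G_int a b f \<tau>\<^sub>0 n D + ereal (real n - 1) * W_int a b f \<tau>\<^sub>0 D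
           + hint f D s (b_star a b f \<tau>\<^sub>0 D)))"

definition r_s :: "ereal \<Rightarrow> ereal \<Rightarrow> (real \<Rightarrow> real) \<Rightarrow> real \<Rightarrow> nat \<Rightarrow> ereal" where
  "r_s a b f \<tau>\<^sub>0 n =
    Lim (to_upper b) (\<lambda>s. Limsup (at_right (real_of_ereal (m_inf a b f))) (\<lambda>D.
      E_int a b f \<tau>\<^sub>0 n D + ereal (real n) * W_int a b f \<tau>\<^sub>0 D
      + hint f D s (b_star a b f \<tau>\<^sub>0 D)))"

definition l_s :: "ereal \<Rightarrow> ereal \<Rightarrow> (real \<Rightarrow> real) \<Rightarrow> real \<Rightarrow> nat \<Rightarrow> ereal" where
  "l_s a b f \<tau>\<^sub>0 n =
    Lim (to_lower a) (\<lambda>s. Limsup (at_right (real_of_ereal (m_inf a b f))) (\<lambda>D.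
      G_int a b f \<tau>\<^sub>0 n D + ereal (real n) * W_int a b f \<tau>\<^sub>0 D
      + hint f D (a_star a b f \<tau>\<^sub>0 D) s))"

definition real_Icc :: "ereal \<Rightarrow> ereal \<Rightarrow> real set" where
  "real_Icc l u = {x. l \<le> ereal x \<and> ereal x \<le> u}"

definition condition_R :: "ereal \<Rightarrow> ereal \<Rightarrow> (real \<Rightarrow> real) \<Rightarrow> ereal \<Rightarrow> bool" where
  "condition_R a b f diam \<longleftrightarrow>
    (\<forall>\<tau>\<in>base_interval a b. m_inf a b f < ereal (invsq f \<tau>)) \<and>
    m_a a f = m_inf a b f \<and> m_b b f = m_inf a b f \<and>
    (\<forall>\<tau>\<^sub>0\<in>base_interval a b.
      real_Icc (r_i a b f \<tau>\<^sub>0 0) diam \<subseteq> (\<Union>n. real_Icc (r_i a b f \<tau>\<^sub>0 n) (r_s a b f \<tau>\<^sub>0 n)) \<and>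
      real_Icc (l_i a b f \<tau>\<^sub>0 0) diam \<subseteq> (\<Union>n. real_Icc (l_i a b f \<tau>\<^sub>0 n) (l_s a b f \<tau>\<^sub>0 n)))"

end

theory Submission
 imports Defs
begin

text \<open>
 Let \<open>V = 1/f^2\<close>. A geodesic between points over distinct \<open>x0\<close>, \<open>x1\<close> of the fiber runs over the geodesic from
 \<open>x0\<close> to \<open>x1\<close>, and as a graph over its arclength it solves \<open>tau' = w/V\<close>, \<open>w' = V'/(2V)\<close>, which conserves the
 energy \<open>D = V - w^2\<close>. So points are joined iff some trajectory of this system goes from \<open>t0\<close> to \<open>t1\<close> in the time
 \<open>l = d(x0, x1)\<close>; the time needed from \<open>u\<close> to \<open>v\<close> without turning is \<open>hint f D u v\<close>.

 Causal geodesics are those with \<open>D <= 0\<close>. They never turn, and their travel time increases strictly with \<open>D\<close>,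
 which gives existence and uniqueness; a causal curve bounds \<open>d(x0, x1)\<close> by the travel time for \<open>D = 0\<close>.

 Connectedness is a shooting problem in the initial velocity \<open>w 0\<close>. It is solvable if near each end of the interval
 there is a barrier: a point such that a trajectory coming to rest there cannot be back at \<open>t1\<close> before \<open>l\<close>. If (C)
 holds at \<open>b\<close> and there is no barrier near \<open>b\<close>, then \<open>i_b <= d_b\<close> yields a trajectory that turns on the left and
 leaves through \<open>b\<close> before \<open>l\<close>, which serves equally well. If (C) fails at \<open>b\<close>, a point close to \<open>b\<close> cannot be joined
 to itself in a time slightly above \<open>2 d_b\<close>, unless \<open>V\<close> exceeds its infimum \<open>m\<close> everywhere and \<open>m_a = m_b = m\<close>.
 In that case trajectories with \<open>D\<close> decreasing to \<open>m\<close> oscillate between neighbourhoods of both ends, and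
 \<open>[r_i^n, r_s^n]\<close> collects the times that such trajectories spend near \<open>b\<close> after \<open>n\<close> turns; hence (R).
\<close>

subsection \<open>Smooth maps\<close>

text \<open>Energy conservation alone gives \<open>tau' = sqrt (V - D) / V\<close>, which is not
  Lipschitz where \<open>V = D\<close>, that is, at the turning points. With the velocity kept as a
  second unknown \<open>w\<close> the system is smooth: turning points are ordinary points of the
  flow, and uniqueness shows that a turning point with \<open>V' = 0\<close> would have to be an
  equilibrium, so that the travel time to it is infinite. The obstacle to shooting is that a
  trajectory may leave the interval before \<open>l\<close>, so the end point is not defined for all
  initial velocities. The vector field is therefore frozen outside a compact part, and the
  velocities are sorted by the side on which the trajectory escapes first or ends. The two classes
  are disjoint; barriers make them open, since a trajectory that merely touches the boundary could
  otherwise fall out of its class under a small change of velocity. Only the end \<open>b\<close> is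
  treated. Substituting \<open>- t\<close> for \<open>t\<close>, which replaces \<open>f\<close> by
  \<open>mirror f\<close>, carries every result over to \<open>a\<close>. For connectedness the
  fiber matters only through its distances, and strong convexity makes every positive
  \<open>l\<close> below the diameter a distance.\<close>

lemmas real_vector_derivative = has_real_derivative_iff_has_vector_derivative

lemma Ck_on_cong:
 assumes "!!x. x : S ==> f x = g x" and "Ck_on k f S"
 shows "Ck_on k g S"
 using assms
proof (induction k arbitrary: f g)
 case 0
 thus ?case using continuous_on_cong by (metis Ck_on.simps(1))
next
 case (Suc k)
 then obtain f' where f': "ALL x:S. (f has_derivative f' x) (at x within S)" "ALL v. Ck_on k (%x. f' x v) S"
  by auto
 have "ALL x:S. (g has_derivative f' x) (at x within S)"
  using f'(1) Suc.prems(1) by (metis has_derivative_transform)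
 thus ?case using f'(2) by auto
qed

lemma Ck_on_subset: "Ck_on k f S ==> T <= S ==> Ck_on k f T"
proof (induction k arbitrary: f)
 case 0
 thus ?case using continuous_on_subset by auto
next
 case (Suc k)
 then obtain f' where f': "ALL x:S. (f has_derivative f' x) (at x within S)" "ALL v. Ck_on k (%x. f' x v) S"
  by auto
 have "ALL x:T. (f has_derivative f' x) (at x within T)"
  using f'(1) Suc.prems(2) by (meson has_derivative_subset subsetD)
 thus ?case using f'(2) Suc.IH Suc.prems(2) by auto
qed

lemma Ck_on_imp_continuous_on: "Ck_on k f S ==> continuous_on S f"
proof (cases k)
 case (Suc n)
 assume "Ck_on k f S"
 then obtain f' where "ALL x:S. (f has_derivative f' x) (at x within S)" using Suc by auto
 thus ?thesis using has_derivative_continuous_on by blast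
qed simp

lemma Ck_on_Suc_D: "Ck_on (Suc k) f S ==> Ck_on k f S"
proof (induction k arbitrary: f)
 case 0
 thus ?case using Ck_on_imp_continuous_on by fastforce
next
 case (Suc k)
 obtain f' where f': "ALL x:S. (f has_derivative f' x) (at x within S)" "ALL v. Ck_on (Suc k) (%x. f' x v) S"
  using Suc.prems by (subst (asm) Ck_on.simps) blast
 show ?case using f' Suc.IH by auto
qed

lemma Ck_on_bounded_linear:
 assumes "bounded_linear L" "Ck_on k f S"
 shows "Ck_on k (%x. L (f x)) S"
 using assms(2)
proof (induction k arbitrary: f)
 case 0
 thus ?case
  using assms(1) by (simp add: linear_continuous_on_compose bounded_linear.continuous_on)
next
 case (Suc k)
 then obtain f' where f': "ALL x:S. (f has_derivative f' x) (at x within S)" "ALL v. Ck_on k (%x. f' x v) S"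
  by auto
 have "ALL x:S. ((%x. L (f x)) has_derivative (%v. L (f' x v))) (at x within S)"
  using f'(1) bounded_linear.has_derivative[OF assms(1)] by blast
 moreover have "ALL v. Ck_on k (%x. L (f' x v)) S" using f'(2) Suc.IH by blast
 ultimately show ?case by auto
qed

lemma Ck_on_const [simp]: "Ck_on k (%x. c) S"
proof (induction k arbitrary: c)
 case (Suc k)
 show ?case by (auto intro!: exI[of _ "%x v. 0"] Suc)
qed simp

lemma Ck_on_linear:
 assumes "bounded_linear L"
 shows "Ck_on k L S"
proof (cases k)
 case 0
 thus ?thesis using assms by (simp add: linear_continuous_on)
next
 case (Suc n)
 have "ALL x:S. (L has_derivative L) (at x within S)"
  using assms by (simp add: bounded_linear_imp_has_derivative)
 thus ?thesis using Suc by auto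
qed

lemma Ck_on_add:
 "Ck_on k f S ==> Ck_on k g S ==> Ck_on k (%x. f x + g x) S"
proof (induction k arbitrary: f g)
 case 0
 thus ?case by (auto intro: continuous_on_add)
next
 case (Suc k)
 then obtain f' g' where
  "ALL x:S. (f has_derivative f' x) (at x within S)" "ALL v. Ck_on k (%x. f' x v) S"
  "ALL x:S. (g has_derivative g' x) (at x within S)" "ALL v. Ck_on k (%x. g' x v) S"
  by auto
 thus ?case using Suc.IH
  by (auto intro!: exI[of _ "%x v. f' x v + g' x v"] has_derivative_add)
qed

lemma Ck_on_sum: "(!!i. i : A ==> Ck_on k (f i) S) ==> Ck_on k (%x. \<Sum>i\<in>A. f i x) S"
 by (induction A rule: infinite_finite_induct) (auto intro: Ck_on_add)

lemma Ck_on_bilinear: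
 assumes "bounded_bilinear pr"
 shows "Ck_on k f S ==> Ck_on k g S ==> Ck_on k (%x. pr (f x) (g x)) S"
proof (induction k arbitrary: f g)
 case 0
 thus ?case using bounded_bilinear.continuous_on[OF assms] by auto
next
 case (Suc k)
 then obtain f' g' where *:
  "ALL x:S. (f has_derivative f' x) (at x within S)" "ALL v. Ck_on k (%x. f' x v) S"
  "ALL x:S. (g has_derivative g' x) (at x within S)" "ALL v. Ck_on k (%x. g' x v) S"
  by auto
 have "Ck_on k f S" "Ck_on k g S" using Suc.prems Ck_on_Suc_D by blast+
 thus ?case using Suc.IH *
  by (auto intro!: exI[of _ "%x v. pr (f x) (g' x v) + pr (f' x v) (g x)"]
    bounded_bilinear.FDERIV[OF assms] Ck_on_add)
qed

lemmas Ck_on_mult = Ck_on_bilinear[OF bounded_bilinear_mult]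
lemmas Ck_on_scaleR = Ck_on_bilinear[OF bounded_bilinear_scaleR]

lemma Ck_on_compose:
 fixes f :: "'b::euclidean_space => 'c::real_normed_vector" and g :: "'a::euclidean_space => 'b"
 shows "Ck_on k f T ==> Ck_on k g S ==> g ` S <= T ==> Ck_on k (%x. f (g x)) S"
proof (induction k arbitrary: f)
 case 0
 thus ?case using continuous_on_compose2 by auto
next
 case (Suc k)
 then obtain f' g' where *:
  "ALL x:T. (f has_derivative f' x) (at x within T)" "ALL v. Ck_on k (%x. f' x v) T"
  "ALL x:S. (g has_derivative g' x) (at x within S)" "ALL v. Ck_on k (%x. g' x v) S"
  by auto
 have d: "((%x. f (g x)) has_derivative (%v. f' (g x) (g' x v))) (at x within S)" if "x : S" for x
  using has_derivative_in_compose[of g "g' x" x S f "f' (g x)"] *(1,3) that Suc.prems(3)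
  by (meson has_derivative_subset image_subset_iff)
 have gk: "Ck_on k g S" using Suc.prems(2) Ck_on_Suc_D by blast
 \<comment> \<open>\<open>Ck_on\<close> controls \<open>f'\<close> only along fixed directions,
   while the direction \<open>g' x v\<close> moves with \<open>x\<close>. Expanding it in the basis
   leaves finitely many fixed directions with coefficients of class C^k.\<close>
 have "Ck_on k (%x. f' (g x) (g' x v)) S" for v
 proof (rule Ck_on_cong)
  show "Ck_on k (%x. \<Sum>b\<in>Basis. (g' x v \<bullet> b) *\<^sub>R f' (g x) b) S"
   using *(2,4) Suc.IH gk Suc.prems(3)
   by (intro Ck_on_sum Ck_on_scaleR Ck_on_bounded_linear[OF bounded_linear_inner_left]) auto
  fix x assume "x : S"
  hence "linear (f' (g x))"
   using *(1) Suc.prems(3) has_derivative_linear by blast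
  thus "(\<Sum>b\<in>Basis. (g' x v \<bullet> b) *\<^sub>R f' (g x) b) = f' (g x) (g' x v)"
   using linear_sum[of "f' (g x)" "%b. (g' x v \<bullet> b) *\<^sub>R b" Basis]
   by (simp add: linear_cmul euclidean_representation)
 qed
 thus ?case using d by (auto intro!: exI[of _ "%x v. f' (g x) (g' x v)"])
qed

lemma Ck_on_real_Suc:
 fixes g :: "real => 'b::real_normed_vector"
 assumes "!!x. x : S ==> (g has_vector_derivative g' x) (at x within S)" "Ck_on k g' S"
 shows "Ck_on (Suc k) g S"
 using assms unfolding has_vector_derivative_def
 by (auto intro!: exI[of _ "%x v. v *\<^sub>R g' x"] Ck_on_scaleR)

text \<open>Bootstrapping: if \<open>g\<close> is of class C^k then so is \<open>G (g x)\<close>,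
  which is the derivative of \<open>g\<close>, and thus \<open>g\<close> is of class
  C^(k+1).\<close>

lemma smooth_on_ode:
 fixes g :: "real => 'b::euclidean_space"
 assumes "smooth_on G T" "g ` S <= T"
  and "!!x. x : S ==> (g has_vector_derivative G (g x)) (at x within S)"
 shows "smooth_on g S"
 unfolding smooth_on_def
proof
 fix k show "Ck_on k g S"
 proof (induction k)
  case 0
  thus ?case using assms(3)
   by (auto intro!: continuous_on_vector_derivative)
 next
  case (Suc k)
  have "Ck_on k (%x. G (g x)) S"
   using assms(1) smooth_on_def by (intro Ck_on_compose[OF _ Suc assms(2)]) blast
  thus ?case using Ck_on_real_Suc[OF assms(3)] by blast
 qed
qed

text \<open>\<open>smooth_on\<close> only asserts that some derivatives exist. They can be
  identified with \<open>g'\<close> where derivatives are unique, hence the condition that no point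
  of \<open>S\<close> is isolated.\<close>

lemma smooth_on_derivative:
 fixes g :: "real => 'b::real_normed_vector"
 assumes "smooth_on g S" and "!!x. x : S ==> (g has_vector_derivative g' x) (at x within S)"
  and "!!x. x : S ==> at x within S ~= bot"
 shows "smooth_on g' S"
 unfolding smooth_on_def
proof
 fix k
 have "Ck_on (Suc k) g S" using assms(1) smooth_on_def by blast
 then obtain f' where f': "ALL x:S. (g has_derivative f' x) (at x within S)" "ALL v. Ck_on k (%x. f' x v) S"
  by auto
 show "Ck_on k g' S"
 proof (rule Ck_on_cong)
  show "Ck_on k (%x. f' x 1) S" using f' by auto
  fix x assume x: "x : S"
  hence "(g has_vector_derivative f' x 1) (at x within S)"
  proof -
   have d: "(g has_derivative f' x) (at x within S)" using f'(1) x by blast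
   have "f' x r = r *\<^sub>R f' x 1" for r
    using linear_cmul[OF has_derivative_linear[OF d], of r 1] by simp
   hence "f' x = (%r. r *\<^sub>R f' x 1)" by blast
   thus ?thesis using d unfolding has_vector_derivative_def by metis
  qed
  thus "f' x 1 = g' x"
   using assms(2,3)[OF x] by (metis vector_derivative_unique_within)
 qed
qed

lemma smooth_on_differentiable:
 assumes "smooth_on g S" "x : S"
 shows "g differentiable (at x within S)"
proof -
 have "Ck_on (Suc 0) g S" using assms(1) smooth_on_def by blast
 thus ?thesis using assms(2) by (auto simp: differentiable_def)
qed

lemma smooth_on_subset: "smooth_on f S ==> T <= S ==> smooth_on f T"
 using Ck_on_subset unfolding smooth_on_def by blast

lemma smooth_on_compose:
 fixes f :: "'b::euclidean_space => 'c::real_normed_vector" and g :: "'a::euclidean_space => 'b"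
 shows "smooth_on f T ==> smooth_on g S ==> g ` S <= T ==> smooth_on (%x. f (g x)) S"
 using Ck_on_compose unfolding smooth_on_def by blast

lemma smooth_on_cong: "(!!x. x : S ==> f x = g x) ==> smooth_on f S ==> smooth_on g S"
 using Ck_on_cong unfolding smooth_on_def by blast

lemma smooth_on_mult:
 fixes f g :: "'a::euclidean_space => real"
 shows "smooth_on f S ==> smooth_on g S ==> smooth_on (%x. f x * g x) S"
 using Ck_on_mult unfolding smooth_on_def by blast

lemma smooth_on_linear: "bounded_linear L ==> smooth_on L S"
 using Ck_on_linear unfolding smooth_on_def by blast

lemma smooth_on_bounded_linear:
 "bounded_linear L ==> smooth_on f S ==> smooth_on (%x. L (f x)) S"
 using Ck_on_bounded_linear unfolding smooth_on_def by blast

lemma smooth_on_const [simp]: "smooth_on (%x. c) S"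
 unfolding smooth_on_def by simp

lemma smooth_on_imp_continuous_on: "smooth_on f S ==> continuous_on S f"
 using Ck_on_imp_continuous_on unfolding smooth_on_def by blast

lemma smooth_on_Pair:
 fixes f :: "'a::euclidean_space => 'b::real_normed_vector" and g :: "'a => 'c::real_normed_vector"
 assumes "smooth_on f S" "smooth_on g S"
 shows "smooth_on (%x. (f x, g x)) S"
proof -
 have "smooth_on (%x. (f x, 0::'c)) S"
  by (rule smooth_on_bounded_linear[OF _ assms(1)]) (intro bounded_linear_intros)
 moreover have "smooth_on (%x. (0::'b, g x)) S"
  by (rule smooth_on_bounded_linear[OF _ assms(2)]) (intro bounded_linear_intros)
 ultimately have "smooth_on (%x. (f x, 0) + (0, g x)) S"
  using Ck_on_add unfolding smooth_on_def by blast
 thus ?thesis by simp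
qed

lemma smooth_on_inverse: "smooth_on (%x::real. inverse x) (- {0})"
 unfolding smooth_on_def
proof
 fix k show "Ck_on k (%x::real. inverse x) (- {0})"
 proof (induction k)
  case 0
  thus ?case by (auto intro!: continuous_intros)
 next
  case (Suc k)
  have "Ck_on k (%x::real. (-1) * (inverse x * inverse x)) (- {0})"
   by (intro Ck_on_mult Suc Ck_on_const)
  moreover have "((%x::real. inverse x) has_vector_derivative (-1) * (inverse x * inverse x)) (at x within - {0})"
   if "x : - {0}" for x
   unfolding real_vector_derivative[symmetric]
   using that by (auto intro!: derivative_eq_intros simp: power2_eq_square)
  ultimately show ?case by (intro Ck_on_real_Suc) auto
 qed
qed

lemma smooth_on_divide:
 fixes f g :: "'a::euclidean_space => real"
 assumes "smooth_on f S" "smooth_on g S" "!!x. x : S ==> g x ~= 0"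
 shows "smooth_on (%x. f x / g x) S"
 unfolding divide_inverse
 by (intro smooth_on_mult assms(1) smooth_on_compose[OF smooth_on_inverse assms(2)]) (use assms(3) in auto)

subsection \<open>Flows of Lipschitz vector fields\<close>

text \<open>Gronwall's inequality: the squared distance, damped by \<open>exp (- 2 L t)\<close>, has
  a nonpositive derivative. It serves both for uniqueness and for continuous dependence on initial
  values.\<close>

lemma lipschitz_solutions_dist:
 fixes F :: "'a::euclidean_space => 'a"
 assumes F: "L-lipschitz_on UNIV F"
  and X: "!!t. t : {0..T} ==> (X has_vector_derivative F (X t)) (at t within {0..T})"
  and Y: "!!t. t : {0..T} ==> (Y has_vector_derivative F (Y t)) (at t within {0..T})"
  and t: "t : {0..T}"
 shows "norm (X t - Y t) <= exp (L * t) * norm (X 0 - Y 0)"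
proof -
 define N where "N t = exp (- (2 * L * t)) * ((X t - Y t) \<bullet> (X t - Y t))" for t
 define N' where "N' t = exp (- (2 * L * t)) * (2 * ((X t - Y t) \<bullet> (F (X t) - F (Y t))))
   - 2 * L * exp (- (2 * L * t)) * ((X t - Y t) \<bullet> (X t - Y t))" for t
 have N': "(N has_real_derivative N' s) (at s within {0..T})" if "s : {0..T}" for s
 proof -
  have d: "((%t. X t - Y t) has_derivative (%h. h *\<^sub>R (F (X s) - F (Y s)))) (at s within {0..T})"
   using has_vector_derivative_diff[OF X[OF that] Y[OF that]]
   unfolding has_vector_derivative_def by simp
  have "((%t. (X t - Y t) \<bullet> (X t - Y t)) has_derivative
   (%h. h * (2 * ((X s - Y s) \<bullet> (F (X s) - F (Y s)))))) (at s within {0..T})"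
   by (rule has_derivative_eq_rhs[OF has_derivative_inner[OF d d]])
    (simp add: fun_eq_iff inner_commute)
  hence "((%t. (X t - Y t) \<bullet> (X t - Y t)) has_real_derivative
   2 * ((X s - Y s) \<bullet> (F (X s) - F (Y s)))) (at s within {0..T})"
   by (simp add: has_field_derivative_def mult_commute_abs)
  note q = this
  have "((%t. exp (- (2 * L * t))) has_real_derivative - (2 * L) * exp (- (2 * L * s))) (at s within {0..T})"
   by (auto intro!: derivative_eq_intros)
  from DERIV_mult[OF this q] show ?thesis
   unfolding N_def N'_def by (simp add: mult_ac)
 qed
 have N'_le: "N' s <= 0" for s
 proof -
  have "(X s - Y s) \<bullet> (F (X s) - F (Y s)) <= norm (X s - Y s) * norm (F (X s) - F (Y s))"
   by (rule norm_cauchy_schwarz)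
  also have "... <= norm (X s - Y s) * (L * norm (X s - Y s))"
   using lipschitz_onD[OF F, of "X s" "Y s"] by (intro mult_left_mono) (auto simp: dist_norm)
  also have "... = L * ((X s - Y s) \<bullet> (X s - Y s))"
   by (simp add: power2_norm_eq_inner[symmetric] power2_eq_square)
  finally have "exp (- (2 * L * s)) * (2 * ((X s - Y s) \<bullet> (F (X s) - F (Y s))))
    <= exp (- (2 * L * s)) * (2 * (L * ((X s - Y s) \<bullet> (X s - Y s))))"
   by (intro mult_left_mono) auto
  thus ?thesis unfolding N'_def by (simp add: algebra_simps)
 qed
 have "N t <= N 0"
 proof (cases "t = 0")
  case False
  hence "0 < t" using t by auto
  then obtain z where "z : {0<..<t}" "N t - N 0 = N' z * (t - 0)"
   using mvt_simple[of 0 t N "%s h. N' s * h"] t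
    has_field_derivative_subset[OF N', where t="{0..t}"]
   by (force simp: has_field_derivative_def)
  hence "N t - N 0 = N' z * t" by simp
  moreover have "N' z * t <= 0" using N'_le[of z] \<open>0 < t\<close> by (intro mult_nonpos_nonneg) auto
  ultimately show ?thesis by linarith
 qed simp
 hence "(norm (X t - Y t))\<^sup>2 <= exp (2 * L * t) * (norm (X 0 - Y 0))\<^sup>2"
  unfolding N_def by (simp add: power2_norm_eq_inner exp_minus field_simps)
 also have "... = (exp (L * t) * norm (X 0 - Y 0))\<^sup>2"
  by (simp add: power_mult_distrib exp_double[symmetric] mult.assoc)
 finally show ?thesis by (rule power2_le_imp_le) simp
qed

text \<open>Picard's theorem, with a weighted supremum norm that makes the Picard map a contraction
 on the whole half line.\<close>

lemma lipschitz_solution_exists: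
 fixes F :: "'a::euclidean_space => 'a"
 assumes F: "L-lipschitz_on UNIV F" and bd: "!!x. norm (F x) <= B"
 obtains X where "X 0 = x0"
  "!!T t. t : {0..T} ==> (X has_vector_derivative F (X t)) (at t within {0..T})"
proof -
 have L0: "0 <= L" using F lipschitz_on_nonneg by blast
 have B0: "0 <= B" using bd[of 0] norm_ge_zero order_trans by blast
 \<comment> \<open>The unknown is \<open>u\<close> with \<open>X t = x0 + exp (l t) u t\<close>.
   Integrating \<open>exp (l r)\<close> produces a factor \<open>1 / l\<close>, so the Picard map
   contracts by \<open>L / l\<close>, which this choice keeps below 1/2.\<close>
 define l where "l = 2 * L + 1"
 have l: "0 < l" "L / l <= 1 / 2" using L0 by (auto simp: l_def field_simps)
 define G where "G u s = F (x0 + exp (l * s) *\<^sub>R apply_bcontfun u s)" for u :: "real \<Rightarrow>\<^sub>C 'a" and s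
 have contF: "continuous_on UNIV F"
  using F by (rule lipschitz_on_continuous_on)
 have contG: "continuous_on S (G u)" for u S
 proof -
  have "continuous_on S (apply_bcontfun u)" for S
   by (rule continuous_on_apply_bcontfun)
  thus ?thesis unfolding G_def
   by (intro continuous_on_compose2[OF contF] continuous_intros) auto
 qed
 \<comment> \<open>\<open>max 0 t\<close> extends the Picard map to negative times, because elements
   of \<open>bcontfun\<close> live on the whole line.\<close>
 define P where "P u t = exp (- (l * max 0 t)) *\<^sub>R integral {0..max 0 t} (G u)" for u t
 have contI: "continuous_on UNIV (%t. integral {0..max 0 t} (G u))" for u
 proof -
  have c0: "continuous_on {0..T} (%t. integral {0..t} (G u))" for T
   by (intro indefinite_integral_continuous_1 integrable_continuous_real contG)
  hence c: "isCont (%t. integral {0..max 0 t} (G u)) t" for t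
  proof -
   have "continuous_on {t-1..t+1} (%t. integral {0..max 0 t} (G u))"
    by (rule continuous_on_compose2[of "{0..max 0 (t+1)}" "%t. integral {0..t} (G u)"])
     (use c0 in "auto intro!: continuous_intros")
   thus ?thesis
    by (rule continuous_on_interior) simp
  qed
  show ?thesis using c continuous_at_imp_continuous_on by blast
 qed
 have intB: "norm (integral {0..t} (G u)) <= B * t" if "0 <= t" for t u
  using integral_bound[OF that contG, of u B] bd that by (auto simp: G_def)
 have Pb: "P u : bcontfun" for u
 proof (rule bcontfun_normI)
  show "continuous_on UNIV (P u)"
   unfolding P_def by (intro continuous_intros contI)
  fix t
  have "l * max 0 t <= exp (l * max 0 t)"
   using exp_ge_add_one_self[of "l * max 0 t"] by linarith
  hence "exp (- (l * max 0 t)) * max 0 t <= 1 / l"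
   using l by (simp add: exp_minus field_simps)
  hence "B * (exp (- (l * max 0 t)) * max 0 t) <= B * (1 / l)"
   using B0 by (intro mult_left_mono)
  moreover have "norm (P u t) <= exp (- (l * max 0 t)) * (B * max 0 t)"
   unfolding P_def using intB[of "max 0 t" u] by (simp add: mult_left_mono)
  ultimately show "norm (P u t) <= B / l" by (simp add: mult_ac)
 qed
 have app: "apply_bcontfun (Bcontfun (P u)) = P u" for u
  using Pb by (simp add: Bcontfun_inverse)
 have contr: "dist (Bcontfun (P u)) (Bcontfun (P v)) <= 1 / 2 * dist u v" for u v
 proof (rule dist_bound)
  fix t :: real
  define s where "s = max 0 t"
  have s: "0 <= s" by (simp add: s_def)
  have est: "norm (G u r - G v r) <= L * dist u v * exp (l * r)" for r
  proof -
   have "norm (G u r - G v r) <= L * norm (exp (l * r) *\<^sub>R apply_bcontfun u r - exp (l * r) *\<^sub>R apply_bcontfun v r)"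
    using lipschitz_onD[OF F, of "x0 + exp (l * r) *\<^sub>R apply_bcontfun u r" "x0 + exp (l * r) *\<^sub>R apply_bcontfun v r"]
    by (simp add: G_def dist_norm)
   also have "... = L * (exp (l * r) * dist (apply_bcontfun u r) (apply_bcontfun v r))"
    by (simp add: scaleR_diff_right[symmetric] dist_norm)
   also have "... <= L * (exp (l * r) * dist u v)"
    using L0 dist_bounded by (intro mult_left_mono) auto
   finally show ?thesis by (simp add: mult_ac)
  qed
  have "((%r. L * dist u v * exp (l * r)) has_integral
    (L * dist u v * exp (l * s) / l - L * dist u v * exp (l * 0) / l)) {0..s}"
   using l(1) s
   by (intro fundamental_theorem_of_calculus)
    (auto intro!: derivative_eq_intros simp: real_vector_derivative[symmetric])
  hence hi: "((%r. L * dist u v * exp (l * r)) has_integral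
    (L * dist u v * exp (l * s) / l - L * dist u v / l)) {0..s}" by simp
  have "0 <= L * dist u v / l" using L0 l by simp
  hence I: "(%r. L * dist u v * exp (l * r)) integrable_on {0..s}"
   "integral {0..s} (%r. L * dist u v * exp (l * r)) <= L * dist u v * exp (l * s) / l"
   using hi has_integral_integrable integral_unique[OF hi] by (blast, linarith)
  have "norm (integral {0..s} (G u) - integral {0..s} (G v))
    = norm (integral {0..s} (%r. G u r - G v r))"
   by (subst integral_diff) (auto intro!: integrable_continuous_real contG)
  also have "... <= integral {0..s} (%r. L * dist u v * exp (l * r))"
   using est I by (intro integral_norm_bound_integral integrable_continuous_real continuous_on_diff contG)
    (auto intro!: continuous_intros)
  also have "... <= L / l * dist u v * exp (l * s)" using I(2) by simp
  also have "... <= 1 / 2 * dist u v * exp (l * s)"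
   using l(2) by (intro mult_right_mono) auto
  finally have "norm (integral {0..s} (G u) - integral {0..s} (G v)) <= 1 / 2 * dist u v * exp (l * s)" .
  hence "exp (- (l * s)) * norm (integral {0..s} (G u) - integral {0..s} (G v)) <= 1 / 2 * dist u v"
   by (simp add: exp_minus divide_simps mult_ac)
  thus "dist (apply_bcontfun (Bcontfun (P u)) t) (apply_bcontfun (Bcontfun (P v)) t) <= 1 / 2 * dist u v"
   unfolding app P_def s_def[symmetric] dist_norm by (simp add: scaleR_diff_right[symmetric])
 qed
 obtain u where u: "Bcontfun (P u) = u"
  using banach_fix_type[of "1/2" "%u. Bcontfun (P u)"] contr by auto
 have ut: "apply_bcontfun u t = P u t" for t using app u by metis
 define X where "X t = x0 + integral {0..t} (G u)" for t
 have Xeq: "x0 + exp (l * t) *\<^sub>R apply_bcontfun u t = X t" if "0 <= t" for t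
  using that by (simp add: ut P_def X_def max_def exp_minus)
 show thesis
 proof
  show "X 0 = x0" by (simp add: X_def)
  fix T t :: real assume t: "t : {0..T}"
  have "((%t. integral {0..t} (G u)) has_vector_derivative G u t) (at t within {0..T})"
   by (rule integral_has_vector_derivative[OF contG t])
  hence "(X has_vector_derivative G u t) (at t within {0..T})"
   unfolding X_def by (auto intro!: derivative_eq_intros)
  thus "(X has_vector_derivative F (X t)) (at t within {0..T})"
   using Xeq[of t] t by (simp add: G_def)
 qed
qed

subsection \<open>Charts and metrics\<close>

lemma at_within_relatively_open:
 assumes "openin (top_of_set S) U" "t : U"
 shows "at t within U = at t within S"
proof -
 obtain W where W: "open W" "U = S \<inter> W" using assms(1) by (auto simp: openin_open)
 show ?thesis
  by (rule at_within_nhd[of t W]) (use assms(2) W in auto)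
qed

lemma interval_not_bot:
 fixes p q :: real
 assumes "p < q" "t : {p..q}"
 shows "at t within {p..q} ~= bot"
 using assms by (simp add: trivial_limit_within islimpt_Icc)

text \<open>\<open>smooth_curve\<close> gives smoothness on the part of the parameter interval that
  a chart sees, but velocities are taken within the whole interval. Since that part is relatively
  open, the two kinds of derivative agree.\<close>

lemma piece_derivatives:
 fixes g :: "real => 'b::real_normed_vector" and p q :: real
 assumes U: "openin (top_of_set {p..q}) U" "p < q" "t : U" and g: "smooth_on g U"
 shows "(g has_vector_derivative vector_derivative g (at t within {p..q})) (at t within {p..q})"
  and "((%s. vector_derivative g (at s within {p..q})) has_vector_derivative
   vector_derivative (%s. vector_derivative g (at s within {p..q})) (at t within {p..q})) (at t within {p..q})"
  and "smooth_on (%s. vector_derivative g (at s within {p..q})) U"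
proof -
 have US: "U <= {p..q}" using U(1) openin_imp_subset by blast
 have at: "at s within U = at s within {p..q}" if "s : U" for s
  using at_within_relatively_open[OF U(1) that] .
 have d: "(g has_vector_derivative vector_derivative g (at s within {p..q})) (at s within {p..q})" if "s : U" for s
  using smooth_on_differentiable[OF g that] at[OF that] vector_derivative_works by metis
 show "(g has_vector_derivative vector_derivative g (at t within {p..q})) (at t within {p..q})"
  using d U(3) by blast
 have "at s within U ~= bot" if "s : U" for s
  using at[OF that] interval_not_bot[OF U(2)] US that by auto
 thus s: "smooth_on (%s. vector_derivative g (at s within {p..q})) U"
  by (intro smooth_on_derivative[OF g]) (use d at in auto)
 show "((%s. vector_derivative g (at s within {p..q})) has_vector_derivative
   vector_derivative (%s. vector_derivative g (at s within {p..q})) (at t within {p..q})) (at t within {p..q})"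
  using smooth_on_differentiable[OF s U(3)] at[OF U(3)] vector_derivative_works by metis
qed

lemma bilinear_expansion:
 fixes B :: "'e::euclidean_space => 'e => real"
 assumes "bilinear B"
 shows "B u v = (\<Sum>b\<in>Basis. \<Sum>b'\<in>Basis. (u \<bullet> b) * (v \<bullet> b') * B b b')"
proof -
 have "B u v = B (\<Sum>b\<in>Basis. (u \<bullet> b) *\<^sub>R b) (\<Sum>b'\<in>Basis. (v \<bullet> b') *\<^sub>R b')"
  by (simp add: euclidean_representation)
 also have "... = (\<Sum>b\<in>Basis. B ((u \<bullet> b) *\<^sub>R b) (\<Sum>b'\<in>Basis. (v \<bullet> b') *\<^sub>R b'))"
  using assms unfolding bilinear_def by (simp add: linear_sum[of "%u. B u _"])
 also have "... = (\<Sum>b\<in>Basis. \<Sum>b'\<in>Basis. B ((u \<bullet> b) *\<^sub>R b) ((v \<bullet> b') *\<^sub>R b'))"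
  using assms unfolding bilinear_def by (intro sum.cong) (simp_all add: linear_sum)
 also have "... = (\<Sum>b\<in>Basis. \<Sum>b'\<in>Basis. (u \<bullet> b) * (v \<bullet> b') * B b b')"
  using bilinear_lmul[OF assms] bilinear_rmul[OF assms] by (intro sum.cong) simp_all
 finally show ?thesis .
qed

locale riem_mfd =
 fixes X :: "('i, 'm::{t2_space, second_countable_topology}, 'e::euclidean_space) srmfd"
 assumes riem: "riemannian_manifold X"
begin

abbreviation U :: "'i => 'e set" where "U i == crd X i ` cdom X i"

lemma semi: "semi_riemannian_manifold X" and smooth_mfd: "smooth_manifold X"
 using riem unfolding riemannian_manifold_def semi_riemannian_manifold_def by blast+

lemma pts_eq: "pts X = (\<Union>i\<in>ind X. cdom X i)"
 using smooth_mfd unfolding smooth_manifold_def by blast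

lemma cdom_openin: "i : ind X ==> openin (top_of_set (pts X)) (cdom X i)"
 and U_open: "i : ind X ==> open (U i)"
 and chart_homeomorphism:
  "i : ind X ==> homeomorphism (cdom X i) (U i) (crd X i) (inv_into (cdom X i) (crd X i))"
 and transition_smooth: "i : ind X ==> j : ind X ==>
  smooth_on (transition X i j) (crd X i ` (cdom X i \<inter> cdom X j))"
 using smooth_mfd unfolding smooth_manifold_def by blast+

lemma crd_inverse: "i : ind X ==> p : cdom X i ==> inv_into (cdom X i) (crd X i) (crd X i p) = p"
 using chart_homeomorphism by (metis homeomorphism_apply1)

lemma chart_at: "p : pts X ==> chart_at X p : ind X & p : cdom X (chart_at X p)"
 unfolding chart_at_def pts_eq by (rule someI_ex) auto

lemma
 assumes "i : ind X" "x : U i"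
 shows met_bilinear: "bilinear (met X i x)"
  and met_sym: "met X i x u v = met X i x v u"
  and met_pos: "u ~= 0 ==> met X i x u u > 0"
 using riem assms unfolding riemannian_manifold_def semi_riemannian_manifold_def by blast+

lemma met_smooth: "i : ind X ==> smooth_on (%x. met X i x u v) (U i)"
 using semi unfolding semi_riemannian_manifold_def by blast

lemma met_nonneg: "i : ind X ==> x : U i ==> met X i x u u >= 0"
 using met_pos[of i x u] met_bilinear[of i x] by (cases "u = 0") (auto simp: bilinear_lzero)

lemma met_eq_0_iff: "i : ind X ==> x : U i ==> met X i x u u = 0 \<longleftrightarrow> u = 0"
 using met_pos[of i x u] met_bilinear[of i x] by (cases "u = 0") (auto simp: bilinear_lzero)

lemma met_add_left: "i : ind X ==> x : U i ==> met X i x (u + v) w = met X i x u w + met X i x v w"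
 and met_add_right: "i : ind X ==> x : U i ==> met X i x w (u + v) = met X i x w u + met X i x w v"
 and met_scale_left: "i : ind X ==> x : U i ==> met X i x (c *\<^sub>R u) w = c * met X i x u w"
 and met_scale_right: "i : ind X ==> x : U i ==> met X i x w (c *\<^sub>R u) = c * met X i x w u"
 and met_diff_left: "i : ind X ==> x : U i ==> met X i x (u - v) w = met X i x u w - met X i x v w"
 using met_bilinear[of i x] bilinear_ladd bilinear_radd bilinear_lmul bilinear_rmul bilinear_lsub
 by (auto simp: bilinear_lmul bilinear_rmul)

lemma met_nondegenerate:
 assumes "i : ind X" "x : U i" "!!w. met X i x u w = met X i x v w"
 shows "u = v"
 using met_diff_left[OF assms(1,2), of u v "u - v"] assms(3) met_eq_0_iff[OF assms(1,2), of "u - v"]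
 by simp

definition dmet :: "'i => 'e => 'e => 'e => 'e => real" where
 "dmet i x u v w = frechet_derivative (%y. met X i y v w) (at x) u"

lemma met_has_derivative:
 assumes "i : ind X" "x : U i"
 shows "((%y. met X i y v w) has_derivative (%u. dmet i x u v w)) (at x)"
proof -
 have "(%y. met X i y v w) differentiable (at x)"
  using smooth_on_differentiable[OF met_smooth[OF assms(1)] assms(2)]
  using at_within_open[OF assms(2) U_open[OF assms(1)]] by metis
 thus ?thesis unfolding dmet_def using frechet_derivative_works by (metis (no_types))
qed

text \<open>Uniqueness of derivatives transfers symmetry and bilinearity from \<open>met\<close> to
  \<open>dmet\<close>.\<close>

lemma dmet_unique:
 assumes "i : ind X" "x : U i" and "(g has_derivative g') (at x)"
  and "!!y. y : U i ==> g y = met X i y v w"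
 shows "dmet i x u v w = g' u"
proof -
 have "((%y. met X i y v w) has_derivative g') (at x)"
  by (rule has_derivative_transform_within_open[OF assms(3) U_open[OF assms(1)] assms(2) assms(4)])
 thus ?thesis
  by (rule fun_cong[OF has_derivative_unique[OF met_has_derivative[OF assms(1,2)]]])
qed

lemma dmet_linear_dir: "i : ind X ==> x : U i ==> linear (%u. dmet i x u v w)"
 by (rule has_derivative_linear[OF met_has_derivative])

lemma dmet_sym: "i : ind X ==> x : U i ==> dmet i x u v w = dmet i x u w v"
 by (rule dmet_unique[OF _ _ met_has_derivative]) (auto intro: met_sym)

lemma dmet_linear_right: 
 assumes "i : ind X" "x : U i"
 shows "linear (%w. dmet i x u v w)"
proof (rule linearI)
 show "dmet i x u v (w + w') = dmet i x u v w + dmet i x u v w'" for w w'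
  by (rule dmet_unique[OF assms has_derivative_add[OF met_has_derivative met_has_derivative]])
   (use assms in "auto simp: met_add_right")
 show "dmet i x u v (c *\<^sub>R w) = c *\<^sub>R dmet i x u v w" for w c
  by (rule dmet_unique[OF assms has_derivative_scaleR_right[OF met_has_derivative]])
   (use assms in "auto simp: met_scale_right")
qed

lemma dmet_bilinear: 
 assumes "i : ind X" "x : U i"
 shows "bilinear (dmet i x u)"
proof -
 have "linear (%v. dmet i x u v w)" for w
  using dmet_linear_right[OF assms, of u w] dmet_sym[OF assms, of u w] by simp
 thus ?thesis unfolding bilinear_def using dmet_linear_right[OF assms] by auto
qed

lemma met_curve_derivative:
 fixes c :: "real => 'e"
 assumes i: "i : ind X" "c t : U i" and t: "t : S"
  and c: "(c has_vector_derivative v) (at t within S)"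
  and u: "(u has_vector_derivative u') (at t within S)"
  and c_in: "\<forall>\<^sub>F s in at t within S. c s : U i"
 shows "((%s. met X i (c s) (u s) (u s)) has_real_derivative
  dmet i (c t) v (u t) (u t) + 2 * met X i (c t) u' (u t)) (at t within S)"
proof -
 \<comment> \<open>Only the coefficients of the metric with fixed vectors have known derivatives in
   the base point; the expansion in a basis separates the motion of the point from that of the
   vector.\<close>
 let ?g = "%s. \<Sum>b\<in>Basis. \<Sum>b'\<in>Basis. (u s \<bullet> b) * (u s \<bullet> b') * met X i (c s) b b'"
 let ?d = "\<Sum>b\<in>Basis. \<Sum>b'\<in>Basis. ((u' \<bullet> b) * (u t \<bullet> b') + (u t \<bullet> b) * (u' \<bullet> b')) * met X i (c t) b b'
   + (u t \<bullet> b) * (u t \<bullet> b') * dmet i (c t) v b b'"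
 have ub: "((%s. u s \<bullet> b) has_real_derivative u' \<bullet> b) (at t within S)" for b
  using bounded_linear.has_vector_derivative[OF bounded_linear_inner_left u]
  by (simp add: real_vector_derivative)
 have mb: "((%s. met X i (c s) b b') has_real_derivative dmet i (c t) v b b') (at t within S)" for b b'
 proof -
  have "((%s. met X i (c s) b b') has_derivative (%h. dmet i (c t) (h *\<^sub>R v) b b')) (at t within S)"
   using has_derivative_compose[OF c[unfolded has_vector_derivative_def]
    met_has_derivative[OF i, of b b']] by simp
  thus ?thesis
   using linear_cmul[OF dmet_linear_dir[OF i, of b b']]
   by (simp add: has_field_derivative_def mult_commute_abs)
 qed
 have "(?g has_real_derivative ?d) (at t within S)"
  by (intro DERIV_sum) (auto intro!: derivative_eq_intros ub mb simp: algebra_simps)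
 moreover have "?d = dmet i (c t) v (u t) (u t) + 2 * met X i (c t) u' (u t)"
 proof -
  have "?d = (\<Sum>b\<in>Basis. \<Sum>b'\<in>Basis. (u' \<bullet> b) * (u t \<bullet> b') * met X i (c t) b b')
   + (\<Sum>b\<in>Basis. \<Sum>b'\<in>Basis. (u t \<bullet> b) * (u' \<bullet> b') * met X i (c t) b b')
   + (\<Sum>b\<in>Basis. \<Sum>b'\<in>Basis. (u t \<bullet> b) * (u t \<bullet> b') * dmet i (c t) v b b')"
   by (simp add: sum.distrib algebra_simps)
  also have "... = met X i (c t) u' (u t) + met X i (c t) (u t) u' + dmet i (c t) v (u t) (u t)"
   by (simp only: bilinear_expansion[OF met_bilinear[OF i], symmetric]
    bilinear_expansion[OF dmet_bilinear[OF i], symmetric])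
  finally show ?thesis using met_sym[OF i, of u' "u t"] by simp
 qed
 ultimately have "(?g has_real_derivative dmet i (c t) v (u t) (u t) + 2 * met X i (c t) u' (u t)) (at t within S)"
  by simp
 moreover have "\<forall>\<^sub>F s in at t within S. ?g s = met X i (c s) (u s) (u s)"
  using c_in by eventually_elim (simp add: bilinear_expansion[OF met_bilinear[OF i(1)], symmetric])
 moreover have "?g t = met X i (c t) (u t) (u t)"
  by (simp add: bilinear_expansion[OF met_bilinear[OF i], symmetric])
 ultimately show ?thesis
  unfolding has_field_derivative_def
  using has_derivative_transform_eventually[of ?g _ t S "%s. met X i (c s) (u s) (u s)"] t by simp
qed

text \<open>A nondegenerate form is an injective map into the dual space, hence onto by dimension.
  This provides the vector that \<open>christoffel\<close> selects by \<open>THE\<close>.\<close>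

lemma riesz:
 assumes i: "i : ind X" "x : U i" and "linear \<omega>"
 shows "EX z. ALL w. met X i x z w = \<omega> w"
proof -
 let ?A = "%z. \<Sum>b\<in>Basis. met X i x z b *\<^sub>R b"
 have lin: "linear ?A"
  using met_add_left[OF i] met_scale_left[OF i]
  by (intro linearI) (simp_all add: scaleR_add_left sum.distrib scaleR_sum_right)
 have exp: "met X i x z w = (\<Sum>b\<in>Basis. (w \<bullet> b) * met X i x z b)" for z w
 proof -
  have l: "linear (met X i x z)" using met_bilinear[OF i] unfolding bilinear_def by blast
  show ?thesis
   using linear_sum[OF l, of "%b. (w \<bullet> b) *\<^sub>R b" Basis] linear_cmul[OF l]
   by (simp add: euclidean_representation)
 qed
 have Ab: "?A z \<bullet> b = met X i x z b" if "b : Basis" for z b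
  using that by (simp add: inner_sum_left_Basis)
 have "inj ?A"
 proof (rule injI)
  fix z z' assume "?A z = ?A z'"
  hence "met X i x z b = met X i x z' b" if "b : Basis" for b using Ab that by metis
  hence "met X i x z w = met X i x z' w" for w by (subst (1 2) exp) simp
  thus "z = z'" using met_nondegenerate[OF i] by blast
 qed
 hence "surj ?A" by (rule linear_inj_imp_surj[OF lin])
 then obtain z where z: "?A z = (\<Sum>b\<in>Basis. \<omega> b *\<^sub>R b)" unfolding surj_def by metis
 have zb: "met X i x z b = \<omega> b" if "b : Basis" for b
  using Ab[OF that, of z] that unfolding z by (simp add: inner_sum_left_Basis)
 have "met X i x z w = \<omega> w" for w
 proof -
  have "\<omega> w = (\<Sum>b\<in>Basis. (w \<bullet> b) * \<omega> b)"
   using linear_sum[OF assms(3), of "%b. (w \<bullet> b) *\<^sub>R b" Basis] linear_cmul[OF assms(3)]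
   by (simp add: euclidean_representation)
  thus ?thesis by (subst exp) (simp add: zb)
 qed
 thus ?thesis by blast
qed

lemma christoffel_met:
 assumes i: "i : ind X" "x : U i"
 shows "met X i x (christoffel X i x u v) w =
  (dmet i x u v w + dmet i x v u w - dmet i x w u v) / 2"
proof -
 have "linear (%w. dmet i x u v w + dmet i x v u w - dmet i x w u v)"
  using linear_compose_sub[OF linear_compose_add[OF dmet_linear_right[OF i, of u v] dmet_linear_right[OF i, of v u]] dmet_linear_dir[OF i, of u v]] .
 from linear_compose_scale_right[OF this, of "1/2"]
 have "linear (%w. (dmet i x u v w + dmet i x v u w - dmet i x w u v) / 2)"
  by simp
 from riesz[OF i this] obtain z where
  z: "ALL w. met X i x z w = (dmet i x u v w + dmet i x v u w - dmet i x w u v) / 2" by blast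
 have "christoffel X i x u v = z"
  unfolding christoffel_def dmet_def[symmetric]
 proof (rule the_equality)
  show "ALL w. met X i x z w = (dmet i x u v w + dmet i x v u w - dmet i x w u v) / 2" by (rule z)
  fix z' assume "ALL w. met X i x z' w = (dmet i x u v w + dmet i x v u w - dmet i x w u v) / 2"
  with z show "z' = z" by (intro met_nondegenerate[OF i]) metis
 qed
 thus ?thesis using z by simp
qed

lemma christoffel_scale:
 assumes i: "i : ind X" "x : U i"
 shows "christoffel X i x (k *\<^sub>R u) (k *\<^sub>R u) = k\<^sup>2 *\<^sub>R christoffel X i x u u"
proof (rule met_nondegenerate[OF i])
 fix w
 show "met X i x (christoffel X i x (k *\<^sub>R u) (k *\<^sub>R u)) w = met X i x (k\<^sup>2 *\<^sub>R christoffel X i x u u) w"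
  using linear_cmul[OF dmet_linear_dir[OF i]] bilinear_lmul[OF dmet_bilinear[OF i]]
   bilinear_rmul[OF dmet_bilinear[OF i]]
  by (simp add: christoffel_met[OF i] met_scale_left[OF i] power2_eq_square field_simps)
qed

end

subsection \<open>Curves\<close>

lemma constant_of_zero_derivative:
 fixes g :: "real => 'b::real_normed_vector"
 assumes "!!t. t : {p..q} ==> (g has_vector_derivative 0) (at t within {p..q})" "s : {p..q}" "t : {p..q}"
 shows "g s = g t"
proof -
 have "(g has_derivative (%h. 0)) (at x within {p..q})" if "x : {p..q}" for x
  using assms(1)[OF that] by (simp add: has_vector_derivative_def)
 from has_derivative_zero_constant[OF convex_real_interval(5) this]
 show ?thesis using assms(2,3) by auto
qed

lemma vector_derivative_transform:
 assumes "(f has_vector_derivative f') (at x within S)" "\<forall>\<^sub>F y in at x within S. f y = g y" "x : S" "f x = g x"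
 shows "(g has_vector_derivative f') (at x within S)"
 using has_derivative_transform_eventually[OF assms(1)[unfolded has_vector_derivative_def] assms(2,4,3)]
 unfolding has_vector_derivative_def .

context riem_mfd
begin

lemma chart_piece_openin:
 assumes "continuous_on S gamma" "gamma ` S <= pts X" "i : ind X"
 shows "openin (top_of_set S) {t : S. gamma t : cdom X i}"
proof -
 have "openin (top_of_set S) (S \<inter> gamma -` cdom X i)"
  by (rule continuous_openin_preimage[OF assms(1) _ cdom_openin[OF assms(3)]]) (use assms(2) in auto)
 thus ?thesis by (simp add: Int_def vimage_def)
qed

lemma curve_derivatives:
 assumes gamma: "smooth_curve X {p..q} gamma" and pq: "p < q" and i: "i : ind X" "t : {p..q}" "gamma t : cdom X i"
 shows "((%s. crd X i (gamma s)) has_vector_derivative velocity X i gamma {p..q} t) (at t within {p..q})"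
  and "(velocity X i gamma {p..q} has_vector_derivative
   vector_derivative (velocity X i gamma {p..q}) (at t within {p..q})) (at t within {p..q})"
  and "\<forall>\<^sub>F s in at t within {p..q}. gamma s : cdom X i"
  and "smooth_on (velocity X i gamma {p..q}) {t : {p..q}. gamma t : cdom X i}"
proof -
 let ?Q = "{t : {p..q}. gamma t : cdom X i}"
 have Q: "openin (top_of_set {p..q}) ?Q"
  using gamma i(1) by (intro chart_piece_openin) (auto simp: smooth_curve_def)
 have s: "smooth_on (%s. crd X i (gamma s)) ?Q"
  using gamma i(1) by (auto simp: smooth_curve_def o_def)
 have t: "t : ?Q" using i by simp
 note d = piece_derivatives[OF Q pq t s]
 show "((%s. crd X i (gamma s)) has_vector_derivative velocity X i gamma {p..q} t) (at t within {p..q})"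
  using d(1) by (simp add: velocity_def)
 have v: "velocity X i gamma {p..q} = (%s. vector_derivative (%s. crd X i (gamma s)) (at s within {p..q}))"
  by (simp add: velocity_def fun_eq_iff)
 show "(velocity X i gamma {p..q} has_vector_derivative
   vector_derivative (velocity X i gamma {p..q}) (at t within {p..q})) (at t within {p..q})"
  using d(2) unfolding v .
 show "smooth_on (velocity X i gamma {p..q}) ?Q"
  using d(3) unfolding v .
 have "\<forall>\<^sub>F s in at t within ?Q. s : ?Q"
  by (simp add: eventually_at_filter)
 thus "\<forall>\<^sub>F s in at t within {p..q}. gamma s : cdom X i"
  unfolding at_within_relatively_open[OF Q t] by (rule eventually_mono) simp
qed

lemma velocity_eqI:
 assumes "p < q" "t : {p..q}" "((%s. crd X i (gamma s)) has_vector_derivative v) (at t within {p..q})"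
 shows "velocity X i gamma {p..q} t = v"
 unfolding velocity_def using assms
 by (intro vector_derivative_within[OF interval_not_bot]) auto

lemma velocity_change_chart:
 assumes gamma: "smooth_curve X {p..q} gamma" and pq: "p < q"
  and t: "t : {p..q}" and i: "i : ind X" "gamma t : cdom X i" and j: "j : ind X" "gamma t : cdom X j"
 shows "velocity X j gamma {p..q} t =
  frechet_derivative (transition X i j) (at (crd X i (gamma t))) (velocity X i gamma {p..q} t)"
proof -
 let ?O = "crd X i ` (cdom X i \<inter> cdom X j)"
 have "openin (top_of_set (pts X)) (cdom X i \<inter> cdom X j)"
  using cdom_openin i(1) j(1) by blast
 hence "openin (top_of_set (cdom X i)) (cdom X i \<inter> cdom X j)"
  by (rule openin_subset_trans) (use pts_eq i in auto)
 hence "openin (top_of_set (U i)) ?O"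
  using homeomorphism_imp_open_map[OF chart_homeomorphism[OF i(1)]] by blast
 hence O: "open ?O" using U_open[OF i(1)] openin_open_trans by blast
 have p: "crd X i (gamma t) : ?O" using i j by blast
 have "transition X i j differentiable (at (crd X i (gamma t)))"
  using smooth_on_differentiable[OF transition_smooth[OF i(1) j(1)] p] at_within_open[OF p O] by simp
 hence D: "(transition X i j has_derivative frechet_derivative (transition X i j) (at (crd X i (gamma t))))
   (at (crd X i (gamma t)))" (is "(_ has_derivative ?D) _")
  using frechet_derivative_works by blast
 have c: "((%s. crd X i (gamma s)) has_derivative (%h. h *\<^sub>R velocity X i gamma {p..q} t)) (at t within {p..q})"
  using curve_derivatives(1)[OF gamma pq i(1) t i(2)] by (simp add: has_vector_derivative_def)
 have "((%s. transition X i j (crd X i (gamma s))) has_derivative (%h. ?D (h *\<^sub>R velocity X i gamma {p..q} t)))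
   (at t within {p..q})"
  using has_derivative_compose[OF c D] .
 hence "((%s. transition X i j (crd X i (gamma s))) has_vector_derivative ?D (velocity X i gamma {p..q} t))
   (at t within {p..q})"
  unfolding has_vector_derivative_def linear_cmul[OF has_derivative_linear[OF D]] .
 moreover have "\<forall>\<^sub>F s in at t within {p..q}. transition X i j (crd X i (gamma s)) = crd X j (gamma s)"
  using curve_derivatives(3)[OF gamma pq i(1) t i(2)]
  by eventually_elim (simp add: transition_def crd_inverse i(1))
 moreover have "transition X i j (crd X i (gamma t)) = crd X j (gamma t)"
  by (simp add: transition_def crd_inverse i)
 ultimately have "((%s. crd X j (gamma s)) has_vector_derivative ?D (velocity X i gamma {p..q} t)) (at t within {p..q})"
  by (rule vector_derivative_transform[OF _ _ t])
 thus ?thesis by (rule velocity_eqI[OF pq t])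
qed

lemma met_change_chart:
 assumes "i : ind X" "j : ind X" "p : cdom X i \<inter> cdom X j"
 shows "met X i (crd X i p) u v = met X j (crd X j p)
    (frechet_derivative (transition X i j) (at (crd X i p)) u)
    (frechet_derivative (transition X i j) (at (crd X i p)) v)"
 using semi assms unfolding semi_riemannian_manifold_def by blast

text \<open>\<open>chart_at\<close> may jump as \<open>t\<close> varies. Independence of the chart
  makes it possible to compute \<open>velocity_sq\<close> in one fixed chart around a given time,
  and so to differentiate it.\<close>

lemma velocity_sq_chart:
 assumes gamma: "smooth_curve X {p..q} gamma" and pq: "p < q"
  and t: "t : {p..q}" and i: "i : ind X" "gamma t : cdom X i"
 shows "velocity_sq X gamma {p..q} t =
  met X i (crd X i (gamma t)) (velocity X i gamma {p..q} t) (velocity X i gamma {p..q} t)"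
proof -
 have p: "gamma t : pts X" using pts_eq i by blast
 let ?j = "chart_at X (gamma t)"
 have j: "?j : ind X" "gamma t : cdom X ?j" using chart_at[OF p] by auto
 show ?thesis
  unfolding velocity_sq_def Let_def
  using met_change_chart[OF i(1) j(1)] velocity_change_chart[OF gamma pq t i j] i j by simp
qed

lemma velocity_sq_nonneg:
 assumes gamma: "smooth_curve X {p..q} gamma" and t: "t : {p..q}"
 shows "velocity_sq X gamma {p..q} t >= 0"
proof -
 have "gamma t : pts X" using gamma t by (auto simp: smooth_curve_def)
 from chart_at[OF this] show ?thesis
  unfolding velocity_sq_def Let_def by (intro met_nonneg) auto
qed

text \<open>Compatibility of the Levi-Civita derivative with the metric: in the Koszul formula with
  three equal arguments two of the three terms cancel, and half of the derivative of the metric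
  remains.\<close>

lemma velocity_sq_derivative:
 assumes gamma: "smooth_curve X {p..q} gamma" and pq: "p < q"
  and t: "t : {p..q}" and i: "i : ind X" "gamma t : cdom X i"
 defines "v == velocity X i gamma {p..q} t" and "acc == vector_derivative (velocity X i gamma {p..q}) (at t within {p..q})"
 shows "(velocity_sq X gamma {p..q} has_real_derivative
  2 * met X i (crd X i (gamma t)) (acc + christoffel X i (crd X i (gamma t)) v v) v) (at t within {p..q})"
proof -
 note cd = curve_derivatives[OF gamma pq i(1) t i(2), folded v_def acc_def]
 have x: "crd X i (gamma t) : U i" using i by simp
 have "((%s. met X i (crd X i (gamma s)) (velocity X i gamma {p..q} s) (velocity X i gamma {p..q} s)) has_real_derivative
   dmet i (crd X i (gamma t)) v (velocity X i gamma {p..q} t) (velocity X i gamma {p..q} t) +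
   2 * met X i (crd X i (gamma t)) acc (velocity X i gamma {p..q} t)) (at t within {p..q})"
  by (rule met_curve_derivative[OF i(1) x t cd(1,2)]) (use cd(3) in eventually_elim, simp)
 hence "((%s. met X i (crd X i (gamma s)) (velocity X i gamma {p..q} s) (velocity X i gamma {p..q} s)) has_real_derivative
  2 * met X i (crd X i (gamma t)) (acc + christoffel X i (crd X i (gamma t)) v v) v) (at t within {p..q})"
  using christoffel_met[OF i(1) x, of v v v] met_add_left[OF i(1) x]
  by (simp add: v_def[symmetric] algebra_simps)
 moreover have "\<forall>\<^sub>F s in at t within {p..q}.
  met X i (crd X i (gamma s)) (velocity X i gamma {p..q} s) (velocity X i gamma {p..q} s) = velocity_sq X gamma {p..q} s"
 proof -
  have "\<forall>\<^sub>F s in at t within {p..q}. s : {p..q} & gamma s : cdom X i"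
   using cd(3) by (simp add: eventually_at_filter)
  thus ?thesis by eventually_elim (simp add: velocity_sq_chart[OF gamma pq _ i(1)])
 qed
 ultimately show ?thesis
  unfolding real_vector_derivative
  by (rule vector_derivative_transform[OF _ _ t]) (simp add: velocity_sq_chart[OF gamma pq t i])
qed

lemma geodesic_speed_constant:
 assumes "geodesic X {0..1} gamma" "s : {0..1}" "t : {0..1}"
 shows "velocity_sq X gamma {0..1} s = velocity_sq X gamma {0..1} t"
proof (rule constant_of_zero_derivative[OF _ assms(2,3)])
 fix t :: real assume t: "t : {0..1}"
 have gamma: "smooth_curve X {0..1} gamma" using assms(1) by (simp add: geodesic_def)
 hence "gamma t : pts X" using t by (auto simp: smooth_curve_def)
 then obtain i where i: "i : ind X" "gamma t : cdom X i" using pts_eq by blast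
 hence "vector_derivative (velocity X i gamma {0..1}) (at t within {0..1}) +
   christoffel X i (crd X i (gamma t)) (velocity X i gamma {0..1} t) (velocity X i gamma {0..1} t) = 0"
  using assms(1) t by (auto simp: geodesic_def)
 thus "(velocity_sq X gamma {0..1} has_vector_derivative 0) (at t within {0..1})"
  using velocity_sq_derivative[OF gamma _ t i] met_bilinear[OF i(1)] i
  by (simp add: bilinear_lzero real_vector_derivative)
qed

text \<open>In each chart the velocity vanishes, so the curve is locally constant, and the parameter
  interval is connected.\<close>

lemma zero_speed_constant:
 assumes gamma: "smooth_curve X {0..1} gamma" and z: "!!t. t : {0..1} ==> velocity_sq X gamma {0..1} t = 0"
  and st: "s : {0..1}" "t : {0..1}"
 shows "gamma s = gamma t"
proof (rule connected_local_const[OF _ st])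
 show "connected {0..1::real}" by simp
 show "ALL a:{0..1}. \<forall>\<^sub>F b in at a within {0..1}. gamma a = gamma b"
 proof
  fix a :: real assume a: "a : {0..1}"
  hence "gamma a : pts X" using gamma by (auto simp: smooth_curve_def)
  then obtain i where i: "i : ind X" "gamma a : cdom X i" using pts_eq by blast
  have "\<forall>\<^sub>F b in at a within {0..1}. gamma b : cdom X i"
   by (rule curve_derivatives(3)[OF gamma _ i(1) a i(2)]) simp
  then obtain d where d: "d > 0" "!!b. b : {0..1} ==> b ~= a ==> dist b a < d ==> gamma b : cdom X i"
   unfolding eventually_at by blast
  let ?J = "{0..1} \<inter> ball a d"
  have in_i: "gamma b : cdom X i" if "b : ?J" for b
   using d(2)[of b] that i(2) by (cases "b = a") (auto simp: dist_commute)
  have "convex ?J" by (intro convex_Int) auto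
  moreover have "((%s. crd X i (gamma s)) has_derivative (%h. 0)) (at b within ?J)" if b: "b : ?J" for b
  proof -
   have b1: "b : {0..1}" using b by simp
   have "velocity X i gamma {0..1} b = 0"
    using z[OF b1] velocity_sq_chart[OF gamma _ b1 i(1) in_i[OF b]] met_eq_0_iff[OF i(1)] in_i[OF b] by simp
   hence "((%s. crd X i (gamma s)) has_derivative (%h. 0)) (at b within {0..1})"
    using curve_derivatives(1)[OF gamma _ i(1) b1 in_i[OF b]] by (simp add: has_vector_derivative_def)
   thus ?thesis by (rule has_derivative_subset) auto
  qed
  ultimately obtain c where c: "!!b. b : ?J ==> crd X i (gamma b) = c"
   using has_derivative_zero_constant[of ?J "%s. crd X i (gamma s)"] by blast
  have "gamma b = gamma a" if b: "b : ?J" for b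
  proof -
   have "crd X i (gamma b) = crd X i (gamma a)" using c[OF b] c[of a] a d(1) by simp
   thus ?thesis using crd_inverse[OF i(1) in_i[OF b]] crd_inverse[OF i] by metis
  qed
  hence "gamma a = gamma b" if "b : {0..1}" "b ~= a" "dist b a < d" for b
   using that by (auto simp: dist_commute)
  thus "\<forall>\<^sub>F b in at a within {0..1}. gamma a = gamma b"
   unfolding eventually_at using d(1) by blast
 qed
qed

text \<open>The chain rule up to second order. It is stated for arbitrary smooth \<open>phi\<close>,
  because the fiber component of a spacetime geodesic becomes a geodesic only after a change of
  parameter that is in general not affine.\<close>

lemma reparametrization:
 assumes sig: "smooth_curve X {0..1} sig" and phi: "smooth_on phi {0..1}" "!!t. t : {0..1} ==> phi t : {0..1}"
  and phi': "!!t. t : {0..1} ==> (phi has_real_derivative phi' t) (at t within {0..1})"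
  and phi'': "!!t. t : {0..1} ==> (phi' has_real_derivative phi'' t) (at t within {0..1})"
 shows "smooth_curve X {0..1} (%t. sig (phi t))"
  and "!!i t. i : ind X ==> t : {0..1} ==> sig (phi t) : cdom X i ==>
   velocity X i (%t. sig (phi t)) {0..1} t = phi' t *\<^sub>R velocity X i sig {0..1} (phi t)"
  and "!!i t. i : ind X ==> t : {0..1} ==> sig (phi t) : cdom X i ==>
   vector_derivative (velocity X i (%t. sig (phi t)) {0..1}) (at t within {0..1}) =
   phi'' t *\<^sub>R velocity X i sig {0..1} (phi t) +
   (phi' t)\<^sup>2 *\<^sub>R vector_derivative (velocity X i sig {0..1}) (at (phi t) within {0..1})"
  and "!!t. t : {0..1} ==> velocity_sq X (%t. sig (phi t)) {0..1} t = (phi' t)\<^sup>2 * velocity_sq X sig {0..1} (phi t)"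
proof -
 have phic: "continuous_on {0..1} phi" using phi(1) by (rule smooth_on_imp_continuous_on)
 have sigc: "continuous_on {0..1} sig" "sig ` {0..1} <= pts X" using sig by (auto simp: smooth_curve_def)
 show S: "smooth_curve X {0..1} (%t. sig (phi t))"
  unfolding smooth_curve_def
 proof (intro conjI ballI)
  show "(%t. sig (phi t)) ` {0..1} <= pts X" using phi(2) sigc(2) by (simp add: image_subset_iff)
  show "continuous_on {0..1} (%t. sig (phi t))"
   by (rule continuous_on_compose2[OF sigc(1) phic]) (use phi(2) in auto)
  fix i assume i: "i : ind X"
  have s: "smooth_on (crd X i \<circ> sig) {t : {0..1}. sig t : cdom X i}"
   using sig i unfolding smooth_curve_def by blast
  have "smooth_on (%t. (crd X i \<circ> sig) (phi t)) {t : {0..1}. sig (phi t) : cdom X i}"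
   by (rule smooth_on_compose[OF s smooth_on_subset[OF phi(1)]]) (use phi(2) in blast)+
  thus "smooth_on (crd X i \<circ> (%t. sig (phi t))) {t : {0..1}. sig (phi t) : cdom X i}"
   by (simp add: o_def)
 qed
 have chain: "((%t. g (phi t)) has_vector_derivative phi' t *\<^sub>R g') (at t within {0..1})"
  if t: "t : {0..1}" and g: "(g has_vector_derivative g') (at (phi t) within {0..1})"
  for g :: "real => 'e" and g' t
 proof -
  have "(g has_vector_derivative g') (at (phi t) within phi ` {0..1})"
   by (rule has_vector_derivative_within_subset[OF g]) (use phi(2) in auto)
  from vector_diff_chain_within[OF phi'[OF t, unfolded real_vector_derivative] this]
  show ?thesis by (simp add: o_def)
 qed
 show v: "velocity X i (%t. sig (phi t)) {0..1} t = phi' t *\<^sub>R velocity X i sig {0..1} (phi t)"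
  if "i : ind X" "t : {0..1}" "sig (phi t) : cdom X i" for i t
  using that phi(2) by (intro velocity_eqI chain curve_derivatives(1)[OF sig]) auto
 show "vector_derivative (velocity X i (%t. sig (phi t)) {0..1}) (at t within {0..1}) =
   phi'' t *\<^sub>R velocity X i sig {0..1} (phi t) +
   (phi' t)\<^sup>2 *\<^sub>R vector_derivative (velocity X i sig {0..1}) (at (phi t) within {0..1})"
  if i: "i : ind X" and t: "t : {0..1}" and it: "sig (phi t) : cdom X i" for i t
 proof (rule vector_derivative_within[OF interval_not_bot])
  have phit: "phi t : {0..1}" using phi(2) t by blast
  have "((%t. phi' t *\<^sub>R velocity X i sig {0..1} (phi t)) has_vector_derivative
   phi' t *\<^sub>R (phi' t *\<^sub>R vector_derivative (velocity X i sig {0..1}) (at (phi t) within {0..1}))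
   + phi'' t *\<^sub>R velocity X i sig {0..1} (phi t)) (at t within {0..1})"
   by (rule has_vector_derivative_scaleR[OF phi''[OF t] chain[OF t curve_derivatives(2)[OF sig _ i phit it]]]) simp
  hence d: "((%t. phi' t *\<^sub>R velocity X i sig {0..1} (phi t)) has_vector_derivative
   phi'' t *\<^sub>R velocity X i sig {0..1} (phi t) +
   (phi' t)\<^sup>2 *\<^sub>R vector_derivative (velocity X i sig {0..1}) (at (phi t) within {0..1})) (at t within {0..1})"
   by (simp add: power2_eq_square add.commute)
  have "\<forall>\<^sub>F s in at t within {0..1}. s : {0..1} & sig (phi s) : cdom X i"
   using curve_derivatives(3)[OF S _ i t it] by (simp add: eventually_at_filter)
  hence "\<forall>\<^sub>F s in at t within {0..1}. phi' s *\<^sub>R velocity X i sig {0..1} (phi s) = velocity X i (%t. sig (phi t)) {0..1} s"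
   by eventually_elim (simp add: v[OF i])
  thus "(velocity X i (%t. sig (phi t)) {0..1} has_vector_derivative
   phi'' t *\<^sub>R velocity X i sig {0..1} (phi t) +
   (phi' t)\<^sup>2 *\<^sub>R vector_derivative (velocity X i sig {0..1}) (at (phi t) within {0..1})) (at t within {0..1})"
   by (rule vector_derivative_transform[OF d _ t]) (simp add: v[OF i t it])
 qed (use t in auto)
 show "velocity_sq X (%t. sig (phi t)) {0..1} t = (phi' t)\<^sup>2 * velocity_sq X sig {0..1} (phi t)" if t: "t : {0..1}" for t
 proof -
  have "sig (phi t) : pts X" using sigc(2) phi(2)[OF t] by blast
  then obtain i where i: "i : ind X" "sig (phi t) : cdom X i" using pts_eq by blast
  show ?thesis
   using velocity_sq_chart[OF S _ t i] velocity_sq_chart[OF sig _ phi(2)[OF t] i] v[OF i(1) t i(2)] i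
   by (simp add: met_scale_left[OF i(1)] met_scale_right[OF i(1)] power2_eq_square)
 qed
qed

end

subsection \<open>Warping functions\<close>

lemma open_base_interval [simp]: "open (base_interval a b)"
proof -
 have "base_interval a b = {t. a < ereal t} \<inter> {t. ereal t < b}"
  by (auto simp: base_interval_def)
 moreover have "open {t. a < ereal t}" "open {t. ereal t < b}"
  by (intro open_Collect_less continuous_intros)+
 ultimately show ?thesis by (metis open_Int)
qed

lemma I_between: "u : base_interval a b ==> v : base_interval a b ==> u <= t ==> t <= v ==> t : base_interval a b"
 unfolding base_interval_def
 by (metis (no_types, lifting) ereal_less_eq(3) less_le_trans le_less_trans mem_Collect_eq)

lemma base_interval_ereal [simp]: "base_interval (ereal u) (ereal v) = {u<..<v}"
 by (auto simp: base_interval_def)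

text \<open>The inverse solves the differential equation \<open>psi' = 1 / d (psi)\<close>, so its
  smoothness is an instance of \<open>smooth_on_ode\<close>.\<close>

lemma smooth_inverse:
 fixes phi d :: "real => real"
 assumes phi: "!!t. t : {0..1} ==> (phi has_real_derivative d t) (at t within {0..1})"
  and pos: "!!t. t : {0..1} ==> 0 < d t" and d: "smooth_on d {0..1}" and ends: "phi 0 = 0" "phi 1 = 1"
 obtains psi where "smooth_on psi {0..1}" "!!r. r : {0..1} ==> psi r : {0..1}" "!!r. r : {0..1} ==> phi (psi r) = r"
  "!!t. t : {0..1} ==> phi t : {0..1}" "!!t. t : {0..1} ==> psi (phi t) = t"
  "!!r. r : {0..1} ==> (psi has_real_derivative 1 / d (psi r)) (at r within {0..1})"
proof -
 have cont: "continuous_on {0..1} phi" using phi by (meson DERIV_continuous continuous_on_eq_continuous_within)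
 have mono: "phi s < phi t" if st: "s : {0..1}" "t : {0..1}" "s < t" for s t
 proof (rule DERIV_pos_imp_increasing_open[OF st(3)])
  show "EX y. (phi has_real_derivative y) (at x) & y > 0" if "s < x" "x < t" for x
  proof -
   have "x : {0<..<1}" using that st by auto
   hence "(phi has_real_derivative d x) (at x)" "x : {0..1}"
    using phi[of x] at_within_Icc_at[of 0 x 1] by auto
   thus ?thesis using pos by blast
  qed
  show "continuous_on {s..t} phi" using cont by (rule continuous_on_subset) (use st in auto)
 qed
 have inj: "inj_on phi {0..1}" by (rule linorder_inj_onI) (use mono in force)+
 have bd: "phi t : {0..1}" if "t : {0..1}" for t
  using mono[of 0 t] mono[of t 1] that ends by (cases "t = 0"; cases "t = 1") auto
 have im: "phi ` {0..1} = {0..1}"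
 proof
  show "{0..1} <= phi ` {0..1}"
   using IVT'[of phi 0 _ 1] ends cont by (force simp: image_iff)
 qed (use bd in auto)
 define psi where "psi = inv_into {0..1} phi"
 have psi: "psi r : {0..1}" "phi (psi r) = r" if "r : {0..1}" for r
  using that im inv_into_into[of r phi "{0..1}"] f_inv_into_f[of r phi "{0..1}"] by (auto simp: psi_def)
 have psiphi: "psi (phi t) = t" if "t : {0..1}" for t
  using inv_into_f_f[OF inj that] by (simp add: psi_def)
 have psicont: "continuous_on {0..1} psi"
  using continuous_on_inv[OF cont _ , of psi] psiphi im by auto
 have der: "(psi has_real_derivative 1 / d (psi r)) (at r within {0..1})" if r: "r : {0..1}" for r
 proof -
  have "((%s. (phi s - phi (psi r)) / (s - psi r)) \<longlongrightarrow> d (psi r)) (at (psi r) within {0..1})"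
   using phi[OF psi(1)[OF r]] by (simp add: has_field_derivative_iff)
  moreover have "filterlim psi (at (psi r) within {0..1}) (at r within {0..1})"
   unfolding filterlim_at
  proof
   show "(psi \<longlongrightarrow> psi r) (at r within {0..1})" using psicont r by (simp add: continuous_on_def)
   have "psi s : {0..1} & psi s ~= psi r" if "s : {0..1}" "s ~= r" for s
    using psi[OF that(1)] psi(2)[OF r] that(2) by metis
   thus "\<forall>\<^sub>F s in at r within {0..1}. psi s : {0..1} & psi s ~= psi r"
    by (auto simp: eventually_at_filter)
  qed
  ultimately have "((%s. (phi (psi s) - phi (psi r)) / (psi s - psi r)) \<longlongrightarrow> d (psi r)) (at r within {0..1})"
   by (rule filterlim_compose)
  hence "((%s. inverse ((phi (psi s) - phi (psi r)) / (psi s - psi r))) \<longlongrightarrow> inverse (d (psi r))) (at r within {0..1})"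
   using pos[OF psi(1)[OF r]] by (intro tendsto_inverse) auto
  moreover have "\<forall>\<^sub>F s in at r within {0..1}.
    inverse ((phi (psi s) - phi (psi r)) / (psi s - psi r)) = (psi s - psi r) / (s - r)"
   using psi(2) r by (auto simp: eventually_at_filter)
  ultimately have "((%s. (psi s - psi r) / (s - r)) \<longlongrightarrow> inverse (d (psi r))) (at r within {0..1})"
   by (rule Lim_transform_eventually)
  thus ?thesis by (simp add: has_field_derivative_iff inverse_eq_divide)
 qed
 have "smooth_on (%t. 1 / d t) {0..1}"
  by (intro smooth_on_divide smooth_on_const d) (use pos in force)
 hence "smooth_on psi {0..1}"
  by (rule smooth_on_ode) (use psi(1) der in "auto simp: real_vector_derivative")
 thus thesis using that psi bd psiphi der by blast
qed

locale warp =
 fixes a b :: ereal and f :: "real => real"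
 assumes ab: "a < b" and f_smooth: "smooth_on f (base_interval a b)"
  and f_pos: "!!tau. tau : base_interval a b ==> f tau > 0"
begin

abbreviation "I == base_interval a b"
abbreviation "V == invsq f"
abbreviation "dV == deriv (invsq f)"

lemma I_nonempty: "I ~= {}"
proof -
 obtain t where "a < ereal t" "ereal t < b" using ab ereal_dense2 by blast
 thus ?thesis by (auto simp: base_interval_def)
qed

lemma V_pos: "tau : I ==> V tau > 0"
 using f_pos[of tau] by (simp add: invsq_def)

lemma f_deriv: "tau : I ==> (f has_real_derivative deriv f tau) (at tau)"
 using smooth_on_differentiable[OF f_smooth] at_within_open[OF _ open_base_interval]
 by (metis DERIV_deriv_iff_real_differentiable)

lemma V_deriv':
 assumes "tau : I"
 shows "(V has_real_derivative - 2 * deriv f tau / (f tau) ^ 3) (at tau)"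
proof -
 have "f tau ~= 0" using f_pos[OF assms] by simp
 thus ?thesis
  unfolding invsq_def
  by (auto intro!: derivative_eq_intros f_deriv[OF assms] simp: power2_eq_square power3_eq_cube field_simps)
qed

lemma dV_eq: "tau : I ==> dV tau = - 2 * deriv f tau / (f tau) ^ 3"
 using V_deriv' by (rule DERIV_imp_deriv)

lemma V_deriv: "tau : I ==> (V has_real_derivative dV tau) (at tau)"
 using V_deriv' dV_eq by simp

lemma V_smooth: "smooth_on V I"
proof -
 have "smooth_on (%tau. 1 / (f tau * f tau)) I"
  by (intro smooth_on_divide smooth_on_const smooth_on_mult f_smooth) (use f_pos in force)
 thus ?thesis by (rule smooth_on_cong[rotated]) (simp add: invsq_def power2_eq_square)
qed

lemma dV_smooth: "smooth_on dV I"
proof (rule smooth_on_derivative[OF V_smooth])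
 fix x assume x: "x : I"
 show "(V has_vector_derivative dV x) (at x within I)"
  using V_deriv[OF x] by (simp add: real_vector_derivative has_vector_derivative_at_within)
 show "at x within I ~= bot"
  using at_within_open[OF x] by simp
qed

lemma V_cont: "continuous_on S V" if "S <= I"
 using smooth_on_imp_continuous_on[OF V_smooth] that continuous_on_subset by blast

lemma dV_cont: "continuous_on S dV" if "S <= I"
 using smooth_on_imp_continuous_on[OF dV_smooth] that continuous_on_subset by blast

text \<open>
 The unparametrized geodesics of \<open>-dtau\<^sup>2 + f\<^sup>2 dy\<^sup>2\<close> as graphs over \<open>y\<close>. The variable \<open>w\<close> is
 \<open>dtau/ds\<close> for the affine parameter \<open>s\<close> with \<open>dy/ds = 1/f\<^sup>2\<close>.
\<close>

definition sol :: "real set => (real => real) => (real => real) => bool" where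
 "sol S tau w \<longleftrightarrow> (ALL y:S. tau y : I &
  (tau has_real_derivative w y / V (tau y)) (at y within S) &
  (w has_real_derivative dV (tau y) / (2 * V (tau y))) (at y within S))"

text \<open>For \<open>l > 0\<close> this says, by \<open>geodesic_joins_iff\<close>, that points
  over \<open>t\<close> and \<open>u\<close> whose fiber components have distance \<open>l\<close>
  are joined by a geodesic.\<close>

definition conn :: "real => real => real => bool" where
 "conn t u l \<longleftrightarrow> (EX tau w. sol {0..l} tau w & tau 0 = t & tau l = u)"

lemma solD:
 assumes "sol S tau w" "y : S"
 shows "tau y : I" "(tau has_real_derivative w y / V (tau y)) (at y within S)"
  "(w has_real_derivative dV (tau y) / (2 * V (tau y))) (at y within S)"
 using assms by (auto simp: sol_def)

lemma sol_continuous: 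
 assumes "sol S tau w"
 shows "continuous_on S tau" "continuous_on S w"
 using solD[OF assms] by (meson DERIV_continuous continuous_on_eq_continuous_within)+

lemma sol_smooth:
 assumes "sol S tau w"
 shows "smooth_on tau S" "smooth_on w S"
proof -
 let ?G = "%z. (snd z / V (fst z), dV (fst z) / (2 * V (fst z)))"
 have V1: "smooth_on (%z. V (fst z)) (I \<times> (UNIV::real set))"
  by (rule smooth_on_compose[OF V_smooth smooth_on_linear[OF bounded_linear_fst]]) auto
 have dV1: "smooth_on (%z. dV (fst z)) (I \<times> (UNIV::real set))"
  by (rule smooth_on_compose[OF dV_smooth smooth_on_linear[OF bounded_linear_fst]]) auto
 have "smooth_on ?G (I \<times> UNIV)"
  by (intro smooth_on_Pair smooth_on_divide smooth_on_mult smooth_on_const V1 dV1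
    smooth_on_linear bounded_linear_snd) (use V_pos in force)+
 hence "smooth_on (%y. (tau y, w y)) S"
  by (rule smooth_on_ode)
   (use solD[OF assms] in "auto intro!: has_vector_derivative_Pair simp: real_vector_derivative")
 from smooth_on_bounded_linear[OF bounded_linear_fst this] smooth_on_bounded_linear[OF bounded_linear_snd this]
 show "smooth_on tau S" "smooth_on w S" by simp_all
qed

lemma sol_subset: "sol S tau w ==> T <= S ==> sol T tau w"
 unfolding sol_def by (meson has_field_derivative_subset subsetD)

lemma sol_energy:
 assumes "sol {p..q} tau w" "y : {p..q}" "z : {p..q}"
 shows "V (tau y) - (w y)\<^sup>2 = V (tau z) - (w z)\<^sup>2"
proof -
 have "((%y. V (tau y) - (w y)\<^sup>2) has_real_derivative 0) (at x within {p..q})" if "x : {p..q}" for x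
 proof -
  note s = solD[OF assms(1) that]
  have "((%y. V (tau y)) has_real_derivative dV (tau x) * (w x / V (tau x))) (at x within {p..q})"
   by (rule DERIV_chain2[OF V_deriv[OF s(1)] s(2)])
  moreover have "((%y. (w y)\<^sup>2) has_real_derivative 2 * w x * (dV (tau x) / (2 * V (tau x)))) (at x within {p..q})"
   using DERIV_power[OF s(3), of 2] by (simp add: mult_ac)
  ultimately have "((%y. V (tau y) - (w y)\<^sup>2) has_real_derivative dV (tau x) * (w x / V (tau x)) - 2 * w x * (dV (tau x) / (2 * V (tau x)))) (at x within {p..q})"
   by (rule DERIV_diff)
  thus ?thesis using V_pos[OF s(1)] by (simp add: field_simps)
 qed
 from has_field_derivative_zero_constant[OF convex_real_interval(5) this] show ?thesis
  using assms(2,3) by auto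
qed

end

subsection \<open>Geodesics of warped products\<close>

locale grw_space = riem_mfd X + warp a b f
 for X :: "('i, 'm::{t2_space, second_countable_topology}, 'e::euclidean_space) srmfd"
  and a b :: ereal and f :: "real => real"
begin

abbreviation "G == grw a b f X"

lemma grw_simps [simp]:
 "pts G = I \<times> pts X" "ind G = ind X" "cdom G i = I \<times> cdom X i"
 "crd G i z = (fst z, crd X i (snd z))"
 "met G i x u v = - (fst u * fst v) + (f (fst x))\<^sup>2 * met X i (snd x) (snd u) (snd v)"
 by (simp_all add: grw_def split_beta)

lemma grw_smooth_curve_iff:
 "smooth_curve G S gamma \<longleftrightarrow> (ALL t:S. fst (gamma t) : I) & smooth_curve X S (%t. snd (gamma t)) &
  continuous_on S (%t. fst (gamma t)) &
  (ALL i:ind X. smooth_on (%t. fst (gamma t)) {t\<in>S. snd (gamma t) : cdom X i})" (is "?L \<longleftrightarrow> ?R")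
proof -
 have mem: "gamma ` S <= pts G \<longleftrightarrow> (ALL t:S. fst (gamma t) : I) & (%t. snd (gamma t)) ` S <= pts X"
  unfolding image_subset_iff by (simp add: mem_Times_iff) blast
 have cont: "continuous_on S gamma \<longleftrightarrow> continuous_on S (%t. fst (gamma t)) & continuous_on S (%t. snd (gamma t))"
  using continuous_on_Pair[of S "%t. fst (gamma t)" "%t. snd (gamma t)"]
  by (auto intro: continuous_on_fst continuous_on_snd)
 have dom: "{t\<in>S. gamma t : cdom G i} = {t\<in>S. snd (gamma t) : cdom X i}" if "ALL t:S. fst (gamma t) : I" for i
  using that by (auto simp: mem_Times_iff)
 have sm: "smooth_on (crd G i \<circ> gamma) Q \<longleftrightarrow>
   smooth_on (%t. fst (gamma t)) Q & smooth_on (crd X i \<circ> (%t. snd (gamma t))) Q" for i Q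
  using smooth_on_Pair[of "%t. fst (gamma t)" Q "crd X i \<circ> (%t. snd (gamma t))"]
   smooth_on_bounded_linear[OF bounded_linear_fst, of "crd G i \<circ> gamma" Q]
   smooth_on_bounded_linear[OF bounded_linear_snd, of "crd G i \<circ> gamma" Q]
  by (auto simp: o_def)
 have "smooth_curve G S gamma \<longleftrightarrow> (ALL t:S. fst (gamma t) : I) & (%t. snd (gamma t)) ` S <= pts X & continuous_on S gamma &
  (ALL i:ind X. smooth_on (crd G i \<circ> gamma) {t\<in>S. gamma t : cdom G i})"
  unfolding smooth_curve_def mem grw_simps(2) by blast
 also have "... \<longleftrightarrow> (ALL t:S. fst (gamma t) : I) & (%t. snd (gamma t)) ` S <= pts X & continuous_on S gamma &
  (ALL i:ind X. smooth_on (crd G i \<circ> gamma) {t\<in>S. snd (gamma t) : cdom X i})"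
  using dom by (simp cong: conj_cong)
 also have "... \<longleftrightarrow> ?R"
  unfolding sm cont smooth_curve_def ball_conj_distrib by (simp only: conj_ac)
 finally show ?thesis .
qed

lemma
 assumes gamma: "smooth_curve G {p..q} gamma" and pq: "p < q" and t: "t : {p..q}"
 shows grw_fst_derivative:
   "((%s. fst (gamma s)) has_real_derivative vector_derivative (%s. fst (gamma s)) (at t within {p..q})) (at t within {p..q})"
  and grw_fst_derivative2:
   "((%t. vector_derivative (%s. fst (gamma s)) (at t within {p..q})) has_real_derivative
    vector_derivative (%t. vector_derivative (%s. fst (gamma s)) (at t within {p..q})) (at t within {p..q}))
    (at t within {p..q})"
proof -
 have c: "smooth_curve X {p..q} (%t. snd (gamma t))" using gamma by (simp add: grw_smooth_curve_iff)
 hence "snd (gamma t) : pts X" using t by (auto simp: smooth_curve_def)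
 then obtain i where i: "i : ind X" "snd (gamma t) : cdom X i" using pts_eq by blast
 have Q: "openin (top_of_set {p..q}) {t : {p..q}. snd (gamma t) : cdom X i}"
  using c i(1) by (intro chart_piece_openin) (auto simp: smooth_curve_def)
 have s: "smooth_on (%t. fst (gamma t)) {t : {p..q}. snd (gamma t) : cdom X i}"
  using gamma i(1) by (simp add: grw_smooth_curve_iff)
 have tQ: "t : {t : {p..q}. snd (gamma t) : cdom X i}" using t i by simp
 note d = piece_derivatives[OF Q pq tQ s]
 show "((%s. fst (gamma s)) has_real_derivative vector_derivative (%s. fst (gamma s)) (at t within {p..q})) (at t within {p..q})"
  using d(1) by (simp add: real_vector_derivative)
 show "((%t. vector_derivative (%s. fst (gamma s)) (at t within {p..q})) has_real_derivative
    vector_derivative (%t. vector_derivative (%s. fst (gamma s)) (at t within {p..q})) (at t within {p..q}))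
    (at t within {p..q})"
  using d(2) by (simp add: real_vector_derivative)
qed

lemma grw_velocity:
 assumes gamma: "smooth_curve G {p..q} gamma" and pq: "p < q" and t: "t : {p..q}" and i: "i : ind X" "snd (gamma t) : cdom X i"
 shows "velocity G i gamma {p..q} t =
  (vector_derivative (%s. fst (gamma s)) (at t within {p..q}), velocity X i (%t. snd (gamma t)) {p..q} t)"
proof -
 have c: "smooth_curve X {p..q} (%t. snd (gamma t))" using gamma by (simp add: grw_smooth_curve_iff)
 have "((%s. (fst (gamma s), crd X i (snd (gamma s)))) has_vector_derivative
  (vector_derivative (%s. fst (gamma s)) (at t within {p..q}), velocity X i (%t. snd (gamma t)) {p..q} t)) (at t within {p..q})"
  using grw_fst_derivative[OF gamma pq t] curve_derivatives(1)[OF c pq i(1) t i(2)]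
  by (intro has_vector_derivative_Pair) (simp_all add: real_vector_derivative)
 thus ?thesis unfolding velocity_def[of G] grw_simps
  by (rule vector_derivative_within[OF interval_not_bot[OF pq t]])
qed

lemma chart_at_grw: "fst z : I ==> chart_at G z = chart_at X (snd z)"
 unfolding chart_at_def by (cases z) simp

lemma grw_velocity_sq:
 assumes gamma: "smooth_curve G {p..q} gamma" and pq: "p < q" and t: "t : {p..q}"
 shows "velocity_sq G gamma {p..q} t = - (vector_derivative (%s. fst (gamma s)) (at t within {p..q}))\<^sup>2
  + (f (fst (gamma t)))\<^sup>2 * velocity_sq X (%t. snd (gamma t)) {p..q} t"
proof -
 have c: "smooth_curve X {p..q} (%t. snd (gamma t))" and I: "fst (gamma t) : I" using gamma t by (simp_all add: grw_smooth_curve_iff)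
 have p: "snd (gamma t) : pts X" using c t by (auto simp: smooth_curve_def)
 note i = chart_at[OF p]
 show ?thesis
  unfolding velocity_sq_def Let_def chart_at_grw[OF I]
  using grw_velocity[OF gamma pq t conjunct1[OF i] conjunct2[OF i]] by (simp add: power2_eq_square)
qed

lemma grw_christoffel:
 assumes i: "i : ind X" "x : U i" and tau: "tau : I"
 shows "christoffel G i (tau, x) (alpha, u) (alpha, u) =
  (f tau * deriv f tau * met X i x u u, christoffel X i x u u + (2 * alpha * deriv f tau / f tau) *\<^sub>R u)"
proof -
 have D: "frechet_derivative (%y. met G i y v w) (at (tau, x)) h =
  2 * f tau * deriv f tau * fst h * met X i x (snd v) (snd w) + (f tau)\<^sup>2 * dmet i x (snd h) (snd v) (snd w)" for v w h
 proof -
  have f1: "((%y. f (fst y)) has_derivative (%h. deriv f tau * fst h)) (at (tau, x))"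
   using has_derivative_compose[OF has_derivative_fst[OF has_derivative_ident], of f "(*) (deriv f tau)" "(tau, x)" UNIV]
    f_deriv[OF tau] by (simp add: has_field_derivative_def)
  have m1: "((%y. met X i (snd y) (snd v) (snd w)) has_derivative (%h. dmet i x (snd h) (snd v) (snd w))) (at (tau, x))"
   using has_derivative_compose[OF has_derivative_snd[OF has_derivative_ident], of "%y. met X i y (snd v) (snd w)" "%h. dmet i x h (snd v) (snd w)" "(tau, x)" UNIV]
    met_has_derivative[OF i] by simp
  have "((%y. - (fst v * fst w) + (f (fst y) * f (fst y)) * met X i (snd y) (snd v) (snd w)) has_derivative
   (%h. 2 * f tau * deriv f tau * fst h * met X i x (snd v) (snd w) + (f tau)\<^sup>2 * dmet i x (snd h) (snd v) (snd w)))
   (at (tau, x))"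
   by (rule has_derivative_eq_rhs[OF has_derivative_add[OF has_derivative_const has_derivative_mult[OF has_derivative_mult[OF f1 f1] m1]]])
    (simp add: fun_eq_iff power2_eq_square algebra_simps)
  thus ?thesis
   by (auto simp: power2_eq_square intro!: frechet_derivative_at[THEN fun_cong, symmetric])
 qed
 have fp: "f tau > 0" by (rule f_pos[OF tau])
 let ?z = "(f tau * deriv f tau * met X i x u u, christoffel X i x u u + (2 * alpha * deriv f tau / f tau) *\<^sub>R u)"
 show ?thesis
  unfolding christoffel_def[of G]
 proof (rule the_equality)
  have fe: "(f tau)\<^sup>2 * (2 * alpha * deriv f tau / f tau) = 2 * f tau * deriv f tau * alpha"
   using fp by (simp add: power2_eq_square)
  show sp: "ALL w. met G i (tau, x) ?z w =
  (frechet_derivative (%y. met G i y (alpha, u) w) (at (tau, x)) (alpha, u)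
   + frechet_derivative (%y. met G i y (alpha, u) w) (at (tau, x)) (alpha, u)
   - frechet_derivative (%y. met G i y (alpha, u) (alpha, u)) (at (tau, x)) w) / 2"
  proof
   fix w
   have "met G i (tau, x) ?z w = - (f tau * deriv f tau * met X i x u u * fst w)
    + ((f tau)\<^sup>2 * met X i x (christoffel X i x u u) (snd w)
    + ((f tau)\<^sup>2 * (2 * alpha * deriv f tau / f tau)) * met X i x u (snd w))"
    by (simp add: met_add_left[OF i] met_scale_left[OF i] distrib_left)
   note m = this
   have c: "met X i x (christoffel X i x u u) (snd w) = dmet i x u u (snd w) - dmet i x (snd w) u u / 2"
    by (simp add: christoffel_met[OF i])
   show "met G i (tau, x) ?z w =
  (frechet_derivative (%y. met G i y (alpha, u) w) (at (tau, x)) (alpha, u)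
   + frechet_derivative (%y. met G i y (alpha, u) w) (at (tau, x)) (alpha, u)
   - frechet_derivative (%y. met G i y (alpha, u) (alpha, u)) (at (tau, x)) w) / 2"
    unfolding D m fe c by (simp add: field_simps)
  qed
  fix z' :: "real \<times> 'e" assume "ALL w. met G i (tau, x) z' w =
  (frechet_derivative (%y. met G i y (alpha, u) w) (at (tau, x)) (alpha, u)
   + frechet_derivative (%y. met G i y (alpha, u) w) (at (tau, x)) (alpha, u)
   - frechet_derivative (%y. met G i y (alpha, u) (alpha, u)) (at (tau, x)) w) / 2"
  hence e: "met G i (tau, x) z' w = met G i (tau, x) ?z w" for w using sp by metis
  have lz: "met X i x y 0 = 0" for y using met_bilinear[OF i] by (simp add: bilinear_rzero)
  have "fst z' = fst ?z" using e[of "(1, 0)"] by (simp add: lz)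
  moreover have "snd z' = snd ?z"
  proof (rule met_nondegenerate[OF i])
   fix w show "met X i x (snd z') w = met X i x (snd ?z) w" using e[of "(0, w)"] fp by simp
  qed
  ultimately show "z' = ?z" by (simp add: prod_eq_iff)
 qed
qed

text \<open>In the second equation the covariant acceleration of the fiber component is a multiple
  of its velocity, so this component is a geodesic of the fiber up to parametrization.\<close>

lemma grw_geodesic_iff:
 "geodesic G {0..1} gamma \<longleftrightarrow> smooth_curve G {0..1} gamma &
  (ALL i:ind X. ALL t:{0..1}. snd (gamma t) : cdom X i -->
   (let tau = (%t. fst (gamma t)); xi = (%t. snd (gamma t)); tau' = (%t. vector_derivative tau (at t within {0..1}));
    v = velocity X i xi {0..1}; x = crd X i (xi t)
   in vector_derivative tau' (at t within {0..1}) + f (tau t) * deriv f (tau t) * met X i x (v t) (v t) = 0 &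
     vector_derivative v (at t within {0..1}) + christoffel X i x (v t) (v t)
      + (2 * tau' t * deriv f (tau t) / f (tau t)) *\<^sub>R v t = 0))"
proof -
 have eq: "vector_derivative (velocity G i gamma {0..1}) (at t within {0..1})
   + christoffel G i (crd G i (gamma t)) (velocity G i gamma {0..1} t) (velocity G i gamma {0..1} t) = 0 \<longleftrightarrow>
   (let tau = (%t. fst (gamma t)); xi = (%t. snd (gamma t)); tau' = (%t. vector_derivative tau (at t within {0..1}));
    v = velocity X i xi {0..1}; x = crd X i (xi t)
   in vector_derivative tau' (at t within {0..1}) + f (tau t) * deriv f (tau t) * met X i x (v t) (v t) = 0 &
     vector_derivative v (at t within {0..1}) + christoffel X i x (v t) (v t)
      + (2 * tau' t * deriv f (tau t) / f (tau t)) *\<^sub>R v t = 0)"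
  if gamma: "smooth_curve G {0..1} gamma" and i: "i : ind X" and t: "t : {0..1}" and it: "snd (gamma t) : cdom X i" for i t
 proof -
  have pq: "(0::real) < 1" by simp
  have c: "smooth_curve X {0..1} (%t. snd (gamma t))" and I: "fst (gamma t) : I" using gamma t by (simp_all add: grw_smooth_curve_iff)
  let ?tau' = "%t. vector_derivative (%t. fst (gamma t)) (at t within {0..1})"
  let ?v = "velocity X i (%t. snd (gamma t)) {0..1}"
  have "((%t. (?tau' t, ?v t)) has_vector_derivative
   (vector_derivative ?tau' (at t within {0..1}), vector_derivative ?v (at t within {0..1}))) (at t within {0..1})"
   using grw_fst_derivative2[OF gamma pq t] curve_derivatives(2)[OF c pq i t it]
   by (intro has_vector_derivative_Pair) (simp_all add: real_vector_derivative)
  moreover have "\<forall>\<^sub>F s in at t within {0..1}. (?tau' s, ?v s) = velocity G i gamma {0..1} s"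
  proof -
   have "\<forall>\<^sub>F s in at t within {0..1}. s : {0..1} & snd (gamma s) : cdom X i"
    using curve_derivatives(3)[OF c pq i t it] by (simp add: eventually_at_filter)
   thus ?thesis by eventually_elim (simp add: grw_velocity[OF gamma pq _ i])
  qed
  ultimately have "(velocity G i gamma {0..1} has_vector_derivative
   (vector_derivative ?tau' (at t within {0..1}), vector_derivative ?v (at t within {0..1}))) (at t within {0..1})"
   by (rule vector_derivative_transform[OF _ _ t]) (simp add: grw_velocity[OF gamma pq t i it])
  hence "vector_derivative (velocity G i gamma {0..1}) (at t within {0..1}) =
   (vector_derivative ?tau' (at t within {0..1}), vector_derivative ?v (at t within {0..1}))"
   by (rule vector_derivative_within[OF interval_not_bot[OF pq t]])
  note vd = this
  have x: "crd X i (snd (gamma t)) : U i" using it by simp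
  show ?thesis
   unfolding vd grw_velocity[OF gamma pq t i it] grw_simps(4) grw_christoffel[OF i x I]
   by (simp add: Let_def zero_prod_def add.assoc)
 qed
 show ?thesis
  unfolding geodesic_def grw_simps(2)
  using eq grw_smooth_curve_iff by (auto simp: mem_Times_iff)
qed

end

section \<open>Length, distance and strong convexity of the fiber\<close>

lemma vector_derivative_cong_on:
 assumes "!!s. s : S ==> g s = h s" "t : S"
 shows "vector_derivative g (at t within S) = vector_derivative h (at t within S)"
proof -
 have "(g has_vector_derivative d) (at t within S) \<longleftrightarrow> (h has_vector_derivative d) (at t within S)" for d
  using has_vector_derivative_transform[OF assms(2), of h g] has_vector_derivative_transform[OF assms(2), of g h]
   assms(1) by metis
 thus ?thesis by (simp add: vector_derivative_def)
qed

lemma velocity_sq_cong: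
 assumes "!!s. s : S ==> gamma s = gamma' s" "t : S"
 shows "velocity_sq X gamma S t = velocity_sq X gamma' S t"
proof -
 have "velocity X i gamma S t = velocity X i gamma' S t" for i
  unfolding velocity_def by (rule vector_derivative_cong_on) (use assms in auto)
 thus ?thesis using assms by (simp add: velocity_sq_def)
qed

lemma curve_length_cong:
 assumes "!!s. s : {0..1} ==> gamma s = gamma' s"
 shows "curve_length X gamma = curve_length X gamma'"
 unfolding curve_length_def
 by (rule Henstock_Kurzweil_Integration.integral_cong) (simp only: velocity_sq_cong[of "{0..1}" gamma gamma', OF assms])

lemma curve_length_const_speed:
 assumes "!!t. t : {0..1} ==> velocity_sq X gamma {0..1} t = c"
 shows "curve_length X gamma = sqrt c"
proof -
 have "curve_length X gamma = integral {0..1::real} (%t. sqrt c)"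
  unfolding curve_length_def by (rule Henstock_Kurzweil_Integration.integral_cong) (simp add: assms)
 thus ?thesis by simp
qed

context riem_mfd
begin

lemma geodesic_reparametrize_affine:
 assumes sig: "geodesic X {0..1} sig" and im: "!!t. t : {0..1} ==> p + c * t : {0..1}"
 shows "geodesic X {0..1} (%t. sig (p + c * t))"
  "!!t. t : {0..1} ==> velocity_sq X (%t. sig (p + c * t)) {0..1} t = c\<^sup>2 * velocity_sq X sig {0..1} (p + c * t)"
proof -
 have s: "smooth_curve X {0..1} sig" using sig by (simp add: geodesic_def)
 have sm: "smooth_on (%t. p + c * t) {0..1}"
  unfolding smooth_on_def by (intro allI Ck_on_add Ck_on_const Ck_on_linear bounded_linear_mult_right)
 have d: "((%t. p + c * t) has_real_derivative c) (at t within {0..1})" for t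
  by (auto intro!: derivative_eq_intros)
 have d0: "((%t. c) has_real_derivative 0) (at t within {0..1})" for t by simp
 note R = reparametrization[OF s sm im d d0]
 show "geodesic X {0..1} (%t. sig (p + c * t))"
  unfolding geodesic_def
 proof (intro conjI ballI impI)
  show "smooth_curve X {0..1} (%t. sig (p + c * t))" by (rule R(1))
  fix i and t :: real assume i: "i : ind X" and t: "t : {0..1}" and it: "sig (p + c * t) : cdom X i"
  hence "vector_derivative (velocity X i sig {0..1}) (at (p + c * t) within {0..1})
   + christoffel X i (crd X i (sig (p + c * t))) (velocity X i sig {0..1} (p + c * t)) (velocity X i sig {0..1} (p + c * t)) = 0"
   using sig im[OF t] by (simp add: geodesic_def)
  thus "vector_derivative (velocity X i (%t. sig (p + c * t)) {0..1}) (at t within {0..1})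
   + christoffel X i (crd X i (sig (p + c * t))) (velocity X i (%t. sig (p + c * t)) {0..1} t)
     (velocity X i (%t. sig (p + c * t)) {0..1} t) = 0"
   using R(2)[OF _ i t it] R(3)[OF _ i t it] christoffel_scale[OF i, of "crd X i (sig (p + c * t))"] it
   by (simp add: scaleR_add_right[symmetric])
 qed
 show "velocity_sq X (%t. sig (p + c * t)) {0..1} t = c\<^sup>2 * velocity_sq X sig {0..1} (p + c * t)" if "t : {0..1}" for t
  by (rule R(4)[OF _ that])
qed

end

locale convex_mfd = riem_mfd X for X :: "('i, 'm::{t2_space, second_countable_topology}, 'e::euclidean_space) srmfd" +
 assumes convex_mfd: "strongly_convex X"
begin

abbreviation "rd == riemannian_dist X"

lemma the_geodesic:
 assumes "p : pts X" "q : pts X"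
 obtains sig where "geodesic_joins X sig p q" "curve_length X sig = rd p q"
  "!!sig'. geodesic_joins X sig' p q ==> (ALL t:{0..1}. sig' t = sig t)"
 using convex_mfd assms unfolding strongly_convex_def only_geodesic_joining_def by metis

text \<open>Speed is constant along a geodesic, and by strong convexity every geodesic from
  \<open>p\<close> to \<open>q\<close> coincides with the minimizing one, whose length is the
  distance.\<close>

lemma geodesic_joins_speed:
 assumes "geodesic_joins X sig p q" "p : pts X" "q : pts X"
 shows "!!t. t : {0..1} ==> velocity_sq X sig {0..1} t = (rd p q)\<^sup>2" and "0 <= rd p q"
proof -
 have g: "geodesic X {0..1} sig" "smooth_curve X {0..1} sig"
  using assms(1) by (auto simp: geodesic_joins_def geodesic_def)
 let ?c = "velocity_sq X sig {0..1} 0"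
 have c: "velocity_sq X sig {0..1} t = ?c" if "t : {0..1}" for t
  using geodesic_speed_constant[OF g(1) that] by simp
 have c0: "0 <= ?c" by (rule velocity_sq_nonneg[OF g(2)]) simp
 obtain sig0 where "curve_length X sig0 = rd p q" "ALL t:{0..1}. sig t = sig0 t"
  using the_geodesic[OF assms(2,3)] assms(1) by metis
 hence l: "sqrt ?c = rd p q"
  using curve_length_cong[of sig sig0] curve_length_const_speed[OF c] by metis
 thus "0 <= rd p q" using c0 by (metis real_sqrt_ge_zero)
 show "velocity_sq X sig {0..1} t = (rd p q)\<^sup>2" if "t : {0..1}" for t
  using l c0 c[OF that] by (metis real_sqrt_pow2)
qed

lemma rd_nonneg: "p : pts X ==> q : pts X ==> 0 <= rd p q"
 by (meson geodesic_joins_speed(2) the_geodesic)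

text \<open>Definiteness of the distance is a consequence of strong convexity here: the minimizing
  geodesic has speed zero and is constant.\<close>

lemma rd_eq_0:
 assumes "p : pts X" "q : pts X" "rd p q = 0"
 shows "p = q"
proof -
 obtain sig where sig: "geodesic_joins X sig p q" using the_geodesic assms by metis
 have "sig 0 = sig 1"
  by (rule zero_speed_constant)
   (use sig geodesic_joins_speed(1)[OF sig assms(1,2)] assms(3) in "auto simp: geodesic_joins_def geodesic_def")
 thus ?thesis using sig by (metis geodesic_joins_def)
qed

lemma constant_geodesic:
 assumes "p : pts X"
 shows "geodesic_joins X (%t. p) p p"
proof -
 have "velocity X i (%t. p) {0..1} t = 0" if "t : {0..1}" for i t
  by (rule velocity_eqI[OF _ that]) auto
 moreover have "vector_derivative (velocity X i (%t. p) {0..1}) (at t within {0..1}) = 0" if t: "t : {0..1}" for i t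
 proof (rule vector_derivative_within[OF interval_not_bot[OF _ t]])
  show "(velocity X i (%t. p) {0..1} has_vector_derivative 0) (at t within {0..1})"
   by (rule has_vector_derivative_transform[OF t _ has_vector_derivative_const[of 0]])
    (simp add: calculation)
 qed simp
 moreover have "christoffel X i (crd X i p) 0 0 = 0" if "i : ind X" "p : cdom X i" for i
  using christoffel_scale[OF that(1), of "crd X i p" 0 0] that by simp
 ultimately show ?thesis
  using assms by (auto simp: geodesic_joins_def geodesic_def smooth_curve_def o_def)
qed

lemma rd_refl: "p : pts X ==> rd p p = 0"
proof -
 assume p: "p : pts X"
 have v: "velocity X i (%t. p) {0..1} 0 = 0" for i
  by (rule velocity_eqI) auto
 have "p : cdom X (chart_at X p)" "chart_at X p : ind X" using chart_at[OF p] by auto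
 hence "velocity_sq X (%t. p) {0..1} 0 = 0"
  using met_bilinear[of "chart_at X p" "crd X (chart_at X p) p"] by (simp add: velocity_sq_def v bilinear_lzero)
 thus ?thesis
  using geodesic_joins_speed(1)[OF constant_geodesic[OF p] p p, of 0] by simp
qed

text \<open>An initial segment of the minimizing geodesic is again the only geodesic between its
  ends, so its length is their distance.\<close>

lemma shorter_distances:
 assumes "p : pts X" "q : pts X" "0 <= l" "l <= rd p q"
 obtains q' where "q' : pts X" "rd p q' = l"
proof (cases "rd p q = 0")
 case True
 thus ?thesis using that[OF assms(1)] rd_refl assms by simp
next
 case False
 hence pos: "rd p q > 0" using rd_nonneg[OF assms(1,2)] by simp
 obtain sig where sig: "geodesic_joins X sig p q" using the_geodesic assms by metis
 have g: "geodesic X {0..1} sig" "smooth_curve X {0..1} sig" and ends: "sig 0 = p" "sig 1 = q"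
  using sig by (auto simp: geodesic_joins_def geodesic_def)
 define c where "c = l / rd p q"
 have c: "0 <= c" "c <= 1" using assms pos by (auto simp: c_def field_simps)
 have q': "sig c : pts X" using g(2) c by (auto simp: smooth_curve_def)
 have im: "0 + c * t : {0..1}" if "t : {0..1}" for t using that c mult_le_one by auto
 note G = geodesic_reparametrize_affine[OF g(1) im, simplified]
 have j: "geodesic_joins X (%t. sig (c * t)) p (sig c)" using G(1) ends by (simp add: geodesic_joins_def)
 have "velocity_sq X (%t. sig (c * t)) {0..1} 0 = c\<^sup>2 * (rd p q)\<^sup>2"
  using G(2)[of 0] geodesic_joins_speed(1)[OF sig assms(1,2), of 0] by simp
 hence "(rd p (sig c))\<^sup>2 = (c * rd p q)\<^sup>2"
  using geodesic_joins_speed(1)[OF j assms(1) q', of 0] by (simp add: power_mult_distrib)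
 hence "rd p (sig c) = c * rd p q"
  using rd_nonneg[OF assms(1) q'] c pos by (simp add: power2_eq_iff_nonneg)
 thus ?thesis using that[OF q'] pos by (simp add: c_def)
qed

end

section \<open>Spacetime geodesics and trajectories\<close>

lemma indefinite_integral_DERIV:
 fixes g :: "real => real"
 assumes "continuous_on {p..q} g" "t : {p..q}"
 shows "((%t. integral {p..t} g) has_real_derivative g t) (at t within {p..q})"
 using integral_has_vector_derivative[OF assms]
 by (simp add: real_vector_derivative)

locale convex_grw = grw_space X a b f + convex_mfd X
 for X :: "('i, 'm::{t2_space, second_countable_topology}, 'e::euclidean_space) srmfd"
  and a b :: ereal and f :: "real => real"
begin

lemma vertical_geodesic:
 assumes t: "t0 : I" "t1 : I" and x: "x : pts X"
 shows "geodesic_joins G (%t. (t0 + t * (t1 - t0), x)) (t0, x) (t1, x)"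
proof -
 let ?tau = "%t. t0 + t * (t1 - t0)"
 have d: "vector_derivative ?tau (at t within {0..1}) = t1 - t0" if "t : {0..1}" for t
  by (rule vector_derivative_within[OF interval_not_bot[OF _ that]])
   (auto simp: real_vector_derivative[symmetric] intro!: derivative_eq_intros)
 have d2: "vector_derivative (%t. vector_derivative ?tau (at t within {0..1})) (at t within {0..1}) = 0"
  if t: "t : {0..1}" for t
 proof -
  have "vector_derivative (%t. vector_derivative ?tau (at t within {0..1})) (at t within {0..1})
   = vector_derivative (%t. t1 - t0) (at t within {0..1})"
   by (rule vector_derivative_cong_on) (use d t in auto)
  also have "... = 0" by (rule vector_derivative_within[OF interval_not_bot[OF _ t]]) auto
  finally show ?thesis .
 qed
 have sm: "smooth_on ?tau S" for S
  using Ck_on_add[OF Ck_on_const Ck_on_linear[OF bounded_linear_mult_left]]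
  unfolding smooth_on_def by blast
 have inI: "?tau t : I" if "t : {0..1}" for t
 proof -
  have "t >= 0" "1 - t >= 0" using that by auto
  show ?thesis
  proof (cases "t0 <= t1")
   case True
   hence "0 <= t * (t1 - t0)" "0 <= (1 - t) * (t1 - t0)"
    using \<open>t >= 0\<close> \<open>1 - t >= 0\<close> by (auto intro!: mult_nonneg_nonneg)
   thus ?thesis by (intro I_between[OF t]) (simp_all add: algebra_simps)
  next
   case False
   hence "0 <= t * (t0 - t1)" "0 <= (1 - t) * (t0 - t1)"
    using \<open>t >= 0\<close> \<open>1 - t >= 0\<close> by (auto intro!: mult_nonneg_nonneg)
   thus ?thesis by (intro I_between[OF t(2,1)]) (simp_all add: algebra_simps)
  qed
 qed
 have gc: "geodesic X {0..1} (%t. x)" using constant_geodesic[OF x] by (simp add: geodesic_joins_def)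
 hence sc: "smooth_curve X {0..1} (%t. x)" by (simp add: geodesic_def)
 have v: "velocity X i (%t. x) {0..1} t = 0" if "t : {0..1}" for i t
  by (rule velocity_eqI[OF _ that]) auto
 have "geodesic G {0..1} (%t. (?tau t, x))"
  unfolding grw_geodesic_iff
 proof (intro conjI ballI impI)
  show "smooth_curve G {0..1} (%t. (?tau t, x))"
   unfolding grw_smooth_curve_iff using inI sc sm by (auto intro!: continuous_intros)
  fix i and t :: real assume i: "i : ind X" and t: "t : {0..1}" and it: "snd (?tau t, x) : cdom X i"
  have "vector_derivative (velocity X i (%t. x) {0..1}) (at t within {0..1})
   + christoffel X i (crd X i x) (velocity X i (%t. x) {0..1} t) (velocity X i (%t. x) {0..1} t) = 0"
   using gc i t it by (simp add: geodesic_def)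
  thus "let tau = (%t. fst (?tau t, x)); xi = (%t. snd (?tau t, x)); tau' = (%t. vector_derivative tau (at t within {0..1}));
    v = velocity X i xi {0..1}; x = crd X i (xi t)
   in vector_derivative tau' (at t within {0..1}) + f (tau t) * deriv f (tau t) * met X i x (v t) (v t) = 0 &
     vector_derivative v (at t within {0..1}) + christoffel X i x (v t) (v t)
      + (2 * tau' t * deriv f (tau t) / f (tau t)) *\<^sub>R v t = 0"
   using v[OF t] d2[OF t] met_bilinear[OF i] it by (simp add: Let_def bilinear_lzero)
 qed
 thus ?thesis by (simp add: geodesic_joins_def)
qed

text \<open>Conservation of \<open>f\<^sup>4 g(x', x')\<close> along a geodesic \<open>(tau, x)\<close> decouples the equation for \<open>tau\<close>.\<close>

lemma grw_geodesic_conserved: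
 assumes g: "geodesic G {0..1} gamma"
 defines "tau == (%t. fst (gamma t))" and "xi == (%t. snd (gamma t))"
  and "tau' == (%t. vector_derivative (%t. fst (gamma t)) (at t within {0..1}))"
 obtains C where "0 <= C"
  "!!t. t : {0..1} ==> (f (tau t))^4 * velocity_sq X xi {0..1} t = C"
  "!!t. t : {0..1} ==> (tau has_real_derivative tau' t) (at t within {0..1})"
  "!!t. t : {0..1} ==> (tau' has_real_derivative C * dV (tau t) / 2) (at t within {0..1})"
proof -
 have sm: "smooth_curve G {0..1} gamma" using g by (simp add: geodesic_def)
 have sx: "smooth_curve X {0..1} xi" and I: "!!t. t : {0..1} ==> tau t : I"
  using sm by (simp_all add: grw_smooth_curve_iff xi_def tau_def)
 have pq: "(0::real) < 1" by simp
 have d1: "(tau has_real_derivative tau' t) (at t within {0..1})" if "t : {0..1}" for t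
  using grw_fst_derivative[OF sm pq that] by (simp add: tau_def tau'_def)
 have chart: "EX i:ind X. xi t : cdom X i" if "t : {0..1}" for t
  using sx that pts_eq unfolding smooth_curve_def by blast
 let ?q = "velocity_sq X xi {0..1}"
 let ?E = "%t. (f (tau t))^4 * ?q t"
 have "(?E has_vector_derivative 0) (at t within {0..1})" if t: "t : {0..1}" for t
 proof -
  obtain i where i: "i : ind X" "xi t : cdom X i" using chart[OF t] by blast
  let ?v = "velocity X i xi {0..1} t" and ?x = "crd X i (xi t)"
  have x: "?x : U i" using i by simp
  have "vector_derivative (velocity X i xi {0..1}) (at t within {0..1}) + christoffel X i ?x ?v ?v
      + (2 * tau' t * deriv f (tau t) / f (tau t)) *\<^sub>R ?v = 0"
   using g i t unfolding grw_geodesic_iff tau_def tau'_def xi_def Let_def by blast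
  hence e: "vector_derivative (velocity X i xi {0..1}) (at t within {0..1}) + christoffel X i ?x ?v ?v
    = (- (2 * tau' t * deriv f (tau t) / f (tau t))) *\<^sub>R ?v"
   by (simp add: eq_neg_iff_add_eq_0)
  have q: "(?q has_real_derivative 2 * ((- (2 * tau' t * deriv f (tau t) / f (tau t))) * ?q t)) (at t within {0..1})"
   using velocity_sq_derivative[OF sx pq t i] velocity_sq_chart[OF sx pq t i]
   unfolding e met_scale_left[OF i(1) x] by simp
  have "((%t. f (tau t)) has_real_derivative deriv f (tau t) * tau' t) (at t within {0..1})"
   by (rule DERIV_chain2[OF f_deriv[OF I[OF t]] d1[OF t]])
  from DERIV_power[OF this, of 4]
  have f4: "((%t. (f (tau t))^4) has_real_derivative 4 * (deriv f (tau t) * tau' t * f (tau t) ^ 3)) (at t within {0..1})"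
   by simp
  have fp: "f (tau t) > 0" by (rule f_pos[OF I[OF t]])
  have "4 * (deriv f (tau t) * tau' t * f (tau t) ^ 3) * ?q t +
   2 * ((- (2 * tau' t * deriv f (tau t) / f (tau t))) * ?q t) * (f (tau t))^4 = 0"
   using fp by (simp add: field_simps power_numeral_reduce)
  thus ?thesis
   using DERIV_mult[OF f4 q] by (simp add: real_vector_derivative)
 qed
 hence E: "?E t = ?E 0" if "t : {0..1}" for t
  using constant_of_zero_derivative[of 0 1 ?E t 0] that by simp
 define C where "C = ?E 0"
 show thesis
 proof (rule that[of C])
  show "0 <= C" unfolding C_def using velocity_sq_nonneg[OF sx, of 0] by simp
  show "(f (tau t))^4 * ?q t = C" if "t : {0..1}" for t using E[OF that] by (simp add: C_def)
  show "(tau has_real_derivative tau' t) (at t within {0..1})" if "t : {0..1}" for t by (rule d1[OF that])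
  fix t :: real assume t: "t : {0..1}"
  obtain i where i: "i : ind X" "xi t : cdom X i" using chart[OF t] by blast
  have "vector_derivative tau' (at t within {0..1}) +
    f (tau t) * deriv f (tau t) * met X i (crd X i (xi t)) (velocity X i xi {0..1} t) (velocity X i xi {0..1} t) = 0"
   using g i t unfolding grw_geodesic_iff tau_def tau'_def xi_def Let_def by blast
  hence "vector_derivative tau' (at t within {0..1}) = - (f (tau t) * deriv f (tau t) * ?q t)"
   using velocity_sq_chart[OF sx pq t i] by simp
  also have "... = C * dV (tau t) / 2"
  proof -
   have Ct: "C = (f (tau t))^4 * ?q t" using E[OF t] by (simp add: C_def)
   have "f (tau t) ~= 0" using f_pos[OF I[OF t]] by simp
   thus ?thesis
    unfolding Ct dV_eq[OF I[OF t]] by (simp add: field_simps power_numeral_reduce)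
  qed
  finally have e: "vector_derivative tau' (at t within {0..1}) = C * dV (tau t) / 2" .
  show "(tau' has_real_derivative C * dV (tau t) / 2) (at t within {0..1})"
   unfolding e[symmetric] unfolding tau'_def by (rule grw_fst_derivative2[OF sm pq t])
 qed
qed

end

lemma DERIV_chain_within:
 fixes g h :: "real => real"
 assumes "(g has_real_derivative d) (at (h x) within T)" "(h has_real_derivative e) (at x within S)" "h ` S <= T"
 shows "((%x. g (h x)) has_real_derivative d * e) (at x within S)"
 using DERIV_image_chain[OF has_field_derivative_subset[OF assms(1,3)] assms(2)] by (simp add: o_def)

lemma integral_continuous_pos:
 fixes g :: "real => real"
 assumes g: "continuous_on {0..1} g" and pos: "!!t. t : {0..1} ==> 0 < g t"
 shows "0 < integral {0..1} g"
proof -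
 obtain x where x: "x : {0..1}" "!!y. y : {0..1} ==> g x <= g y"
  using continuous_attains_inf[OF _ _ g] by auto
 have "integral {0..1::real} (%_. g x) <= integral {0..1} g"
  by (rule integral_le) (use x(2) g in "auto intro: integrable_continuous_real")
 thus ?thesis using pos[OF x(1)] by simp
qed

context convex_grw
begin

text \<open>The constant \<open>C\<close> of the conservation law separates the cases. In the second
  case the last two clauses determine \<open>gamma\<close> by its trajectory, since
  \<open>phi t\<close> is fixed by an integral; this is how uniqueness of trajectories becomes
  uniqueness of geodesics.\<close>

lemma grw_geodesic_cases:
 assumes j: "geodesic_joins G gamma (t0, x0) (t1, x1)"
 obtains (vertical) "x0 = x1" "!!t. t : {0..1} ==> gamma t = (t0 + t * (t1 - t0), x0)"
 | (graph) tau w phi where "0 < rd x0 x1" "sol {0..rd x0 x1} tau w" "tau 0 = t0" "tau (rd x0 x1) = t1"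
  "!!t. t : {0..1} ==> phi t : {0..1}"
  "!!sig t. geodesic_joins X sig x0 x1 ==> t : {0..1} ==> gamma t = (tau (rd x0 x1 * phi t), sig (phi t))"
  "!!t. t : {0..1} ==> integral {0..phi t} (%u. 1 / V (tau (rd x0 x1 * u))) =
    t * integral {0..1} (%u. 1 / V (tau (rd x0 x1 * u)))"
proof -
 have g: "geodesic G {0..1} gamma" and ends: "gamma 0 = (t0, x0)" "gamma 1 = (t1, x1)"
  using j by (auto simp: geodesic_joins_def)
 have sm: "smooth_curve G {0..1} gamma" using g by (simp add: geodesic_def)
 define tau where "tau = (%t. fst (gamma t))"
 define xi where "xi = (%t. snd (gamma t))"
 define tau' where "tau' = (%t. vector_derivative tau (at t within {0..1}))"
 have sx: "smooth_curve X {0..1} xi" and I: "!!t. t : {0..1} ==> tau t : I"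
  using sm by (simp_all add: grw_smooth_curve_iff xi_def tau_def)
 have pts: "x0 : pts X" "x1 : pts X"
 proof -
  have "xi t : pts X" if "t : {0..1}" for t
   using sx that unfolding smooth_curve_def by blast
  from this[of 0] this[of 1] show "x0 : pts X" "x1 : pts X" using ends by (simp_all add: xi_def)
 qed
 obtain C where C: "0 <= C"
  "!!t. t : {0..1} ==> (f (tau t))^4 * velocity_sq X xi {0..1} t = C"
  and d1: "!!t. t : {0..1} ==> (tau has_real_derivative tau' t) (at t within {0..1})"
  and d2: "!!t. t : {0..1} ==> (tau' has_real_derivative C * dV (tau t) / 2) (at t within {0..1})"
  using grw_geodesic_conserved[OF g] unfolding tau_def xi_def tau'_def by metis
 show thesis
 proof (cases "C = 0")
  case True
  have "velocity_sq X xi {0..1} t = 0" if "t : {0..1}" for t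
   using C(2)[OF that] f_pos[OF I[OF that]] True by simp
  hence x: "xi t = xi 0" if "t : {0..1}" for t
   using zero_speed_constant[OF sx] that by (meson atLeastAtMost_iff order_refl zero_le_one)
  have t': "tau' t = tau' 0" if "t : {0..1}" for t
   by (rule constant_of_zero_derivative[of 0 1 tau'])
    (use d2 that in "auto simp: True real_vector_derivative")
  have c: "tau t - t * tau' 0 = tau 0 - 0 * tau' 0" if t: "t : {0..1}" for t
  proof (rule constant_of_zero_derivative[of 0 1 "%t. tau t - t * tau' 0"])
   fix s :: real assume s: "s : {0..1}"
   have "((%t. tau t - t * tau' 0) has_real_derivative tau' s - 1 * tau' 0) (at s within {0..1})"
    by (intro DERIV_diff d1[OF s] DERIV_cmult_right) simp
   thus "((%t. tau t - t * tau' 0) has_vector_derivative 0) (at s within {0..1})"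
    using t'[OF s] by (simp add: real_vector_derivative)
  qed (use t in auto)
  have "t1 = t0 + tau' 0" using c[of 1] ends by (simp add: tau_def)
  hence "tau t = t0 + t * (t1 - t0)" if "t : {0..1}" for t
   using c[OF that] ends by (simp add: tau_def)
  hence "gamma t = (t0 + t * (t1 - t0), x0)" if "t : {0..1}" for t
   using x[OF that] that ends by (simp add: tau_def xi_def prod_eq_iff)
  moreover have "x0 = x1" using x[of 1] ends by (simp add: xi_def)
  ultimately show thesis by (rule vertical[rotated])
 next
  case False
  hence Cpos: "C > 0" using C(1) by simp
  let ?H = "%z::real \<times> real. (snd z, C * dV (fst z) / 2)"
  have dV1: "smooth_on (%z. dV (fst z)) (I \<times> (UNIV::real set))"
   by (rule smooth_on_compose[OF dV_smooth smooth_on_linear[OF bounded_linear_fst]]) auto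
  have "smooth_on ?H (I \<times> UNIV)"
   by (intro smooth_on_Pair smooth_on_divide smooth_on_mult smooth_on_const dV1
    smooth_on_linear[OF bounded_linear_snd]) auto
  hence "smooth_on (%t. (tau t, tau' t)) {0..1}"
   by (rule smooth_on_ode)
    (use I d1 d2 in "auto intro!: has_vector_derivative_Pair simp: real_vector_derivative")
  from smooth_on_bounded_linear[OF bounded_linear_fst this] have tau_smooth: "smooth_on tau {0..1}" by simp
  have Vtau: "smooth_on (%t. V (tau t)) {0..1}"
   by (rule smooth_on_compose[OF V_smooth tau_smooth]) (use I in auto)
  have Vp: "V (tau t) > 0" if "t : {0..1}" for t using V_pos[OF I[OF that]] .
  have Vc: "continuous_on {0..1} (%t. V (tau t))" by (rule smooth_on_imp_continuous_on[OF Vtau])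
  \<comment> \<open>By the conservation law the speed of \<open>xi\<close> is
    \<open>sqrt C * V (tau t)\<close>. So \<open>phi\<close> below is the arclength of the fiber
    component, normalized to total length 1.\<close>
  define N where "N = integral {0..1} (%t. V (tau t))"
  have N: "N > 0"
   unfolding N_def
  by (rule integral_continuous_pos[OF Vc Vp])
  define phi where "phi t = integral {0..t} (%t. V (tau t)) / N" for t
  have phi': "(phi has_real_derivative V (tau t) / N) (at t within {0..1})" if "t : {0..1}" for t
   unfolding phi_def by (rule DERIV_cdivide[OF indefinite_integral_DERIV[OF Vc that]])
  have phi01: "phi 0 = 0" "phi 1 = 1" using N by (auto simp: phi_def N_def)
  have "smooth_on (%t. V (tau t) / N) {0..1}"
   by (intro smooth_on_divide smooth_on_const Vtau) (use N in auto)
  then obtain psi where psi: "smooth_on psi {0..1}" "!!r. r : {0..1} ==> psi r : {0..1}"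
   "!!t. t : {0..1} ==> phi t : {0..1}" "!!t. t : {0..1} ==> psi (phi t) = t"
   "!!r. r : {0..1} ==> (psi has_real_derivative 1 / (V (tau (psi r)) / N)) (at r within {0..1})"
   using smooth_inverse[OF phi' _ _ phi01] Vp N by (smt (verit, best) divide_pos_pos)
  define psi' where "psi' r = N / V (tau (psi r))" for r
  have psid: "(psi has_real_derivative psi' r) (at r within {0..1})" if "r : {0..1}" for r
   using psi(5)[OF that] by (simp add: psi'_def)
  define psi'' where "psi'' r = - (N * (dV (tau (psi r)) * (tau' (psi r) * psi' r))) / (V (tau (psi r)))\<^sup>2" for r
  have psidd: "(psi' has_real_derivative psi'' r) (at r within {0..1})" if r: "r : {0..1}" for r
  proof -
   have p: "psi r : {0..1}" by (rule psi(2)[OF r])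
   have "((%r. tau (psi r)) has_real_derivative tau' (psi r) * psi' r) (at r within {0..1})"
    by (rule DERIV_chain_within[OF d1[OF p] psid[OF r]]) (use psi(2) in auto)
   from DERIV_chain2[OF V_deriv[OF I[OF p]] this]
   have "((%r. V (tau (psi r))) has_real_derivative dV (tau (psi r)) * (tau' (psi r) * psi' r)) (at r within {0..1})" .
   from DERIV_divide[OF DERIV_const[of N] this]
   show ?thesis using Vp[OF p] unfolding psi'_def psi''_def by (simp add: power2_eq_square)
  qed
  define sig' where "sig' = (%r. xi (psi r))"
  note R = reparametrization[OF sx psi(1,2) psid psidd, folded sig'_def]
  have sig'_smooth: "smooth_curve X {0..1} sig'" by (rule R(1))
  have psi01: "psi 0 = 0" "psi 1 = 1" using psi(4)[of 0] psi(4)[of 1] phi01 by auto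
  have sig'_geo: "geodesic X {0..1} sig'"
   unfolding geodesic_def
  proof (intro conjI ballI impI sig'_smooth)
   fix i and r :: real assume i: "i : ind X" and r: "r : {0..1}" and ir: "sig' r : cdom X i"
   have p: "psi r : {0..1}" by (rule psi(2)[OF r])
   have ip: "xi (psi r) : cdom X i" using ir by (simp add: sig'_def)
   let ?v = "velocity X i xi {0..1} (psi r)" and ?x = "crd X i (xi (psi r))"
   let ?k = "2 * tau' (psi r) * deriv f (tau (psi r)) / f (tau (psi r))"
   let ?a = "vector_derivative (velocity X i xi {0..1}) (at (psi r) within {0..1})"
   have "?a + christoffel X i ?x ?v ?v + ?k *\<^sub>R ?v = 0"
    using g i ip p unfolding grw_geodesic_iff tau_def tau'_def xi_def Let_def by blast
   hence e: "?a + christoffel X i ?x ?v ?v = (- ?k) *\<^sub>R ?v" by (simp add: eq_neg_iff_add_eq_0)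
   have fp: "f (tau (psi r)) > 0" by (rule f_pos[OF I[OF p]])
   \<comment> \<open>The second derivative of \<open>psi\<close> exactly cancels the term
     proportional to the velocity, so \<open>sig'\<close> is affinely parametrized and therefore the
     unique geodesic of the fiber.\<close>
   have k: "psi'' r = (psi' r)\<^sup>2 * ?k"
    unfolding psi''_def dV_eq[OF I[OF p]] psi'_def invsq_def using fp
    by (simp add: field_simps power_numeral_reduce)
   have "vector_derivative (velocity X i sig' {0..1}) (at r within {0..1})
     + christoffel X i (crd X i (sig' r)) (velocity X i sig' {0..1} r) (velocity X i sig' {0..1} r)
    = psi'' r *\<^sub>R ?v + (psi' r)\<^sup>2 *\<^sub>R ?a + (psi' r)\<^sup>2 *\<^sub>R christoffel X i ?x ?v ?v"
    using R(2)[OF _ _ _ i r ip] R(3)[OF _ _ _ i r ip] christoffel_scale[OF i, of ?x] ip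
    by (simp add: sig'_def)
   also have "... = psi'' r *\<^sub>R ?v + (psi' r)\<^sup>2 *\<^sub>R (?a + christoffel X i ?x ?v ?v)"
    by (simp add: scaleR_add_right)
   also have "... = 0" unfolding e k by (simp add: scaleR_minus_left)
   finally show "vector_derivative (velocity X i sig' {0..1}) (at r within {0..1})
     + christoffel X i (crd X i (sig' r)) (velocity X i sig' {0..1} r) (velocity X i sig' {0..1} r) = 0" .
  qed
  have sig'_joins: "geodesic_joins X sig' x0 x1"
   using sig'_geo ends psi01 by (simp add: geodesic_joins_def sig'_def xi_def)
  have "(rd x0 x1)\<^sup>2 = velocity_sq X sig' {0..1} 0"
   using geodesic_joins_speed(1)[OF sig'_joins pts, of 0] by simp
  also have "... = (psi' 0)\<^sup>2 * velocity_sq X xi {0..1} 0"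
   using R(4)[of 0] psi01 by simp
  also have "... = N\<^sup>2 * C"
   using C(2)[of 0] f_pos[OF I, of 0] psi01
   by (simp add: psi'_def invsq_def power_mult_distrib power_mult[symmetric])
  also have "... = (N * sqrt C)\<^sup>2" using C by (simp add: power_mult_distrib)
  finally have l: "rd x0 x1 = N * sqrt C"
   using rd_nonneg[OF pts] N C by (simp add: power2_eq_iff_nonneg)
  define l where "l = rd x0 x1"
  have lpos: "l > 0" using l N Cpos by (simp add: l_def)
  have lN: "l = N * sqrt C" by (simp add: l_def l)
  define T where "T y = tau (psi (y / l))" for y
  define w where "w y = tau' (psi (y / l)) / sqrt C" for y
  have yl: "y / l : {0..1}" if "y : {0..l}" for y using that lpos by (auto simp: field_simps)
  have S: "sol {0..l} T w"
   unfolding sol_def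
  proof (intro ballI conjI)
   fix y assume y: "y : {0..l}"
   have p: "psi (y / l) : {0..1}" by (rule psi(2)[OF yl[OF y]])
   show "T y : I" unfolding T_def by (rule I[OF p])
   have "((%y. psi (y / l)) has_real_derivative psi' (y / l) * (1 / l)) (at y within {0..l})"
    by (rule DERIV_chain_within[where h = "%y. y / l" and x = y, OF psid[OF yl[OF y]]]) (use yl lpos in "auto intro!: derivative_eq_intros")
   hence c: "((%y. psi (y / l)) has_real_derivative 1 / (sqrt C * V (T y))) (at y within {0..l})"
    using N Cpos by (simp add: psi'_def T_def lN mult_ac)
   have im: "(%y. psi (y / l)) ` {0..l} <= {0..1}" using psi(2) yl by blast
   show "(T has_real_derivative w y / V (T y)) (at y within {0..l})"
    using DERIV_chain_within[where h = "%y. psi (y / l)" and x = y, OF d1[OF p] c im] unfolding T_def[symmetric] w_def by (simp add: T_def[abs_def])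
   have "((%y. tau' (psi (y / l))) has_real_derivative C * dV (T y) / 2 * (1 / (sqrt C * V (T y)))) (at y within {0..l})"
    using DERIV_chain_within[where h = "%y. psi (y / l)" and x = y, OF d2[OF p] c im] by (simp add: T_def)
   from DERIV_cdivide[OF this, of "sqrt C"]
   have w': "(w has_real_derivative C * dV (T y) / 2 * (1 / (sqrt C * V (T y))) / sqrt C) (at y within {0..l})"
    by (simp add: w_def[abs_def])
   have "C * dV (T y) / 2 * (1 / (sqrt C * V (T y))) / sqrt C = C * dV (T y) / ((sqrt C * sqrt C) * (2 * V (T y)))"
    by (simp add: mult_ac)
   also have "... = dV (T y) / (2 * V (T y))" using Cpos by simp
   finally have "C * dV (T y) / 2 * (1 / (sqrt C * V (T y))) / sqrt C = dV (T y) / (2 * V (T y))" .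
   thus "(w has_real_derivative dV (T y) / (2 * V (T y))) (at y within {0..l})"
    using w' by simp
  qed
  have P: "integral {0..r} (%u. 1 / V (T (l * u))) = psi r / N" if r: "r : {0..1}" for r
  proof -
   have "((%u. 1 / V (T (l * u))) has_integral psi r / N - psi 0 / N) {0..r}"
   proof (rule fundamental_theorem_of_calculus)
    fix u assume u: "u : {0..r}"
    hence u1: "u : {0..1}" using r by auto
    have "((%u. psi u / N) has_real_derivative psi' u / N) (at u within {0..r})"
     by (rule has_field_derivative_subset[OF DERIV_cdivide[OF psid[OF u1]]]) (use r in auto)
    thus "((%u. psi u / N) has_vector_derivative 1 / V (T (l * u))) (at u within {0..r})"
     using N lpos by (simp add: psi'_def T_def real_vector_derivative)
   qed (use r in auto)
   thus ?thesis using psi01 by (simp add: integral_unique)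
  qed
  show thesis
  proof (rule graph[of T w phi])
   show "0 < rd x0 x1" "sol {0..rd x0 x1} T w" using lpos S by (simp_all add: l_def)
   show "T 0 = t0" "T (rd x0 x1) = t1" using lpos psi01 ends by (simp_all add: T_def l_def[symmetric] tau_def)
   show "phi t : {0..1}" if "t : {0..1}" for t by (rule psi(3)[OF that])
   show "gamma t = (T (rd x0 x1 * phi t), sig (phi t))" if sig: "geodesic_joins X sig x0 x1" and t: "t : {0..1}" for sig t
   proof -
    have "sig (phi t) = sig' (phi t)"
     using the_geodesic[OF pts] sig sig'_joins psi(3)[OF t] by metis
    thus ?thesis using psi(4)[OF t] lpos
     by (simp add: T_def l_def[symmetric] sig'_def tau_def xi_def)
   qed
   show "integral {0..phi t} (%u. 1 / V (T (rd x0 x1 * u))) = t * integral {0..1} (%u. 1 / V (T (rd x0 x1 * u)))"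
    if t: "t : {0..1}" for t
    unfolding l_def[symmetric] P[OF psi(3)[OF t]] using P[of 1] psi(4)[OF t] psi01 by simp
  qed
 qed
qed

text \<open>The converse construction: \<open>phi\<close> inverts the normalized integral of
  \<open>1 / V\<close> along the trajectory, because the affine parameter \<open>s\<close> satisfies
  \<open>ds = dy / V\<close> up to a factor. As \<open>k\<close> is positive, the sign of the energy
  decides the causal character.\<close>

lemma sol_imp_geodesic:
 assumes pts: "x0 : pts X" "x1 : pts X" and lpos: "0 < rd x0 x1"
  and S: "sol {0..rd x0 x1} tau w"
 obtains gamma k where "geodesic_joins G gamma (tau 0, x0) (tau (rd x0 x1), x1)" "0 < k"
  "!!t. t : {0..1} ==> velocity_sq G gamma {0..1} t = k * (V (tau 0) - (w 0)\<^sup>2)"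
proof -
 define l where "l = rd x0 x1"
 have l: "l > 0" and S: "sol {0..l} tau w" using lpos S by (simp_all add: l_def)
 obtain sig where sig: "geodesic_joins X sig x0 x1" using the_geodesic[OF pts] by metis
 have sg: "geodesic X {0..1} sig" and ss: "smooth_curve X {0..1} sig" and ends: "sig 0 = x0" "sig 1 = x1"
  using sig by (auto simp: geodesic_joins_def geodesic_def)
 have speed: "velocity_sq X sig {0..1} r = l\<^sup>2" if "r : {0..1}" for r
  using geodesic_joins_speed(1)[OF sig pts that] by (simp add: l_def)
 define g where "g u = 1 / V (tau (l * u))" for u
 have lu: "l * u : {0..l}" if "u : {0..1}" for u using that l by (auto simp: mult_le_cancel_left1)
 have I: "tau (l * u) : I" if "u : {0..1}" for u using solD(1)[OF S lu[OF that]] .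
 have Vp: "V (tau (l * u)) > 0" if "u : {0..1}" for u by (rule V_pos[OF I[OF that]])
 have "smooth_on (%u. tau (l * u)) {0..1}"
  by (rule smooth_on_compose[OF sol_smooth(1)[OF S] smooth_on_linear[OF bounded_linear_mult_right]]) (use lu in auto)
 hence "smooth_on (%u. V (tau (l * u))) {0..1}"
  by (rule smooth_on_compose[OF V_smooth]) (use I in auto)
 hence g_smooth: "smooth_on g {0..1}"
  unfolding g_def by (rule smooth_on_divide[OF smooth_on_const]) (use Vp in force)
 have gc: "continuous_on {0..1} g" by (rule smooth_on_imp_continuous_on[OF g_smooth])
 have gp: "g u > 0" if "u : {0..1}" for u using Vp[OF that] by (simp add: g_def)
 define N where "N = integral {0..1} g"
 have N: "N > 0" unfolding N_def by (rule integral_continuous_pos[OF gc gp])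
 define psi where "psi r = integral {0..r} g / N" for r
 have psi': "(psi has_real_derivative g r / N) (at r within {0..1})" if "r : {0..1}" for r
  unfolding psi_def by (rule DERIV_cdivide[OF indefinite_integral_DERIV[OF gc that]])
 have psi01: "psi 0 = 0" "psi 1 = 1" using N by (auto simp: psi_def N_def)
 have "smooth_on (%r. g r / N) {0..1}"
  by (rule smooth_on_divide[OF g_smooth smooth_on_const]) (use N in auto)
 then obtain phi where phi: "smooth_on phi {0..1}" "!!t. t : {0..1} ==> phi t : {0..1}"
  "!!r. r : {0..1} ==> phi (psi r) = r"
  "!!t. t : {0..1} ==> (phi has_real_derivative 1 / (g (phi t) / N)) (at t within {0..1})"
  using smooth_inverse[OF psi' _ _ psi01] gp N by (smt (verit, best) divide_pos_pos)
 have phi01: "phi 0 = 0" "phi 1 = 1" using phi(3)[of 0] phi(3)[of 1] psi01 by auto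
 define T where "T t = tau (l * phi t)" for t
 have TI: "T t : I" if "t : {0..1}" for t unfolding T_def by (rule I[OF phi(2)[OF that]])
 define phi' where "phi' t = N * V (T t)" for t
 have phid: "(phi has_real_derivative phi' t) (at t within {0..1})" if "t : {0..1}" for t
  using phi(4)[OF that] by (simp add: phi'_def g_def T_def mult.commute)
 have lphi: "((%t. l * phi t) has_real_derivative l * phi' t) (at t within {0..1})" if "t : {0..1}" for t
  by (rule DERIV_cmult[OF phid[OF that]])
 have im: "(%t. l * phi t) ` {0..1} <= {0..l}" using lu phi(2) by blast
 define T' where "T' t = l * N * w (l * phi t)" for t
 have Td: "(T has_real_derivative T' t) (at t within {0..1})" if t: "t : {0..1}" for t
 proof -
  have "(T has_real_derivative w (l * phi t) / V (T t) * (l * phi' t)) (at t within {0..1})"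
   using DERIV_chain_within[where h = "%t. l * phi t" and x = t, OF solD(2)[OF S lu[OF phi(2)[OF t]]] lphi[OF t] im]
   by (simp add: T_def[abs_def])
  moreover have "w (l * phi t) / V (T t) * (l * phi' t) = T' t"
   using V_pos[OF TI[OF t]] by (simp add: phi'_def T'_def)
  ultimately show ?thesis by simp
 qed
 have Tdd: "(T' has_real_derivative (l * N)\<^sup>2 * dV (T t) / 2) (at t within {0..1})" if t: "t : {0..1}" for t
 proof -
  have "(T' has_real_derivative l * N * (dV (T t) / (2 * V (T t)) * (l * phi' t))) (at t within {0..1})"
   unfolding T'_def
   using DERIV_cmult[OF DERIV_chain_within[where h = "%t. l * phi t" and x = t, OF solD(3)[OF S lu[OF phi(2)[OF t]]] lphi[OF t] im], of "l * N"]
   by (simp add: T_def)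
  moreover have "l * N * (dV (T t) / (2 * V (T t)) * (l * phi' t)) = (l * N)\<^sup>2 * dV (T t) / 2"
   using V_pos[OF TI[OF t]] by (simp add: phi'_def power2_eq_square)
  ultimately show ?thesis by (simp only:)
 qed
 define phi'' where "phi'' t = N * (dV (T t) * T' t)" for t
 have phidd: "(phi' has_real_derivative phi'' t) (at t within {0..1})" if t: "t : {0..1}" for t
  unfolding phi'_def phi''_def by (rule DERIV_cmult[OF DERIV_chain2[OF V_deriv[OF TI[OF t]] Td[OF t]]])
 note R = reparametrization[OF ss phi(1,2) phid phidd]
 define gamma where "gamma = (%t. (T t, sig (phi t)))"
 have T_smooth: "smooth_on T {0..1}"
  unfolding T_def
  by (rule smooth_on_compose[OF sol_smooth(1)[OF S] smooth_on_bounded_linear[OF bounded_linear_mult_right phi(1)]])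
   (rule im)
 have gamma_smooth: "smooth_curve G {0..1} gamma"
  unfolding grw_smooth_curve_iff gamma_def fst_conv snd_conv
 proof (intro conjI ballI)
  show "smooth_on T {t : {0..1}. sig (phi t) : cdom X i}" for i
   by (rule smooth_on_subset[OF T_smooth]) blast
 qed (use TI R(1) smooth_on_imp_continuous_on[OF T_smooth] in auto)
 have vT: "vector_derivative T (at t within {0..1}) = T' t" if t: "t : {0..1}" for t
  using Td[OF t] by (intro vector_derivative_within[OF interval_not_bot[OF _ t]])
   (auto simp: real_vector_derivative)
 have vT': "vector_derivative (%t. vector_derivative T (at t within {0..1})) (at t within {0..1}) = (l * N)\<^sup>2 * dV (T t) / 2"
  if t: "t : {0..1}" for t
 proof -
  have "vector_derivative (%t. vector_derivative T (at t within {0..1})) (at t within {0..1})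
   = vector_derivative T' (at t within {0..1})"
   by (rule vector_derivative_cong_on) (use vT t in auto)
  also have "... = (l * N)\<^sup>2 * dV (T t) / 2"
   using Tdd[OF t] by (intro vector_derivative_within[OF interval_not_bot[OF _ t]])
    (auto simp: real_vector_derivative)
  finally show ?thesis .
 qed
 have "geodesic G {0..1} gamma"
  unfolding grw_geodesic_iff
 proof (intro conjI ballI impI gamma_smooth)
  fix i and t :: real assume i: "i : ind X" and t: "t : {0..1}" and it': "snd (gamma t) : cdom X i"
  have it: "sig (phi t) : cdom X i" using it' by (simp add: gamma_def)
  have p: "phi t : {0..1}" by (rule phi(2)[OF t])
  let ?v = "velocity X i sig {0..1} (phi t)" and ?x = "crd X i (sig (phi t))"
  let ?a = "vector_derivative (velocity X i sig {0..1}) (at (phi t) within {0..1})"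
  have x: "?x : U i" using it by simp
  have geo: "?a + christoffel X i ?x ?v ?v = 0" using sg i it p by (simp add: geodesic_def)
  have v: "velocity X i (%t. sig (phi t)) {0..1} t = phi' t *\<^sub>R ?v" using R(2)[OF _ _ _ i t it] by simp
  have acc: "vector_derivative (velocity X i (%t. sig (phi t)) {0..1}) (at t within {0..1}) = phi'' t *\<^sub>R ?v + (phi' t)\<^sup>2 *\<^sub>R ?a"
   using R(3)[OF _ _ _ i t it] by simp
  have m: "met X i ?x (phi' t *\<^sub>R ?v) (phi' t *\<^sub>R ?v) = (phi' t)\<^sup>2 * l\<^sup>2"
   using velocity_sq_chart[OF ss _ p i it] speed[OF p]
   by (simp add: met_scale_left[OF i x] met_scale_right[OF i x] power2_eq_square)
  have fp: "f (T t) ~= 0" using f_pos[OF TI[OF t]] by simp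
  have e1: "(l * N)\<^sup>2 * dV (T t) / 2 + f (T t) * deriv f (T t) * ((phi' t)\<^sup>2 * l\<^sup>2) = 0"
   unfolding phi'_def dV_eq[OF TI[OF t]] invsq_def using fp by (simp add: field_simps power_numeral_reduce)
  have k: "phi'' t + (2 * T' t * deriv f (T t) / f (T t)) * phi' t = 0"
   unfolding phi'_def phi''_def dV_eq[OF TI[OF t]] invsq_def using fp by (simp add: field_simps power_numeral_reduce)
  have "phi'' t *\<^sub>R ?v + (phi' t)\<^sup>2 *\<^sub>R ?a + (phi' t)\<^sup>2 *\<^sub>R christoffel X i ?x ?v ?v
    + (2 * T' t * deriv f (T t) / f (T t)) *\<^sub>R (phi' t *\<^sub>R ?v)
   = (phi'' t + (2 * T' t * deriv f (T t) / f (T t)) * phi' t) *\<^sub>R ?v + (phi' t)\<^sup>2 *\<^sub>R (?a + christoffel X i ?x ?v ?v)"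
   by (simp add: scaleR_add_left scaleR_add_right)
  also have "... = 0" unfolding geo k by simp
  finally have e2: "phi'' t *\<^sub>R ?v + (phi' t)\<^sup>2 *\<^sub>R ?a + (phi' t)\<^sup>2 *\<^sub>R christoffel X i ?x ?v ?v
    + (2 * T' t * deriv f (T t) / f (T t)) *\<^sub>R (phi' t *\<^sub>R ?v) = 0" .
  show "let tau = (%t. fst (gamma t)); xi = (%t. snd (gamma t)); tau' = (%t. vector_derivative tau (at t within {0..1}));
    v = velocity X i xi {0..1}; x = crd X i (xi t)
   in vector_derivative tau' (at t within {0..1}) + f (tau t) * deriv f (tau t) * met X i x (v t) (v t) = 0 &
     vector_derivative v (at t within {0..1}) + christoffel X i x (v t) (v t)
      + (2 * tau' t * deriv f (tau t) / f (tau t)) *\<^sub>R v t = 0"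
   unfolding Let_def gamma_def fst_conv snd_conv v acc m vT[OF t] vT'[OF t] christoffel_scale[OF i x]
   using e1 e2 by blast
 qed
 hence "geodesic_joins G gamma (tau 0, x0) (tau (rd x0 x1), x1)"
  using ends phi01 by (simp add: geodesic_joins_def gamma_def T_def l_def)
 moreover have "0 < (l * N)\<^sup>2" using l N by simp
 moreover have "velocity_sq G gamma {0..1} t = (l * N)\<^sup>2 * (V (tau 0) - (w 0)\<^sup>2)" if t: "t : {0..1}" for t
 proof -
  have fp: "f (T t) ~= 0" using f_pos[OF TI[OF t]] by simp
  have "velocity_sq G gamma {0..1} t = - (T' t)\<^sup>2 + (f (T t))\<^sup>2 * ((phi' t)\<^sup>2 * l\<^sup>2)"
   using grw_velocity_sq[OF gamma_smooth _ t] R(4)[OF _ _ _ t] speed[OF phi(2)[OF t]] vT[OF t] by (simp add: gamma_def)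
  also have "... = (l * N)\<^sup>2 * (V (T t) - (w (l * phi t))\<^sup>2)"
   using fp by (simp add: T'_def phi'_def invsq_def field_simps power_numeral_reduce)
  also have "V (T t) - (w (l * phi t))\<^sup>2 = V (tau 0) - (w 0)\<^sup>2"
   unfolding T_def by (rule sol_energy[OF S lu[OF phi(2)[OF t]]]) (use l in auto)
  finally show ?thesis .
 qed
 ultimately show thesis by (rule that)
qed

end

subsection \<open>The travel length\<close>

context warp
begin

definition h :: "real => real => real" where
 "h D tau = 1 / ((f tau)\<^sup>2 * sqrt (V tau - D))"

text \<open>With \<open>hint\<close> as the measure of an interval, additivity, monotonicity and
  approximation from inside come from measure theory. The indicator is there because
  \<open>f\<close> is arbitrary outside \<open>I\<close>, and measurability is known only after
  cutting off.\<close>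

definition hm :: "real => real measure" where
 "hm D = density lborel (%tau. ennreal (h D tau) * indicator I tau)"

lemma base_interval_subset: "a <= lo ==> hi <= b ==> base_interval lo hi <= I"
 by (auto simp: base_interval_def)

lemma I_bounds: "u : I ==> a <= ereal u" "u : I ==> ereal u <= b"
 by (auto simp: base_interval_def)

lemma base_interval_measurable [measurable]: "base_interval lo hi : sets borel"
 using open_base_interval by (rule borel_open)

lemma f_measurable [measurable]: "(%tau. indicator I tau * f tau) : borel_measurable borel"
 using borel_measurable_continuous_on_indicator[OF base_interval_measurable smooth_on_imp_continuous_on[OF f_smooth]]
  by simp

lemma h_measurable [measurable]: "(%tau. ennreal (h D tau) * indicator I tau) : borel_measurable borel"
proof -
 let ?g = "%tau. indicator I tau * f tau"
 have "(%tau. ennreal (1 / ((?g tau)\<^sup>2 * sqrt (1 / (?g tau)\<^sup>2 - D))) * indicator I tau) : borel_measurable borel"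
  by measurable
 also have "(%tau. ennreal (1 / ((?g tau)\<^sup>2 * sqrt (1 / (?g tau)\<^sup>2 - D))) * indicator I tau)
   = (%tau. ennreal (h D tau) * indicator I tau)"
  by (auto simp: fun_eq_iff h_def invsq_def indicator_def)
 finally show ?thesis .
qed

lemma sets_hm [simp]: "sets (hm D) = sets borel" by (simp add: hm_def)

lemma hint_eq_emeasure:
 assumes "a <= lo" "hi <= b"
 shows "hint f D lo hi = enn2ereal (emeasure (hm D) (base_interval lo hi))"
proof -
 have "emeasure (hm D) (base_interval lo hi)
  = (\<integral>\<^sup>+tau. ennreal (h D tau) * indicator I tau * indicator (base_interval lo hi) tau \<partial>lborel)"
  unfolding hm_def by (subst emeasure_density) auto
 also have "... = (\<integral>\<^sup>+tau. ennreal (h D tau) * indicator (base_interval lo hi) tau \<partial>lborel)"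
  using base_interval_subset[OF assms] by (intro nn_integral_cong) (auto simp: indicator_def)
 finally show ?thesis unfolding hint_def h_def by simp
qed

lemma hint_nonneg [simp]: "0 <= hint f D lo hi"
 unfolding hint_def by simp

lemma hint_empty [simp]: "hi <= lo ==> hint f D lo hi = 0"
proof -
 assume "hi <= lo"
 hence "base_interval lo hi = {}"
  unfolding base_interval_def using order.strict_trans2[of _ hi lo] by (auto dest: less_asym)
 thus ?thesis by (simp add: hint_def zero_ennreal.rep_eq)
qed

lemma hint_mono:
 assumes "a <= lo" "hi <= b" "lo <= lo'" "hi' <= hi"
 shows "hint f D lo' hi' <= hint f D lo hi"
proof -
 have s: "base_interval lo' hi' <= base_interval lo hi"
  using assms(3,4) unfolding base_interval_def by (auto intro: le_less_trans less_le_trans)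
 have "a <= lo'" "hi' <= b" using assms order_trans by blast+
 thus ?thesis using assms(1,2) s
  by (simp add: hint_eq_emeasure less_eq_ennreal.rep_eq[symmetric] emeasure_mono)
qed

lemma hint_add:
 assumes lo: "a <= lo" "hi <= b" and c: "lo <= ereal c" "ereal c <= hi"
 shows "hint f D lo hi = hint f D lo c + hint f D c hi"
proof (cases "lo = ereal c | ereal c = hi")
 case True
 thus ?thesis by auto
next
 case False
 hence c': "lo < ereal c" "ereal c < hi" using c by auto
 have eq: "base_interval lo hi = (base_interval lo c \<union> base_interval c hi) \<union> {c}"
 proof (rule set_eqI)
  fix x :: real
  have "x < c ==> ereal x < hi" "x > c ==> lo < ereal x"
   using c' less_trans[of "ereal x" "ereal c" hi] less_trans[of lo "ereal c" "ereal x"] by auto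
  thus "x : base_interval lo hi \<longleftrightarrow> x : (base_interval lo c \<union> base_interval c hi) \<union> {c}"
   using c' unfolding base_interval_def by (cases x c rule: linorder_cases) auto
 qed
 have n: "emeasure (hm D) {c} = 0"
 proof -
  have "(\<integral>\<^sup>+tau. ennreal (h D tau) * indicator I tau * indicator {c} tau \<partial>lborel) = 0"
   by (subst nn_integral_0_iff_AE) (auto intro!: AE_I[where N="{c}"])
  thus ?thesis unfolding hm_def by (subst emeasure_density) auto
 qed
 have "emeasure (hm D) (base_interval lo hi)
   = emeasure (hm D) (base_interval lo c \<union> base_interval c hi)"
  unfolding eq by (rule emeasure_Un_null_set) (use n in auto)
 also have "... = emeasure (hm D) (base_interval lo c) + emeasure (hm D) (base_interval c hi)"
  by (rule plus_emeasure[symmetric]) (auto simp: base_interval_def)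
 finally have e: "emeasure (hm D) (base_interval lo hi)
   = emeasure (hm D) (base_interval lo c) + emeasure (hm D) (base_interval c hi)" .
 have "ereal c <= b" "a <= ereal c" using assms order_trans by blast+
 thus ?thesis using lo by (simp add: hint_eq_emeasure e plus_ennreal.rep_eq)
qed

text \<open>Continuity of the measure from below. Improper travel times are handled through compact
  subintervals, where the integrand is continuous as long as \<open>D < V\<close>.\<close>

lemma hint_approx:
 assumes lo: "a <= lo" "hi <= b" and c: "0 <= c" "c < hint f D lo hi"
 obtains u v where "lo < ereal u" "u < v" "ereal v < hi" "c < hint f D u v"
proof -
 have lh: "lo < hi" using c hint_empty[of hi lo D] by (cases "lo < hi") auto
 obtain u l :: "nat => real" where ul: "einterval lo hi = (\<Union>i. {l i .. u i})" "incseq u" "decseq l"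
  "!!i. l i < u i" "!!i. lo < l i" "!!i. u i < hi"
  "(%i. ereal (l i)) \<longlonglongrightarrow> lo" "(%i. ereal (u i)) \<longlonglongrightarrow> hi"
  by (rule einterval_Icc_approximation[OF lh, unfolded comp_def]) (rule that; assumption)
 let ?A = "%n. {l n<..<u n}"
 have inc: "incseq ?A"
  using incseq_SucD[OF ul(2)] decseq_SucD[OF ul(3)] by (intro incseq_SucI greaterThanLessThan_subseteq_greaterThanLessThan[THEN iffD2]) blast
 have un: "(\<Union>n. ?A n) = base_interval lo hi"
 proof
  show "(\<Union>n. ?A n) <= base_interval lo hi"
  proof
   fix x assume "x : (\<Union>n. ?A n)"
   then obtain n where "l n < x" "x < u n" by auto
   thus "x : base_interval lo hi"
    using ul(5)[of n] ul(6)[of n] less_trans[of lo "ereal (l n)" "ereal x"]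
     less_trans[of "ereal x" "ereal (u n)" hi] by (simp add: base_interval_def)
  qed
  show "base_interval lo hi <= (\<Union>n. ?A n)"
  proof
   fix t assume "t : base_interval lo hi"
   hence t: "lo < ereal t" "ereal t < hi" by (auto simp: base_interval_def)
   have "\<forall>\<^sub>F n in sequentially. ereal (l n) < ereal t & ereal t < ereal (u n)"
    using order_tendstoD(2)[OF ul(7) t(1)] order_tendstoD(1)[OF ul(8) t(2)] by eventually_elim auto
   thus "t : (\<Union>n. ?A n)" unfolding eventually_sequentially by auto
  qed
 qed
 have "(SUP n. emeasure (hm D) (?A n)) = emeasure (hm D) (base_interval lo hi)"
 proof -
  have "range ?A <= sets (hm D)" by auto
  from SUP_emeasure_incseq[OF this inc] show ?thesis unfolding un .
 qed
 moreover have "e2ennreal c < emeasure (hm D) (base_interval lo hi)"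
  using c lo by (simp add: hint_eq_emeasure less_ennreal.rep_eq enn2ereal_e2ennreal)
 ultimately have "e2ennreal c < (SUP n. emeasure (hm D) (?A n))" by simp
 then obtain n where n: "e2ennreal c < emeasure (hm D) (?A n)"
  unfolding less_SUP_iff by blast
 have "a <= ereal (l n)" "ereal (u n) <= b"
  using ul(5,6)[of n] lo by (auto intro: order_trans less_imp_le)
 hence "c < hint f D (l n) (u n)"
  using n c by (simp add: hint_eq_emeasure less_ennreal.rep_eq enn2ereal_e2ennreal)
 thus ?thesis using that[of "l n" "u n"] ul(4,5,6)[of n] by simp
qed

lemma h_pos: "tau : I ==> D < V tau ==> 0 < h D tau"
 using f_pos[of tau] by (simp add: h_def)

lemma h_continuous_on:
 assumes "S <= I" "!!tau. tau : S ==> D < V tau"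
 shows "continuous_on S (h D)"
proof -
 have "(f tau)\<^sup>2 * sqrt (V tau - D) ~= 0" if "tau : S" for tau
  using f_pos[of tau] assms that by force
 thus ?thesis
  unfolding h_def using assms
  by (intro continuous_intros V_cont continuous_on_subset[OF smooth_on_imp_continuous_on[OF f_smooth]]) auto
qed

lemma hint_compact:
 assumes uv: "u <= v" "{u..v} <= I" and D: "!!tau. tau : {u..v} ==> D < V tau"
 shows "hint f D u v = ereal (integral {u..v} (h D))"
proof -
 have c: "continuous_on {u..v} (h D)" by (rule h_continuous_on[OF uv(2) D])
 have hi: "(h D has_integral integral {u..v} (h D)) {u..v}"
  using integrable_continuous_real[OF c] by (rule integrable_integral)
 have "(\<integral>\<^sup>+tau. ennreal (h D tau) * indicator {u<..<v} tau \<partial>lborel)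
   = (\<integral>\<^sup>+tau. ennreal (h D tau) * indicator {u..v} tau \<partial>lborel)"
 proof (rule nn_integral_cong_AE)
  have "AE tau in lborel. tau ~= u & tau ~= v"
   using AE_lborel_singleton[of u] AE_lborel_singleton[of v] by eventually_elim auto
  thus "AE tau in lborel. ennreal (h D tau) * indicator {u<..<v} tau = ennreal (h D tau) * indicator {u..v} tau"
   by eventually_elim (auto simp: indicator_def)
 qed
 also have "... = ennreal (integral {u..v} (h D))"
  by (rule nn_integral_has_integral_lebesgue'[OF _ hi]) (use h_pos D uv in "auto simp: less_imp_le subset_iff")
 finally have "hint f D u v = enn2ereal (ennreal (integral {u..v} (h D)))"
  unfolding hint_def h_def by simp
 moreover have "0 <= integral {u..v} (h D)"
  by (rule integral_nonneg) (use h_pos D uv integrable_continuous_real[OF c] in "auto simp: less_imp_le subset_iff")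
 ultimately show ?thesis by simp
qed

lemma hint_pos:
 assumes lo: "a <= lo" "hi <= b" "lo < hi" and D: "!!tau. tau : base_interval lo hi ==> D < V tau"
 shows "0 < hint f D lo hi"
proof -
 obtain u where u: "lo < ereal u" "ereal u < hi" using lo(3) ereal_dense2 by blast
 obtain v where v: "ereal u < ereal v" "ereal v < hi" using u(2) ereal_dense2 by blast
 have uv: "u < v" using v by simp
 have sub: "{u..v} <= base_interval lo hi"
 proof
  fix x assume "x : {u..v}"
  thus "x : base_interval lo hi"
   using u v less_le_trans[of lo "ereal u" "ereal x"] le_less_trans[of "ereal x" "ereal v" hi]
   by (simp add: base_interval_def)
 qed
 hence subI: "{u..v} <= I" using base_interval_subset[OF lo(1,2)] by blast
 have Duv: "!!tau. tau : {u..v} ==> D < V tau" using D sub by blast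
 have c: "continuous_on {u..v} (h D)" by (rule h_continuous_on[OF subI Duv])
 obtain x where x: "x : {u..v}" "!!y. y : {u..v} ==> h D x <= h D y"
  using continuous_attains_inf[OF _ _ c] uv by auto
 have "integral {u..v} (%_. h D x) <= integral {u..v} (h D)"
  by (rule integral_le) (use x(2) c in "auto intro: integrable_continuous_real")
 moreover have "0 < h D x" using h_pos x(1) Duv subI by blast
 hence "0 < integral {u..v} (%_. h D x)" using uv by simp
 ultimately have "0 < integral {u..v} (h D)" by (rule less_le_trans[rotated])
 hence "0 < hint f D u v" using hint_compact[OF less_imp_le[OF uv] subI Duv] by simp
 also have "... <= hint f D lo hi"
  by (rule hint_mono[OF lo(1,2)]) (use u v in "auto intro: less_imp_le")
 finally show ?thesis .
qed

lemma hint_mono_D: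
 assumes "a <= lo" "hi <= b" "D <= D'" "!!tau. tau : base_interval lo hi ==> D' < V tau"
 shows "hint f D lo hi <= hint f D' lo hi"
proof -
 have "h D tau <= h D' tau" if t: "tau : base_interval lo hi" for tau
 proof -
  have "0 < sqrt (V tau - D')" "sqrt (V tau - D') <= sqrt (V tau - D)" using assms(4)[OF t] assms(3) by auto
  moreover have "0 < f tau" using f_pos base_interval_subset[OF assms(1,2)] t by blast
  ultimately show ?thesis unfolding h_def by (intro divide_left_mono mult_left_mono mult_pos_pos) auto
 qed
 hence "(\<integral>\<^sup>+tau\<in>base_interval lo hi. ennreal (h D tau) \<partial>lborel) <= (\<integral>\<^sup>+tau\<in>base_interval lo hi. ennreal (h D' tau) \<partial>lborel)"
  by (intro nn_integral_mono) (auto simp: indicator_def ennreal_leI)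
 thus ?thesis unfolding hint_def h_def[symmetric] by (simp add: less_eq_ennreal.rep_eq[symmetric])
qed

lemma hint_tendsto:
 assumes uv: "u <= v" "{u..v} <= I" and D: "!!tau. tau : {u..v} ==> D0 < V tau"
 shows "((%D. hint f D u v) \<longlongrightarrow> hint f D0 u v) (nhds D0)"
proof -
 obtain x where x: "x : {u..v}" "!!y. y : {u..v} ==> V x <= V y"
  using continuous_attains_inf[OF _ _ V_cont[OF uv(2)]] uv by auto
 let ?W = "{..<V x}"
 have W: "D < V tau" if "D : ?W" "tau : {u..v}" for D tau
  using x(2)[OF that(2)] that(1) by simp
 have "continuous_on (?W \<times> {u..v}) (%(D, tau). h D tau)"
 proof -
  have f1: "continuous_on (?W \<times> {u..v}) (%z. f (snd z))"
   by (rule continuous_on_compose2[OF smooth_on_imp_continuous_on[OF f_smooth]]) (use uv in "auto intro!: continuous_intros")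
  have V1: "continuous_on (?W \<times> {u..v}) (%z. V (snd z))"
   by (rule continuous_on_compose2[OF V_cont[OF uv(2)]]) (auto intro!: continuous_intros)
  have nz: "(f (snd z))\<^sup>2 * sqrt (V (snd z) - fst z) ~= 0" if "z : ?W \<times> {u..v}" for z
   using W[of "fst z" "snd z"] f_pos[of "snd z"] that uv(2) by (force simp: mem_Times_iff)
  show ?thesis unfolding h_def split_beta
   by (intro continuous_intros f1 V1) (use nz in blast)
 qed
 hence "continuous_on ?W (%D. integral (cbox u v) (h D))"
  by (intro integral_continuous_on_param) (simp add: cbox_interval)
 moreover have D0: "D0 : ?W" using D[OF x(1)] by simp
 ultimately have "isCont (%D. integral {u..v} (h D)) D0"
  by (simp add: continuous_on_eq_continuous_at cbox_interval)
 hence "((%D. integral {u..v} (h D)) \<longlongrightarrow> integral {u..v} (h D0)) (nhds D0)"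
  using tendsto_at_iff_tendsto_nhds[of "%D. integral {u..v} (h D)" D0] unfolding isCont_def by blast
 hence "((%D. ereal (integral {u..v} (h D))) \<longlongrightarrow> ereal (integral {u..v} (h D0))) (nhds D0)"
  by (rule tendsto_ereal)
 moreover have "\<forall>\<^sub>F D in nhds D0. ereal (integral {u..v} (h D)) = hint f D u v"
  using eventually_nhds_in_open[OF open_lessThan D0]
  by eventually_elim (use W in "auto intro!: hint_compact[OF uv, symmetric]")
 ultimately show ?thesis
  using hint_compact[OF uv D] by (auto intro: Lim_transform_eventually)
qed

text \<open>Only lower semicontinuity in \<open>D\<close> can be expected, since
  \<open>V = D0\<close> may hold at the ends and the integrand may blow up there. A compact
  subinterval carries the strict inequality, and on it \<open>hint\<close> is continuous in
  \<open>D\<close>.\<close>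

lemma hint_lsc:
 assumes lo: "a <= lo" "hi <= b" and D: "!!tau. tau : base_interval lo hi ==> D0 < V tau"
  and c: "0 <= c" "c < hint f D0 lo hi"
 obtains u v where "lo < ereal u" "u < v" "ereal v < hi" "\<forall>\<^sub>F D in nhds D0. c < hint f D u v"
proof -
 obtain u v where uv: "lo < ereal u" "u < v" "ereal v < hi" "c < hint f D0 u v"
  by (rule hint_approx[OF lo c])
 have sub: "{u..v} <= base_interval lo hi"
 proof
  fix x assume "x : {u..v}"
  thus "x : base_interval lo hi"
   using uv less_le_trans[of lo "ereal u" "ereal x"] le_less_trans[of "ereal x" "ereal v" hi]
   by (simp add: base_interval_def)
 qed
 have "((%D. hint f D u v) \<longlongrightarrow> hint f D0 u v) (nhds D0)"
  by (rule hint_tendsto) (use uv sub D base_interval_subset[OF lo] in auto)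
 hence "\<forall>\<^sub>F D in nhds D0. c < hint f D u v" using uv(4) by (rule order_tendstoD)
 thus ?thesis using that uv by blast
qed

end

subsection \<open>Travel length along trajectories\<close>

context warp
begin

lemma sol_D:
 assumes "sol {p..q} tau w" "y : {p..q}" "z : {p..q}"
 shows "(w y)\<^sup>2 = V (tau y) - (V (tau z) - (w z)\<^sup>2)"
 using sol_energy[OF assms] by simp

lemma sol_strict_mono:
 assumes S: "sol {p..q} tau w" and w: "!!y. y : {p<..<q} ==> 0 < w y"
  and "y : {p..q}" "z : {p..q}" "y < z"
 shows "tau y < tau z"
proof (rule DERIV_pos_imp_increasing_open[OF \<open>y < z\<close>])
 show "continuous_on {y..z} tau"
  by (rule continuous_on_subset[OF sol_continuous(1)[OF S]]) (use assms in auto)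
 fix x assume x: "y < x" "x < z"
 hence xpq: "x : {p<..<q}" "x : {p..q}" using assms by auto
 have "(tau has_real_derivative w x / V (tau x)) (at x)"
  using solD(2)[OF S xpq(2)] at_within_Icc_at[of p x q] xpq(1) by simp
 thus "EX d. (tau has_real_derivative d) (at x) & 0 < d"
  using w[OF xpq(1)] V_pos[OF solD(1)[OF S xpq(2)]] by (blast intro: divide_pos_pos)
qed

text \<open>While \<open>w > 0\<close>, energy conservation gives \<open>w = sqrt (V - D)\<close>,
  hence \<open>tau' * h D tau = 1\<close>, and substitution computes the elapsed time.\<close>

lemma sol_time_closed:
 assumes S: "sol {p..q} tau w" and pq: "p <= q" and w: "!!y. y : {p..q} ==> 0 < w y"
  and z: "z : {p..q}"
 shows "hint f (V (tau z) - (w z)\<^sup>2) (tau p) (tau q) = ereal (q - p)"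
proof -
 let ?D = "V (tau z) - (w z)\<^sup>2"
 note c = sol_continuous(1)[OF S]
 have mono: "tau y <= tau y'" if "y : {p..q}" "y' : {p..q}" "y <= y'" for y y'
  using sol_strict_mono[OF S _ that(1,2)] w that(3) by (cases "y = y'") fastforce+
 have im: "EX y:{p..q}. tau y = x" if "x : {tau p..tau q}" for x
  using IVT'[of tau p x q] that pq c by auto
 have VD: "?D < V (tau y)" if "y : {p..q}" for y
  using sol_D[OF S that z] zero_less_power[OF w[OF that], of 2] by linarith
 have sub: "{tau p..tau q} <= I" using im solD(1)[OF S] by blast
 have D: "?D < V x" if "x : {tau p..tau q}" for x using im[OF that] VD by blast
 have le: "tau p <= tau q" using mono[of p q] pq by simp
 have "((%y. (w y / V (tau y)) *\<^sub>R h ?D (tau y)) has_integral integral {tau p..tau q} (h ?D)) {p..q}"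
  by (rule has_integral_substitution[OF pq le, where c = "tau p" and d = "tau q"])
   (use mono pq h_continuous_on[OF sub D] solD(2)[OF S] in auto)
 moreover have "(w y / V (tau y)) *\<^sub>R h ?D (tau y) = 1" if y: "y : {p..q}" for y
 proof -
  have "V (tau y) - ?D = (w y)\<^sup>2" using sol_D[OF S y z] by simp
  hence "sqrt (V (tau y) - ?D) = w y" using w[OF y] by simp
  thus ?thesis using w[OF y] f_pos[OF solD(1)[OF S y]] by (simp add: h_def invsq_def)
 qed
 ultimately have "((%y. 1::real) has_integral integral {tau p..tau q} (h ?D)) {p..q}"
  using has_integral_cong[of "{p..q}" "%y. (w y / V (tau y)) *\<^sub>R h ?D (tau y)" "%y. 1"] by blast
 moreover have "((%y. 1::real) has_integral (q - p)) {p..q}"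
  using has_integral_const_real[of "1::real" p q] pq by simp
 ultimately have "integral {tau p..tau q} (h ?D) = q - p" using has_integral_unique by blast
 thus ?thesis using hint_compact[OF le sub D] by simp
qed

text \<open>Here \<open>w\<close> may vanish at the ends, as it does at turning points. The integral
  is then improper, and both inequalities come from inner subintervals.\<close>

lemma sol_time:
 assumes S: "sol {p..q} tau w" and pq: "p <= q" and w: "!!y. y : {p<..<q} ==> 0 < w y"
  and z: "z : {p..q}"
 shows "hint f (V (tau z) - (w z)\<^sup>2) (tau p) (tau q) = ereal (q - p)"
proof (cases "p = q")
 case False
 hence pq': "p < q" using pq by simp
 let ?D = "V (tau z) - (w z)\<^sup>2"
 have inner: "hint f ?D (tau y) (tau y') = ereal (y' - y)" if "p < y" "y <= y'" "y' < q" for y y'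
 proof -
  have sub: "{y..y'} <= {p..q}" using that by auto
  have "hint f (V (tau y) - (w y)\<^sup>2) (tau y) (tau y') = ereal (y' - y)"
   by (rule sol_time_closed[OF sol_subset[OF S sub]]) (use that w in auto)
  thus ?thesis using sol_energy[OF S _ z, of y] that by simp
 qed
 have Iq: "a <= ereal (tau p)" "ereal (tau q) <= b" using I_bounds solD(1)[OF S] pq by auto
 have mono: "tau y < tau y'" if "y : {p..q}" "y' : {p..q}" "y < y'" for y y'
  using sol_strict_mono[OF S w that] by blast
 show ?thesis
 proof (rule antisym)
  show "hint f ?D (tau p) (tau q) <= ereal (q - p)"
  proof (rule ccontr)
   assume "~ ?thesis"
   hence "ereal (q - p) < hint f ?D (tau p) (tau q)" "0 <= ereal (q - p)" using pq by auto
   then obtain u v where uv: "tau p < u" "u < v" "v < tau q" "ereal (q - p) < hint f ?D u v"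
    using hint_approx[OF Iq, of "ereal (q - p)" ?D] by (metis less_ereal.simps(1))
   obtain y where y: "y : {p..q}" "tau y = u"
    using IVT'[of tau p u q] uv pq sol_continuous(1)[OF S] by auto
   obtain y' where y': "y' : {p..q}" "tau y' = v"
    using IVT'[of tau p v q] uv pq sol_continuous(1)[OF S] by auto
   have "p < y" using uv(1) y by (cases "p = y") auto
   moreover have "y' < q" using uv(3) y' by (cases "y' = q") auto
   moreover have "y < y'" using mono[OF y'(1) y(1)] y y' uv(2) by (cases y y' rule: linorder_cases) auto
   ultimately have "hint f ?D u v = ereal (y' - y)" "y' - y < q - p" using inner[of y y'] y y' by auto
   thus False using uv(4) by simp
  qed
  show "ereal (q - p) <= hint f ?D (tau p) (tau q)"
  proof (rule ereal_le_epsilon2)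
   fix e :: real assume e: "0 < e"
   define d where "d = min (e/2) ((q - p)/2)"
   have d: "0 < d" "2 * d <= e" "p + d <= q - d" using e pq' by (auto simp: d_def min_def field_simps)
   have "ereal (q - p - 2 * d) = hint f ?D (tau (p + d)) (tau (q - d))"
    using inner[of "p + d" "q - d"] d by (simp add: algebra_simps)
   also have "... <= hint f ?D (tau p) (tau q)"
    using mono[of p "p + d"] mono[of "q - d" q] d pq by (intro hint_mono[OF Iq]) auto
   finally have "ereal (q - p - 2 * d) + ereal e <= hint f ?D (tau p) (tau q) + ereal e"
    by (rule add_right_mono)
   thus "ereal (q - p) <= hint f ?D (tau p) (tau q) + ereal e"
    using d(2) by (auto elim!: order_trans[rotated])
  qed
 qed
qed simp

text \<open>A passage from \<open>tau p\<close> to \<open>tau q\<close> may turn back several times,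
  but \<open>w^2 = V - D\<close> keeps \<open>V >= D\<close> on the whole range. Equality at an
  interior point would make it a minimum of \<open>V\<close> visited with \<open>w = 0\<close>, thus
  an equilibrium; the hypothesis \<open>eq\<close> stands in for the uniqueness theorem that
  excludes this.\<close>

lemma sol_cross_passes:
 assumes S: "sol {p..q} tau w" and pq: "p <= q" and z: "z : {p..q}"
  and t: "t : {tau p<..<tau q}"
  and eq: "!!y. y : {p..q} ==> w y = 0 ==> dV (tau y) = 0 ==> tau p = tau q"
 shows "V (tau z) - (w z)\<^sup>2 < V t"
proof (rule ccontr)
 let ?D = "V (tau z) - (w z)\<^sup>2"
 assume "~ ?D < V t"
 have ge: "?D <= V x" if x: "x : {tau p..tau q}" for x
 proof -
  obtain y where "y : {p..q}" "tau y = x"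
   using IVT'[of tau p x q] x pq sol_continuous(1)[OF S] by auto
  thus ?thesis using sol_D[OF S _ z, of y] zero_le_power2[of "w y"] by auto
 qed
 obtain y where y: "y : {p..q}" "tau y = t"
  using IVT'[of tau p t q] t pq sol_continuous(1)[OF S] by auto
 have Vt: "V t = ?D" using ge[of t] t \<open>~ ?D < V t\<close> by auto
 hence "w y = 0" using sol_D[OF S y(1) z] y by simp
 moreover have "dV (tau y) = 0"
 proof (rule DERIV_local_min[OF V_deriv[OF solD(1)[OF S y(1)]]])
  show "0 < min (t - tau p) (tau q - t)" using t by auto
  show "ALL x. \<bar>tau y - x\<bar> < min (t - tau p) (tau q - t) --> V (tau y) <= V x"
  proof (intro allI impI)
   fix x assume "\<bar>tau y - x\<bar> < min (t - tau p) (tau q - t)"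
   hence "x : {tau p..tau q}" using y by (simp add: abs_less_iff)
   thus "V (tau y) <= V x" using ge y Vt by simp
  qed
 qed
 ultimately show False using eq[OF y(1)] t by auto
qed

text \<open>\<open>z'\<close> is the first time at height \<open>v\<close>, and \<open>z\<close> the
  last time before it at height \<open>u\<close>.\<close>

lemma last_before_first:
 fixes g :: "real => real"
 assumes c: "continuous_on {p..q} g" and "p <= q" "g p <= u" "u < v" "v <= g q"
 obtains z z' where "p <= z" "z < z'" "z' <= q" "g z = u" "g z' = v" "!!y. y : {z..z'} ==> g y : {u..v}"
proof -
 define A where "A = {y : {p..q}. g y = v}"
 have "closed A" unfolding A_def
  using continuous_closed_preimage_constant[OF c] by simp
 moreover have "A ~= {}"
  using IVT'[of g p v q] assms unfolding A_def by auto
 moreover have "bdd_below A" unfolding A_def by (rule bdd_belowI[of _ p]) auto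
 ultimately have z'A: "Inf A : A" by (intro closed_contains_Inf)
 define z' where "z' = Inf A"
 have z': "z' : {p..q}" "g z' = v" using z'A by (auto simp: A_def z'_def)
 have lt: "g y < v" if y: "y : {p..<z'}" for y
 proof (rule ccontr)
  assume "~ g y < v"
  then obtain x where "x : {p..y}" "g x = v"
   using IVT'[of g p v y] assms y z' continuous_on_subset[OF c, of "{p..y}"] by auto
  hence "x : A" using y z' by (auto simp: A_def)
  hence "z' <= x" unfolding z'_def using \<open>bdd_below A\<close> by (rule cInf_lower)
  thus False using \<open>x : {p..y}\<close> y by auto
 qed
 have c': "continuous_on {p..z'} g" using c by (rule continuous_on_subset) (use z' in auto)
 define B where "B = {y : {p..z'}. g y = u}"
 have "closed B" unfolding B_def
  using continuous_closed_preimage_constant[OF c'] by simp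
 moreover have "B ~= {}"
  using IVT'[of g p u z'] assms c' z' unfolding B_def by auto
 moreover have "bdd_above B" unfolding B_def by (rule bdd_aboveI[of _ z']) auto
 ultimately have zB: "Sup B : B" by (intro closed_contains_Sup)
 define z where "z = Sup B"
 have z: "z : {p..z'}" "g z = u" using zB by (auto simp: B_def z_def)
 have gt: "u < g y" if y: "y : {z<..z'}" for y
 proof (rule ccontr)
  assume "~ u < g y"
  then obtain x where "x : {y..z'}" "g x = u"
   using IVT'[of g y u z'] assms y z z' continuous_on_subset[OF c', of "{y..z'}"] by auto
  hence "x : B" using y z by (auto simp: B_def)
  hence "x <= z" unfolding z_def using \<open>bdd_above B\<close> by (rule cSup_upper)
  thus False using \<open>x : {y..z'}\<close> y by auto
 qed
 have "z ~= z'" using z z' assms by auto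
 show thesis
 proof (rule that[of z z'])
  fix y assume "y : {z..z'}"
  thus "g y : {u..v}" using gt[of y] lt[of y] z z' by (cases "y = z"; cases "y = z'") auto
 qed (use z z' \<open>z ~= z'\<close> in auto)
qed

text \<open>For \<open>u < v\<close> inside the range, the stretch from the last visit to
  \<open>u\<close> before the first visit to \<open>v\<close> stays between them, where
  \<open>w\<close> cannot vanish. So it is a monotone passage and lasts \<open>hint f D u v\<close>.
  Only an inequality results, because other turns cost extra time.\<close>

lemma sol_cross_time:
 assumes S: "sol {p..q} tau w" and pq: "p <= q" and z: "z : {p..q}" and lt: "tau p < tau q"
  and D: "!!t. t : {tau p<..<tau q} ==> V (tau z) - (w z)\<^sup>2 < V t"
 shows "hint f (V (tau z) - (w z)\<^sup>2) (tau p) (tau q) <= ereal (q - p)"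
proof (rule ccontr)
 let ?D = "V (tau z) - (w z)\<^sup>2"
 assume n: "~ ?thesis"
 have Iq: "a <= ereal (tau p)" "ereal (tau q) <= b" using I_bounds solD(1)[OF S] pq by auto
 have "ereal (q - p) < hint f ?D (tau p) (tau q)" "0 <= ereal (q - p)" using pq n by auto
 then obtain u v where uv: "tau p < u" "u < v" "v < tau q" "ereal (q - p) < hint f ?D u v"
  using hint_approx[OF Iq, of "ereal (q - p)" ?D] by (metis less_ereal.simps(1))
 obtain y y' where y: "p <= y" "y < y'" "y' <= q" "tau y = u" "tau y' = v" "!!x. x : {y..y'} ==> tau x : {u..v}"
  using last_before_first[OF sol_continuous(1)[OF S] pq, of u v] uv by auto
 have sub: "{y..y'} <= {p..q}" using y by auto
 note S' = sol_subset[OF S sub]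
 have w0: "w x ~= 0" if "x : {y..y'}" for x
  using sol_D[OF S _ z, of x] D[of "tau x"] y(6)[OF that] uv sub that by auto
 have wp: "0 < w x" if x: "x : {y..y'}" for x
 proof (rule ccontr)
  assume "~ 0 < w x"
  hence wx: "w x < 0" using w0[OF x] by simp
  have neg: "w x' < 0" if x': "x' : {y..y'}" for x'
  proof (rule ccontr)
   assume "~ w x' < 0"
   hence "0 : closed_segment (w x) (w x')" using wx by (simp add: closed_segment_eq_real_ivl)
   then obtain x0 where "x0 : closed_segment x x'" "w x0 = 0"
    using IVT'_closed_segment_real[of 0 w x x'] continuous_on_subset[OF sol_continuous(2)[OF S'], of "closed_segment x x'"] x x'
    by (auto simp: closed_segment_eq_real_ivl split: if_splits)
   thus False using w0[of x0] x x' by (auto simp: closed_segment_eq_real_ivl split: if_splits)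
  qed
  have "tau y' < tau y"
  proof (rule DERIV_neg_imp_decreasing_open[OF y(2)])
   show "continuous_on {y..y'} tau" by (rule sol_continuous(1)[OF S'])
   fix r assume r: "y < r" "r < y'"
   hence "(tau has_real_derivative w r / V (tau r)) (at r)"
    using solD(2)[OF S', of r] at_within_Icc_at[of y r y'] by simp
   moreover have "w r / V (tau r) < 0" using neg[of r] V_pos[OF solD(1)[OF S', of r]] r by (simp add: divide_neg_pos)
   ultimately show "EX d. (tau has_real_derivative d) (at r) & d < 0" by blast
  qed
  thus False using y uv by simp
 qed
 have "hint f (V (tau y) - (w y)\<^sup>2) (tau y) (tau y') = ereal (y' - y)"
  by (rule sol_time_closed[OF S']) (use wp y in auto)
 moreover have "V (tau y) - (w y)\<^sup>2 = ?D" using sol_energy[OF S _ z, of y] y by simp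
 ultimately have "hint f ?D u v = ereal (y' - y)" using y by simp
 thus False using uv(4) y by simp
qed

end

subsection \<open>Existence and uniqueness of trajectories\<close>

lemma smooth_lipschitz_bounded:
 fixes g :: "real => real"
 assumes g: "smooth_on g S" "open S" and uv: "{u..v} <= S"
 obtains L B where "0 <= L" "0 <= B" "!!x y. x : {u..v} ==> y : {u..v} ==> \<bar>g x - g y\<bar> <= L * \<bar>x - y\<bar>"
  "!!x. x : {u..v} ==> \<bar>g x\<bar> <= B"
proof -
 have d: "(g has_real_derivative deriv g x) (at x)" if "x : S" for x
  using smooth_on_differentiable[OF g(1) that] at_within_open[OF that g(2)]
  by (metis DERIV_deriv_iff_real_differentiable)
 have "smooth_on (deriv g) S"
  by (rule smooth_on_derivative[OF g(1)])
   (use d at_within_open[OF _ g(2)] in "auto simp: real_vector_derivative")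
 hence "compact (deriv g ` {u..v})" "compact (g ` {u..v})"
  using smooth_on_imp_continuous_on g(1) uv continuous_on_subset
  by (auto intro!: compact_continuous_image intro: continuous_on_subset)
 then obtain L B where LB: "!!x. x : {u..v} ==> norm (deriv g x) <= L" "!!x. x : {u..v} ==> norm (g x) <= B"
  using compact_imp_bounded[of "deriv g ` {u..v}"] compact_imp_bounded[of "g ` {u..v}"]
  unfolding bounded_iff by blast
 have "\<bar>g x - g y\<bar> <= max L 0 * \<bar>x - y\<bar>" if "x : {u..v}" "y : {u..v}" for x y
  using field_differentiable_bound[of "{u..v}" g "deriv g" "max L 0" x y] that uv d LB(1)
  by (auto intro: has_field_derivative_at_within simp: le_max_iff_disj subset_iff)
 thus thesis using that[of "max L 0" "max B 0"] LB(2) by (auto simp: le_max_iff_disj)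
qed

definition cl :: "real => real => real => real" where
 "cl lo hi x = max lo (min hi x)"

lemma cl_in: "lo <= hi ==> cl lo hi x : {lo..hi}"
 and cl_eq: "x : {lo..hi} ==> cl lo hi x = x"
 and cl_dist: "\<bar>cl lo hi x - cl lo hi y\<bar> <= \<bar>x - y\<bar>"
 by (auto simp: cl_def)

context warp
begin

text \<open>The system of \<open>sol\<close> with both coordinates clamped to a compact rectangle,
  which makes it bounded and globally Lipschitz.\<close>

definition field :: "real => real => real => real \<times> real => real \<times> real" where
 "field u v M z = (cl (- M) M (snd z) * (1 / V (cl u v (fst z))), dV (cl u v (fst z)) / (2 * V (cl u v (fst z))))"

lemma field_lipschitz:
 assumes uv: "u <= v" "{u..v} <= I" and M: "0 <= M"
 obtains L B where "L-lipschitz_on UNIV (field u v M)" "!!z. norm (field u v M z) <= B"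
proof -
 have s1: "smooth_on (%x. 1 / V x) I"
  by (rule smooth_on_divide[OF smooth_on_const V_smooth]) (use V_pos in force)
 have s2: "smooth_on (%x. dV x / (2 * V x)) I"
  by (rule smooth_on_divide[OF dV_smooth smooth_on_mult[OF smooth_on_const V_smooth]]) (use V_pos in force)
 obtain L1 B1 where
  1: "0 <= L1" "0 <= B1" "!!x y. x : {u..v} ==> y : {u..v} ==> \<bar>1 / V x - 1 / V y\<bar> <= L1 * \<bar>x - y\<bar>"
   "!!x. x : {u..v} ==> \<bar>1 / V x\<bar> <= B1"
  by (rule smooth_lipschitz_bounded[OF s1 open_base_interval uv(2)]) (rule that; assumption)
 obtain L2 B2 where
  2: "0 <= L2" "0 <= B2" "!!x y. x : {u..v} ==> y : {u..v} ==> \<bar>dV x / (2 * V x) - dV y / (2 * V y)\<bar> <= L2 * \<bar>x - y\<bar>"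
   "!!x. x : {u..v} ==> \<bar>dV x / (2 * V x)\<bar> <= B2"
  by (rule smooth_lipschitz_bounded[OF s2 open_base_interval uv(2)]) (rule that; assumption)
 have "(B1 + M * L1 + L2)-lipschitz_on UNIV (field u v M)"
 proof (rule lipschitz_onI)
  show "0 <= B1 + M * L1 + L2" using 1 2 M by simp
  fix z z' :: "real \<times> real"
  let ?n = "norm (z - z')"
  define c c' s s' where "c = cl u v (fst z)" and "c' = cl u v (fst z')"
   and "s = cl (- M) M (snd z)" and "s' = cl (- M) M (snd z')"
  have cc: "c : {u..v}" "c' : {u..v}" and s: "\<bar>s'\<bar> <= M"
   using cl_in[OF uv(1)] cl_in[of "- M" M "snd z'"] M by (auto simp: c_def c'_def s'_def)
  have fs: "\<bar>fst z - fst z'\<bar> <= ?n" "\<bar>snd z - snd z'\<bar> <= ?n"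
   using norm_fst_le[of "fst z - fst z'" "snd z - snd z'"] norm_snd_le[of "snd z - snd z'" "fst z - fst z'"]
   by (simp_all add: minus_prod_def)
  have dc: "\<bar>c - c'\<bar> <= ?n" and ds: "\<bar>s - s'\<bar> <= ?n"
   using cl_dist order_trans fs unfolding c_def c'_def s_def s'_def by blast+
  have "s * (1 / V c) - s' * (1 / V c') = (s - s') * (1 / V c) + s' * (1 / V c - 1 / V c')"
   by (simp add: algebra_simps diff_divide_distrib)
  hence "\<bar>s * (1 / V c) - s' * (1 / V c')\<bar> <= \<bar>s - s'\<bar> * \<bar>1 / V c\<bar> + \<bar>s'\<bar> * \<bar>1 / V c - 1 / V c'\<bar>"
   by (metis abs_mult abs_triangle_ineq)
  also have "... <= ?n * B1 + M * (L1 * ?n)"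
   using 1(4)[OF cc(1)] order_trans[OF 1(3)[OF cc] mult_left_mono[OF dc 1(1)]] ds s M 1(2)
   by (intro add_mono mult_mono) auto
  finally have e1: "\<bar>s * (1 / V c) - s' * (1 / V c')\<bar> <= (B1 + M * L1) * ?n" by (simp add: algebra_simps)
  have e2: "\<bar>dV c / (2 * V c) - dV c' / (2 * V c')\<bar> <= L2 * ?n"
   using order_trans[OF 2(3)[OF cc] mult_left_mono[OF dc 2(1)]] .
  have "dist (field u v M z) (field u v M z') =
   norm (s * (1 / V c) - s' * (1 / V c'), dV c / (2 * V c) - dV c' / (2 * V c'))"
   by (simp add: field_def dist_norm c_def c'_def s_def s'_def)
  also have "... <= \<bar>s * (1 / V c) - s' * (1 / V c')\<bar> + \<bar>dV c / (2 * V c) - dV c' / (2 * V c')\<bar>"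
   using norm_Pair_le by (metis real_norm_def)
  finally show "dist (field u v M z) (field u v M z') <= (B1 + M * L1 + L2) * dist z z'"
   using e1 e2 by (simp add: dist_norm algebra_simps)
 qed
 moreover have "norm (field u v M z) <= M * B1 + B2" for z
 proof -
  have c: "cl u v (fst z) : {u..v}" and s: "\<bar>cl (- M) M (snd z)\<bar> <= M"
   using cl_in[OF uv(1)] cl_in[of "- M" M "snd z"] M by auto
  have "norm (field u v M z) <= \<bar>cl (- M) M (snd z) * (1 / V (cl u v (fst z)))\<bar>
    + \<bar>dV (cl u v (fst z)) / (2 * V (cl u v (fst z)))\<bar>"
   unfolding field_def using norm_Pair_le by (metis real_norm_def)
  also have "... <= M * B1 + B2"
   unfolding abs_mult using 1(4)[OF c] 2(4)[OF c] s M by (intro add_mono mult_mono) auto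
  finally show ?thesis .
 qed
 ultimately show thesis by (rule that)
qed

lemma sol_iff_field:
 assumes "{u..v} <= I" "!!y. y : S ==> tau y : {u..v}" "!!y. y : S ==> w y : {- M..M}"
 shows "sol S tau w \<longleftrightarrow> (ALL y:S. ((%y. (tau y, w y)) has_vector_derivative field u v M (tau y, w y)) (at y within S))"
proof -
 have F: "field u v M (tau y, w y) = (w y / V (tau y), dV (tau y) / (2 * V (tau y)))" if "y : S" for y
  using cl_eq[OF assms(2)[OF that]] cl_eq[OF assms(3)[OF that]] by (simp add: field_def)
 have P: "((%y. (tau y, w y)) has_vector_derivative (d, e)) (at y within S) \<longleftrightarrow>
  (tau has_real_derivative d) (at y within S) & (w has_real_derivative e) (at y within S)" for d e y
  using bounded_linear.has_vector_derivative[OF bounded_linear_fst, of "%y. (tau y, w y)" "(d, e)" "at y within S"]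
   bounded_linear.has_vector_derivative[OF bounded_linear_snd, of "%y. (tau y, w y)" "(d, e)" "at y within S"]
  by (auto simp: real_vector_derivative intro: has_vector_derivative_Pair)
 show ?thesis unfolding sol_def using F P assms(1,2) by auto
qed

text \<open>\<open>s * s = 1\<close> covers time shifts and time reversal at once; reversal flips
  the sign of \<open>w\<close>.\<close>

lemma sol_affine:
 assumes S: "sol {p..q} tau w" and s: "s * s = 1"
  and im: "!!y. y : {p'..q'} ==> c + s * y : {p..q}"
 shows "sol {p'..q'} (%y. tau (c + s * y)) (%y. s * w (c + s * y))"
 unfolding sol_def
proof (intro ballI conjI)
 fix y assume y: "y : {p'..q'}"
 note d = solD[OF S im[OF y]]
 have l: "((%y. c + s * y) has_real_derivative s) (at y within {p'..q'})" by (auto intro!: derivative_eq_intros)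
 have sub: "(%y. c + s * y) ` {p'..q'} <= {p..q}" using im by auto
 show "tau (c + s * y) : I" by (rule d(1))
 show "((%y. tau (c + s * y)) has_real_derivative s * w (c + s * y) / V (tau (c + s * y))) (at y within {p'..q'})"
  using DERIV_chain_within[where h = "%y. c + s * y" and x = y, OF d(2) l sub] by (simp add: mult.commute)
 have "((%y. s * w (c + s * y)) has_real_derivative s * (dV (tau (c + s * y)) / (2 * V (tau (c + s * y))) * s)) (at y within {p'..q'})"
  by (rule DERIV_cmult[OF DERIV_chain_within[where h = "%y. c + s * y" and x = y, OF d(3) l sub]])
 moreover have e: "s * (dV (tau (c + s * y)) / (2 * V (tau (c + s * y))) * s) = (s * s) * (dV (tau (c + s * y)) / (2 * V (tau (c + s * y))))"
  by simp
 ultimately show "((%y. s * w (c + s * y)) has_real_derivative dV (tau (c + s * y)) / (2 * V (tau (c + s * y)))) (at y within {p'..q'})"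
  unfolding e s by simp
qed

text \<open>Both solutions stay in a common compact rectangle, inside which the clamped field is the
  true one, so Gronwall's inequality applies.\<close>

lemma sol_unique_0:
 assumes S: "sol {0..q} tau w" and S': "sol {0..q} tau' w'" and e: "tau 0 = tau' 0" "w 0 = w' 0" and y: "y : {0..q}"
 shows "tau y = tau' y" "w y = w' y"
proof -
 have cp: "compact (tau ` {0..q} \<union> tau' ` {0..q})" "compact (w ` {0..q} \<union> w' ` {0..q})"
  using sol_continuous[OF S] sol_continuous[OF S'] by (auto intro!: compact_Un compact_continuous_image)
 have ne: "tau ` {0..q} \<union> tau' ` {0..q} ~= {}" using y by auto
 obtain u where u: "u : tau ` {0..q} \<union> tau' ` {0..q}" "!!x. x : tau ` {0..q} \<union> tau' ` {0..q} ==> u <= x"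
  using compact_attains_inf[OF cp(1) ne] by blast
 obtain v where v: "v : tau ` {0..q} \<union> tau' ` {0..q}" "!!x. x : tau ` {0..q} \<union> tau' ` {0..q} ==> x <= v"
  using compact_attains_sup[OF cp(1) ne] by blast
 obtain M where M: "!!x. x : w ` {0..q} \<union> w' ` {0..q} ==> norm x <= M"
  using compact_imp_bounded[OF cp(2)] unfolding bounded_iff by blast
 have uvI: "u : I" "v : I" using u(1) v(1) solD(1)[OF S] solD(1)[OF S'] by auto
 have uv: "u <= v" "{u..v} <= I" using u(2)[OF v(1)] I_between[OF uvI] by auto
 have M0: "0 <= M" using M[of "w y"] y by auto
 obtain L B where F: "L-lipschitz_on UNIV (field u v M)"
  using field_lipschitz[OF uv M0] by metis
 have in1: "tau x : {u..v}" "tau' x : {u..v}" if "x : {0..q}" for x using u(2) v(2) that by auto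
 have in2: "w x : {- M..M}" "w' x : {- M..M}" if "x : {0..q}" for x
  using M[of "w x"] M[of "w' x"] that by (auto simp: abs_le_iff)
 have "norm ((tau y, w y) - (tau' y, w' y)) <= exp (L * y) * norm ((tau 0, w 0) - (tau' 0, w' 0))"
  by (rule lipschitz_solutions_dist[OF F _ _ y])
   (use S S' sol_iff_field[OF uv(2), of "{0..q}" tau w M] sol_iff_field[OF uv(2), of "{0..q}" tau' w' M] in1 in2 in blast)+
 hence "(tau y, w y) - (tau' y, w' y) = 0" using e by simp
 hence "(tau y, w y) = (tau' y, w' y)" by (simp only: right_minus_eq)
 thus "tau y = tau' y" "w y = w' y" by simp_all
qed

lemma sol_const:
 assumes "t : I" "dV t = 0"
 shows "sol S (%y. t) (%y. 0)"
 using assms by (auto simp: sol_def)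

text \<open>The constant trajectory has the same initial values; uniqueness is applied forwards from
  \<open>z\<close> and, after time reversal, backwards.\<close>

lemma sol_equilibrium:
 assumes S: "sol {p..q} tau w" and z: "z : {p..q}" "w z = 0" "dV (tau z) = 0" and y: "y : {p..q}"
 shows "tau y = tau z"
proof -
 have I: "tau z : I" by (rule solD(1)[OF S z(1)])
 show ?thesis
 proof (cases "z <= y")
  case True
  have "sol {0..q - z} (%y. tau (z + 1 * y)) (%y. 1 * w (z + 1 * y))"
   by (rule sol_affine[OF S]) (use z in auto)
  from sol_unique_0(1)[OF this sol_const[OF I z(3)], of "y - z"] show ?thesis using z y True by simp
 next
  case False
  have "sol {0..z - p} (%y. tau (z + (- 1) * y)) (%y. (- 1) * w (z + (- 1) * y))"
   by (rule sol_affine[OF S]) (use z in auto)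
  from sol_unique_0(1)[OF this sol_const[OF I z(3)], of "z - y"] show ?thesis using z y False by simp
 qed
qed

lemma sol_cross:
 assumes S: "sol {p..q} tau w" and pq: "p <= q" and z: "z : {p..q}" and lt: "tau p < tau q"
 shows "!!t. t : {tau p<..<tau q} ==> V (tau z) - (w z)\<^sup>2 < V t"
  and "hint f (V (tau z) - (w z)\<^sup>2) (tau p) (tau q) <= ereal (q - p)"
proof -
 show "V (tau z) - (w z)\<^sup>2 < V t" if "t : {tau p<..<tau q}" for t
 proof (rule sol_cross_passes[OF S pq z that])
  fix y assume y: "y : {p..q}" "w y = 0" "dV (tau y) = 0"
  show "tau p = tau q" using sol_equilibrium[OF S y, of p] sol_equilibrium[OF S y, of q] pq by simp
 qed
 thus "hint f (V (tau z) - (w z)\<^sup>2) (tau p) (tau q) <= ereal (q - p)"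
  by (rule sol_cross_time[OF S pq z lt])
qed

end

text \<open>A continuation argument. Up to the first exit time from \<open>A\<close> the curve is in
  \<open>A\<close>, so in the limit it is in \<open>C\<close>, and \<open>step\<close> puts it back
  into \<open>A\<close>.\<close>

lemma stay_inside:
 fixes g :: "real => 'a::metric_space"
 assumes g: "continuous_on {0..Y} g" and A: "open A" and C: "closed C" "A <= C" and 0: "g 0 : A"
  and step: "!!y. y : {0..Y} ==> (!!z. z : {0..y} ==> g z : C) ==> g y : A"
  and y: "y : {0..Y}"
 shows "g y : A"
proof (rule ccontr)
 assume n: "g y ~: A"
 define B where "B = {y : {0..Y}. g y : - A}"
 have "closed ({0..Y} \<inter> g -` (- A))"
  using A by (intro continuous_closed_preimage[OF g]) auto
 hence "closed B" by (simp add: B_def Int_def vimage_def)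
 moreover have "B ~= {}" "bdd_below B" using n y unfolding B_def by (auto intro: bdd_belowI[of _ 0])
 ultimately have sB: "Inf B : B" by (intro closed_contains_Inf)
 define s where "s = Inf B"
 have s: "s : {0..Y}" "g s ~: A" using sB by (auto simp: B_def s_def)
 have lt: "g z : A" if "z : {0..<s}" for z
 proof (rule ccontr)
  assume "g z ~: A"
  hence "z : B" using that s by (auto simp: B_def)
  hence "s <= z" unfolding s_def using \<open>bdd_below B\<close> by (rule cInf_lower)
  thus False using that by simp
 qed
 have "s ~= 0" using s(2) 0 by auto
 hence s0: "0 < s" using s(1) by simp
 have "(g \<longlongrightarrow> g s) (at s within {0..s})"
  using continuous_on_subset[OF g, of "{0..s}"] s by (auto simp: continuous_on_def)
 moreover have "\<forall>\<^sub>F z in at s within {0..s}. g z : C"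
  by (auto simp: eventually_at_filter intro!: always_eventually subsetD[OF C(2)] lt)
 moreover have "at s within {0..s} ~= bot" using interval_not_bot[of 0 s s] s0 by simp
 ultimately have gs: "g s : C" using C(1) Lim_in_closed_set by blast
 have "g s : A"
  by (rule step[OF s(1)]) (use lt gs C(2) in "force simp: le_less")
 thus False using s by simp
qed

context warp
begin

lemma sol_start_right:
 assumes S: "sol {0..Y} tau w" and Y: "0 < Y" and start: "0 < w 0 | w 0 = 0 & 0 < dV (tau 0)"
 obtains d where "0 < d" "!!z. z : {0..Y} ==> 0 < z ==> z < d ==> 0 < w z"
proof (cases "0 < w 0")
 case True
 have "(w \<longlongrightarrow> w 0) (at 0 within {0..Y})"
  using sol_continuous(2)[OF S] Y by (simp add: continuous_on_def)
 from order_tendstoD(1)[OF this True] show ?thesis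
  unfolding eventually_at using that by (auto simp: dist_real_def)
next
 case False
 hence 0: "w 0 = 0" "0 < dV (tau 0)" using start by auto
 have "0 < dV (tau 0) / (2 * V (tau 0))" using 0 V_pos[OF solD(1)[OF S, of 0]] Y by simp
 from has_real_derivative_pos_inc_right[OF solD(3)[OF S, of 0] this] Y
 obtain d where "d > 0" "!!h. 0 < h ==> h : {0..Y} ==> h < d ==> w 0 < w h" by auto
 thus ?thesis using that 0 by metis
qed

text \<open>A rising trajectory can stop rising only where \<open>V = D\<close>, and it cannot come
  to \<open>hi\<close> before the time \<open>hint f D (tau 0) hi\<close>. The bound
  \<open>hi\<close> is an extended real so that it may be \<open>b\<close> itself.\<close>

lemma run_right:
 assumes S: "sol {0..Y} tau w" and start: "0 < w 0 | w 0 = 0 & 0 < dV (tau 0)"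
 defines "D == V (tau 0) - (w 0)\<^sup>2"
 assumes hi: "hi <= b" "ereal (tau 0) < hi"
  and VD: "!!t. tau 0 < t ==> ereal t < hi ==> D < V t"
  and y: "0 < y" "y <= Y" "ereal y < hint f D (tau 0) hi"
 shows "0 < w y" "tau 0 < tau y" "ereal (tau y) < hi" "hint f D (tau 0) (tau y) = ereal y"
proof -
 have Y: "0 < Y" using y by simp
 obtain d where d: "0 < d" "!!z. z : {0..Y} ==> 0 < z ==> z < d ==> 0 < w z"
  using sol_start_right[OF S Y start] by blast
 define good where "good z \<longleftrightarrow> 0 < w z & ereal (tau z) < hi" for z
 have time: "hint f D (tau 0) (tau s) = ereal s" if "0 <= s" "s <= Y" "!!z. 0 < z ==> z < s ==> 0 < w z" for s
  using sol_time[OF sol_subset[OF S, of "{0..s}"], of 0] that by (auto simp: D_def)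
 have inc: "tau 0 < tau s" if "0 < s" "s <= Y" "!!z. 0 < z ==> z < s ==> 0 < w z" for s
  using sol_strict_mono[OF sol_subset[OF S, of "{0..s}"], of 0 s] that by auto
 note c = sol_continuous[OF S]
 have ctau: "((%z. ereal (tau z)) \<longlongrightarrow> ereal (tau s)) (at s within {0..Y})" if "s : {0..Y}" for s
  using c(1) that by (intro tendsto_ereal) (simp add: continuous_on_def)
 have cw: "(w \<longlongrightarrow> w s) (at s within {0..Y})" if "s : {0..Y}" for s
  using c(2) that by (simp add: continuous_on_def)
 have all: "good z" if "0 < z" "z <= y" for z
 proof (rule ccontr)
  assume n: "~ good z"
  define B where "B = {z. 0 < z & z <= y & ~ good z}"
  have B: "B ~= {}" "bdd_below B" using n that unfolding B_def by (auto intro: bdd_belowI[of _ 0])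
  define s where "s = Inf B"
  have lt: "good z" if "0 < z" "z < s" for z
  proof (rule ccontr)
   assume "~ good z"
   moreover have "s <= y" using cInf_lower[OF _ B(2)] B(1) unfolding s_def B_def by force
   ultimately have "z : B" using that by (simp add: B_def)
   thus False using cInf_lower[OF _ B(2)] that unfolding s_def by force
  qed
  have s0: "0 < s"
  proof -
   obtain d' where d': "0 < d'" "!!z. z : {0..Y} ==> z ~= 0 ==> dist z 0 < d' ==> ereal (tau z) < hi"
    using order_tendstoD(2)[OF ctau[of 0] hi(2)] Y unfolding eventually_at by auto
   have "min d d' <= s"
    unfolding s_def
   proof (rule cInf_greatest[OF B(1)])
    fix z assume "z : B"
    thus "min d d' <= z" using d(2)[of z] d'(2)[of z] y unfolding B_def good_def by fastforce
   qed
   thus ?thesis using d d' by simp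
  qed
  have sy: "s <= y" using cInf_lower[OF _ B(2)] B(1) unfolding s_def B_def by force
  have sY: "s : {0..Y}" using s0 sy y by auto
  have wpos: "!!z. 0 < z ==> z < s ==> 0 < w z" using lt by (simp add: good_def)
  have ts: "hint f D (tau 0) (tau s) = ereal s" "tau 0 < tau s"
   using time[of s] inc[of s] wpos s0 sY by auto
  have nb: "at s within {0..s} ~= bot" using interval_not_bot[of 0 s s] s0 by simp
  have sub: "{0..s} <= {0..Y}" using sY by auto
  have ev: "\<forall>\<^sub>F z in at s within {0..s}. good z"
  proof -
   have "\<forall>\<^sub>F z in at s within {0..s}. 0 < z"
    using order_tendstoD(1)[OF tendsto_ident_at s0] .
   thus ?thesis unfolding eventually_at_filter by eventually_elim (use lt in "force simp: less_le")
  qed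
  have ws: "0 <= w s"
   by (rule tendsto_lowerbound[OF tendsto_within_subset[OF cw[OF sY] sub] _ nb])
    (use ev in eventually_elim, auto simp: good_def)
  have tauhi: "ereal (tau s) <= hi"
   by (rule tendsto_upperbound[OF tendsto_within_subset[OF ctau[OF sY] sub] _ nb])
    (use ev in eventually_elim, auto simp: good_def)
  have ngs: "~ good s"
  proof
   assume gs: "good s"
   have "\<forall>\<^sub>F z in at s within {0..Y}. good z"
    using order_tendstoD(1)[OF cw[OF sY], of 0] order_tendstoD(2)[OF ctau[OF sY], of hi] gs
    unfolding good_def by (auto intro: eventually_conj)
   then obtain e where e: "0 < e" "!!z. z : {0..Y} ==> z ~= s ==> dist z s < e ==> good z"
    unfolding eventually_at by blast
   have "s + e <= Inf B"
   proof (rule cInf_greatest[OF B(1)])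
    fix z assume z: "z : B"
    hence "s <= z" using cInf_lower[OF _ B(2)] unfolding s_def by blast
    moreover have "z ~= s" using z gs by (auto simp: B_def)
    ultimately show "s + e <= z" using e(2)[of z] z y by (force simp: B_def dist_real_def)
   qed
   thus False using e by (simp add: s_def)
  qed
  \<comment> \<open>At the infimum \<open>s\<close> of the bad times either \<open>hi\<close> is
    reached, which is too early, or \<open>V > D\<close> forces \<open>w s > 0\<close>, so that
    \<open>s\<close> would be good.\<close>
  show False
  proof (cases "ereal (tau s) = hi")
   case True
   hence "ereal s = hint f D (tau 0) hi" using ts by simp
   thus False using y(3) sy by (metis ereal_less_eq(3) leD)
  next
   case False
   hence lt': "ereal (tau s) < hi" using tauhi by simp
   hence "0 < (w s)\<^sup>2" using VD[OF ts(2) lt'] sol_D[OF S sY, of 0] Y by (simp add: D_def)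
   hence "0 < w s" using ws by (simp add: less_le)
   thus False using ngs lt' by (simp add: good_def)
  qed
 qed
 show "0 < w y" "ereal (tau y) < hi" using all[of y] y by (auto simp: good_def)
 have wp: "!!z. 0 < z ==> z < y ==> 0 < w z" using all by (simp add: good_def)
 show "tau 0 < tau y" "hint f D (tau 0) (tau y) = ereal y" using inc[of y] time[of y] wp y by auto
qed

text \<open>The limit case of \<open>run_right\<close>: at the time \<open>hint\<close> itself the
  point \<open>v\<close> is attained, also when \<open>v\<close> is a turning point.\<close>

lemma run_right_upto:
 assumes S: "sol {0..Y} tau w" and start: "0 < w 0 | w 0 = 0 & 0 < dV (tau 0)"
 defines "D == V (tau 0) - (w 0)\<^sup>2"
 assumes v: "v : I" "tau 0 < v" and VD: "!!t. tau 0 < t ==> t < v ==> D < V t"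
  and y: "0 <= y" "y <= Y" "ereal y <= hint f D (tau 0) v"
 shows "0 <= w y" "tau y : {tau 0..v}" "hint f D (tau 0) (tau y) = ereal y"
  "ereal y = hint f D (tau 0) v ==> tau y = v"
proof -
 have "0 <= w y & tau y : {tau 0..v} & hint f D (tau 0) (tau y) = ereal y & (ereal y = hint f D (tau 0) v --> tau y = v)"
 proof (cases "y = 0")
  case True
  have I0: "tau 0 : I" using solD(1)[OF S, of 0] y by auto
  have "0 < hint f D (tau 0) v"
   by (rule hint_pos) (use I_bounds[OF I0] I_bounds[OF v(1)] v VD in auto)
  thus ?thesis using True v start by (auto simp: zero_ereal_def)
 next
  case False
  hence y0: "0 < y" using y by simp
  have yY: "y : {0..Y}" using y by auto
  have I0: "tau 0 : I" using solD(1)[OF S, of 0] y by auto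
  have vb: "ereal v <= b" "ereal (tau 0) < ereal v" using I_bounds v by auto
  have pre: "0 < w z & tau 0 < tau z & tau z < v" if "0 < z" "z < y" for z
  proof -
   have "ereal z < hint f D (tau 0) v" using that y(3) by (metis ereal_less_eq(3) less_le_trans less_ereal.simps(1))
   thus ?thesis
    using run_right[OF S start vb(1) vb(2), of z] VD that y unfolding D_def by auto
  qed
  have nb: "at y within {0..y} ~= bot" using interval_not_bot[of 0 y y] y0 by simp
  have sub: "{0..y} <= {0..Y}" using y by auto
  have ev: "\<forall>\<^sub>F z in at y within {0..y}. 0 < w z & tau 0 < tau z & tau z < v"
  proof -
   have "\<forall>\<^sub>F z in at y within {0..y}. 0 < z"
    using order_tendstoD(1)[OF tendsto_ident_at y0] .
   thus ?thesis unfolding eventually_at_filter by eventually_elim (use pre in "force simp: less_le")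
  qed
  have lim: "(w \<longlongrightarrow> w y) (at y within {0..y})" "(tau \<longlongrightarrow> tau y) (at y within {0..y})"
   using continuous_on_subset[OF sol_continuous(1)[OF S] sub] continuous_on_subset[OF sol_continuous(2)[OF S] sub] y0
   by (auto simp: continuous_on_def)
  have 1: "0 <= w y" by (rule tendsto_lowerbound[OF lim(1) _ nb]) (use ev in eventually_elim, auto)
  have 2: "tau 0 <= tau y" by (rule tendsto_lowerbound[OF lim(2) _ nb]) (use ev in eventually_elim, auto)
  have 3: "tau y <= v" by (rule tendsto_upperbound[OF lim(2) _ nb]) (use ev in eventually_elim, auto)
  have 4: "hint f D (tau 0) (tau y) = ereal y"
   using sol_time[OF sol_subset[OF S sub], of 0] pre y unfolding D_def by auto
  have 5: "tau y = v" if e: "ereal y = hint f D (tau 0) v"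
  proof (rule ccontr)
   assume "tau y ~= v"
   hence lt: "tau y < v" using 3 by simp
   have "0 < hint f D (tau y) v"
    by (rule hint_pos) (use I_bounds[OF I0] I_bounds[OF v(1)] I_bounds[OF solD(1)[OF S yY]] lt VD 2 in auto)
   moreover have "hint f D (tau 0) v = hint f D (tau 0) (tau y) + hint f D (tau y) v"
    by (rule hint_add) (use I_bounds[OF I0] vb 2 3 in auto)
   ultimately have "ereal y = ereal y + hint f D (tau y) v" "0 < hint f D (tau y) v" using 4 e by simp_all
   thus False by (cases "hint f D (tau y) v") auto
  qed
  show ?thesis using 1 2 3 4 5 by auto
 qed
 thus "0 <= w y" "tau y : {tau 0..v}" "hint f D (tau 0) (tau y) = ereal y"
  "ereal y = hint f D (tau 0) v ==> tau y = v" by auto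
qed

text \<open>All trajectories from \<open>t\<close> are given for all times as curves of the clamped
  field. They keep their meaning only as long as \<open>tau\<close> stays in \<open>{u..v}\<close>;
  in exchange they depend on the initial velocity with a Lipschitz constant that is uniform on
  bounded times.\<close>

lemma flow_family:
 assumes uv: "u <= v" "{u..v} <= I" and t: "t : {u..v}" and Q: "0 <= Q"
 shows "EX (tau :: real => real => real) w L. (ALL p. tau p 0 = t) & (ALL p. w p 0 = p) &
  (ALL p Y. continuous_on {0..Y} (tau p)) & (ALL p Y. continuous_on {0..Y} (w p)) & 0 <= L &
  (ALL p p' y. 0 <= y --> \<bar>tau p y - tau p' y\<bar> <= exp (L * y) * \<bar>p - p'\<bar>) &
  (ALL p:{- Q..Q}. ALL Y. (ALL y:{0..Y}. tau p y : {u..v}) --> sol {0..Y} (tau p) (w p))"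
proof -
 have "compact (V ` {u..v})" by (intro compact_continuous_image V_cont uv compact_Icc)
 then obtain B where B: "!!x. x : {u..v} ==> norm (V x) <= B"
  using compact_imp_bounded[of "V ` {u..v}"] unfolding bounded_iff by blast
 have B0: "0 <= B" using B[OF t] norm_ge_zero order_trans by blast
 \<comment> \<open>Any \<open>M\<close> with \<open>M^2 > B + Q^2\<close> will do: while the curve
   stays in \<open>{u..v}\<close>, the energy gives \<open>w^2 <= B + Q^2\<close>, and the clamp on
   \<open>w\<close> is never active.\<close>
 define M where "M = Q + B + 1"
 have "M\<^sup>2 = Q\<^sup>2 + B + (1 + B + B\<^sup>2 + 2 * Q + 2 * (B * Q))"
  by (simp add: M_def power2_eq_square algebra_simps)
 moreover have "0 <= B * Q" "0 <= B\<^sup>2" using Q B0 by auto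
 ultimately have "B + Q\<^sup>2 < M\<^sup>2" using Q B0 by linarith
 hence M: "0 <= M" "Q < M" "B + Q\<^sup>2 < M\<^sup>2"
  using Q B0 by (auto simp: M_def)
 obtain L C where F: "L-lipschitz_on UNIV (field u v M)" "!!z. norm (field u v M z) <= C"
  using field_lipschitz[OF uv M(1)] by metis
 have "EX X. X 0 = z & (ALL T. ALL s:{0..T}. (X has_vector_derivative field u v M (X s)) (at s within {0..T}))" for z
  using lipschitz_solution_exists[OF F, of z] by metis
 then obtain X where X: "!!z. X z 0 = z"
  "!!z T s. s : {0..T} ==> (X z has_vector_derivative field u v M (X z s)) (at s within {0..T})"
  by metis
 define tau w where "tau p y = fst (X (t, p) y)" and "w p y = snd (X (t, p) y)" for p y
 have cX: "continuous_on {0..Y} (X z)" for z Y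
  using X(2) by (meson continuous_on_vector_derivative)
 have cw: "continuous_on {0..Y} (w p)" and ct: "continuous_on {0..Y} (tau p)" for p Y
  unfolding tau_def w_def by (intro continuous_intros cX)+
 have L0: "0 <= L" using F(1) lipschitz_on_nonneg by blast
 have "tau p 0 = t" "w p 0 = p" for p by (simp_all add: tau_def w_def X)
 moreover have "\<bar>tau p y - tau p' y\<bar> <= exp (L * y) * \<bar>p - p'\<bar>" if y0: "0 <= y" for p p' y
  proof -
   have y: "y : {0..y}" using y0 by simp
   have "\<bar>tau p y - tau p' y\<bar> <= norm (X (t, p) y - X (t, p') y)"
    unfolding tau_def by (metis fst_diff norm_fst_le prod.collapse real_norm_def)
   also have "... <= exp (L * y) * norm (X (t, p) 0 - X (t, p') 0)"
    by (rule lipschitz_solutions_dist[OF F(1) X(2) X(2) y])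
   also have "norm (X (t, p) 0 - X (t, p') 0) = \<bar>p - p'\<bar>" by (simp add: X norm_Pair)
   finally show ?thesis .
  qed
 moreover have "sol {0..Y} (tau p) (w p)" if p: "p : {- Q..Q}" and K: "!!y. y : {0..Y} ==> tau p y : {u..v}" for p Y
  proof -
   have part: "sol {0..Y'} (tau p) (w p)" if Y': "Y' <= Y" and wM: "!!y. y : {0..Y'} ==> w p y : {- M..M}" for Y'
   proof -
    have "sol {0..Y'} (tau p) (w p) \<longleftrightarrow> (ALL y:{0..Y'}. ((%y. (tau p y, w p y)) has_vector_derivative field u v M (tau p y, w p y)) (at y within {0..Y'}))"
     by (rule sol_iff_field[OF uv(2)]) (use K Y' wM in auto)
    thus ?thesis using X(2) by (simp add: tau_def w_def)
   qed
   have "w p y : {- M<..<M}" if "y : {0..Y}" for y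
   proof (rule stay_inside[OF cw[of Y p] _ _ _ _ _ that, where C = "{- M..M}"])
    show "w p 0 : {- M<..<M}" using p M by (auto simp: w_def X)
    fix y assume y: "y : {0..Y}" "!!z. z : {0..y} ==> w p z : {- M..M}"
    have S: "sol {0..y} (tau p) (w p)" by (rule part) (use y in auto)
    have "(w p y)\<^sup>2 = V (tau p y) - (V (tau p 0) - (w p 0)\<^sup>2)"
     by (rule sol_D[OF S]) (use y in auto)
    also have "... <= B + Q\<^sup>2"
    proof -
     have "V (tau p y) <= B" using B[OF K[OF y(1)]] by simp
     moreover have "0 <= V (tau p 0)" using V_pos[of t] t uv by (auto simp: tau_def X)
     moreover have "(w p 0)\<^sup>2 <= Q\<^sup>2"
      using p Q by (intro power2_le_iff_abs_le[THEN iffD2]) (auto simp: w_def X)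
     ultimately show ?thesis by linarith
    qed
    finally have "(w p y)\<^sup>2 < M\<^sup>2" using M by simp
    hence "\<bar>w p y\<bar> < M" using M(1) abs_less_iff power2_less_imp_less[of "\<bar>w p y\<bar>" M] by simp
    thus "w p y : {- M<..<M}" by auto
   qed auto
   thus ?thesis by (intro part) force+
  qed
 ultimately show ?thesis using cw ct L0
  by (intro exI[of _ tau] exI[of _ w] exI[of _ L]) simp
qed

text \<open>An a priori bound implies existence. The field is taken on a slightly larger interval,
  so that the bound by \<open>{u..v}\<close> keeps the trajectory in the interior of the region
  where the field is the true one.\<close>

lemma sol_exists_confined:
 assumes uv: "u : I" "v : I" and t: "t : {u..v}" and Y: "0 <= Y"
  and conf: "!!Y' tau w. 0 <= Y' ==> Y' <= Y ==> sol {0..Y'} tau w ==> tau 0 = t ==> w 0 = w0 ==> tau Y' : {u..v}"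
 obtains tau w where "sol {0..Y} tau w" "tau 0 = t" "w 0 = w0"
proof -
 obtain e where e: "0 < e" "cball u e <= I" "cball v e <= I"
 proof -
  obtain e1 e2 where "0 < e1" "cball u e1 <= I" "0 < e2" "cball v e2 <= I"
   using open_contains_cball open_base_interval uv by metis
  thus thesis using that[of "min e1 e2"] by (auto simp: subset_iff)
 qed
 have K: "u - e <= v + e" "{u - e..v + e} <= I"
  using e t I_between[of "u - e" a b "v + e"] by (auto simp: subset_iff dist_real_def)
 have tK: "t : {u - e..v + e}" using t e by auto
 obtain tau w :: "real => real => real" where F: "ALL p. tau p 0 = t" "ALL p. w p 0 = p"
  "ALL p Y. continuous_on {0..Y} (tau p)"
  and sol': "ALL p:{- \<bar>w0\<bar>..\<bar>w0\<bar>}. ALL Y. (ALL y:{0..Y}. tau p y : {u - e..v + e}) --> sol {0..Y} (tau p) (w p)"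
  using flow_family[OF K tK abs_ge_zero[of w0]] by blast
 have sol: "sol {0..Y} (tau w0) (w w0)" if "!!y. y : {0..Y} ==> tau w0 y : {u - e..v + e}" for Y
 proof -
  have "w0 : {- \<bar>w0\<bar>..\<bar>w0\<bar>}" by auto
  thus ?thesis using sol' that by blast
 qed
 have "tau w0 y : {u - e<..<v + e}" if "y : {0..Y}" for y
 proof (rule stay_inside[OF F(3)[rule_format, of Y w0] _ _ _ _ _ that, where C = "{u - e..v + e}"])
  show "tau w0 0 : {u - e<..<v + e}" using t e by (auto simp: F)
  fix y assume y: "y : {0..Y}" "!!z. z : {0..y} ==> tau w0 z : {u - e..v + e}"
  have "sol {0..y} (tau w0) (w w0)" by (rule sol) (use y in auto)
  hence "tau w0 y : {u..v}" using conf[of y "tau w0" "w w0"] y F by auto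
  thus "tau w0 y : {u - e<..<v + e}" using e by auto
 qed auto
 hence "sol {0..Y} (tau w0) (w w0)" by (intro sol) force+
 thus thesis using that F by blast
qed

end

subsection \<open>Shooting\<close>

lemma first_time:
 fixes g :: "real => real"
 assumes g: "continuous_on {0..l} g" and C: "closed C" and y: "y : {0..l}" "g y : C"
 obtains s where "s : {0..y}" "g s : C" "!!z. z : {0..<s} ==> g z ~: C"
proof -
 define B where "B = {0..l} \<inter> g -` C"
 have "closed B" unfolding B_def using C by (intro continuous_closed_preimage[OF g]) auto
 moreover have B: "B ~= {}" "bdd_below B" using y unfolding B_def by (auto intro: bdd_belowI[of _ 0])
 ultimately have sB: "Inf B : B" by (intro closed_contains_Inf)
 have lo: "Inf B <= z" if "z : B" for z using that B(2) by (rule cInf_lower)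
 show thesis
 proof (rule that[of "Inf B"])
  show "Inf B : {0..y}" "g (Inf B) : C" using sB lo[of y] y by (auto simp: B_def)
  show "g z ~: C" if "z : {0..<Inf B}" for z
  proof
   assume "g z : C"
   hence "z : B" using that sB by (auto simp: B_def)
   thus False using lo that by force
  qed
 qed
qed

text \<open>\<open>A p\<close> says that the trajectory gets up to \<open>beta\<close>, or ends
  above \<open>t1\<close>, without having met \<open>alpha\<close>. A strict overshoot is stable
  under small changes of \<open>p\<close>; a mere touch of \<open>beta\<close> is not, and
  \<open>up\<close> replaces it by an overshoot or by staying above \<open>t1\<close> until
  \<open>l\<close>.\<close>

lemma shooting_open:
 fixes tau :: "real => real => real"
 assumes p: "p : J" and l: "0 <= l" and cont: "continuous_on {0..l} (tau p)"
  and unif: "!!e. 0 < e ==> EX d>0. ALL p':J. \<bar>p' - p\<bar> < d --> (ALL y:{0..l}. \<bar>tau p' y - tau p y\<bar> < e)"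
  and t: "alpha < t1" "t1 < beta" "tau p 0 < beta"
  and up: "!!y. y : {0..<l} ==> (!!z. z : {0..<y} ==> alpha < tau p z & tau p z < beta) ==> tau p y = beta ==>
   (ALL z:{y..l}. t1 < tau p z) | (EX x:{y..l}. beta < tau p x & (ALL z:{y..x}. alpha < tau p z))"
 defines "A == (%p. EX y:{0..l}. (ALL z:{0..y}. alpha < tau p z) & (beta <= tau p y | (y = l & t1 < tau p y)))"
 assumes A: "A p"
 shows "EX d>0. ALL p':J. \<bar>p' - p\<bar> < d --> A p'"
proof -
 have stable: "EX d>0. ALL p':J. \<bar>p' - p\<bar> < d --> A p'"
  if x: "x : {0..l}" "!!z. z : {0..x} ==> alpha < tau p z" and end': "beta < tau p x | (x = l & t1 < tau p x)" for x
 proof -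
  obtain m where m: "m : {0..x}" "!!z. z : {0..x} ==> tau p m <= tau p z"
   using continuous_attains_inf[OF _ _ continuous_on_subset[OF cont, of "{0..x}"]] x(1) by auto
  define e where "e = min (tau p m - alpha) (if beta < tau p x then tau p x - beta else tau p x - t1)"
  have "0 < e" using x(2)[OF m(1)] end' by (auto simp: e_def)
  from unif[OF this] obtain d where d: "d > 0"
   "!!p' y. p' : J ==> \<bar>p' - p\<bar> < d ==> y : {0..l} ==> \<bar>tau p' y - tau p y\<bar> < e" by blast
  have "A p'" if p': "p' : J" "\<bar>p' - p\<bar> < d" for p'
   unfolding A_def
  proof (intro bexI[of _ x] conjI ballI x(1))
   fix z assume z: "z : {0..x}"
   thus "alpha < tau p' z" using d(2)[OF p', of z] m(2)[OF z] x(1) by (auto simp: e_def)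
  next
   show "beta <= tau p' x | (x = l & t1 < tau p' x)"
    using d(2)[OF p' x(1)] end' by (auto simp: e_def split: if_splits)
  qed
  thus ?thesis using d(1) by blast
 qed
 obtain y where y: "y : {0..l}" "!!z. z : {0..y} ==> alpha < tau p z" "beta <= tau p y | (y = l & t1 < tau p y)"
  using A unfolding A_def by blast
 show ?thesis
 proof (cases "beta <= tau p y")
  case False
  thus ?thesis using stable[of y] y by auto
 next
  case True
  obtain s where s: "s : {0..y}" "tau p s : {beta..}" "!!z. z : {0..<s} ==> tau p z ~: {beta..}"
   using first_time[OF cont, of "{beta..}" y] True y(1) by auto
  have before: "alpha < tau p z & tau p z < beta" if "z : {0..<s}" for z
   using s(3)[OF that] y(2)[of z] that s(1) by auto
  show ?thesis
  proof (cases "tau p s = beta")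
   case False
   thus ?thesis using stable[of s] s y by auto
  next
   case eq: True
   show ?thesis
   proof (cases "s = l")
    case True
    thus ?thesis using stable[of s] s y eq t by auto
   next
    case False
    hence "s : {0..<l}" using s(1) y(1) by auto
    from up[OF this before eq] show ?thesis
    proof
     assume st: "ALL z:{s..l}. t1 < tau p z"
     have "alpha < tau p z" if "z : {0..l}" for z
     proof (cases "z < s")
      case False
      hence "t1 < tau p z" using st that by auto
      thus ?thesis using t by simp
     qed (use before[of z] that in auto)
     thus ?thesis using stable[of l] st l s y(1) by auto
    next
     assume "EX x:{s..l}. beta < tau p x & (ALL z:{s..x}. alpha < tau p z)"
     then obtain x where x: "x : {s..l}" "beta < tau p x" "!!z. z : {s..x} ==> alpha < tau p z" by blast
     have "alpha < tau p z" if "z : {0..x}" for z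
      using x(3)[of z] before[of z] that by (cases "z < s") auto
     thus ?thesis using stable[of x] x s by auto
    qed
   qed
  qed
 qed
qed

text \<open>The velocities that escape upwards and those that escape downwards form disjoint
  nonempty open subsets of an interval. By connectedness some velocity is in neither, and its
  trajectory stays inside and ends at \<open>t1\<close>.\<close>

lemma shooting:
 fixes tau :: "real => real => real"
 assumes pq: "pa <= pb" and l: "0 <= l" and cont: "!!p. p : {pa..pb} ==> continuous_on {0..l} (tau p)"
  and unif: "!!p e. p : {pa..pb} ==> 0 < e ==>
   EX d>0. ALL p':{pa..pb}. \<bar>p' - p\<bar> < d --> (ALL y:{0..l}. \<bar>tau p' y - tau p y\<bar> < e)"
  and t: "alpha < t1" "t1 < beta" and t0: "!!p. p : {pa..pb} ==> tau p 0 : {alpha<..<beta}"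
  and up: "!!p y. p : {pa..pb} ==> y : {0..<l} ==> (!!z. z : {0..<y} ==> alpha < tau p z & tau p z < beta) ==> tau p y = beta ==>
   (ALL z:{y..l}. t1 < tau p z) | (EX x:{y..l}. beta < tau p x & (ALL z:{y..x}. alpha < tau p z))"
  and down: "!!p y. p : {pa..pb} ==> y : {0..<l} ==> (!!z. z : {0..<y} ==> alpha < tau p z & tau p z < beta) ==> tau p y = alpha ==>
   (ALL z:{y..l}. tau p z < t1) | (EX x:{y..l}. tau p x < alpha & (ALL z:{y..x}. tau p z < beta))"
  and A: "EX y:{0..l}. (ALL z:{0..y}. alpha < tau pb z) & (beta <= tau pb y | (y = l & t1 < tau pb y))"
  and B: "EX y:{0..l}. (ALL z:{0..y}. tau pa z < beta) & (tau pa y <= alpha | (y = l & tau pa y < t1))"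
 obtains p where "p : {pa..pb}" "tau p l = t1" "!!y. y : {0..l} ==> tau p y : {alpha<..<beta}"
proof -
 let ?J = "{pa..pb}"
 define A where "A p \<longleftrightarrow> (EX y:{0..l}. (ALL z:{0..y}. alpha < tau p z) & (beta <= tau p y | (y = l & t1 < tau p y)))" for p
 define B where "B p \<longleftrightarrow> (EX y:{0..l}. (ALL z:{0..y}. tau p z < beta) & (tau p y <= alpha | (y = l & tau p y < t1)))" for p
 have Aopen: "EX d>0. ALL p':?J. \<bar>p' - p\<bar> < d --> A p'" if p: "p : ?J" "A p" for p
  unfolding A_def
  by (rule shooting_open[OF p(1) l cont[OF p(1)] unif[OF p(1)] t _ up[OF p(1)] p(2)[unfolded A_def]])
   (use t0[OF p(1)] in auto)
 have Bopen: "EX d>0. ALL p':?J. \<bar>p' - p\<bar> < d --> B p'" if p: "p : ?J" "B p" for p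
 proof -
  have "EX d>0. ALL p':?J. \<bar>p' - p\<bar> < d --> (EX y:{0..l}. (ALL z:{0..y}. - beta < - tau p' z) & (- alpha <= - tau p' y | (y = l & - t1 < - tau p' y)))"
  proof (rule shooting_open[OF p(1) l])
   show "continuous_on {0..l} (%y. - tau p y)" by (intro continuous_intros cont p)
   show "EX d>0. ALL p':?J. \<bar>p' - p\<bar> < d --> (ALL y:{0..l}. \<bar>- tau p' y - - tau p y\<bar> < e)" if "0 < e" for e
    using unif[OF p(1) that] by (simp add: abs_minus_commute)
   show "(ALL z:{y..l}. - t1 < - tau p z) | (EX x:{y..l}. - alpha < - tau p x & (ALL z:{y..x}. - beta < - tau p z))"
    if "y : {0..<l}" "!!z. z : {0..<y} ==> - beta < - tau p z & - tau p z < - alpha" "- tau p y = - alpha" for y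
    using down[OF p(1) that(1)] that(2,3) by simp
  qed (use t t0[OF p(1)] p(2) in "auto simp: B_def")
  thus ?thesis by (simp add: B_def)
 qed
 have disj: "~ (A p & B p)" if "p : ?J" for p
 proof
  assume "A p & B p"
  then obtain y y' where y: "y : {0..l}" "!!z. z : {0..y} ==> alpha < tau p z" "beta <= tau p y | (y = l & t1 < tau p y)"
   and y': "y' : {0..l}" "!!z. z : {0..y'} ==> tau p z < beta" "tau p y' <= alpha | (y' = l & tau p y' < t1)"
   unfolding A_def B_def by metis
  show False
  proof (cases "y <= y'")
   case True
   hence "y = l & t1 < tau p y" using y'(2)[of y] y by auto
   thus False using True y' y(2)[of y'] by auto
  next
   case False
   hence "y' = l & tau p y' < t1" using y(2)[of y'] y' by auto
   thus False using False y by auto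
  qed
 qed
 show thesis
 proof (cases "EX p:?J. ~ A p & ~ B p")
  case True
  then obtain p where p: "p : ?J" "~ A p" "~ B p" by blast
  have ins: "tau p y : {alpha<..<beta}" if y: "y : {0..l}" for y
  proof (rule ccontr)
   assume "tau p y ~: {alpha<..<beta}"
   hence n: "tau p y : - {alpha<..<beta}" by blast
   obtain s where s: "s : {0..y}" "tau p s : - {alpha<..<beta}" "!!z. z : {0..<s} ==> tau p z ~: - {alpha<..<beta}"
    by (rule first_time[OF cont[OF p(1)] closed_Compl[OF open_greaterThanLessThan] y n]) (rule that)
   have before: "alpha < tau p z & tau p z < beta" if "z : {0..<s}" for z using s(3)[OF that] by auto
   have sl: "s : {0..l}" using s y by auto
   consider "beta <= tau p s" | "tau p s <= alpha" using s(2) by force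
   thus False
   proof cases
    case 1
    hence "ALL z:{0..s}. alpha < tau p z" using before t by (auto simp: le_less)
    hence "A p" unfolding A_def using 1 sl by blast
    thus False using p by simp
   next
    case 2
    hence "ALL z:{0..s}. tau p z < beta" using before t by (auto simp: le_less)
    hence "B p" unfolding B_def using 2 sl by blast
    thus False using p by simp
   qed
  qed
  have "~ t1 < tau p l" using p(2) ins l unfolding A_def by force
  moreover have "~ tau p l < t1" using p(3) ins l unfolding B_def by force
  ultimately have "tau p l = t1" by simp
  thus thesis using that p(1) ins by blast
 next
  case False
  let ?A = "{p\<in>?J. A p}" and ?B = "{p\<in>?J. B p}"
  have "openin (top_of_set ?J) ?A" "openin (top_of_set ?J) ?B"
   unfolding openin_euclidean_subtopology_iff using Aopen Bopen by (auto simp: dist_real_def)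
  moreover have "?J <= ?A \<union> ?B" "?A \<inter> ?B = {}" using False disj by auto
  moreover have "?A ~= {}" "?B ~= {}" using A B pq unfolding A_def B_def by auto
  ultimately have "~ connected ?J" unfolding connected_openin by blast
  thus thesis by simp
 qed
qed

subsection \<open>Reflection of the time axis\<close>

abbreviation (input) mirror :: "(real => real) => real => real" where
 "mirror f == (%t. f (- t))"

lemma I_reflect: "t : base_interval (- b) (- a) \<longleftrightarrow> - t : base_interval a b"
 unfolding base_interval_def by (cases a; cases b) auto

lemma invsq_reflect: "invsq (mirror f) t = invsq f (- t)"
 by (simp add: invsq_def)

context warp
begin

lemma warp_reflect: "warp (- b) (- a) (mirror f)"
proof
 show "- b < - a" using ab by simp
 show "smooth_on (mirror f) (base_interval (- b) (- a))"
  by (rule smooth_on_compose[OF f_smooth smooth_on_linear[OF bounded_linear_minus[OF bounded_linear_ident]]])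
   (auto simp: I_reflect)
 show "0 < f (- tau)" if "tau : base_interval (- b) (- a)" for tau
  using f_pos that by (simp add: I_reflect)
qed

lemma dV_reflect:
 assumes "- t : I"
 shows "deriv (invsq (mirror f)) t = - dV (- t)"
proof (rule DERIV_imp_deriv)
 have "((%t. V (- t)) has_real_derivative dV (- t) * - 1) (at t)"
  by (rule DERIV_chain2[where g = uminus and x = t, OF V_deriv[OF assms]]) (auto intro!: derivative_eq_intros)
 thus "(invsq (mirror f) has_real_derivative - dV (- t)) (at t)"
  unfolding invsq_reflect[abs_def] by simp
qed

lemma sol_reflect:
 assumes "sol S tau w"
 shows "warp.sol (- b) (- a) (mirror f) S (%y. - tau y) (%y. - w y)"
proof -
 interpret R: warp "- b" "- a" "mirror f" by (rule warp_reflect)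
 show ?thesis
  unfolding R.sol_def
 proof (intro ballI conjI)
  fix y assume y: "y : S"
  note s = solD[OF assms y]
  show "- tau y : R.I" using s(1) by (simp add: I_reflect)
  show "((%y. - tau y) has_real_derivative - w y / invsq (mirror f) (- tau y)) (at y within S)"
   using DERIV_minus[OF s(2)] by (simp add: invsq_reflect)
  show "((%y. - w y) has_real_derivative deriv (invsq (mirror f)) (- tau y) / (2 * invsq (mirror f) (- tau y))) (at y within S)"
   using DERIV_minus[OF s(3)] s(1) by (simp add: invsq_reflect dV_reflect)
 qed
qed

lemma sol_reflectD:
 assumes "warp.sol (- b) (- a) (mirror f) S tau w"
 shows "sol S (%y. - tau y) (%y. - w y)"
proof -
 interpret R: warp "- b" "- a" "mirror f" by (rule warp_reflect)
 show ?thesis using R.sol_reflect[OF assms] by simp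
qed

lemma conn_reflect: "warp.conn (- b) (- a) (mirror f) (- t) (- u) l \<longleftrightarrow> conn t u l"
proof -
 interpret R: warp "- b" "- a" "mirror f" by (rule warp_reflect)
 show ?thesis
  unfolding R.conn_def conn_def
  using sol_reflect sol_reflectD by (metis (no_types, lifting) minus_minus)
qed

lemma hint_reflect:
 assumes "a <= lo" "hi <= b"
 shows "hint (mirror f) D (- hi) (- lo) = hint f D lo hi"
proof -
 have m: "(%t. ennreal (h D t) * indicator (base_interval lo hi) t) : borel_measurable borel"
 proof -
  have "(%t. ennreal (h D t) * indicator I t * indicator (base_interval lo hi) t) : borel_measurable borel"
   by measurable
  also have "(%t. ennreal (h D t) * indicator I t * indicator (base_interval lo hi) t)
   = (%t. ennreal (h D t) * indicator (base_interval lo hi) t)"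
   using base_interval_subset[OF assms] by (auto simp: fun_eq_iff indicator_def)
  finally show ?thesis .
 qed
 have "(\<integral>\<^sup>+t. ennreal (h D t) * indicator (base_interval lo hi) t \<partial>lborel)
  = (\<integral>\<^sup>+t. ennreal (h D (- t)) * indicator (base_interval lo hi) (- t) \<partial>lborel)"
  using nn_integral_real_affine[OF m, of "- 1" 0] by simp
 thus ?thesis
  unfolding hint_def h_def
  by (simp add: invsq_reflect I_reflect indicator_def)
qed

lemma run_left_upto:
 assumes S: "sol {0..Y} tau w" and start: "w 0 < 0 | w 0 = 0 & dV (tau 0) < 0"
 defines "D == V (tau 0) - (w 0)\<^sup>2"
 assumes v: "v : I" "v < tau 0" and VD: "!!t. v < t ==> t < tau 0 ==> D < V t"
  and y: "0 <= y" "y <= Y" "ereal y <= hint f D v (tau 0)"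
 shows "w y <= 0" "tau y : {v..tau 0}" "hint f D (tau y) (tau 0) = ereal y"
  "ereal y = hint f D v (tau 0) ==> tau y = v"
proof -
 interpret R: warp "- b" "- a" "mirror f" by (rule warp_reflect)
 have I0: "tau 0 : I" "tau y : I" using solD(1)[OF S] y by auto
 have h: "hint (mirror f) D (- tau 0) (- u) = hint f D u (tau 0)" if "u : I" for u
  using hint_reflect[of "ereal u" "ereal (tau 0)" D] I_bounds that I0 by simp
 have D': "invsq (mirror f) (- tau 0) - (- w 0)\<^sup>2 = D" by (simp add: D_def invsq_reflect)
 have st: "0 < - w 0 | - w 0 = 0 & 0 < deriv (invsq (mirror f)) (- tau 0)"
  using start dV_reflect[of "- tau 0"] I0 by auto
 have VD': "D < invsq (mirror f) t" if "- tau 0 < t" "t < - v" for t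
  using VD[of "- t"] that by (simp add: invsq_reflect)
 note RR = R.run_right_upto[where v = "- v" and y = y, OF sol_reflect[OF S] st, unfolded D', OF _ _ VD' y(1,2)]
 have 1: "- v : R.I" "- tau 0 < - v" using v by (simp_all add: I_reflect)
 have 2: "ereal y <= hint (mirror f) D (- tau 0) (- v)" using y(3) h[OF v(1)] by simp
 show "w y <= 0" using RR(1)[OF 1] 2 by simp
 show "tau y : {v..tau 0}" using RR(2)[OF 1] 2 by simp
 show "hint f D (tau y) (tau 0) = ereal y" using RR(3)[OF 1] 2 h[OF I0(2)] by simp
 show "tau y = v" if "ereal y = hint f D v (tau 0)"
  using RR(4)[OF 1] 2 that h[OF v(1)] by simp
qed

lemma sol_cross_left:
 assumes S: "sol {p..q} tau w" and pq: "p <= q" and z: "z : {p..q}" and lt: "tau q < tau p"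
 shows "!!t. t : {tau q<..<tau p} ==> V (tau z) - (w z)\<^sup>2 < V t"
  and "hint f (V (tau z) - (w z)\<^sup>2) (tau q) (tau p) <= ereal (q - p)"
proof -
 interpret R: warp "- b" "- a" "mirror f" by (rule warp_reflect)
 note RC = R.sol_cross[OF sol_reflect[OF S] pq z]
 show "V (tau z) - (w z)\<^sup>2 < V t" if "t : {tau q<..<tau p}" for t
  using RC(1)[of "- t"] lt that by (simp add: invsq_reflect)
 have "tau q : I" "tau p : I" using solD(1)[OF S] pq by auto
 thus "hint f (V (tau z) - (w z)\<^sup>2) (tau q) (tau p) <= ereal (q - p)"
  using RC(2) lt hint_reflect[of "tau q" "tau p"] I_bounds by (simp add: invsq_reflect)
qed

lemma reach_right:
 assumes t: "t : I" "v : I" "t < v" and start: "0 < w0 | w0 = 0 & 0 < dV t"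
  and VD: "!!s. t < s ==> s < v ==> V t - w0\<^sup>2 < V s"
  and Y: "0 <= Y" "ereal Y <= hint f (V t - w0\<^sup>2) t v"
 obtains tau w where "sol {0..Y} tau w" "tau 0 = t" "w 0 = w0"
proof (rule sol_exists_confined[OF t(1,2) _ Y(1)])
 show "t : {t..v}" using t by simp
 fix Y' tau w assume a: "0 <= Y'" "Y' <= Y" "sol {0..Y'} tau w" "tau 0 = t" "w 0 = w0"
 have st: "0 < w 0 | w 0 = 0 & 0 < dV (tau 0)" using start a by simp
 have "ereal Y' <= hint f (V t - w0\<^sup>2) t v" using a(2) Y(2) by (metis ereal_less_eq(3) order_trans)
 thus "tau Y' : {t..v}"
  using run_right_upto(2)[OF a(3) st, of v Y'] t VD a by simp
qed (rule that)

text \<open>At a critical turning point the trajectory would have to rest, so it is not reached in finite time.\<close>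

lemma hint_degenerate_infinite:
 assumes v: "v : I" "V v = D" "dV v = 0" and u: "u : I" "u < v" and VD: "!!s. u < s ==> s < v ==> D < V s"
 shows "hint f D u v = \<infinity>"
proof (rule ccontr)
 assume n: "hint f D u v ~= \<infinity>"
 obtain t where t: "u < t" "t < v" using dense u(2) by blast
 have tI: "t : I" using I_between[OF u(1) v(1)] t by simp
 define w0 where "w0 = sqrt (V t - D)"
 have w0: "0 < w0" "V t - w0\<^sup>2 = D" using VD[OF t] by (simp_all add: w0_def)
 have "hint f D t v <= hint f D u v"
  by (rule hint_mono) (use I_bounds u v t in auto)
 then obtain T where T: "hint f D t v = ereal T" "0 <= T"
  using n hint_nonneg[of D t v] by (cases "hint f D t v") auto
 have VD': "V t - w0\<^sup>2 < V s" if "t < s" "s < v" for s using VD[of s] that t w0 by simp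
 have "EX tau w. sol {0..T} tau w & tau 0 = t & w 0 = w0"
  by (rule reach_right[OF tI v(1) t(2) disjI1[OF w0(1)] VD' T(2)]) (use T w0 in auto)
 then obtain tau w where S: "sol {0..T} tau w" "tau 0 = t" "w 0 = w0" by blast
 have "0 < w 0" "tau 0 < v" using S w0 t by simp_all
 have VD'': "V (tau 0) - (w 0)\<^sup>2 < V s" if "tau 0 < s" "s < v" for s using VD'[of s] that S(2,3) by simp
 have T': "hint f (V (tau 0) - (w 0)\<^sup>2) (tau 0) v = ereal T" using S(2,3) w0 T by simp
 have "tau T = v"
  by (rule run_right_upto(4)[OF S(1) disjI1[OF \<open>0 < w 0\<close>] v(1) \<open>tau 0 < v\<close> VD'' T(2) order_refl])
   (simp_all only: T' order_refl)
 moreover have "(w T)\<^sup>2 = V (tau T) - (V (tau 0) - (w 0)\<^sup>2)"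
  by (rule sol_D[OF S(1)]) (use T in auto)
 ultimately have "w T = 0" using S w0 v by simp
 hence "tau 0 = tau T" using sol_equilibrium[OF S(1), of T 0] \<open>tau T = v\<close> v T by simp
 thus False using S \<open>tau T = v\<close> t by simp
qed

lemma turning_deriv_le:
 assumes v: "v : I" "V v = D" and u: "u < v" and VD: "!!s. u < s ==> s < v ==> D < V s"
 shows "dV v <= 0"
proof (rule ccontr)
 assume "~ dV v <= 0"
 then obtain d where d: "d > 0" "!!h. 0 < h ==> h < d ==> V (v - h) < V v"
  using DERIV_pos_inc_left[OF V_deriv[OF v(1)]] by auto
 define h where "h = min (d / 2) ((v - u) / 2)"
 have h: "0 < h" "h < d" "u < v - h" using d u by (auto simp: h_def min_def field_simps)
 have "D < V (v - h)" by (rule VD) (use h in auto)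
 thus False using d(2)[of h] h v by auto
qed

subsection \<open>Barriers\<close>

text \<open>A member of the flow family: defined for all times, but a solution only up to times
  before which it has not left \<open>{u..v}\<close>.\<close>

definition traj :: "real => real => (real => real) => (real => real) => bool" where
 "traj u v g w \<longleftrightarrow> (ALL Y. continuous_on {0..Y} g) & (ALL Y. (ALL y:{0..Y}. g y : {u..v}) --> sol {0..Y} g w)"

lemma traj_confined:
 assumes T: "traj u v g w" and cd: "u < c" "d < v" "g 0 : {c..d}"
  and conf: "!!y. 0 <= y ==> y <= Y ==> sol {0..y} g w ==> g y : {c..d}"
 shows "sol {0..Y} g w"
proof -
 have "g y : {u<..<v}" if "y : {0..Y}" for y
 proof (rule stay_inside[OF _ _ _ _ _ _ that, where C = "{u..v}"])
  show "continuous_on {0..Y} g" using T by (simp add: traj_def)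
  fix y assume y: "y : {0..Y}" "!!z. z : {0..y} ==> g z : {u..v}"
  hence "sol {0..y} g w" using T unfolding traj_def by blast
  hence "g y : {c..d}" using conf[of y] y by auto
  thus "g y : {u<..<v}" using cd by auto
 qed (use cd in auto)
 hence "ALL y:{0..Y}. g y : {u..v}" by force
 thus ?thesis using T unfolding traj_def by blast
qed

text \<open>A point is a barrier if a trajectory from \<open>t0\<close> that comes to rest there does not return to \<open>t1\<close>
 before \<open>l\<close>.\<close>

definition barrier :: "real => real => real => real => bool" where
 "barrier t0 t1 l beta \<longleftrightarrow> beta : I & t0 < beta & t1 < beta &
  ((EX t:{min t0 t1<..<beta}. V t <= V beta) | ereal l < hint f (V beta) t0 beta + hint f (V beta) t1 beta)"

text \<open>This provides the hypothesis \<open>up\<close> of the shooting lemma. At its first visit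
  to \<open>beta\<close> the trajectory has \<open>w >= 0\<close>. If \<open>w > 0\<close>, it
  overshoots. If \<open>w = 0\<close>, its energy is \<open>V beta\<close>, and a return to
  \<open>t1\<close> by the time \<open>l\<close> would cross ranges that are either blocked by a
  point with \<open>V <= V beta\<close> or too long for the barrier. An energy below
  \<open>V beta\<close> excludes the case \<open>w = 0\<close>.\<close>

lemma barrier_up:
 assumes T: "traj u v g w" and uv: "{u..v} <= I" and alpha: "u < alpha" "alpha < t1" "t1 < beta" "beta < v" "alpha < g 0" "g 0 < beta"
  and bar: "barrier (g 0) t1 l beta | V (g 0) - (w 0)\<^sup>2 < V beta"
  and y: "y : {0..<l}" and before: "!!z. z : {0..<y} ==> alpha < g z & g z < beta" and gy: "g y = beta"
 shows "(ALL z:{y..l}. t1 < g z) | (EX x:{y..l}. beta < g x & (ALL z:{y..x}. alpha < g z))"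
proof -
 have gc: "continuous_on {0..Y} g" for Y using T by (simp add: traj_def)
 have solI: "sol {0..Y} g w" if "!!y. y : {0..Y} ==> g y : {u..v}" for Y
  using T that by (simp add: traj_def)
 have y0: "0 < y" using gy alpha y by (cases "y = 0") auto
 have bey: "alpha < g z & g z <= beta" if "z : {0..y}" for z
  using before[of z] gy that alpha by (cases "z = y") auto
 have S: "sol {0..y} g w" by (rule solI) (use bey alpha in force)
 have betaI: "beta : I" using uv alpha by auto
 have wy: "0 <= w y"
 proof (rule ccontr)
  assume "~ 0 <= w y"
  hence "w y / V (g y) < 0" using V_pos[OF betaI] gy by (simp add: divide_neg_pos)
  from has_real_derivative_neg_dec_left[OF solD(2)[OF S, of y] this] y0
  obtain d where d: "d > 0" "!!h. 0 < h ==> y - h : {0..y} ==> h < d ==> g y < g (y - h)" by auto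
  define h where "h = min (d / 2) y"
  have "g y < g (y - h)" by (rule d(2)) (use d y0 in "auto simp: h_def min_def")
  moreover have "g (y - h) <= beta" using bey[of "y - h"] y0 d by (auto simp: h_def min_def split: if_splits)
  ultimately show False using gy by simp
 qed
 show ?thesis
 proof (cases "w y = 0")
  case False
  hence wp: "0 < w y" using wy by simp
  have "(g \<longlongrightarrow> beta) (at y within {0..l})" using gc[of l] y gy by (auto simp: continuous_on_def)
  hence "\<forall>\<^sub>F z in at y within {0..l}. alpha < g z & g z < v"
   using order_tendstoD alpha by (intro eventually_conj) (force intro: order_tendstoD)+
  then obtain e where e: "0 < e" "!!z. z : {0..l} ==> z ~= y ==> dist z y < e ==> alpha < g z & g z < v"
   unfolding eventually_at by blast
  define Y where "Y = min l (y + e / 2)"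
  have Y: "y < Y" "Y <= l" using e y by (auto simp: Y_def)
  have near: "alpha < g z & g z < v" if "z : {y..Y}" for z
   using e(2)[of z] that y gy alpha e(1) by (cases "z = y") (auto simp: Y_def dist_real_def)
  have "alpha < g z & g z <= v" if "z : {0..Y}" for z
   using near[of z] bey[of z] that alpha by (cases "z <= y") auto
  hence S': "sol {0..Y} g w" by (intro solI) (use alpha in force)
  have "0 < w y / V (g y)" using wp V_pos[OF betaI] gy by simp
  from has_real_derivative_pos_inc_right[OF solD(2)[OF S', of y] this] Y y
  obtain d where d: "d > 0" "!!h. 0 < h ==> y + h : {0..Y} ==> h < d ==> g y < g (y + h)" by auto
  define h where "h = min (d / 2) (Y - y)"
  have h: "0 < h" "h < d" "y + h <= Y" using d Y by (auto simp: h_def)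
  have "beta < g (y + h)" using d(2)[of h] h y gy by auto
  thus ?thesis using h Y near by (intro disjI2 bexI[of _ "y + h"]) auto
 next
  case True
  let ?D = "V (g 0) - (w 0)\<^sup>2"
  have De: "?D = V beta" using sol_energy[OF S, of y 0] y0 gy True by simp
  hence bar': "barrier (g 0) t1 l beta" using bar by simp
  have c1: "!!t. t : {g 0<..<beta} ==> V beta < V t" "hint f (V beta) (g 0) beta <= ereal y"
   using sol_cross[OF S, of 0] y0 gy alpha De by auto
  have dV: "dV beta < 0"
  proof -
   have "dV beta <= 0" by (rule turning_deriv_le[OF betaI refl alpha(6)]) (use c1(1) in auto)
   moreover have "dV beta ~= 0"
    using sol_equilibrium[OF S, of y 0] True gy y0 alpha(6) by auto
   ultimately show ?thesis by simp
  qed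
  show ?thesis
  proof (rule ccontr)
   assume "~ ?thesis"
   then obtain z1 where z1: "z1 : {y..l}" "g z1 <= t1" by force
   define gg where "gg s = g (y + s)" for s
   have "continuous_on {0..l - y} gg"
    unfolding gg_def by (rule continuous_on_compose2[OF gc[of l]]) (use y0 in "auto intro!: continuous_intros")
   then obtain s where s: "s : {0..z1 - y}" "gg s : {..t1}" "!!z. z : {0..<s} ==> gg z ~: {..t1}"
    by (rule first_time[of "l - y" gg "{..t1}" "z1 - y"]) (use z1 in "auto simp: gg_def")
   define z where "z = y + s"
   have z: "y <= z" "z <= l" "g z <= t1" using s z1 by (auto simp: z_def gg_def)
   have after: "t1 < g x" if "x : {y..<z}" for x
    using s(3)[of "x - y"] that by (auto simp: gg_def z_def)
   have yz: "y < z" using z gy alpha by (cases "y = z") auto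
   have gz: "g z = t1"
   proof -
    have lim: "(g \<longlongrightarrow> g z) (at z within {y..z})"
     using continuous_on_subset[OF gc[of l], of "{y..z}"] z y0 yz by (auto simp: continuous_on_def)
    have "t1 <= g z"
     by (rule tendsto_lowerbound[OF lim _ interval_not_bot[OF yz]])
      (use yz in "auto simp: eventually_at_filter intro!: always_eventually less_imp_le[OF after]")
    thus ?thesis using z by simp
   qed
   have low: "u < g x" if "x : {0..z}" for x
    using bey[of x] after[of x] gz that alpha by (cases "x <= y"; cases "x = z") force+
   \<comment> \<open>Since \<open>V' < 0\<close> at \<open>beta\<close>, just to the right of it
     \<open>V\<close> lies below the energy, where no trajectory of that energy can be. So the curve
     stays in \<open>{u..v}\<close> and is a solution up to the time \<open>z\<close>.\<close>
   obtain d where d: "d > 0" "!!h. 0 < h ==> h < d ==> V (beta + h) < V beta"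
    using DERIV_neg_dec_right[OF V_deriv[OF betaI] dV] by auto
   define e where "e = min (d / 2) (v - beta)"
   have e: "0 < e" "e < d" "beta + e <= v" using d alpha by (auto simp: e_def min_def)
   have up: "g x : {..<beta + e}" if "x : {0..z}" for x
   proof (rule stay_inside[OF gc[of z] _ _ _ _ _ that, where C = "{..beta + e}"])
    fix x assume x: "x : {0..z}" "!!x'. x' : {0..x} ==> g x' : {..beta + e}"
    have S'': "sol {0..x} g w"
    proof (rule solI)
     fix x' assume x': "x' : {0..x}"
     thus "g x' : {u..v}" using low[of x'] x(2)[OF x'] x(1) e by auto
    qed
    have "(w x)\<^sup>2 = V (g x) - ?D" by (rule sol_D[OF S'']) (use x in auto)
    hence "V beta <= V (g x)" using De zero_le_power2[of "w x"] by linarith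
    moreover have "g x <= beta + e" using x(2)[of x] x(1) by simp
    ultimately show "g x : {..<beta + e}" using d(2)[of "g x - beta"] e by (cases "g x <= beta") auto
   qed (use alpha e in auto)
   have S': "sol {0..z} g w"
   proof (rule solI)
    fix x assume x: "x : {0..z}"
    show "g x : {u..v}" using low[OF x] up[OF x] e by auto
   qed
   have S'': "sol {y..z} g w" by (rule sol_subset[OF S']) (use y0 in auto)
   have De': "V (g y) - (w y)\<^sup>2 = V beta" using gy True by simp
   have c2: "!!t. t : {t1<..<beta} ==> V beta < V t" "hint f (V beta) t1 beta <= ereal (z - y)"
    using sol_cross_left[OF S'' z(1), of y] De' z gz gy alpha by auto
   have "~ (EX t:{min (g 0) t1<..<beta}. V t <= V beta)"
   proof
    assume "EX t:{min (g 0) t1<..<beta}. V t <= V beta"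
    then obtain t where t: "min (g 0) t1 < t" "t < beta" "V t <= V beta" by auto
    then consider "g 0 < t" | "t1 < t" by linarith
    thus False using c1(1)[of t] c2(1)[of t] t by cases auto
   qed
   hence "ereal l < hint f (V beta) (g 0) beta + hint f (V beta) t1 beta"
    using bar' by (simp add: barrier_def)
   also have "... <= ereal y + ereal (z - y)" by (rule add_mono[OF c1(2) c2(2)])
   finally show False using z by simp
  qed
 qed
qed

text \<open>For \<open>D\<close> tending to minus infinity the trajectories become arbitrarily fast:
  with \<open>D <= - r^2\<close> the integrand is at most \<open>B / r\<close>, where
  \<open>B\<close> bounds \<open>V\<close>.\<close>

lemma hint_small:
 assumes uv: "u <= v" "{u..v} <= I" and e: "0 < e"
 obtains D0 where "!!D. D <= D0 ==> hint f D u v <= ereal e" "D0 < 0"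
proof -
 have "compact (V ` {u..v})" by (intro compact_continuous_image V_cont uv compact_Icc)
 then obtain B where B: "!!x. x : {u..v} ==> norm (V x) <= B"
  using compact_imp_bounded[of "V ` {u..v}"] unfolding bounded_iff by blast
 have B0: "0 <= B" using B[of u] norm_ge_zero[of "V u"] uv by auto
 define r where "r = (v - u) * B / e + 1"
 have r: "0 < r" using uv e B0 by (auto simp: r_def intro!: add_nonneg_pos)
 have "hint f D u v <= ereal e" if D: "D <= - r\<^sup>2" for D
 proof -
  have Dn: "D < V tau" if "tau : {u..v}" for tau
  proof -
   have "0 < V tau" using V_pos that uv by blast
   thus ?thesis using D zero_le_power2[of r] by linarith
  qed
  have "h D tau <= B / r" if t: "tau : {u..v}" for tau
  proof -
   have tI: "tau : I" using t uv by blast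
   have "r = sqrt (r\<^sup>2)" using r by simp
   also have "... <= sqrt (V tau - D)" using D V_pos[OF tI] by (intro real_sqrt_le_mono) linarith
   finally have "r <= sqrt (V tau - D)" .
   moreover have "h D tau = V tau / sqrt (V tau - D)" by (simp add: h_def invsq_def)
   ultimately show ?thesis using B[OF t] V_pos[OF tI] r by (simp add: frac_le)
  qed
  hence "integral {u..v} (h D) <= integral {u..v} (%_. B / r)"
   by (intro integral_le) (auto intro!: integrable_continuous_real h_continuous_on[OF uv(2) Dn])
  also have "... = (v - u) * B / r" using uv by simp
  also have "... <= e" using r e uv B0 by (simp add: r_def field_simps)
  finally show ?thesis using hint_compact[OF uv Dn] by simp
 qed
 thus thesis using that[of "- r\<^sup>2"] r by simp
qed

lemma hits_right:
 assumes T: "traj u v g w" and uv: "u < g 0" "g 0 < beta" "beta < v" "{u..v} <= I"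
  and start: "0 < w 0 | w 0 = 0 & 0 < dV (g 0)"
  and VD: "!!t. g 0 < t ==> t < beta ==> V (g 0) - (w 0)\<^sup>2 < V t"
  and y: "0 <= y" "hint f (V (g 0) - (w 0)\<^sup>2) (g 0) beta = ereal y"
 shows "sol {0..y} g w" "g y = beta" "!!z. z : {0..y} ==> g z : {g 0..beta}"
proof -
 have betaI: "beta : I" using uv by auto
 have conf: "g z : {g 0..beta}" if "sol {0..z} g w" "0 <= z" "z <= y" for z
  by (rule run_right_upto(2)[OF that(1) start betaI uv(2) VD that(2) order_refl]) (use that y in simp_all)
 show S: "sol {0..y} g w" by (rule traj_confined[OF T uv(1,3) _ conf]) (use uv in auto)
 show "g y = beta"
  by (rule run_right_upto(4)[OF S start betaI uv(2) VD y(1) order_refl]) (simp_all add: y(2))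
 show "g z : {g 0..beta}" if "z : {0..y}" for z
  by (rule conf[OF sol_subset[OF S]]) (use that in auto)
qed

lemma traj_reflect:
 assumes "traj u v g w"
 shows "warp.traj (- b) (- a) (mirror f) (- v) (- u) (%y. - g y) (%y. - w y)"
proof -
 interpret R: warp "- b" "- a" "mirror f" by (rule warp_reflect)
 show ?thesis
  unfolding R.traj_def
 proof (intro conjI allI impI)
  show "continuous_on {0..Y} (%y. - g y)" for Y
   using assms unfolding traj_def by (intro continuous_intros) blast
  show "R.sol {0..Y} (%y. - g y) (%y. - w y)" if "ALL y:{0..Y}. - g y : {- v..- u}" for Y
  proof (rule sol_reflect)
   have "ALL y:{0..Y}. g y : {u..v}" using that by auto
   thus "sol {0..Y} g w" using assms unfolding traj_def by blast
  qed
 qed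
qed

definition barrier_a :: "real => real => real => real => bool" where
 "barrier_a t0 t1 l alpha \<longleftrightarrow> warp.barrier (- b) (- a) (mirror f) (- t0) (- t1) l (- alpha)"

lemma interval_reflect: "{u..v} <= I ==> {- v..- u} <= base_interval (- b) (- a)"
 by (auto simp: I_reflect subset_iff)

lemma barrier_down:
 assumes T: "traj u v g w" and uv: "{u..v} <= I" and alpha: "u < alpha" "alpha < t1" "t1 < beta" "beta < v" "alpha < g 0" "g 0 < beta"
  and bar: "barrier_a (g 0) t1 l alpha"
  and y: "y : {0..<l}" and before: "!!z. z : {0..<y} ==> alpha < g z & g z < beta" and gy: "g y = alpha"
 shows "(ALL z:{y..l}. g z < t1) | (EX x:{y..l}. g x < alpha & (ALL z:{y..x}. g z < beta))"
proof -
 interpret R: warp "- b" "- a" "mirror f" by (rule warp_reflect)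
 have "(ALL z:{y..l}. - t1 < - g z) | (EX x:{y..l}. - alpha < - g x & (ALL z:{y..x}. - beta < - g z))"
  by (rule R.barrier_up[OF traj_reflect[OF T] interval_reflect[OF uv]])
   (use alpha bar y before gy in "auto simp: barrier_a_def")
 thus ?thesis by simp
qed

lemma hits_left:
 assumes T: "traj u v g w" and uv: "u < alpha" "alpha < g 0" "g 0 < v" "{u..v} <= I"
  and start: "w 0 < 0 | w 0 = 0 & dV (g 0) < 0"
  and VD: "!!t. alpha < t ==> t < g 0 ==> V (g 0) - (w 0)\<^sup>2 < V t"
  and y: "0 <= y" "hint f (V (g 0) - (w 0)\<^sup>2) alpha (g 0) = ereal y"
 shows "sol {0..y} g w" "g y = alpha" "!!z. z : {0..y} ==> g z : {alpha..g 0}"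
proof -
 have alphaI: "alpha : I" using uv by auto
 have conf: "g z : {alpha..g 0}" if "sol {0..z} g w" "0 <= z" "z <= y" for z
  by (rule run_left_upto(2)[OF that(1) start alphaI uv(2) VD that(2) order_refl]) (use that y in simp_all)
 show S: "sol {0..y} g w" by (rule traj_confined[OF T uv(1,3) _ conf]) (use uv in auto)
 show "g y = alpha"
  by (rule run_left_upto(4)[OF S start alphaI uv(2) VD y(1) order_refl]) (simp_all add: y(2))
 show "g z : {alpha..g 0}" if "z : {0..y}" for z
  by (rule conf[OF sol_subset[OF S]]) (use that in auto)
qed

lemma extend_interval:
 assumes "u : I" "v : I" "u <= v"
 obtains u' v' where "u' < u" "v < v'" "{u'..v'} <= I"
proof -
 obtain e1 e2 where e: "0 < e1" "cball u e1 <= I" "0 < e2" "cball v e2 <= I"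
  using open_contains_cball open_base_interval assms by metis
 have "u - e1 : I" "v + e2 : I" using e by (auto simp: subset_iff dist_real_def)
 hence "{u - e1..v + e2} <= I" using I_between[of "u - e1" a b "v + e2"] by (meson atLeastAtMost_iff subsetI)
 thus thesis using that[of "u - e1" "v + e2"] e by simp
qed

text \<open>Shooting with velocities between \<open>- Q\<close> and \<open>pb\<close>. A large
  \<open>Q\<close> sends the trajectory through \<open>alpha\<close> before \<open>l\<close>, and
  \<open>hit\<close> says that \<open>pb\<close> sends it through \<open>beta\<close>. The
  alternative to a barrier at \<open>beta\<close> is an energy below \<open>V beta\<close>, which
  can be ensured by the initial velocity alone.\<close>

lemma connect_core:
 assumes I: "alpha : I" "beta : I" and t: "alpha < t0" "t0 < beta" "alpha < t1" "t1 < beta" and l: "0 < l"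
  and bar_a: "barrier_a t0 t1 l alpha"
  and upc: "!!p. p <= pb ==> barrier t0 t1 l beta | V t0 - p\<^sup>2 < V beta"
  and hit: "!!u v g w. traj u v g w ==> u < alpha ==> beta < v ==> {u..v} <= I ==> g 0 = t0 ==> w 0 = pb ==>
   EX y:{0..l}. (ALL z:{0..y}. alpha < g z) & beta <= g y"
 shows "conn t0 t1 l"
proof -
 obtain u v where uv: "u < alpha" "beta < v" "{u..v} <= I"
  using extend_interval[OF I] t by (metis less_imp_le less_trans)
 have at0: "{alpha..t0} <= I" using uv t by (auto simp: subset_iff)
 obtain D0 where D0: "!!D. D <= D0 ==> hint f D alpha t0 <= ereal l" "D0 < 0"
  using hint_small[OF less_imp_le[OF t(1)] at0 l] by metis
 have t0I: "t0 : I" using at0 t by auto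
 \<comment> \<open>\<open>Q >= \<bar>pb\<bar>\<close> makes the interval of velocities nonempty, and
   \<open>Q^2 >= V t0 - D0\<close> pushes the energy so low that \<open>alpha\<close> is reached by
   the time \<open>l\<close>.\<close>
 define Q where "Q = max \<bar>pb\<bar> (V t0 - D0 + 1)"
 have Q: "0 < Q" "pb : {- Q..Q}" using V_pos[OF t0I] D0(2) by (auto simp: Q_def max_def)
 have Q2: "V t0 - Q\<^sup>2 <= D0"
 proof -
  have "1 <= Q" "V t0 - D0 <= Q" using V_pos[OF t0I] D0(2) by (auto simp: Q_def)
  hence "V t0 - D0 <= Q\<^sup>2" by (metis dual_order.trans order_less_le power2_eq_square mult_left_mono mult.right_neutral Q(1))
  thus ?thesis by simp
 qed
 have uv': "u <= v" "t0 : {u..v}" using uv t by auto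
 obtain tau w L where F: "ALL p. tau p 0 = t0" "ALL p. w p 0 = p"
  "ALL p Y. continuous_on {0..Y} (tau p)" "ALL p Y. continuous_on {0..Y} (w p)" "0 <= L"
  "ALL p p' y. 0 <= y --> \<bar>tau p y - tau p' y\<bar> <= exp (L * y) * \<bar>p - p'\<bar>"
  "ALL p:{- Q..Q}. ALL Y. (ALL y:{0..Y}. tau p y : {u..v}) --> sol {0..Y} (tau p) (w p)"
  using flow_family[OF uv'(1) uv(3) uv'(2) less_imp_le[OF Q(1)]] by blast
 have T: "traj u v (tau p) (w p)" if "p : {- Q..pb}" for p
  using F(3,7) that Q by (simp add: traj_def)
 have unif: "EX d>0. ALL p':{- Q..pb}. \<bar>p' - p\<bar> < d --> (ALL y:{0..l}. \<bar>tau p' y - tau p y\<bar> < e)" if "0 < e" for p e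
 proof (intro exI[of _ "e / exp (L * l)"] conjI ballI impI)
  show "0 < e / exp (L * l)" using that by simp
  fix p' y assume p': "\<bar>p' - p\<bar> < e / exp (L * l)" and y: "y : {0..l}"
  have "\<bar>tau p' y - tau p y\<bar> <= exp (L * y) * \<bar>p' - p\<bar>" using F(6) y by simp
  also have "... <= exp (L * l) * \<bar>p' - p\<bar>"
   using y F(5) by (intro mult_right_mono) (auto intro: mult_left_mono)
  also have "... < e" using p' by (simp add: field_simps)
  finally show "\<bar>tau p' y - tau p y\<bar> < e" .
 qed
 have "EX p:{- Q..pb}. tau p l = t1 & (ALL y:{0..l}. tau p y : {alpha<..<beta})"
 proof -
  have pq: "- Q <= pb" using Q by simp
  have cont: "continuous_on {0..l} (tau p)" for p using F(3) by blast
  have up: "(ALL z:{y..l}. t1 < tau p z) | (EX x:{y..l}. beta < tau p x & (ALL z:{y..x}. alpha < tau p z))"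
   if "p : {- Q..pb}" "y : {0..<l}" "!!z. z : {0..<y} ==> alpha < tau p z & tau p z < beta" "tau p y = beta" for p y
   by (rule barrier_up[OF T[OF that(1)] uv(3,1) t(3,4) uv(2) _ _ _ that(2-4)])
    (use t F upc that(1) in auto)
  have down: "(ALL z:{y..l}. tau p z < t1) | (EX x:{y..l}. tau p x < alpha & (ALL z:{y..x}. tau p z < beta))"
   if "p : {- Q..pb}" "y : {0..<l}" "!!z. z : {0..<y} ==> alpha < tau p z & tau p z < beta" "tau p y = alpha" for p y
   by (rule barrier_down[OF T[OF that(1)] uv(3,1) t(3,4) uv(2) _ _ _ that(2-4)])
    (use t F bar_a in auto)
  have A: "EX y:{0..l}. (ALL z:{0..y}. alpha < tau pb z) & (beta <= tau pb y | (y = l & t1 < tau pb y))"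
   using hit[OF T[of pb] uv] pq F by fastforce
  have B: "EX y:{0..l}. (ALL z:{0..y}. tau (- Q) z < beta) & (tau (- Q) y <= alpha | (y = l & tau (- Q) y < t1))"
  proof -
   have TQ: "traj u v (tau (- Q)) (w (- Q))" by (rule T) (use pq in auto)
   have small: "hint f (V t0 - Q\<^sup>2) alpha t0 <= ereal l" by (rule D0(1)[OF Q2])
   then obtain y where y: "hint f (V t0 - Q\<^sup>2) alpha t0 = ereal y" "0 <= y" "y <= l"
    using hint_nonneg[of "V t0 - Q\<^sup>2" alpha t0] by (cases "hint f (V t0 - Q\<^sup>2) alpha t0") auto
   have VD: "V t0 - Q\<^sup>2 < V s" if "alpha < s" "s < t0" for s
    using V_pos[of s] at0 that Q2 D0(2) by (force simp: subset_iff)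
   have s0: "tau (- Q) 0 = t0" "w (- Q) 0 = - Q" using F by auto
   note H = hits_left[OF TQ, unfolded s0, OF uv(1) t(1) _ uv(3) _ _ y(2)]
   have "tau (- Q) y = alpha" "!!z. z : {0..y} ==> tau (- Q) z : {alpha..t0}"
    using H(2,3) uv t Q VD y by auto
   thus ?thesis using y t by (intro bexI[of _ y]) force+
  qed
  show ?thesis
   by (rule shooting[OF pq less_imp_le[OF l] cont unif t(3,4) _ up down A B]) (use F t in auto)
 qed
 then obtain p where p: "p : {- Q..pb}" "tau p l = t1" "!!y. y : {0..l} ==> tau p y : {alpha<..<beta}" by blast
 have "ALL y:{0..l}. tau p y : {u..v}" using p(3) uv by force
 hence "sol {0..l} (tau p) (w p)" using T[OF p(1)] unfolding traj_def by blast
 thus ?thesis unfolding conn_def using F p by blast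
qed

text \<open>With barriers on both sides the upper velocity \<open>pb\<close> may be chosen as large
  as is needed to pass \<open>beta\<close> before \<open>l\<close>.\<close>

lemma connect_by_barriers:
 assumes t: "alpha < t0" "t0 < beta" "alpha < t1" "t1 < beta" and I: "alpha : I" and l: "0 < l"
  and bars: "barrier_a t0 t1 l alpha" "barrier t0 t1 l beta"
 shows "conn t0 t1 l"
proof -
 have betaI: "beta : I" using bars(2) by (simp add: barrier_def)
 have tb: "{t0..beta} <= I" using I_between[OF I betaI] t by auto
 obtain D0 where D0: "!!D. D <= D0 ==> hint f D t0 beta <= ereal l" "D0 < 0"
  using hint_small[OF less_imp_le[OF t(2)] tb l] by metis
 have t0I: "t0 : I" using tb t by auto
 define Q where "Q = V t0 - D0 + 1"
 have Q: "0 < Q" "1 <= Q" using V_pos[OF t0I] D0(2) by (auto simp: Q_def)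
 have "Q * 1 <= Q * Q" using Q by (intro mult_left_mono) auto
 hence Q2: "V t0 - Q\<^sup>2 <= D0" by (simp add: Q_def power2_eq_square)
 obtain y where y: "hint f (V t0 - Q\<^sup>2) t0 beta = ereal y" "0 <= y" "y <= l"
  using D0(1)[OF Q2] hint_nonneg[of "V t0 - Q\<^sup>2" t0 beta] by (cases "hint f (V t0 - Q\<^sup>2) t0 beta") auto
 show ?thesis
 proof (rule connect_core[OF I betaI t l bars(1), of Q])
  fix u v g w assume T: "traj u v g w" and uv: "u < alpha" "beta < v" "{u..v} <= I" and s0: "g 0 = t0" "w 0 = Q"
  have VD: "V t0 - Q\<^sup>2 < V s" if "t0 < s" "s < beta" for s
   using V_pos[of s] tb that Q2 D0(2) by (force simp: subset_iff)
  note H = hits_right[OF T, unfolded s0, OF _ t(2) uv(2,3) _ _ y(2)]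
  have "g y = beta" "!!z. z : {0..y} ==> g z : {t0..beta}"
   using H(2,3) uv t Q VD y by auto
  thus "EX y:{0..l}. (ALL z:{0..y}. alpha < g z) & beta <= g y"
   using y t by (intro bexI[of _ y]) force+
 qed (use bars in blast)
qed

text \<open>The upper velocity is the negative number \<open>- q\<close> for which the trajectory
  falls to \<open>s\<close>, turns there and passes \<open>beta\<close> by the time
  \<open>l\<close>. All velocities below it have energy at most \<open>D < V beta\<close>, so none
  of them comes to rest at \<open>beta\<close>, and no barrier is required there.\<close>

lemma connect_by_bounce:
 assumes t: "alpha < s" "s < t0" "t0 < beta" "alpha < t1" "t1 < beta" and I: "alpha : I" "beta : I" and l: "0 < l"
  and bar: "barrier_a t0 t1 l alpha"
  and D: "V s = D" "0 < dV s" "!!x. s < x ==> x <= beta ==> D < V x"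
  and time: "hint f D s t0 + hint f D s beta <= ereal l"
 shows "conn t0 t1 l"
proof -
 define q where "q = sqrt (V t0 - D)"
 have q: "0 < q" "V t0 - q\<^sup>2 = D" using D(3)[of t0] t by (simp_all add: q_def)
 have sI: "s : I" using I_between[OF I] t by simp
 have nn: "0 <= hint f D s t0" "0 <= hint f D s beta" by simp_all
 obtain y1 y2 where y: "hint f D s t0 = ereal y1" "hint f D s beta = ereal y2" "0 <= y1" "0 <= y2" "y1 + y2 <= l"
  using nn time by (cases "hint f D s t0"; cases "hint f D s beta") auto
 show ?thesis
 proof (rule connect_core[OF I _ t(3,4,5) l bar, of "- q"])
  show "alpha < t0" using t by simp
  fix p assume "p <= - q"
  hence "q * q <= (- p) * (- p)" using q by (intro mult_mono) auto
  hence "V t0 - p\<^sup>2 <= D" using q(2) by (simp add: power2_eq_square)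
  thus "barrier t0 t1 l beta | V t0 - p\<^sup>2 < V beta" using D(3)[of beta] t by force
 next
  fix u v g w assume T: "traj u v g w" and uv: "u < alpha" "beta < v" "{u..v} <= I" and s0: "g 0 = t0" "w 0 = - q"
  have D0: "V t0 - (- q)\<^sup>2 = D" using q by simp
  note H = hits_left[OF T, unfolded s0 D0, of s y1]
  have H1: "sol {0..y1} g w" "g y1 = s" "!!z. z : {0..y1} ==> g z : {s..t0}"
   using H uv t q D(3) y by auto
  have "(w y1)\<^sup>2 = V (g y1) - (V (g 0) - (w 0)\<^sup>2)" by (rule sol_D[OF H1(1)]) (use y in auto)
  hence w1: "w y1 = 0" using H1(2) D(1) s0 D0 by simp
  have after: "g (y1 + z) : {s..beta}" if S: "sol {0..y1 + z} g w" and z: "0 <= z" "z <= y2" for z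
  proof -
   have S': "sol {0..z} (%y. g (y1 + 1 * y)) (%y. 1 * w (y1 + 1 * y))"
    by (rule sol_affine[OF S]) (use y in auto)
   have i: "g (y1 + 1 * 0) = s" "1 * w (y1 + 1 * 0) = 0" using H1(2) w1 by simp_all
   have e: "V s - 0\<^sup>2 = D" using D by simp
   have "g (y1 + 1 * z) : {s..beta}"
    by (rule run_right_upto(2)[OF S', unfolded i e, OF _ I(2) _ _ z(1) order_refl])
     (use D t z y in auto)
   thus ?thesis by simp
  qed
  have conf: "g z : {s..beta}" if "sol {0..z} g w" "0 <= z" "z <= y1 + y2" for z
  proof (cases "z <= y1")
   case True
   thus ?thesis using H1(3)[of z] that t by auto
  next
   case False
   thus ?thesis using after[of "z - y1"] that by simp
  qed
  have us: "u < s" using uv t by simp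
  have S: "sol {0..y1 + y2} g w"
   by (rule traj_confined[OF T us uv(2) _ conf]) (use t s0 in auto)
  have S': "sol {0..y2} (%y. g (y1 + 1 * y)) (%y. 1 * w (y1 + 1 * y))"
   by (rule sol_affine[OF S]) (use y in auto)
  have i: "g (y1 + 1 * 0) = s" "1 * w (y1 + 1 * 0) = 0" using H1(2) w1 by simp_all
  have e: "V s - 0\<^sup>2 = D" using D by simp
  have "g (y1 + 1 * y2) = beta"
   by (rule run_right_upto(4)[OF S', unfolded i e, OF _ I(2) _ _ y(4) order_refl])
    (use D t y in auto)
  hence "beta <= g (y1 + y2)" by simp
  moreover have "ALL z:{0..y1 + y2}. alpha < g z"
  proof
   fix z assume z: "z : {0..y1 + y2}"
   have "g z : {s..beta}" by (rule conf[OF sol_subset[OF S]]) (use z in auto)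
   thus "alpha < g z" using t by auto
  qed
  ultimately show "EX y:{0..l}. (ALL z:{0..y}. alpha < g z) & beta <= g y"
   using y by (intro bexI[of _ "y1 + y2"]) auto
 qed
qed

end

subsection \<open>Turning points and behaviour at the ends\<close>

lemma eventually_to_upper:
 "eventually P (to_upper b) \<longleftrightarrow> (EX s. ereal s < b & (ALL tau. s < tau & ereal tau < b --> P tau))"
 if "b ~= - \<infinity>"
proof (cases b)
 case (real r)
 have "eventually P (at_left r) \<longleftrightarrow> (EX s<r. ALL tau>s. tau < r --> P tau)"
  by (rule eventually_at_left_field)
 thus ?thesis using real by (auto simp: to_upper_def)
next
 case PInf
 thus ?thesis by (simp add: to_upper_def eventually_at_top_dense)
qed (use that in simp)

lemma to_upper_reflect: "to_upper (- a) = filtermap uminus (to_lower a)"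
 by (cases a) (auto simp: to_upper_def to_lower_def at_left_minus at_top_mirror)

context warp
begin

lemma b_not_MInf: "b ~= - \<infinity>" and a_not_PInf: "a ~= \<infinity>"
 using ab by auto

lemma base_mem: "t : I \<longleftrightarrow> a < ereal t & ereal t < b"
 by (simp add: base_interval_def)

lemma b_star_cases:
 assumes t: "t : I" "D < V t"
 obtains (turn) beta where "beta : I" "t < beta" "V beta = D" "!!s. t <= s ==> s < beta ==> D < V s" "b_star a b f t D = ereal beta"
 | (exit) "!!s. s : I ==> t <= s ==> D < V s" "b_star a b f t D = b"
proof -
 define A where "A = {tau\<in>I. t <= tau & V tau = D}"
 have "t ~: A" using t by (auto simp: A_def)
 moreover have "ereal t ~= b" using t by (auto simp: base_mem)
 \<comment> \<open>As \<open>D < V t\<close>, the base point is not a turning point, so both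
   branches in the definition of \<open>b_star\<close> give the same value.\<close>
 ultimately have e: "ereal ` A \<union> {b} - {ereal t} = ereal ` A \<union> {b}" by auto
 have bs: "b_star a b f t D = Inf (ereal ` A \<union> {b})"
  by (simp only: b_star_def Let_def A_def[symmetric] e if_cancel)
 have pos: "D < V s" if s: "s : I" "t <= s" and n: "!!x. t <= x ==> x <= s ==> x ~: A" for s
 proof (rule ccontr)
  assume "~ D < V s"
  moreover have "continuous_on {t..s} V" by (rule V_cont) (use I_between[OF t(1) s(1)] in auto)
  ultimately obtain x where "t <= x" "x <= s" "V x = D"
   using IVT2'[of V s D t] t s by auto
  thus False using n[of x] I_between[OF t(1) s(1), of x] by (auto simp: A_def)
 qed
 show thesis
 proof (cases "A = {}")
  case True
  thus thesis using bs pos by (intro exit) auto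
 next
  case False
  have bdd: "bdd_below A" by (rule bdd_belowI[of _ t]) (auto simp: A_def)
  define beta where "beta = Inf A"
  obtain x where x: "x : A" using False by blast
  have lo: "beta <= y" if "y : A" for y using cInf_lower[OF that bdd] by (simp add: beta_def)
  have "closed ({t..x} \<inter> V -` {D})"
   by (intro continuous_closed_preimage V_cont) (use x I_between[OF t(1)] in "auto simp: A_def")
  moreover have ne: "{t..x} \<inter> V -` {D} ~= {}" "bdd_below ({t..x} \<inter> V -` {D})"
   using x by (auto simp: A_def intro: bdd_belowI[of _ t])
  ultimately have m: "Inf ({t..x} \<inter> V -` {D}) : {t..x} \<inter> V -` {D}" (is "?m : _") by (intro closed_contains_Inf)
  have mA: "?m : A" using m x I_between[OF t(1), of x ?m] by (auto simp: A_def)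
  have "?m <= y" if "y : A" for y
  proof (cases "y <= x")
   case True
   thus ?thesis using that ne(2) by (intro cInf_lower) (auto simp: A_def)
  next
   case False
   thus ?thesis using m by auto
  qed
  hence "beta = ?m" using mA lo by (metis beta_def antisym cInf_greatest False)
  hence betaA: "beta : A" using mA by simp
  show thesis
  proof (rule turn[of beta])
   show "beta : I" "V beta = D" using betaA by (auto simp: A_def)
   show "t < beta" using betaA t by (cases "t = beta") (auto simp: A_def)
   show "D < V s" if "t <= s" "s < beta" for s
   proof (rule pos)
    show "s : I" using I_between[OF t(1), of beta s] betaA that by (auto simp: A_def)
   qed (use that lo in force)+
   show "b_star a b f t D = ereal beta"
    unfolding bs
   proof (rule Inf_eqI)
    fix y assume "y : ereal ` A \<union> {b}"
    thus "ereal beta <= y" using lo betaA by (auto simp: A_def base_mem)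
   next
    fix y assume "!!z. z : ereal ` A \<union> {b} ==> y <= z"
    thus "y <= ereal beta" using betaA by blast
   qed
  qed
 qed
qed

lemma b_star_eqI:
 assumes "t : I" "beta : I" "t < beta" "V beta = D" "!!s. t <= s ==> s < beta ==> D < V s"
 shows "b_star a b f t D = ereal beta"
proof -
 have "D < V t" using assms by simp
 from assms(1) this show ?thesis
 proof (cases rule: b_star_cases)
  case (turn beta')
  have "beta' = beta" using assms(3-5) turn(2-4) by (metis less_irrefl less_imp_le linorder_less_linear)
  thus ?thesis using turn by simp
 next
  case exit
  thus ?thesis using assms by force
 qed
qed

lemma b_star_eq_b:
 assumes "t : I" "!!s. s : I ==> t <= s ==> D < V s"
 shows "b_star a b f t D = b"
proof -
 have "D < V t" using assms by simp
 from assms(1) this show ?thesis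
  by (cases rule: b_star_cases) (use assms in force)+
qed

lemma a_star_reflect:
 assumes "t : I"
 shows "a_star a b f t D = - b_star (- b) (- a) (mirror f) (- t) D"
proof -
 let ?A = "ereal ` {tau\<in>I. tau <= t & V tau = D} \<union> {a}"
 let ?B = "ereal ` {tau\<in>base_interval (- b) (- a). - t <= tau & invsq (mirror f) tau = D} \<union> {- a}"
 have B: "?B = uminus ` ?A"
 proof -
  have "{tau\<in>base_interval (- b) (- a). - t <= tau & invsq (mirror f) tau = D}
   = uminus ` {tau\<in>I. tau <= t & V tau = D}"
   by (auto simp: I_reflect invsq_reflect image_iff intro!: exI[of _ "- _"])
  thus ?thesis by (simp add: image_Un image_image)
 qed
 have B': "?B - {ereal (- t)} = uminus ` (?A - {ereal t})"
  unfolding B by (auto simp: image_iff) (metis ereal_uminus_uminus uminus_ereal.simps(1))+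
 have d: "deriv (invsq (mirror f)) (- t) = - dV t"
  using dV_reflect[of "- t"] assms by simp
 show ?thesis
  unfolding a_star_def b_star_def Let_def d B' unfolding B
  by (cases "dV t < 0")
   (simp_all only: ereal_Inf_uminus_image_eq ereal_uminus_uminus neg_0_less_iff_less if_True if_False)
qed

lemma b_star_le:
 assumes "t : I"
 shows "b_star a b f t D <= b"
proof -
 have "b : (ereal ` {tau\<in>I. t <= tau & V tau = D} \<union> {b}) - {ereal t}" using assms by (auto simp: base_mem)
 thus ?thesis
  unfolding b_star_def Let_def by (auto intro: Inf_lower)
qed

lemma m_b_nonneg: "0 <= m_b b f"
 unfolding m_b_def by (rule Liminf_bounded) (simp add: invsq_def)

lemma less_m_bD:
 assumes "c < m_b b f"
 obtains s where "ereal s < b" "!!tau. s < tau ==> ereal tau < b ==> c < ereal (V tau)"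
proof -
 have "eventually (%tau. c < ereal (V tau)) (to_upper b)"
  using assms le_Liminf_iff[of "m_b b f" "to_upper b" "%tau. ereal (V tau)"] unfolding m_b_def by blast
 thus thesis using that unfolding eventually_to_upper[OF b_not_MInf] by blast
qed

lemma m_b_lessD:
 assumes "m_b b f < c" "s : I"
 obtains tau where "s < tau" "tau : I" "ereal (V tau) < c"
proof (rule ccontr)
 assume n: "~ thesis"
 have "c <= m_b b f"
  unfolding m_b_def
 proof (rule Liminf_bounded)
  show "eventually (%tau. c <= ereal (V tau)) (to_upper b)"
   unfolding eventually_to_upper[OF b_not_MInf]
  proof (intro exI[of _ s] conjI allI impI)
   show "ereal s < b" using assms by (simp add: base_mem)
   fix tau assume tau: "s < tau & ereal tau < b"
   hence "tau : I" using assms(2) unfolding base_mem by (meson less_ereal.simps(1) less_trans)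
   thus "c <= ereal (V tau)" using that tau n by (meson not_le)
  qed
 qed
 thus False using assms by simp
qed

lemma m_inf_le: "t : I ==> m_inf a b f <= ereal (V t)"
 unfolding m_inf_def by (rule INF_lower)

lemma m_inf_ge: "(!!t. t : I ==> c <= ereal (V t)) ==> c <= m_inf a b f"
 unfolding m_inf_def by (rule INF_greatest)

lemma m_inf_le_m_b: "m_inf a b f <= m_b b f"
proof (rule ccontr)
 assume "~ ?thesis"
 hence "m_b b f < m_inf a b f" by simp
 moreover obtain s where "s : I" using I_nonempty by blast
 ultimately obtain tau where "tau : I" "ereal (V tau) < m_inf a b f" using m_b_lessD by blast
 thus False using m_inf_le[of tau] by simp
qed

abbreviation "mu == real_of_ereal (m_b b f)"

lemma mu_eq:
 assumes "t : I" "m_b b f < ereal (V t)"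
 shows "ereal mu = m_b b f"
 using m_b_nonneg assms by (cases "m_b b f") auto

text \<open>\<open>d_b\<close>, and below \<open>i_b\<close> and the alternative of Condition (C),
  with the base point as a parameter: the choice by \<open>SOME\<close> in their definitions does
  not commute with reflection.\<close>

definition dbc :: "real => ereal" where
 "dbc c = Limsup (at mu) (%D. hint f D c (b_star a b f c D)) - hint f mu c b"

definition ibc :: "real => ereal" where
 "ibc c = (INF D\<in>{D. m_inf a b f < ereal D & ereal D <= m_b b f}. hint f D (a_star a b f c D) b)"

definition Cb :: "ereal => real => bool" where
 "Cb diam c \<longleftrightarrow> ~ rel_min_b a b f |
  (EX c. close_b a b f c & hint f mu c b = \<infinity>) |
  2 * dbc c >= diam |
  (2 * dbc c < diam & m_inf a b f < m_b b f & dbc c >= ibc c)"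

lemma close_bD:
 assumes "close_b a b f c"
 shows "c : I" "!!t. t : I ==> c <= t ==> m_b b f < ereal (V t)"
  "EX s:I. s < c & (ALL t:I. s <= t --> m_b b f < ereal (V t))"
proof -
 obtain s where s: "c : I" "s < c" "!!tau. tau : I ==> s < tau ==> m_b b f < ereal (V tau)"
  using assms unfolding close_b_def by blast
 show "c : I" by (rule s)
 show "m_b b f < ereal (V t)" if "t : I" "c <= t" for t using s that by auto
 obtain u v where "u < c" "{u..v} <= I" "c < v" using extend_interval[OF s(1) s(1)] by blast
 moreover define x where "x = max u ((s + c) / 2)"
 ultimately have "x : I" "x < c" "s < x" using s(2) by (auto simp: x_def subset_iff max_def)
 thus "EX s:I. s < c & (ALL t:I. s <= t --> m_b b f < ereal (V t))"
  using s(3) by (intro bexI[of _ x]) auto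
qed

lemma rel_min_b_close:
 assumes "rel_min_b a b f"
 shows "EX c. close_b a b f c"
proof -
 obtain s where s: "ereal s < b" "ALL tau:I. s < tau --> m_b b f < ereal (V tau)"
  using assms unfolding rel_min_b_def by blast
 have "max a (ereal s) < b" using ab s by simp
 then obtain c where "max a (ereal s) < ereal c" "ereal c < b" using ereal_dense2 by blast
 thus ?thesis using s unfolding close_b_def base_mem by (intro exI[of _ c]) auto
qed

end

section \<open>The end of the interval when barriers are absent\<close>

lemma ereal_split_sum:
 fixes A B :: ereal
 assumes "ereal l < A + B" "0 < A" "0 < B" "0 < l"
 obtains r0 r1 where "0 <= r0" "0 <= r1" "ereal r0 < A" "ereal r1 < B" "l <= r0 + r1"
proof (cases A)
 case (real p)
 show ?thesis
 proof (cases B)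
  case (real q)
  define e where "e = (p + q - l) / 2"
  have e: "0 < e" "0 < p" "0 < q" using assms real \<open>A = ereal p\<close> by (auto simp: e_def)
  show ?thesis
   by (rule that[of "max 0 (p - e)" "max 0 (q - e)"])
    (use e real \<open>A = ereal p\<close> in "auto simp: e_def max_def field_simps")
 next
  case PInf
  thus ?thesis using that[of 0 l] assms by (auto simp: zero_ereal_def)
 qed (use assms in auto)
next
 case PInf
 thus ?thesis using that[of l 0] assms by (auto simp: zero_ereal_def)
qed (use assms in auto)

context warp
begin

lemma V_lower_nhds:
 assumes "u <= v" "{u..v} <= I" "!!t. t : {u..v} ==> D0 < V t"
 shows "\<forall>\<^sub>F D in nhds D0. ALL t:{u..v}. D < V t"
proof -
 obtain x where x: "x : {u..v}" "!!y. y : {u..v} ==> V x <= V y"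
  using continuous_attains_inf[OF _ _ V_cont[OF assms(2)]] assms(1) by auto
 have "\<forall>\<^sub>F D in nhds D0. D : {..<V x}"
  by (rule eventually_nhds_in_open) (use assms(3)[OF x(1)] in auto)
 thus ?thesis by eventually_elim (use x in force)
qed

lemma sub_I: "u : I ==> v : I ==> {u..v} <= I"
 by (meson atLeastAtMost_iff I_between subsetI)

lemma right_in_I: "c : I ==> x : base_interval c b ==> x : I & c < x"
 unfolding base_interval_def by (auto dest: less_trans[of a "ereal c" "ereal x"])

lemma max_I: "u : I ==> v : I ==> max u v : I"
 by (simp add: max_def)

lemma next_in_I:
 assumes "t : I"
 obtains u where "t < u" "u : I"
proof -
 obtain u v where "u < t" "t < v" "{u..v} <= I" using extend_interval[OF assms assms order_refl] .
 thus thesis by (intro that[of v]) auto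
qed

lemma hint_finite:
 assumes "u : I" "v : I" "u <= v" "!!t. t : {u..v} ==> D < V t"
 obtains r where "hint f D u v = ereal r" "0 <= r"
 using hint_compact[OF assms(3) sub_I[OF assms(1,2)] assms(4)] hint_nonneg[of D u v] by auto

lemma mu_less_iff:
 assumes "ereal mu = m_b b f"
 shows "m_b b f < ereal x \<longleftrightarrow> mu < x" "ereal x <= m_b b f \<longleftrightarrow> x <= mu"
 using assms by (metis less_ereal.simps(1), metis ereal_less_eq(3))

text \<open>Every \<open>beta\<close> far out satisfies the opposite inequalities:
  \<open>V beta\<close> is below all values between \<open>min t0 t1\<close> and
  \<open>beta\<close>, and the two times to \<open>beta\<close> at the energy \<open>V beta\<close>
  add up to at most \<open>l\<close>. Letting \<open>beta\<close> tend to \<open>b\<close> yields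
  the relative minimum and the bound at the energy \<open>m_b\<close>; applying the inequality to
  the turning points of energies slightly above \<open>m_b\<close> yields the bound for
  \<open>d_b\<close>.\<close>

lemma no_barrier:
 assumes t: "t0 : I" "t1 : I" and l: "0 < l" and s0: "s0 : I"
  and nb: "ALL beta>s0. ~ barrier t0 t1 l beta"
 shows "rel_min_b a b f"
  and "!!x. x : I ==> min t0 t1 <= x ==> m_b b f < ereal (V x)"
  and "hint f mu t0 b + hint f mu t1 b <= ereal l"
  and "!!c. close_b a b f c ==> 2 * dbc c + (hint f mu t0 b + hint f mu t1 b) <= ereal l"
proof -
 define c0 where "c0 = max s0 (max t0 t1)"
 have c0: "c0 : I" "s0 <= c0" "t0 <= c0" "t1 <= c0" using t s0 by (auto simp: c0_def max_def)
 have nb': "(ALL x:{min t0 t1<..<beta}. V beta < V x) & hint f (V beta) t0 beta + hint f (V beta) t1 beta <= ereal l"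
  if "beta : I" "c0 < beta" for beta
  using nb[rule_format, of beta] that c0 unfolding barrier_def by (auto simp: not_le not_less)
 have N1: "V y < V x" if "x : I" "y : I" "c0 < x" "x < y" for x y
  using nb'[of y] that c0 by auto
 have Nm: "m_b b f < ereal (V x)" if x: "x : I" "c0 < x" for x
 proof -
  obtain y where y: "x < y" "y : I" using next_in_I[OF x(1)] by blast
  have "m_b b f <= ereal (V y)"
  proof (rule ccontr)
   assume "~ ?thesis"
   then obtain s where s: "ereal s < b" "!!tau. s < tau ==> ereal tau < b ==> ereal (V y) < ereal (V tau)"
    using less_m_bD[of "ereal (V y)"] by (metis not_le)
   have "ereal (max s y) < b" using s(1) y(2) by (simp add: base_mem max_def)
   then obtain z where z: "ereal (max s y) < ereal z" "ereal z < b" using ereal_dense2 by blast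
   hence "z : I" using y(2) unfolding base_mem by (meson less_ereal.simps(1) less_trans max_less_iff_conj)
   thus False using s(2)[of z] z N1[OF y(2) _ _, of z] y x by auto
  qed
  thus ?thesis using N1[OF x(1) y(2) x(2) y(1)] by (metis le_less_trans less_ereal.simps(1))
 qed
 show rel: "rel_min_b a b f"
  unfolding rel_min_b_def using c0 Nm by (intro exI[of _ c0]) (auto simp: base_mem)
 show N2: "m_b b f < ereal (V x)" if x: "x : I" "min t0 t1 <= x" for x
 proof (cases "c0 < x")
  case True
  thus ?thesis using Nm x by blast
 next
  case False
  obtain beta where beta: "c0 < beta" "beta : I" using next_in_I[OF c0(1)] by blast
  have "V beta <= V x"
  proof (cases "min t0 t1 = x")
   case True
   have xb: "x < beta" using False beta by simp
   have "(V \<longlongrightarrow> V x) (at x within {x..beta})"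
    using V_cont[OF sub_I[OF x(1) beta(2)]] xb by (simp add: continuous_on_def)
   moreover have "\<forall>\<^sub>F y in at x within {x..beta}. V beta <= V y"
   proof -
    have "V beta <= V y" if "x < y" "y <= beta" for y
     using nb'[OF beta(2,1)] True that by (cases "y = beta") (auto simp: less_imp_le)
    thus ?thesis by (auto simp: eventually_at_filter intro!: always_eventually)
   qed
   ultimately show ?thesis
    using tendsto_lowerbound[OF _ _ interval_not_bot[OF xb, of x]] xb by auto
  next
   case n: False
   thus ?thesis using nb'[OF beta(2,1)] x beta False by (auto intro: less_imp_le)
  qed
  thus ?thesis using Nm[OF beta(2,1)] by (metis ereal_less_eq(3) less_le_trans)
 qed
 have mu: "ereal mu = m_b b f"
  using mu_eq[OF t(1)] N2[OF t(1)] by simp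
 have muV: "mu < V x" if "x : I" "min t0 t1 <= x" for x
  using N2[OF that] by (simp add: mu_less_iff[OF mu])
 have fin: "mu < V x" if "x : base_interval t0 b | x : base_interval t1 b" for x
  using that t by (intro muV) (auto simp: base_interval_def intro: less_trans)
 have aI: "a <= ereal t0" "a <= ereal t1" "ereal t0 < b" "ereal t1 < b" using t by (auto simp: base_mem)
 show N3: "hint f mu t0 b + hint f mu t1 b <= ereal l"
 proof (rule ccontr)
  assume "~ ?thesis"
  hence gt: "ereal l < hint f mu t0 b + hint f mu t1 b" by simp
  have p: "0 < hint f mu t0 b" "0 < hint f mu t1 b"
   by (intro hint_pos; use aI fin in auto)+
  \<comment> \<open>\<open>l\<close> is shared between the two integrals such that each excess
    survives on a compact subinterval for energies near \<open>mu\<close>. A point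
    \<open>beta\<close> beyond these subintervals with \<open>V beta\<close> close to
    \<open>mu\<close> then violates the bound by \<open>l\<close>.\<close>
  obtain r0 r1 where r: "0 <= r0" "0 <= r1" "ereal r0 < hint f mu t0 b" "ereal r1 < hint f mu t1 b" "l <= r0 + r1"
   by (rule ereal_split_sum[OF gt p l])
  obtain u0 v0 where uv0: "ereal t0 < ereal u0" "u0 < v0" "ereal v0 < b" "\<forall>\<^sub>F D in nhds mu. ereal r0 < hint f D u0 v0"
   by (rule hint_lsc[OF aI(1) order_refl _ _ r(3)]) (use fin r in auto)
  obtain u1 v1 where uv1: "ereal t1 < ereal u1" "u1 < v1" "ereal v1 < b" "\<forall>\<^sub>F D in nhds mu. ereal r1 < hint f D u1 v1"
   by (rule hint_lsc[OF aI(2) order_refl _ _ r(4)]) (use fin r in auto)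
  have "\<forall>\<^sub>F D in nhds mu. ereal r0 < hint f D u0 v0 & ereal r1 < hint f D u1 v1"
   using uv0(4) uv1(4) by eventually_elim simp
  then obtain d where d: "d > 0" "!!D. dist D mu < d ==> ereal r0 < hint f D u0 v0 & ereal r1 < hint f D u1 v1"
   unfolding eventually_nhds_metric by blast
  have "v0 : I" "v1 : I" using uv0 uv1 aI t unfolding base_mem by (auto intro: less_trans le_less_trans)
  hence mI: "max c0 (max v0 v1) : I" using c0 by (auto simp: max_def)
  have "m_b b f < ereal (mu + d)" using d(1) by (simp add: mu_less_iff[OF mu])
  then obtain beta where beta: "max c0 (max v0 v1) < beta" "beta : I" "ereal (V beta) < ereal (mu + d)"
   by (rule m_b_lessD[OF _ mI])
  have "dist (V beta) mu < d" using muV[OF beta(2)] beta c0 by (auto simp: dist_real_def min_le_iff_disj)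
  note dd = d(2)[OF this]
  have bb: "ereal beta <= b" by (rule I_bounds(2)[OF beta(2)])
  have "hint f (V beta) u0 v0 <= hint f (V beta) t0 beta" "hint f (V beta) u1 v1 <= hint f (V beta) t1 beta"
   using uv0 uv1 beta aI by (intro hint_mono[OF _ bb]; auto)+
  hence "ereal r0 < hint f (V beta) t0 beta" "ereal r1 < hint f (V beta) t1 beta" using dd by (auto intro: less_le_trans)
  moreover have "hint f (V beta) t0 beta + hint f (V beta) t1 beta <= ereal l" using nb'[OF beta(2)] beta(1) by auto
  ultimately show False using r(5)
   by (cases "hint f (V beta) t0 beta"; cases "hint f (V beta) t1 beta") auto
 qed
 show "2 * dbc c + (hint f mu t0 b + hint f mu t1 b) <= ereal l" if close: "close_b a b f c" for c
 proof -
  note cl = close_bD[OF close]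
  obtain c' where c': "max c c0 < c'" "c' : I" by (rule next_in_I[OF max_I[OF cl(1) c0(1)]])
  have lt: "c < c'" "c0 < c'" "t0 < c'" "t1 < c'" using c' c0 by auto
  have muc: "mu < V x" if "x : I" "c <= x" for x
   using cl(2)[OF that] by (simp add: mu_less_iff[OF mu])
  have I': "a <= ereal c" "ereal c' < b" "a <= ereal c'" "ereal c < b" using cl(1) c'(2) by (auto simp: base_mem)
  define m where "m = min c (min t0 t1)"
  have mI: "m : I" "m <= c'" using cl(1) t lt by (auto simp: m_def min_def)
  have Vm: "mu < V x" if "x : {m..c'}" for x
   using that muc[of x] muV[of x] sub_I[OF mI(1) c'(2)] by (auto simp: m_def min_def subset_iff split: if_splits)
  obtain x0 where x0: "hint f mu t0 c' = ereal x0"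
   by (rule hint_finite[OF t(1) c'(2)]) (use lt Vm in "auto simp: m_def")
  obtain x1 where x1: "hint f mu t1 c' = ereal x1"
   by (rule hint_finite[OF t(2) c'(2)]) (use lt Vm in "auto simp: m_def")
  obtain y where y: "hint f mu c c' = ereal y"
   by (rule hint_finite[OF cl(1) c'(2)]) (use lt Vm in "auto simp: m_def")
  have add: "hint f D u b = hint f D u c' + hint f D c' b" if "u : I" "u < c'" for D u
   using hint_add[of "ereal u" b c'] that I' by (simp add: base_mem less_imp_le)
  obtain z where z: "hint f mu c' b = ereal z" "x0 + z + (x1 + z) <= l"
   using N3 add[OF t(1), of mu] add[OF t(2), of mu] lt x0 x1 by (cases "hint f mu c' b") auto
  \<comment> \<open>Energies below \<open>mu\<close> run out to \<open>b\<close>, with a tail beyond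
    \<open>c'\<close> of at most \<open>z <= (l - x0 - x1) / 2\<close>. Energies above
    \<open>mu\<close> turn at some \<open>beta > c'\<close>; the tail from \<open>c'\<close> to
    \<open>beta\<close> occurs twice in a sum bounded by \<open>l\<close>, whose other parts are at
    least \<open>x0\<close> and \<open>x1\<close>. Subtracting \<open>y + z\<close> from the limit
    superior bounds \<open>dbc c\<close>.\<close>
  have "Limsup (at mu) (%D. hint f D c (b_star a b f c D)) <= ereal (y + (l - x0 - x1) / 2)"
  proof (rule ereal_le_epsilon2)
   fix e :: real assume e: "0 < e"
   have "((%D. hint f D c c') \<longlongrightarrow> hint f mu c c') (nhds mu)"
    by (rule hint_tendsto) (use lt Vm sub_I[OF cl(1) c'(2)] in "auto simp: m_def")
   hence e1: "\<forall>\<^sub>F D in nhds mu. hint f D c c' < ereal (y + e)"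
    by (rule order_tendstoD) (use y e in simp)
   have e2: "\<forall>\<^sub>F D in nhds mu. ALL t:{m..c'}. D < V t"
    by (rule V_lower_nhds[OF mI(2) sub_I[OF mI(1) c'(2)] Vm])
   have "\<forall>\<^sub>F D in nhds mu. D ~= mu --> hint f D c (b_star a b f c D) <= ereal (y + (l - x0 - x1) / 2 + e)"
    using e1 e2
   proof eventually_elim
    case (elim D)
    have Vc: "D < V c" using elim(2) lt by (auto simp: m_def)
    show ?case
    proof
     assume "D ~= mu"
     consider "D < mu" | "mu < D" using \<open>D ~= mu\<close> by linarith
     thus "hint f D c (b_star a b f c D) <= ereal (y + (l - x0 - x1) / 2 + e)"
     proof cases
      case 1
      have muc': "mu < V x" if "x : base_interval c' b" for x
       using right_in_I[OF c'(2) that] lt by (intro muc) auto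
      have "b_star a b f c D = b"
       by (rule b_star_eq_b[OF cl(1)]) (use 1 muc in force)
      moreover have "hint f D c' b <= hint f mu c' b"
       using I' 1 muc' by (intro hint_mono_D) auto
      ultimately have "hint f D c (b_star a b f c D) <= ereal (y + e) + ereal z"
       using add[OF cl(1) lt(1), of D] elim(1) z(1) \<open>b_star a b f c D = b\<close>
       by (cases "hint f D c c'"; cases "hint f D c' b") auto
      also have "... <= ereal (y + (l - x0 - x1) / 2 + e)" using z(2) by (simp add: field_simps)
      finally show ?thesis .
     next
      case 2
      from cl(1) Vc show ?thesis
      proof (cases rule: b_star_cases)
       case (turn beta)
       have cbeta: "c' < beta"
        using elim(2) turn(2,3) lt by (intro not_le_imp_less notI) (auto simp: m_def)
       have bbeta: "ereal beta <= b" by (rule I_bounds(2)[OF turn(1)])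
       have addb: "hint f D u beta = hint f D u c' + hint f D c' beta" if "u : I" "u < c'" for u
        using hint_add[of "ereal u" "ereal beta" c' D] that cbeta bbeta by (simp add: base_mem less_imp_le)
       have mono: "hint f mu u c' <= hint f D u c'" if "u : I" "u >= m" for u
        using that 2 elim(2) c'(2) by (intro hint_mono_D) (auto simp: base_mem)
       have "hint f D t0 beta + hint f D t1 beta <= ereal l"
        using nb'[OF turn(1)] cbeta lt turn(3) by auto
       hence "(hint f D t0 c' + hint f D c' beta) + (hint f D t1 c' + hint f D c' beta) <= ereal l"
        using addb t lt by simp
       moreover have "ereal x0 <= hint f D t0 c'" "ereal x1 <= hint f D t1 c'"
        using mono[OF t(1)] mono[OF t(2)] x0 x1 by (auto simp: m_def)
       ultimately have "hint f D c' beta <= ereal ((l - x0 - x1) / 2)"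
        by (cases "hint f D t0 c'"; cases "hint f D t1 c'"; cases "hint f D c' beta") (auto simp: field_simps)
       hence "hint f D c beta <= ereal (y + e) + ereal ((l - x0 - x1) / 2)"
        using addb[OF cl(1) lt(1)] elim(1) by (cases "hint f D c c'"; cases "hint f D c' beta") (auto simp: field_simps)
       thus ?thesis using turn(5) by (simp add: algebra_simps)
      next
       case exit
       have "m_b b f < ereal D" using 2 by (simp add: mu_less_iff[OF mu])
       then obtain x where "c < x" "x : I" "ereal (V x) < ereal D" by (rule m_b_lessD[OF _ cl(1)])
       thus ?thesis using exit(1)[of x] by simp
      qed
     qed
    qed
   qed
   hence "\<forall>\<^sub>F D in at mu. hint f D c (b_star a b f c D) <= ereal (y + (l - x0 - x1) / 2 + e)"
    by (simp add: eventually_at_filter)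
   hence "Limsup (at mu) (%D. hint f D c (b_star a b f c D)) <= ereal (y + (l - x0 - x1) / 2 + e)"
    by (rule Limsup_bounded)
   thus "Limsup (at mu) (%D. hint f D c (b_star a b f c D)) <= ereal (y + (l - x0 - x1) / 2) + ereal e" by simp
  qed
  hence "dbc c <= ereal ((l - x0 - x1) / 2 - z)"
   unfolding dbc_def using add[OF cl(1) lt(1), of mu] y z(1)
   by (cases "Limsup (at mu) (%D. hint f D c (b_star a b f c D))") (auto simp: field_simps)
  moreover have "hint f mu t0 b + hint f mu t1 b = ereal (x0 + z + (x1 + z))"
   using add[OF t(1), of mu] add[OF t(2), of mu] lt x0 x1 z(1) by simp
  ultimately show ?thesis by (cases "dbc c") (auto simp: field_simps)
 qed
qed

text \<open>The reflected form of \<open>hint_degenerate_infinite\<close>, in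
  contraposition.\<close>

lemma hint_degenerate_left:
 assumes u: "u : I" "V u = D" and v: "v : I" "u < v" and VD: "!!s. u < s ==> s < v ==> D < V s"
  and fin: "hint f D u v ~= \<infinity>"
 shows "0 < dV u"
proof -
 interpret R: warp "- b" "- a" "mirror f" by (rule warp_reflect)
 have h: "hint (mirror f) D (- v) (- u) = hint f D u v"
  using hint_reflect[of "ereal u" "ereal v" D] I_bounds u v by simp
 have I': "- u : R.I" "- v : R.I" using u v by (simp_all add: I_reflect)
 have V': "invsq (mirror f) (- u) = D" using u by (simp add: invsq_reflect)
 have VD': "D < invsq (mirror f) s" if "- v < s" "s < - u" for s
  using VD[of "- s"] that by (simp add: invsq_reflect)
 have d: "deriv (invsq (mirror f)) (- u) = - dV u" using dV_reflect[of "- u"] u by simp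
 have "- dV u <= 0" using R.turning_deriv_le[OF I'(1) V', of "- v"] VD' v d by simp
 moreover have "- dV u ~= 0"
  using R.hint_degenerate_infinite[OF I'(1) V' _ I'(2)] VD' v d h fin by auto
 ultimately show ?thesis by simp
qed

lemma a_star_cases:
 assumes t: "t : I" "D < V t"
 obtains (turn) alpha where "alpha : I" "alpha < t" "V alpha = D" "!!s. s <= t ==> alpha < s ==> D < V s" "a_star a b f t D = ereal alpha"
 | (exit) "!!s. s : I ==> s <= t ==> D < V s" "a_star a b f t D = a"
proof -
 interpret R: warp "- b" "- a" "mirror f" by (rule warp_reflect)
 have "- t : R.I" "D < invsq (mirror f) (- t)" using t by (simp_all add: I_reflect invsq_reflect)
 thus thesis
 proof (cases rule: R.b_star_cases)
  case (turn beta)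
  show thesis
  proof (rule that(1)[of "- beta"])
   show "D < V s" if "s <= t" "- beta < s" for s using turn(4)[of "- s"] that by (simp add: invsq_reflect)
  qed (use turn a_star_reflect[OF t(1), of D] in "auto simp: I_reflect invsq_reflect")
 next
  case exit
  show thesis
  proof (rule that(2))
   show "D < V s" if "s : I" "s <= t" for s using exit(1)[of "- s"] that by (simp add: invsq_reflect I_reflect)
  qed (use exit a_star_reflect[OF t(1), of D] in auto)
 qed
qed

text \<open>Without barriers \<open>no_barrier\<close> gives the relative minimum, finite tails and
  \<open>2 d_b < l <= diam\<close>. This refutes all alternatives of Condition (C) at
  \<open>b\<close> except \<open>i_b <= d_b\<close>, which supplies the bounce.\<close>

lemma Cb_alternatives:
 assumes C: "Cb diam c" and close: "rel_min_b a b f --> close_b a b f c"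
  and t: "t0 : I" "t1 : I" and l: "0 < l" "ereal l <= diam"
 obtains (barriers) "!!s. s : I ==> EX beta>s. barrier t0 t1 l beta"
 | (bounce) s D where "m_inf a b f < m_b b f" "!!x. x : I ==> min t0 t1 <= x ==> m_b b f < ereal (V x)"
   "s : I" "s < t0" "s < t1" "V s = D" "0 < dV s" "!!x. x : I ==> s < x ==> D < V x"
   "hint f D s t0 + hint f D s b <= ereal l"
proof (cases "ALL s:I. EX beta>s. barrier t0 t1 l beta")
 case True
 thus thesis by (intro barriers) blast
next
 case False
 then obtain s0 where s0: "s0 : I" "ALL beta>s0. ~ barrier t0 t1 l beta" by blast
 note N = no_barrier[OF t l(1) s0]
 have cl: "close_b a b f c" by (rule close[rule_format, OF N(1)])
 have mu: "ereal mu = m_b b f" using mu_eq[OF t(1)] N(2)[OF t(1)] by simp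
 have muV: "mu < V x" if "x : I" "min t0 t1 <= x" for x using N(2)[OF that] by (simp add: mu_less_iff[OF mu])
 have pos: "0 < hint f mu t0 b" "0 < hint f mu t1 b"
 proof -
  have fin: "mu < V x" if "x : base_interval t0 b | x : base_interval t1 b" for x
   using that t by (intro muV) (auto simp: base_interval_def min_le_iff_disj less_imp_le dest: less_trans[of a "ereal _" "ereal _"])
  show "0 < hint f mu t0 b" "0 < hint f mu t1 b"
   using t fin by (intro hint_pos; auto simp: base_mem)+
 qed
 have nfin: "hint f mu c1 b ~= \<infinity>" if c1: "close_b a b f c1" for c1
 proof -
  have c1I: "c1 : I" by (rule close_bD(1)[OF c1])
  obtain c' where c': "max c1 t0 < c'" "c' : I" by (rule next_in_I[OF max_I[OF c1I t(1)]])
  have bb: "ereal c' <= b" "a <= ereal c1" "a <= ereal t0" using c' c1I t by (auto simp: base_mem)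
  have "hint f mu c' b <= hint f mu t0 b" using bb c' by (intro hint_mono) auto
  moreover have "hint f mu t0 b ~= \<infinity>" using N(3) by (cases "hint f mu t0 b") auto
  moreover obtain r where "hint f mu c1 c' = ereal r"
  proof (rule hint_finite[OF c1I c'(2)])
   show "c1 <= c'" using c' by simp
   show "mu < V x" if "x : {c1..c'}" for x
    using close_bD(2)[OF c1, of x] that sub_I[OF c1I c'(2)] by (auto simp: mu_less_iff[OF mu] subset_iff)
  qed
  moreover have "hint f mu c1 b = hint f mu c1 c' + hint f mu c' b"
   by (rule hint_add) (use bb c' in auto)
  ultimately show ?thesis by (cases "hint f mu c' b") auto
 qed
 have d: "2 * dbc c + (hint f mu t0 b + hint f mu t1 b) <= ereal l" by (rule N(4)[OF cl])
 have "2 * dbc c < ereal l" using d pos by (cases "2 * dbc c"; cases "hint f mu t0 b"; cases "hint f mu t1 b") auto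
 hence dl: "2 * dbc c < ereal l" "~ diam <= 2 * dbc c" using l(2) by (auto dest: less_le_trans)
 hence mm: "m_inf a b f < m_b b f" and ib: "ibc c <= dbc c"
  using C N(1) nfin unfolding Cb_def by auto
 \<comment> \<open>A competitor for \<open>i_b\<close> takes less than \<open>l / 2\<close> from its
   left turning point \<open>s\<close> to \<open>b\<close>. The way from \<open>t0\<close> down to
   \<open>s\<close> is no longer than that, so the whole detour ends before
   \<open>l\<close>.\<close>
 have "ibc c < ereal (l / 2)" using ib dl(1) by (cases "dbc c"; cases "ibc c") auto
 then obtain D where D: "m_inf a b f < ereal D" "ereal D <= m_b b f" "hint f D (a_star a b f c D) b < ereal (l / 2)"
  unfolding ibc_def by (auto simp: INF_less_iff)
 have DV: "D < V x" if "x : I" "c <= x" for x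
  using close_bD(2)[OF cl that] D(2) by (meson le_less_trans less_ereal.simps(1))
 have DV2: "D < V x" if "x : I" "min t0 t1 <= x" for x
  using N(2)[OF that] D(2) by (meson le_less_trans less_ereal.simps(1))
 have cI: "c : I" by (rule close_bD(1)[OF cl])
 from cI DV[OF cI order_refl] show thesis
 proof (cases rule: a_star_cases)
  case (turn s)
  have sV: "D < V x" if "x : I" "s < x" for x using turn(4)[of x] DV[of x] that by (cases "x <= c") auto
  have st: "s < t0" "s < t1"
   using DV2[OF turn(1)] turn(3) by (auto simp: min_le_iff_disj intro: not_le_imp_less)
  have bb: "a <= ereal s" "ereal t0 <= b" "ereal c < b" using turn(1) t cI by (auto simp: base_mem)
  have "hint f D s t0 <= hint f D s b" by (rule hint_mono) (use bb in auto)
  moreover have hb: "hint f D s b < ereal (l / 2)" using D(3) turn(5) by simp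
  ultimately have h2: "hint f D s t0 + hint f D s b <= ereal l"
   using hint_nonneg[of D s t0] by (cases "hint f D s t0"; cases "hint f D s b") auto
  have "hint f D s c <= hint f D s b" by (rule hint_mono) (use bb in auto)
  hence "hint f D s c ~= \<infinity>" using hb by auto
  hence "0 < dV s"
   by (intro hint_degenerate_left[OF turn(1,3) cI turn(2)]) (use turn(4) in auto)
  thus thesis by (intro bounce[OF mm N(2) turn(1) st turn(3) _ sV h2])
 next
  case exit
  have "ereal D <= m_inf a b f"
  proof (rule m_inf_ge)
   fix x assume "x : I"
   thus "ereal D <= ereal (V x)" using exit(1)[of x] DV[of x] by (cases "x <= c") auto
  qed
  thus thesis using D(1) by simp
 qed
qed

end

section \<open>Reflection of Condition (C) and its sufficiency\<close>

lemma m_a_reflect: "m_a a f = m_b (- a) (mirror f)"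
 unfolding m_a_def m_b_def to_upper_reflect
 by (subst Liminf_filtermap_eq) (simp_all add: invsq_reflect inj_def)

lemma m_inf_reflect: "m_inf (- b) (- a) (mirror f) = m_inf a b f"
proof -
 have "base_interval (- b) (- a) = uminus ` base_interval a b"
  by (auto simp: I_reflect image_iff intro!: bexI[of _ "- _"])
 thus ?thesis unfolding m_inf_def by (simp add: image_image invsq_reflect)
qed

lemma close_a_reflect: "close_a a b f c \<longleftrightarrow> close_b (- b) (- a) (mirror f) (- c)"
proof -
 have "(EX s>c. ALL tau:base_interval a b. tau < s --> m_a a f < ereal (invsq f tau)) \<longleftrightarrow>
  (EX s<(- c). ALL tau:base_interval (- b) (- a). s < tau --> m_a a f < ereal (invsq f (- tau)))" (is "?L \<longleftrightarrow> ?R")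
 proof
  assume ?L
  then obtain s where "s > c" "ALL tau:base_interval a b. tau < s --> m_a a f < ereal (invsq f tau)" by blast
  thus ?R by (intro exI[of _ "- s"]) (auto simp: I_reflect)
 next
  assume ?R
  then obtain s where "s < - c" and s: "ALL tau:base_interval (- b) (- a). s < tau --> m_a a f < ereal (invsq f (- tau))" by blast
  moreover have "m_a a f < ereal (invsq f tau)" if "tau : base_interval a b" "tau < - s" for tau
   using s[rule_format, of "- tau"] that by (simp add: I_reflect)
  ultimately show ?L by (intro exI[of _ "- s"]) auto
 qed
 thus ?thesis
  unfolding close_a_def close_b_def m_a_reflect[of a f, symmetric] by (simp add: I_reflect invsq_reflect)
qed

lemma rel_min_a_reflect: "rel_min_a a b f \<longleftrightarrow> rel_min_b (- b) (- a) (mirror f)"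
proof
 assume "rel_min_a a b f"
 then obtain s where "a < ereal s" "ALL tau:base_interval a b. tau < s --> m_a a f < ereal (invsq f tau)"
  unfolding rel_min_a_def by blast
 moreover have "ereal (- s) < - a"
  using \<open>a < ereal s\<close> by (metis ereal_minus_less_minus uminus_ereal.simps(1))
 ultimately show "rel_min_b (- b) (- a) (mirror f)"
  unfolding rel_min_b_def m_a_reflect[of a f, symmetric]
  by (intro exI[of _ "- s"]) (auto simp: I_reflect invsq_reflect)
next
 assume "rel_min_b (- b) (- a) (mirror f)"
 then obtain s where "ereal s < - a" and s: "ALL tau:base_interval (- b) (- a). s < tau --> m_a a f < ereal (invsq f (- tau))"
  unfolding rel_min_b_def m_a_reflect[of a f, symmetric] invsq_reflect by blast
 moreover have "m_a a f < ereal (invsq f tau)" if "tau : base_interval a b" "tau < - s" for tau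
  using s[rule_format, of "- tau"] that by (simp add: I_reflect)
 moreover have "a < ereal (- s)" using \<open>ereal s < - a\<close> by (simp add: ereal_less_uminus_reorder)
 ultimately show "rel_min_a a b f" unfolding rel_min_a_def by blast
qed

context warp
begin

lemma hint_reflect':
 assumes "t : I" "D < V t"
 shows "hint f D (a_star a b f t D) t = hint (mirror f) D (- t) (b_star (- b) (- a) (mirror f) (- t) D)"
  and "hint f D (a_star a b f t D) b = hint (mirror f) D (- b) (b_star (- b) (- a) (mirror f) (- t) D)"
  and "hint f D t (b_star a b f t D) = hint (mirror f) D (a_star (- b) (- a) (mirror f) (- t) D) (- t)"
  and "hint f D a (b_star a b f t D) = hint (mirror f) D (a_star (- b) (- a) (mirror f) (- t) D) (- a)"
proof -
 interpret R: warp "- b" "- a" "mirror f" by (rule warp_reflect)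
 have t': "- t : R.I" using assms by (simp add: I_reflect)
 have as: "a_star a b f t D = - b_star (- b) (- a) (mirror f) (- t) D"
  by (rule a_star_reflect[OF assms(1)])
 have bs: "a_star (- b) (- a) (mirror f) (- t) D = - b_star a b f t D"
  using R.a_star_reflect[OF t', of D] by simp
 have "b_star (- b) (- a) (mirror f) (- t) D <= - a" by (rule R.b_star_le[OF t'])
 hence ale: "a <= a_star a b f t D" unfolding as by (metis ereal_minus_le_minus ereal_uminus_uminus)
 show "hint f D (a_star a b f t D) t = hint (mirror f) D (- t) (b_star (- b) (- a) (mirror f) (- t) D)"
  using hint_reflect[OF ale I_bounds(2)[OF assms(1)], of D] as by simp
 show "hint f D (a_star a b f t D) b = hint (mirror f) D (- b) (b_star (- b) (- a) (mirror f) (- t) D)"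
  using hint_reflect[OF ale order_refl, of D] as by simp
 show "hint f D t (b_star a b f t D) = hint (mirror f) D (a_star (- b) (- a) (mirror f) (- t) D) (- t)"
  using hint_reflect[OF I_bounds(1)[OF assms(1)] b_star_le[OF assms(1)], of D D] bs by simp
 show "hint f D a (b_star a b f t D) = hint (mirror f) D (a_star (- b) (- a) (mirror f) (- t) D) (- a)"
  using hint_reflect[OF order_refl b_star_le[OF assms(1)], of D D] bs by simp
qed

lemma conn_if_barriers_a:
 assumes C: "Cb diam c" "rel_min_b a b f --> close_b a b f c"
  and A: "ALL s:I. EX alpha<s. barrier_a t0 t1 l alpha"
  and t: "t0 : I" "t1 : I" and l: "0 < l" "ereal l <= diam"
 shows "conn t0 t1 l"
proof -
 interpret R: warp "- b" "- a" "mirror f" by (rule warp_reflect)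
 have aI: "alpha : I" if "barrier_a t0 t1 l alpha" for alpha
  using that unfolding barrier_a_def R.barrier_def by (simp add: I_reflect)
 have min_I: "min t0 t1 : I" using t by (simp add: min_def)
 from C(1,2) t l show ?thesis
 proof (cases rule: Cb_alternatives)
  case barriers
  obtain alpha where alpha: "alpha < min t0 t1" "barrier_a t0 t1 l alpha" using A min_I by blast
  obtain beta where beta: "max t0 t1 < beta" "barrier t0 t1 l beta" using barriers[OF max_I[OF t]] by blast
  show ?thesis by (rule connect_by_barriers[OF _ _ _ _ aI[OF alpha(2)] l(1) alpha(2) beta(2)]) (use alpha beta in auto)
 next
  case (bounce s D)
  obtain alpha where alpha: "alpha < s" "barrier_a t0 t1 l alpha" using A bounce(3) by blast
  obtain beta where beta: "max t0 t1 < beta" "beta : I" by (rule next_in_I[OF max_I[OF t]])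
  have "hint f D s beta <= hint f D s b"
   using I_bounds(1)[OF bounce(3)] I_bounds(2)[OF beta(2)] by (intro hint_mono) auto
  hence le: "hint f D s t0 + hint f D s beta <= ereal l"
   using bounce(9) by (meson add_left_mono order_trans)
  have DV: "D < V x" if "s < x" "x <= beta" for x
   using that by (intro bounce(8) I_between[OF bounce(3) beta(2)]) auto
  show ?thesis
   by (rule connect_by_bounce[OF alpha(1) bounce(4) _ _ _ aI[OF alpha(2)] beta(2) l(1) alpha(2) bounce(6,7) DV le])
    (use alpha beta bounce(5) in auto)
 qed
qed

text \<open>One end may do without barriers if the other has them. The remaining case, a bounce at
  both ends, contradicts itself.\<close>

lemma C_imp_conn:
 assumes Cb: "Cb diam c" "rel_min_b a b f --> close_b a b f c"
  and Ca: "warp.Cb (- b) (- a) (mirror f) diam c'"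
   "rel_min_b (- b) (- a) (mirror f) --> close_b (- b) (- a) (mirror f) c'"
  and t: "t0 : I" "t1 : I" and l: "0 < l" "ereal l <= diam"
 shows "conn t0 t1 l"
proof -
 interpret R: warp "- b" "- a" "mirror f" by (rule warp_reflect)
 have t': "- t0 : R.I" "- t1 : R.I" using t by (simp_all add: I_reflect)
 from Ca t' l show ?thesis
 proof (cases rule: R.Cb_alternatives)
  case barriers
  show ?thesis
  proof (rule conn_if_barriers_a[OF Cb _ t l], rule ballI)
   fix s assume "s : I"
   hence "- s : R.I" by (simp add: I_reflect)
   then obtain beta where "- s < beta" "R.barrier (- t0) (- t1) l beta" using barriers by blast
   thus "EX alpha<s. barrier_a t0 t1 l alpha" unfolding barrier_a_def by (intro exI[of _ "- beta"]) auto
  qed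
 next
  case bounce_a: (bounce s' D')
  from Cb t l show ?thesis
  proof (cases rule: Cb_alternatives)
   case barriers
   have "R.conn (- t0) (- t1) l"
   proof (rule R.conn_if_barriers_a[OF Ca _ t' l], rule ballI)
    fix s assume "s : R.I"
    hence "- s : I" by (simp add: I_reflect)
    then obtain beta where "- s < beta" "barrier t0 t1 l beta" using barriers by blast
    thus "EX alpha<s. R.barrier_a (- t0) (- t1) l alpha"
     unfolding R.barrier_a_def by (intro exI[of _ "- beta"]) auto
   qed
   thus ?thesis by (simp add: conn_reflect)
  next
   case (bounce s D)
   \<comment> \<open>\<open>V\<close> exceeds \<open>m_b\<close> to the right of
     \<open>min t0 t1\<close> and \<open>m_a\<close> to the left of \<open>max t0 t1\<close>. These
     two parts cover \<open>I\<close>, so one of the two numbers would be at most the infimum of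
     \<open>V\<close>, against \<open>m < m_b\<close> and \<open>m < m_a\<close>.\<close>
   have "min (m_b b f) (m_b (- a) (mirror f)) <= m_inf a b f"
   proof (rule m_inf_ge)
    fix x assume x: "x : I"
    show "min (m_b b f) (m_b (- a) (mirror f)) <= ereal (V x)"
    proof (cases "min t0 t1 <= x")
     case True
     thus ?thesis using bounce(2)[OF x] by (simp add: min_le_iff_disj less_imp_le)
    next
     case False
     hence "min (- t0) (- t1) <= - x" "- x : R.I" using x by (auto simp: I_reflect)
     thus ?thesis using bounce_a(2)[of "- x"] by (simp add: min_le_iff_disj less_imp_le invsq_reflect)
    qed
   qed
   moreover have "m_inf a b f < min (m_b b f) (m_b (- a) (mirror f))"
    using bounce(1) bounce_a(1) by (simp add: m_inf_reflect)
   ultimately show ?thesis by (auto simp: min_le_iff_disj not_le[symmetric])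
  qed
 qed
qed

lemma condition_C_iff:
 "condition_C a b f diam \<longleftrightarrow> Cb diam (SOME c. close_b a b f c) &
  warp.Cb (- b) (- a) (mirror f) diam (- (SOME c. close_a a b f c))"
proof -
 interpret R: warp "- b" "- a" "mirror f" by (rule warp_reflect)
 define ca where "ca = (SOME c. close_a a b f c)"
 define mua where "mua = real_of_ereal (m_a a f)"
 have b: "d_b a b f = dbc (SOME c. close_b a b f c)" "i_b a b f = ibc (SOME c. close_b a b f c)"
  by (simp_all add: d_b_def dbc_def i_b_def ibc_def Let_def)
 have "R.Cb diam (- ca) \<longleftrightarrow>
  ~ rel_min_a a b f |
  (EX c. close_a a b f c & hint f mua a c = \<infinity>) |
  2 * d_a a b f >= diam |
  (2 * d_a a b f < diam & m_inf a b f < m_a a f & d_a a b f >= i_a a b f)"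
 proof (cases "rel_min_a a b f")
  case True
  hence "EX c. close_a a b f c"
   using R.rel_min_b_close close_a_reflect[of a b f "- _"] by (auto simp: rel_min_a_reflect)
  hence "close_a a b f ca" unfolding ca_def by (rule someI_ex)
  hence cl: "close_b (- b) (- a) (mirror f) (- ca)" by (simp add: close_a_reflect)
  have caI: "ca : I" using R.close_bD(1)[OF cl] by (simp add: I_reflect)
  have mua: "ereal mua = m_a a f"
   using R.mu_eq[OF R.close_bD(1)[OF cl] R.close_bD(2)[OF cl R.close_bD(1)[OF cl] order_refl]]
   by (simp add: mua_def m_a_reflect)
  have Vca: "mua < V ca"
   using R.close_bD(2)[OF cl R.close_bD(1)[OF cl] order_refl] unfolding m_a_reflect[symmetric] mua[symmetric]
   by (simp add: invsq_reflect)
  have h1: "hint f mua a c = hint (mirror f) mua (- c) (- a)" if "c : I" for c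
   using hint_reflect[OF order_refl I_bounds(2)[OF that], of mua] by simp
  have e1: "(EX c. close_a a b f c & hint f mua a c = \<infinity>) \<longleftrightarrow>
   (EX c. close_b (- b) (- a) (mirror f) c & hint (mirror f) mua c (- a) = \<infinity>)" (is "?L \<longleftrightarrow> ?R")
  proof
   assume ?L
   then obtain c where c: "close_a a b f c" "hint f mua a c = \<infinity>" by blast
   hence "c : I" by (simp add: close_a_def)
   thus ?R using c h1[of c] by (intro exI[of _ "- c"]) (simp add: close_a_reflect)
  next
   assume ?R
   then obtain c where c: "close_b (- b) (- a) (mirror f) c" "hint (mirror f) mua c (- a) = \<infinity>" by blast
   hence "- c : I" by (simp add: close_b_def I_reflect)
   thus ?L using c h1[of "- c"] by (intro exI[of _ "- c"]) (simp add: close_a_reflect)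
  qed
  \<comment> \<open>\<open>hint_reflect'\<close> asks for \<open>D < V ca\<close>, which is
    available only near \<open>mua\<close>; for a limit at \<open>mua\<close> this is
    enough.\<close>
  have ev: "eventually (%D. D < V ca) (at mua)"
   using Vca eventually_nhds_in_open[of "{..<V ca}" mua] by (simp add: eventually_at_filter eventually_mono)
  have e2: "d_a a b f = R.dbc (- ca)"
   unfolding d_a_def R.dbc_def Let_def ca_def[symmetric] m_a_reflect[symmetric] mua_def[symmetric]
   using h1[OF caI] by (intro arg_cong2[where f = minus] Limsup_eq)
    (auto intro: eventually_mono[OF ev] hint_reflect'(1)[OF caI])
  have e3: "i_a a b f = R.ibc (- ca)"
   unfolding i_a_def R.ibc_def Let_def ca_def[symmetric] m_a_reflect[symmetric] m_inf_reflect
  proof (rule INF_cong[OF refl])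
   fix D assume "D : {D. m_inf a b f < ereal D & ereal D <= m_a a f}"
   hence "D < V ca" using Vca mua by (metis (no_types, lifting) ereal_less_eq(3) le_less_trans mem_Collect_eq)
   thus "hint f D a (b_star a b f ca D) =
     hint (mirror f) D (a_star (- b) (- a) (mirror f) (- ca) D) (- a)"
    by (rule hint_reflect'(4)[OF caI])
  qed
  show ?thesis
   unfolding R.Cb_def e1 e2 e3 m_a_reflect[symmetric] m_inf_reflect rel_min_a_reflect[symmetric] mua_def[symmetric] ..
 qed (simp add: R.Cb_def rel_min_a_reflect[symmetric])
 thus ?thesis
  unfolding condition_C_def Cb_def[of diam "SOME c. close_b a b f c"] b ca_def mua_def by simp
qed

subsection \<open>Failure of condition (C)\<close>

lemma start_right:
 assumes S: "sol {0..Y} tau w" and Y: "0 < Y" and start: "0 < w 0 | w 0 = 0 & 0 < dV (tau 0)"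
 obtains y where "y : {0..Y}" "tau 0 < tau y"
proof -
 obtain d where d: "0 < d" "!!z. z : {0..Y} ==> 0 < z ==> z < d ==> 0 < w z"
  by (rule sol_start_right[OF S Y start]) (rule that)
 define q where "q = min Y d"
 have q: "0 < q" "q <= Y" "q <= d" using d Y by (auto simp: q_def)
 have "tau 0 < tau q"
  by (rule sol_strict_mono[of 0 q tau w]) (use q d sol_subset[OF S, of "{0..q}"] in auto)
 thus thesis using that[of q] q by auto
qed

lemma start_left:
 assumes S: "sol {0..Y} tau w" and Y: "0 < Y" and start: "w 0 < 0 | w 0 = 0 & dV (tau 0) < 0"
 obtains y where "y : {0..Y}" "tau y < tau 0"
proof -
 interpret R: warp "- b" "- a" "mirror f" by (rule warp_reflect)
 have "tau 0 : I" using solD(1)[OF S] Y by auto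
 hence "deriv (invsq (mirror f)) (- tau 0) = - dV (tau 0)" using dV_reflect[of "- tau 0"] by simp
 hence st: "0 < - w 0 | - w 0 = 0 & 0 < deriv (invsq (mirror f)) (- tau 0)" using start by auto
 obtain y where "y : {0..Y}" "- tau 0 < - tau y" by (rule R.start_right[OF sol_reflect[OF S] Y st])
 thus thesis using that by simp
qed

lemma sol_extremum:
 assumes S: "sol {0..l} tau w" and y: "0 < y" "y < l"
  and ext: "(ALL z:{0..l}. tau y <= tau z) | (ALL z:{0..l}. tau z <= tau y)"
 shows "w y = 0"
proof -
 have yI: "y : {0..l}" using y by simp
 have d: "(tau has_real_derivative w y / V (tau y)) (at y)"
  using solD(2)[OF S yI] y by (simp add: at_within_Icc_at)
 define e where "e = min y (l - y)"
 have e: "0 < e" "!!z. \<bar>y - z\<bar> < e ==> z : {0..l}" using y by (auto simp: e_def)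
 have "w y / V (tau y) = 0"
  using ext
 proof
  assume "ALL z:{0..l}. tau y <= tau z"
  thus ?thesis using e by (intro DERIV_local_min[OF d e(1)]) blast
 next
  assume "ALL z:{0..l}. tau z <= tau y"
  thus ?thesis using e by (intro DERIV_local_max[OF d e(1)]) blast
 qed
 thus ?thesis using V_pos[OF solD(1)[OF S yI]] by simp
qed

text \<open>A trajectory from \<open>t\<close> back to \<open>t\<close> in the time \<open>l\<close>
  that gets below \<open>t\<close> has a lowest point, and it needs more than \<open>l / 2\<close>
  both before and after it. If it never gets below \<open>t\<close>, its highest point is a turning
  point reached after a time \<open>T < l / 2\<close>; it is then back at \<open>t\<close> at the
  time \<open>2 T < l\<close> with negative velocity, and does get below \<open>t\<close>.\<close>

lemma no_return:
 assumes t: "t : I" "dV t < 0" and l: "0 < l"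
  and R: "!!x. x : I ==> t < x ==> V x < V t ==> (!!s. t < s ==> s < x ==> V x < V s) ==>
   hint f (V x) t x < ereal (l / 2) & dV x < 0"
  and L: "!!s. s : I ==> s < t ==> V s <= V t ==> (!!x. s < x ==> x < t ==> V s < V x) ==>
   ereal (l / 2) < hint f (V s) s t"
 shows "~ conn t t l"
proof
 assume "conn t t l"
 then obtain tau w where S: "sol {0..l} tau w" and e: "tau 0 = t" "tau l = t" unfolding conn_def by blast
 define D where "D = V t - (w 0)\<^sup>2"
 have D: "(w y)\<^sup>2 = V (tau y) - D" if "y : {0..l}" for y
  using sol_D[OF S that, of 0] l by (simp add: D_def e)
 have c: "continuous_on {0..l} tau" by (rule sol_continuous(1)[OF S])
 show False
 proof (cases "EX y:{0..l}. tau y < t")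
  case True
  obtain y0 where y0: "y0 : {0..l}" "!!y. y : {0..l} ==> tau y0 <= tau y"
   using continuous_attains_inf[OF compact_Icc _ c] l by auto
  have lt: "tau y0 < t" using True y0(2) by force
  hence y0': "0 < y0" "y0 < l" using y0(1) e by (auto simp: less_le)
  have "w y0 = 0" by (rule sol_extremum[OF S y0']) (use y0 in blast)
  hence VD: "V (tau y0) = D" using D[OF y0(1)] by simp
  have S1: "sol {y0..l} tau w" and S2: "sol {0..y0} tau w" using sol_subset[OF S] y0' by auto
  have e1: "V (tau y0) - (w y0)\<^sup>2 = D" using VD \<open>w y0 = 0\<close> by simp
  have 1: "D < V x" if "tau y0 < x" "x < t" for x
   using sol_cross(1)[OF S1, of y0 x] that lt e y0' e1 by auto
  have 2: "hint f D (tau y0) t <= ereal (l - y0)"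
   using sol_cross(2)[OF S1, of y0] lt e y0' e1 by auto
  have 3: "hint f D (tau y0) t <= ereal y0"
   using sol_cross_left(2)[OF S2, of y0] lt e y0' e1 by auto
  have "ereal (l / 2) < hint f D (tau y0) t"
   using L[OF solD(1)[OF S y0(1)] lt] VD 1 by (auto simp: D_def)
  thus False using 2 3 by (cases "hint f D (tau y0) t") auto
 next
  case False
  hence ge: "t <= tau y" if "y : {0..l}" for y using that by force
  have w0: "0 < w 0"
  proof (rule ccontr)
   assume "~ 0 < w 0"
   hence st: "w 0 < 0 | w 0 = 0 & dV (tau 0) < 0" using t e by auto
   obtain y where "y : {0..l}" "tau y < tau 0" by (rule start_left[OF S l st])
   thus False using ge e by force
  qed
  obtain y where y: "y : {0..l}" "tau 0 < tau y" by (rule start_right[OF S l]) (use w0 in auto)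
  obtain y1 where y1: "y1 : {0..l}" "!!y. y : {0..l} ==> tau y <= tau y1"
   using continuous_attains_sup[OF compact_Icc _ c] l by auto
  have lt: "t < tau y1" using y1(2)[OF y(1)] y(2) e by simp
  hence y1': "0 < y1" "y1 < l" using y1(1) e by (auto simp: less_le)
  have "w y1 = 0" by (rule sol_extremum[OF S y1']) (use y1 in blast)
  hence VD: "V (tau y1) = D" using D[OF y1(1)] by simp
  have S1: "sol {0..y1} tau w" using sol_subset[OF S] y1' by auto
  have DV: "D < V x" if "t < x" "x < tau y1" for x
   using sol_cross(1)[OF S1, of y1 x] that lt e y1' VD \<open>w y1 = 0\<close> by auto
  have h: "hint f D t (tau y1) < ereal (l / 2)" "dV (tau y1) < 0"
   using R[OF solD(1)[OF S y1(1)] lt] VD DV w0 by (auto simp: D_def)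
  then obtain T where T: "hint f D t (tau y1) = ereal T" "0 <= T" "2 * T < l"
   using hint_nonneg[of D t "tau y1"] by (cases "hint f D t (tau y1)") auto
  have tauT: "tau T = tau y1"
   by (rule run_right_upto(4)[OF S _ solD(1)[OF S y1(1)]]) (use e lt DV w0 T in "simp_all add: D_def")
  have wT: "w T = 0" using D[of T] T tauT VD by simp
  have S2: "sol {0..l - T} (%y. tau (T + 1 * y)) (%y. 1 * w (T + 1 * y))"
   by (rule sol_affine[OF S]) (use T in auto)
  have 2: "1 * w (T + 1 * T) <= 0" "tau (T + 1 * T) = t"
   by (rule run_left_upto(1,4)[OF S2 _ t(1), of T];
    use tauT wT h(2) lt VD DV T e in "simp_all")+
  hence "(w (T + T))\<^sup>2 = (w 0)\<^sup>2" using D[of "T + T"] T by (simp add: D_def)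
  hence st: "w (T + T) < 0" using w0 2 by (cases "w (T + T) = 0") auto
  have S3: "sol {0..l - 2 * T} (%y. tau (2 * T + 1 * y)) (%y. 1 * w (2 * T + 1 * y))"
   by (rule sol_affine[OF S]) (use T in auto)
  obtain z where z: "z : {0..l - 2 * T}" "tau (2 * T + 1 * z) < tau (2 * T + 1 * 0)"
   by (rule start_left[OF S3]) (use st T in auto)
  thus False using ge[of "2 * T + z"] 2(2) T by simp
 qed
qed

lemma right_mem: "c : I ==> c <= v ==> ereal v < b ==> v : I"
 unfolding base_mem by (meson ereal_less_eq(3) less_le_trans)

lemma minimum_dV_0:
 assumes t: "t : I" and m: "!!x. x : I ==> V t <= V x"
 shows "dV t = 0"
proof -
 obtain u v where uv: "u < t" "t < v" "{u..v} <= I" by (rule extend_interval[OF t t order_refl])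
 show ?thesis
 proof (rule DERIV_local_min[OF V_deriv[OF t]])
  show "0 < min (t - u) (v - t)" using uv by simp
  show "ALL y. \<bar>t - y\<bar> < min (t - u) (v - t) --> V t <= V y"
   using uv(3) by (intro allI impI m) (auto simp: subset_iff abs_if split: if_splits)
 qed
qed

lemma hint_tail_small:
 assumes c: "c : I" and fin: "hint f D c b ~= \<infinity>" and e: "0 < e" and DV: "!!x. x : I ==> c <= x ==> D < V x"
 obtains v where "v : I" "c <= v" "hint f D v b < ereal e"
proof -
 have cb: "a <= ereal c" "ereal c < b" using c by (auto simp: base_mem less_imp_le)
 have "!!x. x : base_interval c b ==> D < V x" using right_in_I[OF c] DV by (meson less_imp_le)
 hence "0 < hint f D c b" by (intro hint_pos[OF cb(1) order_refl cb(2)]) auto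
 then obtain h0 where h0: "hint f D c b = ereal h0" "0 < h0" using fin by (cases "hint f D c b") auto
 have "0 <= ereal (max 0 (h0 - e))" "ereal (max 0 (h0 - e)) < hint f D c b"
  using h0 e by (auto simp: max_def zero_ereal_def)
 then obtain u v where uv: "ereal c < ereal u" "u < v" "ereal v < b" "ereal (max 0 (h0 - e)) < hint f D u v"
  by (rule hint_approx[OF cb(1) order_refl])
 have cv: "c < v" using uv by simp
 have "v : I" using c uv(3) cv unfolding base_mem by (meson less_ereal.simps(1) less_trans)
 moreover have "hint f D u v <= hint f D c v" using cb uv by (intro hint_mono) auto
 hence "ereal (max 0 (h0 - e)) < hint f D c v" by (rule less_le_trans[OF uv(4)])
 moreover have "hint f D c b = hint f D c v + hint f D v b" using cb uv cv by (intro hint_add) auto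
 ultimately show thesis using that[of v] h0 cv
  by (cases "hint f D c v"; cases "hint f D v b") (auto simp: max_def split: if_splits)
qed

text \<open>For \<open>t\<close> close to \<open>b\<close>, a left turning point \<open>s\<close> of
  any energy up to \<open>V t\<close> is more than \<open>l / 2\<close> away. Energies near
  \<open>m_b\<close> are covered by lower semicontinuity and those between \<open>m\<close> and
  \<open>m_b\<close> by \<open>l / 2 < i_b\<close>; at the energy \<open>m\<close> the turning point
  is critical. If \<open>V > m_b\<close> everywhere, then \<open>ne\<close> leaves only
  \<open>m_a > m\<close>, and left turning points do not exist.\<close>

lemma not_Cb_left:
 assumes cl: "close_b a b f c" and fin: "hint f mu c b ~= \<infinity>" and l: "0 < l"
  and ib: "m_inf a b f < m_b b f --> ereal (l / 2) < ibc c"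
  and ne: "~ ((ALL x:I. m_inf a b f < ereal (V x)) & m_a a f = m_inf a b f & m_b b f = m_inf a b f)"
 obtains v d where "v : I" "c <= v" "0 < d"
  "ALL t:I. ALL s:I. v < t & V t < mu + d & (ALL x. c <= x & x < t --> V t < V x) &
   s < t & V s <= V t & (ALL x. s < x & x < t --> V s < V x) --> ereal (l / 2) < hint f (V s) s t"
proof -
 interpret R: warp "- b" "- a" "mirror f" by (rule warp_reflect)
 have cI: "c : I" by (rule close_bD(1)[OF cl])
 have mu: "ereal mu = m_b b f" by (rule mu_eq[OF cI close_bD(2)[OF cl cI order_refl]])
 have muV: "mu < V x" if "x : I" "c <= x" for x
  using close_bD(2)[OF cl that] by (simp add: mu_less_iff[OF mu])
 show thesis
 proof (cases "EX x:I. V x <= mu")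
  case False
  hence muall: "mu < V x" if "x : I" for x using that by force
  \<comment> \<open>Here \<open>m = m_b\<close> is not attained and \<open>m_a > m\<close>, so
    \<open>V\<close> is bounded away from \<open>mu\<close> on everything left of \<open>c\<close>,
    and energies near \<open>mu\<close> do not turn there.\<close>
  have "m_b b f <= m_inf a b f"
   using muall by (intro m_inf_ge) (simp add: mu_less_iff[OF mu] less_imp_le)
  hence me: "m_b b f = m_inf a b f" using m_inf_le_m_b by simp
  have "m_inf a b f < ereal (V x)" if "x : I" for x
   using muall[OF that] me mu by (metis less_ereal.simps(1))
  hence "m_a a f ~= m_b b f" using ne me by auto
  moreover have "m_inf a b f <= m_a a f"
   using R.m_inf_le_m_b by (simp add: m_inf_reflect m_a_reflect)
  ultimately have "ereal mu < m_b (- a) (mirror f)" using me mu by (simp add: m_a_reflect[symmetric] less_le)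
  then obtain k where k: "ereal mu < ereal k" "ereal k < m_b (- a) (mirror f)" using ereal_dense2 by blast
  obtain s0 where s0: "ereal s0 < - a" "!!tau. s0 < tau ==> ereal tau < - a ==> k < invsq f (- tau)"
   by (rule R.less_m_bD[OF k(2)]) (simp add: invsq_reflect)
  define u where "u = min c (- s0)"
  have as: "a < ereal (- s0)" using s0(1) by (metis ereal_minus_less_minus ereal_uminus_uminus uminus_ereal.simps(1))
  have "ereal u <= ereal c" by (simp add: u_def)
  hence "ereal u < b" using cI unfolding base_mem by (meson le_less_trans)
  hence uI: "u : I" using as cI by (auto simp: base_mem u_def min_def)
  have kV: "k < V s" if "s : I" "s < u" for s
  proof -
   have "ereal (- s) < - a" using that unfolding base_mem by (metis ereal_minus_less_minus uminus_ereal.simps(1))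
   thus ?thesis using s0(2)[of "- s"] that by (simp add: u_def)
  qed
  have "\<forall>\<^sub>F D in nhds mu. ALL x:{u..c}. D < V x"
   by (rule V_lower_nhds) (use sub_I[OF uI cI] muall in "auto simp: u_def subset_iff")
  then obtain d where d: "0 < d" "!!D. dist D mu < d ==> ALL x:{u..c}. D < V x"
   unfolding eventually_nhds_metric by blast
  show thesis
  proof (rule that[of c "min d (k - mu)"], goal_cases)
   case 4
   show ?case
   proof (intro ballI impI, elim conjE, goal_cases)
   case (1 t s)
   hence t: "t : I" "c < t" "V t < mu + min d (k - mu)" and tx: "!!x. c <= x ==> x < t ==> V t < V x"
    and s: "s : I" "s < t" "V s <= V t" by blast+
   have "mu < V t" by (rule muall[OF t(1)])
   hence "dist (V t) mu < d" using t(3) by (auto simp: dist_real_def)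
   hence "V t < V s" if "s : {u..c}" using d(2) that by blast
   moreover have "V t < V s" if "s < u" using kV[OF s(1) that] t(3) by simp
   moreover have "V t < V s" if "c < s" using tx[of s] s that by simp
   ultimately show "ereal (l / 2) < hint f (V s) s t" using s by fastforce
   qed
  qed (use cI d k in auto)
 next
  case True
  then obtain x0 where x0: "x0 : I" "V x0 <= mu" by blast
  hence "x0 < c" using muV by force
  from cI muV[OF cI order_refl] obtain alpha where alpha: "alpha : I" "alpha < c" "V alpha = mu"
   "!!s. s <= c ==> alpha < s ==> mu < V s" "a_star a b f c mu = ereal alpha"
  proof (cases rule: a_star_cases)
   case (turn alpha)
   thus thesis using that by blast
  next
   case exit
   thus thesis using x0 \<open>x0 < c\<close> by force
  qed
  have alphaV: "mu < V x" if "x : I" "alpha < x" for x using alpha(4)[of x] muV[of x] that by fastforce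
  have alphab: "a <= ereal alpha" "ereal c <= b" "ereal c < b" using alpha(1) cI by (auto simp: base_mem less_imp_le)
  have inf: "hint f (V s) s t = \<infinity>" if s: "s : I" "t : I" "s < t" "ereal (V s) <= m_inf a b f"
   "!!x. s < x ==> x < t ==> V s < V x" for s t
  proof (rule ccontr)
   assume n: "hint f (V s) s t ~= \<infinity>"
   have "V s <= V x" if "x : I" for x using m_inf_le[OF that] s(4) by (metis ereal_less_eq(3) order_trans)
   hence "dV s = 0" by (rule minimum_dV_0[OF s(1)])
   thus False using hint_degenerate_left[OF s(1) refl s(2,3) s(5) n] by simp
  qed
  \<comment> \<open>If \<open>m < m_b\<close>, then \<open>mu\<close> is itself a competitor for
    \<open>i_b\<close>. Otherwise \<open>alpha\<close> is a minimum of \<open>V\<close>, hence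
    critical, and the time to it is infinite.\<close>
  have gt: "ereal (l / 2) < hint f mu alpha b"
  proof (cases "m_inf a b f < m_b b f")
   case lt: True
   have "ibc c <= hint f mu (a_star a b f c mu) b"
    unfolding ibc_def using lt mu by (intro INF_lower) auto
   thus ?thesis using ib[rule_format, OF lt] alpha(5) by simp
  next
   case False
   have "hint f mu alpha c = \<infinity>"
    using inf[OF alpha(1) cI alpha(2)] False alpha(3,4) mu by simp
   moreover have "hint f mu alpha c <= hint f mu alpha b" using alphab by (intro hint_mono) auto
   ultimately show ?thesis by simp
  qed
  obtain u v where uv: "ereal alpha < ereal u" "u < v" "ereal v < b" "\<forall>\<^sub>F D in nhds mu. ereal (l / 2) < hint f D u v"
   by (rule hint_lsc[OF alphab(1) order_refl _ _ gt]) (use alphaV right_in_I[OF alpha(1)] l in "auto simp: zero_ereal_def")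
  have uv': "alpha < u" "v : I" using right_mem[OF alpha(1) _ uv(3)] uv by auto
  hence "u : I" using I_between[OF alpha(1) _, of v u] uv by auto
  note uv' = uv' this
  have uc: "{u..max u (max v c)} <= I" by (intro sub_I max_I uv' cI)
  have "\<forall>\<^sub>F D in nhds mu. ALL x:{u..max u (max v c)}. D < V x"
   by (rule V_lower_nhds) (use uc uv' alphaV in "auto simp: subset_iff")
  with uv(4) have "\<forall>\<^sub>F D in nhds mu. ereal (l / 2) < hint f D u v & (ALL x:{u..max u (max v c)}. D < V x)"
   by eventually_elim simp
  then obtain d where d: "0 < d" "!!D. dist D mu < d ==> ereal (l / 2) < hint f D u v & (ALL x:{u..max u (max v c)}. D < V x)"
   unfolding eventually_nhds_metric by blast
  obtain e where e: "0 < e" "m_inf a b f < m_b b f ==> ereal (l / 2 + e) < ibc c"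
  proof (cases "m_inf a b f < m_b b f")
   case True
   from ereal_dense2[OF ib[rule_format, OF True]] obtain z where "ereal (l / 2) < ereal z" "ereal z < ibc c" by blast
   thus thesis by (intro that[of "z - l / 2"]) auto
  next
   case False
   thus thesis by (intro that[of 1]) auto
  qed
  obtain v1 where v1: "v1 : I" "c <= v1" "hint f mu v1 b < ereal e"
   by (rule hint_tail_small[OF cI fin e(1) muV])
  show thesis
  proof (rule that[of "max v v1" d], goal_cases)
   case 4
   show ?case
   proof (intro ballI impI, elim conjE, goal_cases)
   case (1 t s)
   hence t: "t : I" "max v v1 < t" "V t < mu + d" and tx: "!!x. c <= x ==> x < t ==> V t < V x"
    and s: "s : I" "s < t" "V s <= V t" and sx: "!!x. s < x ==> x < t ==> V s < V x" by blast+
   have sc: "s < c" using tx[of s] s by force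
   have st: "a <= ereal s" "ereal t <= b" "ereal t < b" using s t by (auto simp: base_mem less_imp_le)
   \<comment> \<open>The first case uses the compact piece between \<open>u\<close> and
     \<open>v\<close>, the second is a critical minimum. In the third, \<open>s\<close> is the left
     turning point for the energy \<open>V s\<close> as seen from \<open>c\<close>, so the time from
     \<open>s\<close> to \<open>b\<close> exceeds \<open>l / 2 + e\<close>, and the tail beyond
     \<open>t\<close> is shorter than \<open>e\<close>.\<close>
   consider "mu <= V s" | "ereal (V s) <= m_inf a b f" | "V s < mu" "m_inf a b f < ereal (V s)" by force
   thus "ereal (l / 2) < hint f (V s) s t"
   proof cases
    case 1
    hence "dist (V s) mu < d" using s(3) t(3) by (auto simp: dist_real_def)
    note d2 = d(2)[OF this]
    have "s < u" using d2 sc by (intro not_le_imp_less notI) auto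
    hence "hint f (V s) u v <= hint f (V s) s t" using st t by (intro hint_mono) auto
    thus ?thesis using d2 by (auto intro: less_le_trans)
   next
    case 2
    thus ?thesis using inf[OF s(1) t(1) s(2) 2 sx] by simp
   next
    case 3
    have "ereal (V s) < m_b b f" using 3(1) mu by (metis less_ereal.simps(1))
    hence lt: "m_inf a b f < m_b b f" using 3(2) by (rule less_trans[rotated])
    have Vc: "V s < V c" using 3 muV[OF cI] by simp
    from cI Vc have as: "a_star a b f c (V s) = ereal s"
    proof (cases rule: a_star_cases)
     case (turn alpha')
     have "~ alpha' < s" using turn(4)[of s] sc by auto
     moreover have "~ s < alpha'" using sx[of alpha'] turn(2,3) t(2) v1(2) by auto
     ultimately show ?thesis using turn(5) by simp
    next
     case exit
     thus ?thesis using s sc by force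
    qed
    have "ibc c <= hint f (V s) (a_star a b f c (V s)) b"
     unfolding ibc_def using 3 by (intro INF_lower) (auto simp: mu_less_iff[OF mu])
    hence 1: "ereal (l / 2 + e) < hint f (V s) s b" using e(2)[OF lt] as by simp
    have 2: "hint f (V s) s b = hint f (V s) s t + hint f (V s) t b" by (rule hint_add) (use st s in auto)
    have "hint f (V s) t b <= hint f mu t b"
    proof (rule hint_mono_D)
     show "mu < V x" if "x : base_interval t b" for x
      using right_in_I[OF t(1) that] t(2) v1(2) by (intro muV) auto
    qed (use 3 I_bounds t in auto)
    also have "... <= hint f mu v1 b" using v1(1) t by (intro hint_mono) (auto simp: base_mem less_imp_le)
    finally have "hint f (V s) t b < ereal e" using v1(3) by simp
    thus ?thesis using 1 2 by (cases "hint f (V s) s t"; cases "hint f (V s) t b") auto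
   qed
   qed
  qed (use d v1 uv' in "auto intro!: max_I")
 qed
qed

text \<open>An \<open>l\<close> between \<open>2 d_b\<close> and both \<open>diam\<close> and, where
  it is defined, \<open>2 i_b\<close> leaves a gap for closed trajectories at a point
  \<open>t\<close> close to \<open>b\<close>: excursions to the right of \<open>t\<close> are
  shorter than \<open>l\<close>, those to the left longer, which is the situation of
  \<open>no_return\<close>.\<close>

lemma not_Cb_not_conn:
 assumes nC: "~ Cb diam c" and cl: "rel_min_b a b f --> close_b a b f c"
  and ne: "~ ((ALL x:I. m_inf a b f < ereal (V x)) & m_a a f = m_inf a b f & m_b b f = m_inf a b f)"
 obtains t l where "t : I" "0 < l" "ereal l < diam" "~ conn t t l"
proof -
 define H where "H D = hint f D c (b_star a b f c D)" for D
 have clo: "close_b a b f c" and fin: "hint f mu c b ~= \<infinity>" and dd: "2 * dbc c < diam"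
  and di: "m_inf a b f < m_b b f ==> dbc c < ibc c"
  using nC cl unfolding Cb_def by (auto simp: not_le)
 have cI: "c : I" by (rule close_bD(1)[OF clo])
 have cb: "a <= ereal c" "ereal c < b" using cI by (auto simp: base_mem less_imp_le)
 have mu: "ereal mu = m_b b f" by (rule mu_eq[OF cI close_bD(2)[OF clo cI order_refl]])
 have muV: "mu < V x" if "x : I" "c <= x" for x
  using close_bD(2)[OF clo that] by (simp add: mu_less_iff[OF mu])
 have muV': "mu < V x" if "x : base_interval c b" for x
  using right_in_I[OF cI that] by (intro muV) auto
 have "0 < hint f mu c b" by (rule hint_pos[OF cb(1) order_refl cb(2) muV'])
 then obtain h0 where h0: "hint f mu c b = ereal h0" "0 < h0" using fin by (cases "hint f mu c b") auto
 \<comment> \<open>This is \<open>d_b >= 0\<close>. It comes from energies below \<open>mu\<close>,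
   for which \<open>b_star\<close> is \<open>b\<close> and the integrals approach
   \<open>h0\<close>.\<close>
 have "ereal h0 <= Limsup (at mu) H"
 proof (rule ccontr)
  assume "~ ?thesis"
  hence "max 0 (Limsup (at mu) H) < ereal h0" using h0 by auto
  then obtain r where r: "max 0 (Limsup (at mu) H) < ereal r" "ereal r < hint f mu c b"
   using ereal_dense2 h0 by metis
  obtain u v where uv: "ereal c < ereal u" "u < v" "ereal v < b" "\<forall>\<^sub>F D in nhds mu. ereal r < hint f D u v"
   by (rule hint_lsc[OF cb(1) order_refl _ _ r(2)]) (use muV' r(1) in auto)
  have "\<forall>\<^sub>F D in at mu. H D < ereal r" using r(1) by (intro Limsup_lessD) auto
  hence "\<forall>\<^sub>F D in nhds mu. D ~= mu --> H D < ereal r" by (simp add: eventually_at_filter)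
  with uv(4) have "\<forall>\<^sub>F D in nhds mu. ereal r < hint f D u v & (D ~= mu --> H D < ereal r)"
   by eventually_elim simp
  then obtain d where d: "0 < d" "!!D. dist D mu < d ==> ereal r < hint f D u v & (D ~= mu --> H D < ereal r)"
   unfolding eventually_nhds_metric by blast
  define D where "D = mu - d / 2"
  have D: "D < mu" "dist D mu < d" using d(1) by (auto simp: D_def dist_real_def)
  have "H D = hint f D c b"
   unfolding H_def using D(1) muV by (subst b_star_eq_b[OF cI]) force+
  moreover have "hint f D u v <= hint f D c b" using cb uv by (intro hint_mono) auto
  ultimately show False using d(2)[OF D(2)] D(1) by auto
 qed
 moreover have dbc: "dbc c = Limsup (at mu) H - ereal h0" by (simp add: dbc_def H_def[abs_def] h0(1))
 moreover have "Limsup (at mu) H ~= \<infinity>" using dd dbc by auto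
 ultimately obtain delta where delta: "dbc c = ereal delta" "0 <= delta" "Limsup (at mu) H = ereal (delta + h0)"
  by (cases "Limsup (at mu) H") auto
 define K where "K = (if m_inf a b f < m_b b f then min diam (2 * ibc c) else diam)"
 have "2 * dbc c < 2 * ibc c" if "dbc c < ibc c" using that delta(1) by (cases "ibc c") auto
 hence "ereal (2 * delta) < K" using dd di delta(1) by (auto simp: K_def)
 then obtain l where l: "ereal (2 * delta) < ereal l" "ereal l < K" using ereal_dense2 by blast
 have l': "0 < l" "2 * delta < l" "ereal l < diam" using l delta(2) by (auto simp: K_def split: if_splits)
 have ib: "m_inf a b f < m_b b f --> ereal (l / 2) < ibc c"
  using l(2) by (cases "ibc c") (auto simp: K_def)
 obtain v d where vd: "v : I" "c <= v" "0 < d"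
  "ALL t:I. ALL s:I. v < t & V t < mu + d & (ALL x. c <= x & x < t --> V t < V x) &
   s < t & V s <= V t & (ALL x. s < x & x < t --> V s < V x) --> ereal (l / 2) < hint f (V s) s t"
  by (rule not_Cb_left[OF clo fin l'(1) ib ne]) (rule that)
 \<comment> \<open>Half of the gap between \<open>d_b\<close> and \<open>l / 2\<close>. One half
   absorbs the error in the limit superior, the other the tail of the integral at the energy
   \<open>mu\<close>.\<close>
 define gamma where "gamma = (l / 2 - delta) / 2"
 have gamma: "0 < gamma" "delta + h0 < h0 + l / 2 - gamma" using l'(2) by (auto simp: gamma_def field_simps)
 obtain v1 where v1: "v1 : I" "c <= v1" "hint f mu v1 b < ereal gamma"
  by (rule hint_tail_small[OF cI fin gamma(1) muV])
 define v' where "v' = max v v1"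
 have v': "v' : I" "c <= v'" "v <= v'" "v1 <= v'" using vd v1 by (auto simp: v'_def intro: max_I)
 have "\<forall>\<^sub>F D in at mu. H D < ereal (h0 + l / 2 - gamma)" using delta(3) gamma(2) by (intro Limsup_lessD) auto
 hence "\<forall>\<^sub>F D in nhds mu. D ~= mu --> H D < ereal (h0 + l / 2 - gamma)" by (simp add: eventually_at_filter)
 moreover have "\<forall>\<^sub>F D in nhds mu. ALL x:{c..v'}. D < V x"
  by (rule V_lower_nhds[OF v'(2) sub_I[OF cI v'(1)]]) (use muV sub_I[OF cI v'(1)] in auto)
 ultimately have "\<forall>\<^sub>F D in nhds mu. (D ~= mu --> H D < ereal (h0 + l / 2 - gamma)) & (ALL x:{c..v'}. D < V x)"
  by eventually_elim simp
 then obtain d' where d': "0 < d'"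
  "!!D. dist D mu < d' ==> (D ~= mu --> H D < ereal (h0 + l / 2 - gamma)) & (ALL x:{c..v'}. D < V x)"
  unfolding eventually_nhds_metric by blast
 have "m_b b f < ereal (mu + min d d')" using vd(3) d'(1) by (simp add: mu_less_iff[OF mu])
 then obtain x0 where x0: "v' < x0" "x0 : I" "ereal (V x0) < ereal (mu + min d d')"
  by (rule m_b_lessD[OF _ v'(1)])
 have x0mu: "mu < V x0" using x0(1,2) v'(2) by (intro muV) auto
 have win: "!!D. mu < D ==> D <= V x0 ==> H D < ereal (h0 + l / 2 - gamma) & (ALL x:{c..v'}. D < V x)"
  using d'(2) x0(3) by (auto simp: dist_real_def)
 have Vc: "V x0 < V c" using win[OF x0mu order_refl] v'(2) by auto
 \<comment> \<open>Passing from \<open>x0\<close> to the first point with the same value ensures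
   \<open>V > V t\<close> between \<open>c\<close> and \<open>t\<close>. So a turning point to the
   right of \<open>t\<close>, at an energy of at most \<open>V t\<close>, is also the turning point
   as seen from \<open>c\<close>, and \<open>H\<close> measures the time to it.\<close>
 from cI Vc obtain t where t: "t : I" "c < t" "V t = V x0" "!!s. c <= s ==> s < t ==> V x0 < V s"
   "b_star a b f c (V x0) = ereal t"
 proof (cases rule: b_star_cases)
  case (turn t)
  thus thesis using that by blast
 next
  case exit
  thus thesis using exit(1)[OF x0(2)] x0(1) v'(2) by simp
 qed
 have tv: "v' < t"
  using win[OF x0mu order_refl, THEN conjunct2, THEN bspec, of t] t(2,3) by (cases "t <= v'") auto
 have key: "hint f D t x < ereal (l / 2)" "hint f D c x ~= \<infinity>"
  if x: "x : I" "t <= x" "V x = D" "D <= V t" "!!s. t <= s ==> s < x ==> D < V s" for x D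
 proof -
  have Dmu: "mu < D" using muV[OF x(1)] x(2,3) t(2) by simp
  have "b_star a b f c D = ereal x"
  proof (rule b_star_eqI[OF cI x(1) _ x(3)])
   show "D < V s" if "c <= s" "s < x" for s using t(4)[of s] t(3) x(4) x(5)[of s] that by fastforce
  qed (use t x in auto)
  hence Hx: "hint f D c x < ereal (h0 + l / 2 - gamma)" using win[OF Dmu] x(4) t(3) by (simp add: H_def)
  have tx: "ereal t <= b" "ereal x <= b" using t(1) x(1) by (auto simp: base_mem less_imp_le)
  have 1: "hint f D c x = hint f D c t + hint f D t x" by (rule hint_add) (use cb t x tx in auto)
  have 2: "hint f mu c b = hint f mu c t + hint f mu t b" by (rule hint_add) (use cb t tx in auto)
  have "hint f mu t b <= hint f mu v1 b" using v1(1) tv v'(4) by (intro hint_mono) (auto simp: base_mem less_imp_le)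
  hence 3: "hint f mu t b < ereal gamma" using v1(3) by (rule le_less_trans)
  have 4: "hint f mu c t <= hint f D c t"
   by (rule hint_mono_D) (use cb tx Dmu t(3,4) x(4) in "auto simp: base_interval_def less_imp_le intro: le_less_trans")
  show "hint f D c x ~= \<infinity>" using Hx by auto
  show "hint f D t x < ereal (l / 2)"
   using Hx 1 2 3 4 h0(1)
   by (cases "hint f D c t"; cases "hint f D t x"; cases "hint f mu c t"; cases "hint f mu t b") auto
 qed
 have neg: "dV x < 0" if x: "x : I" "t <= x" "V x = D" "D <= V t" "!!s. t <= s ==> s < x ==> D < V s" for x D
 proof -
  have cx: "c < x" using x t by simp
  have DV: "D < V s" if "c < s" "s < x" for s using t(4)[of s] t(3) x(4) x(5)[of s] that by fastforce
  have "dV x <= 0" by (rule turning_deriv_le[OF x(1,3) cx DV])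
  moreover have "dV x ~= 0" using hint_degenerate_infinite[OF x(1,3) _ cI cx DV] key(2)[OF x] by auto
  ultimately show ?thesis by simp
 qed
 have "~ conn t t l"
 proof (rule no_return[OF t(1) _ l'(1)])
  show "dV t < 0" by (rule neg[OF t(1) order_refl refl order_refl]) simp
  fix x assume x: "x : I" "t < x" "V x < V t" "!!s. t < s ==> s < x ==> V x < V s"
  have x': "V x < V s" if "t <= s" "s < x" for s using x(3) x(4)[of s] that by (cases "s = t") auto
  show "hint f (V x) t x < ereal (l / 2) & dV x < 0"
   using key(1)[OF x(1) _ refl _ x'] neg[OF x(1) _ refl _ x'] x by auto
 next
  fix s assume s: "s : I" "s < t" "V s <= V t" "!!x. s < x ==> x < t ==> V s < V x"
  show "ereal (l / 2) < hint f (V s) s t"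
   using vd(4)[rule_format, OF t(1) s(1)] s tv v' t x0(3) by auto
 qed
 thus thesis using that t(1) l' by blast
qed

section \<open>Dependence of travel times on the energy\<close>

text \<open>The time of a direct passage is continuous in \<open>D\<close> and tends to 0 as
  \<open>D\<close> tends to minus infinity; the intermediate value theorem finds the energy that
  takes exactly \<open>l\<close>.\<close>

lemma direct_right:
 assumes t: "t0 : I" "t1 : I" "t0 < t1" and l: "0 < l" and V: "!!x. x : {t0..t1} ==> D0 < V x"
  and le: "ereal l <= hint f D0 t0 t1"
 obtains tau w where "sol {0..l} tau w" "tau 0 = t0" "tau l = t1" "V t0 - (w 0)\<^sup>2 <= D0"
proof -
 have tt: "t0 <= t1" "{t0..t1} <= I" using t sub_I by auto
 obtain D' where D': "!!D. D <= D' ==> hint f D t0 t1 <= ereal l" by (rule hint_small[OF tt l]) (rule that)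
 define D1 where "D1 = min D' D0"
 have "EX D>=D1. D <= D0 & hint f D t0 t1 = ereal l"
 proof (rule IVT')
  show "hint f D1 t0 t1 <= ereal l" by (rule D') (simp add: D1_def)
  show "continuous_on {D1..D0} (%D. hint f D t0 t1)"
   unfolding continuous_on_def
  proof (intro ballI)
   fix D assume "D : {D1..D0}"
   hence "((%D. hint f D t0 t1) \<longlongrightarrow> hint f D t0 t1) (nhds D)"
    using V by (intro hint_tendsto[OF tt]) force
   thus "((%D. hint f D t0 t1) \<longlongrightarrow> hint f D t0 t1) (at D within {D1..D0})"
    by (rule tendsto_mono[rotated]) (simp add: at_within_def inf.coboundedI1)
  qed
 qed (use le in "auto simp: D1_def")
 then obtain D where D: "D <= D0" "hint f D t0 t1 = ereal l" by blast
 define w0 where "w0 = sqrt (V t0 - D)"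
 have DV: "D < V x" if "x : {t0..t1}" for x using V[OF that] D(1) by simp
 have w0: "0 < w0" "V t0 - w0\<^sup>2 = D" using DV[of t0] t by (auto simp: w0_def)
 obtain tau w where S: "sol {0..l} tau w" "tau 0 = t0" "w 0 = w0"
  by (rule reach_right[OF t, of w0 l]) (use w0 DV D l in auto)
 have "tau l = t1"
  by (rule run_right_upto(4)[OF S(1) _ t(2)]) (use S w0 DV D l t in auto)
 thus thesis using that[OF S(1,2)] S w0 D by simp
qed

text \<open>Where \<open>V' <= - k\<close> and \<open>V <= M\<close>, the integrand
  \<open>V / sqrt (V - D)\<close> is at most \<open>M / k\<close> times
  \<open>- V' / sqrt (V - D)\<close>, whose antiderivative is a multiple of
  \<open>sqrt (V - D)\<close>. The bound is uniform in \<open>D\<close>, as is needed for continuity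
  of the time to a moving turning point.\<close>

lemma near_turn:
 assumes x: "x < beta" "{x..beta} <= I" "V beta = D" and k: "0 < k" and dV: "!!y. y : {x..beta} ==> dV y <= - k & V y <= M"
 shows "hint f D x beta <= ereal (2 * M / k * sqrt (V x - D))"
proof (rule ccontr)
 let ?B = "2 * M / k * sqrt (V x - D)"
 have VD: "D < V y" if "y : {x..<beta}" for y
 proof -
  have "V beta < V y"
  proof (rule DERIV_neg_imp_decreasing[where f = V])
   fix z assume "y <= z" "z <= beta"
   hence z: "z : {x..beta}" using that by auto
   hence "z : I" "dV z < 0" using x(2) dV[OF z] k by auto
   thus "EX d. (V has_real_derivative d) (at z) & d < 0" using V_deriv by blast
  qed (use that in auto)
  thus ?thesis using x by simp
 qed
 have "V x <= M" "0 < V x" using dV[of x] x V_pos[of x] by (auto simp: subset_iff)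
 hence M: "0 < M" by simp
 have "0 <= ?B" using M k VD[of x] x by simp
 assume "~ ?thesis"
 hence "ereal ?B < hint f D x beta" by simp
 moreover have "a <= ereal x" "ereal beta <= b" using x by (auto intro!: I_bounds)
 ultimately obtain u v where uv: "ereal x < ereal u" "u < v" "ereal v < ereal beta" "ereal ?B < hint f D u v"
  using hint_approx[of "ereal x" "ereal beta" "ereal ?B" D] \<open>0 <= ?B\<close> by auto
 hence xv: "x < v" "v < beta" "{x..v} <= I" using x(2) by auto
 have "hint f D u v <= hint f D x v"
  using uv xv by (intro hint_mono) (auto intro!: I_bounds)
 also have "... = ereal (integral {x..v} (h D))"
  by (rule hint_compact) (use xv VD in auto)
 finally have gt: "?B < integral {x..v} (h D)" using uv(4) by (meson less_ereal.simps(1) less_le_trans)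
 let ?F = "%y. - (2 * M / k) * sqrt (V y - D)"
 have "((%y. - (2 * M / k) * (dV y / (2 * sqrt (V y - D)))) has_integral (?F v - ?F x)) {x..v}"
 proof (rule fundamental_theorem_of_calculus)
  fix y assume y: "y : {x..v}"
  have "(?F has_real_derivative - (2 * M / k) * (dV y / (2 * sqrt (V y - D)))) (at y)"
   using VD[of y] V_deriv[of y] y xv k by (auto intro!: derivative_eq_intros simp: field_simps)
  thus "(?F has_vector_derivative - (2 * M / k) * (dV y / (2 * sqrt (V y - D)))) (at y within {x..v})"
   by (simp add: real_vector_derivative[symmetric] has_field_derivative_at_within)
 qed (use xv in simp)
 moreover have "(h D has_integral integral {x..v} (h D)) {x..v}"
  by (intro integrable_integral integrable_continuous_real h_continuous_on) (use xv VD in auto)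
 moreover have "h D y <= - (2 * M / k) * (dV y / (2 * sqrt (V y - D)))" if y: "y : {x..v}" for y
 proof -
  have d: "0 < sqrt (V y - D)" "V y <= M" "k <= - dV y" using VD[of y] dV[of y] y xv by auto
  have "V y * k <= M * (- dV y)" using d k M by (intro mult_mono) auto
  hence "V y / sqrt (V y - D) <= (M * (- dV y) / k) / sqrt (V y - D)"
   using d k by (intro divide_right_mono) (auto simp: field_simps)
  thus ?thesis by (simp add: h_def invsq_def field_simps)
 qed
 ultimately have "integral {x..v} (h D) <= ?F v - ?F x" using has_integral_le by blast
 also have "... <= ?B" using M k VD[of v] xv by simp
 finally show False using gt by simp
qed

section \<open>Oscillation between two turning points\<close>

lemma half_right:
 assumes S: "sol {0..l} tau w" and start: "0 < w 0 | w 0 = 0 & 0 < dV (tau 0)" and D: "V (tau 0) - (w 0)\<^sup>2 = D"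
  and beta: "beta : I" "tau 0 < beta" "V beta = D" "!!x. tau 0 < x ==> x < beta ==> D < V x"
  and R: "hint f D (tau 0) beta = ereal R" "R <= l"
 shows "0 <= R" "tau R = beta" "w R = 0" "dV beta < 0"
proof -
 show R0: "0 <= R" using hint_nonneg[of D "tau 0" beta] R by simp
 have I0: "tau 0 : I" using solD(1)[OF S, of 0] R R0 by simp
 show "tau R = beta"
  by (rule run_right_upto(4)[OF S start beta(1,2)]) (use R R0 D beta(4) in auto)
 thus "w R = 0" using sol_D[OF S, of R 0] R R0 D beta(3) by simp
 have "dV beta <= 0" by (rule turning_deriv_le[OF beta(1,3,2,4)])
 moreover have "dV beta ~= 0" using hint_degenerate_infinite[OF beta(1,3) _ I0 beta(2,4)] R by auto
 ultimately show "dV beta < 0" by simp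
qed

lemma half_left:
 assumes S: "sol {0..l} tau w" and start: "w 0 < 0 | w 0 = 0 & dV (tau 0) < 0" and D: "V (tau 0) - (w 0)\<^sup>2 = D"
  and alpha: "alpha : I" "alpha < tau 0" "V alpha = D" "!!x. alpha < x ==> x < tau 0 ==> D < V x"
  and L: "hint f D alpha (tau 0) = ereal L" "L <= l"
 shows "0 <= L" "tau L = alpha" "w L = 0" "0 < dV alpha"
proof -
 show L0: "0 <= L" using hint_nonneg[of D alpha "tau 0"] L by simp
 have I0: "tau 0 : I" using solD(1)[OF S, of 0] L L0 by simp
 show "tau L = alpha"
  by (rule run_left_upto(4)[OF S start alpha(1,2)]) (use L L0 D alpha(4) in auto)
 thus "w L = 0" using sol_D[OF S, of L 0] L L0 D alpha(3) by simp
 show "0 < dV alpha" by (rule hint_degenerate_left[OF alpha(1,3) I0 alpha(2,4)]) (use L in auto)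
qed

lemma sol_shift:
 assumes "sol {0..l} tau w" "0 <= c"
 shows "sol {0..l - c} (%y. tau (c + y)) (%y. w (c + y))"
proof -
 have "sol {0..l - c} (%y. tau (c + 1 * y)) (%y. 1 * w (c + 1 * y))"
  by (rule sol_affine[OF assms(1)]) (use assms(2) in auto)
 thus ?thesis by simp
qed

text \<open>The first rise and fall. Until the top at \<open>beta\<close> the trajectory is beyond
  \<open>s\<close> once the time to \<open>s\<close> has elapsed; on the way down it stays beyond
  \<open>s\<close> until it has covered the stretch from \<open>beta\<close> back to
  \<open>s\<close>.\<close>

lemma excursion0:
 fixes s :: real
 assumes S: "sol {0..l} tau w" and start: "0 < w 0 | w 0 = 0 & 0 < dV (tau 0)" and D: "V (tau 0) - (w 0)\<^sup>2 = D"
  and beta: "beta : I" "tau 0 < s" "s < beta" "V beta = D" "!!x. tau 0 < x ==> x < beta ==> D < V x" and l: "0 <= l"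
 shows "ereal l <= hint f D (tau 0) beta ==> s <= tau l \<longleftrightarrow> hint f D (tau 0) s <= ereal l"
  and "hint f D (tau 0) beta < ereal l ==> ereal l <= hint f D (tau 0) beta + hint f D alpha beta ==> alpha : I ==> alpha <= s ==>
   (!!x. alpha < x ==> x < beta ==> D < V x) ==> s <= tau l \<longleftrightarrow> ereal l <= hint f D (tau 0) beta + hint f D s beta"
proof -
 have I0: "tau 0 : I" using solD(1)[OF S, of 0] l by simp
 have beta0: "tau 0 < beta" using beta by simp
 have mono: "hint f D u v < hint f D u x & hint f D x v' < hint f D v v'"
  if "hint f D u v ~= \<infinity>" "hint f D x v' ~= \<infinity>" "u : I" "v' : I" "u <= v" "v < x" "x <= v'" "!!z. v < z ==> z < x ==> D < V z" for u v x v' :: real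
 proof -
  have "0 < hint f D v x" "hint f D u x = hint f D u v + hint f D v x" "hint f D v v' = hint f D v x + hint f D x v'"
   by (rule hint_pos hint_add; use that I_bounds[OF that(3)] I_bounds[OF that(4)] in
    \<open>auto simp: base_interval_def intro: order_trans[of a "ereal u"] order_trans[of _ "ereal v'" b]\<close>)+
  thus ?thesis using that(1,2)
   by (cases "hint f D v x"; cases "hint f D u v"; cases "hint f D x v'") auto
 qed
 show "s <= tau l \<longleftrightarrow> hint f D (tau 0) s <= ereal l" if le: "ereal l <= hint f D (tau 0) beta"
 proof -
  have r: "tau l : {tau 0..beta}" "hint f D (tau 0) (tau l) = ereal l"
   using run_right_upto(2,3)[OF S start beta(1) beta0, of l] D beta(5) l le by auto
  show ?thesis
  proof
   assume "s <= tau l"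
   hence "hint f D (tau 0) s <= hint f D (tau 0) (tau l)"
    using I0 solD(1)[OF S, of l] l by (intro hint_mono I_bounds) auto
   thus "hint f D (tau 0) s <= ereal l" using r(2) by simp
  next
   assume "hint f D (tau 0) s <= ereal l"
   thus "s <= tau l"
    using mono[of "tau 0" "tau l" s s] r I0 I_between[OF I0 beta(1), of s] beta by (intro leI notI) (auto simp: not_le[symmetric])
  qed
 qed
 show "s <= tau l \<longleftrightarrow> ereal l <= hint f D (tau 0) beta + hint f D s beta"
  if gt: "hint f D (tau 0) beta < ereal l" "ereal l <= hint f D (tau 0) beta + hint f D alpha beta" and alpha: "alpha : I" "alpha <= s"
   "!!x. alpha < x ==> x < beta ==> D < V x"
 proof -
  obtain R where R: "hint f D (tau 0) beta = ereal R" "R < l" using gt(1) hint_nonneg[of D "tau 0" beta]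
   by (cases "hint f D (tau 0) beta") auto
  note hr = half_right[OF S start D beta(1) beta0 beta(4,5) R(1) less_imp_le[OF R(2)]]
  have alphabeta: "alpha < beta" using alpha beta by simp
  have S2: "sol {0..l - R} (%y. tau (R + y)) (%y. w (R + y))" by (rule sol_shift[OF S hr(1)])
  have r: "tau l : {alpha..beta}" "hint f D (tau l) beta = ereal (l - R)"
   using run_left_upto(2,3)[OF S2 _ alpha(1), of "l - R"] hr R gt(2) alpha alphabeta beta(4)
   by (cases "hint f D alpha beta"; auto)+
  show ?thesis
  proof
   assume "s <= tau l"
   hence "hint f D (tau l) beta <= hint f D s beta"
    using I0 beta I_between[OF I0 beta(1), of s] by (intro hint_mono I_bounds) auto
   thus "ereal l <= hint f D (tau 0) beta + hint f D s beta" using r(2) R by (cases "hint f D s beta") auto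
  next
   assume "ereal l <= hint f D (tau 0) beta + hint f D s beta"
   hence le: "ereal (l - R) <= hint f D s beta" using R by (cases "hint f D s beta") auto
   have "hint f D s beta < hint f D (tau l) beta" if "tau l < s"
   proof -
    have "hint f D s beta <= hint f D (tau 0) beta" using I0 beta by (intro hint_mono I_bounds) auto
    hence "hint f D s beta ~= \<infinity>" using R by auto
    thus ?thesis
     using mono[of "tau l" "tau l" s beta] that r alpha beta R I_between[OF alpha(1) beta(1), of "tau l"] by auto
   qed
   thus "s <= tau l" using le r(2) by force
  qed
 qed
qed

text \<open>After rising to \<open>beta\<close> and falling to \<open>alpha\<close> the trajectory
  is at rest with \<open>V' > 0\<close>, which is again an admissible start for a rise. Both kinds
  of start are kept in one hypothesis, so that the lemma can be iterated.\<close>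

lemma period:
 assumes S: "sol {0..l} tau w" and start: "0 < w 0 | w 0 = 0 & 0 < dV (tau 0)" and D: "V (tau 0) - (w 0)\<^sup>2 = D"
  and beta: "beta : I" "tau 0 < beta" "V beta = D" and alpha: "alpha : I" "alpha <= tau 0" "V alpha = D" "!!x. alpha < x ==> x < beta ==> D < V x"
  and R: "hint f D (tau 0) beta = ereal R" "hint f D alpha beta = ereal W" "R + W <= l"
 shows "0 <= R" "0 <= W" "sol {0..l - (R + W)} (%y. tau (R + W + y)) (%y. w (R + W + y))"
  "tau (R + W) = alpha" "w (R + W) = 0" "0 < dV alpha"
proof -
 show W: "0 <= W" using hint_nonneg[of D alpha beta] R by simp
 have alphabeta: "alpha < beta" using alpha beta by simp
 note hr = half_right[OF S start D beta _ R(1)]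
 have hr: "0 <= R" "tau R = beta" "w R = 0" "dV beta < 0"
  by (rule hr; use alpha beta W R in simp)+
 have S2: "sol {0..l - R} (%y. tau (R + y)) (%y. w (R + y))" by (rule sol_shift[OF S hr(1)])
 have hl: "tau (R + W) = alpha" "w (R + W) = 0" "0 < dV alpha"
  by (rule half_left(2,3,4)[where L = W, OF S2 _ _ alpha(1) _ alpha(3)]; use hr alpha(4) beta(3) alphabeta R in simp)+
 show "0 <= R" "tau (R + W) = alpha" "w (R + W) = 0" "0 < dV alpha" by (fact hr hl)+
 show "sol {0..l - (R + W)} (%y. tau (R + W + y)) (%y. w (R + W + y))"
  using sol_shift[OF S, of "R + W"] hr W by simp
qed

text \<open>The times at which a trajectory that starts rising from \<open>x\<close> passes
  \<open>s\<close> upwards (\<open>T_in\<close>) and downwards (\<open>T_out\<close>) in its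
  excursion number \<open>k\<close>, counted from 0; \<open>hint f D alpha beta\<close> is half a
  period. For \<open>k = 0\<close> the way up begins at \<open>x\<close> instead of
  \<open>alpha\<close>.\<close>

definition T_in :: "real => real => real => real => real => nat => ereal" where
 "T_in D alpha beta x s k = (if k = 0 then hint f D x s
  else hint f D x beta + ereal (2 * real k - 1) * hint f D alpha beta + hint f D alpha s)"

definition T_out :: "real => real => real => real => real => nat => ereal" where
 "T_out D alpha beta x s k = hint f D x beta + ereal (2 * real k) * hint f D alpha beta + hint f D s beta"

text \<open>Induction on the number of completed periods: restarting at \<open>alpha\<close>
  shortens \<open>l\<close> and both passage times by the same amount, and lowers \<open>k\<close>
  by one.\<close>

lemma excursion:
 assumes "sol {0..l} tau w" "0 < w 0 | w 0 = 0 & 0 < dV (tau 0)" "V (tau 0) - (w 0)\<^sup>2 = D" "0 <= l"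
  and "alpha <= tau 0" "tau 0 < s"
  and beta: "beta : I" "s < beta" "V beta = D" and alpha: "alpha : I" "V alpha = D" "!!x. alpha < x ==> x < beta ==> D < V x"
 shows "T_in D alpha beta (tau 0) s k <= ereal l ==> ereal l <= T_out D alpha beta (tau 0) s k ==> s <= tau l"
 using assms(1-6)
proof (induction k arbitrary: tau w l)
 case 0
 have taubeta: "tau 0 < beta" using 0 beta by simp
 have VD: "D < V x" if "tau 0 < x" "x < beta" for x using alpha(3)[of x] 0(7) that by simp
 note e0 = excursion0[OF 0(3,4,5) beta(1) 0(8) beta(2,3) VD 0(6)]
 show ?case
 proof (cases "ereal l <= hint f D (tau 0) beta")
  case True
  thus ?thesis using e0(1)[OF _ _ True] 0(1) by (simp add: T_in_def)
 next
  case False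
  have le: "ereal l <= hint f D (tau 0) beta + hint f D s beta" using 0(2) by (simp add: T_out_def zero_ereal_def[symmetric])
  have "hint f D s beta <= hint f D alpha beta" using alpha beta 0(7,8) by (intro hint_mono I_bounds) auto
  hence le': "ereal l <= hint f D (tau 0) beta + hint f D alpha beta"
   using le by (meson add_left_mono order_trans)
  show ?thesis using e0(2)[of alpha] False le le' alpha 0(7,8) by simp
 qed
next
 case (Suc k)
 have taubeta: "tau 0 < beta" using Suc.prems beta by simp
 have W0: "0 < hint f D alpha beta" using alpha beta Suc.prems(7,8) by (intro hint_pos I_bounds) (auto simp: base_interval_def)
 have "hint f D (tau 0) beta + ereal (2 * real k + 1) * hint f D alpha beta + hint f D alpha s <= ereal l"
  using Suc.prems(1) by (simp add: T_in_def algebra_simps)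
 then obtain R W h where R: "hint f D (tau 0) beta = ereal R" "hint f D alpha beta = ereal W" "hint f D alpha s = ereal h"
  "R + (2 * real k + 1) * W + h <= l" "0 <= h" "0 < W"
  using W0 hint_nonneg[of D "tau 0" beta] hint_nonneg[of D alpha s]
  by (cases "hint f D (tau 0) beta"; cases "hint f D alpha beta"; cases "hint f D alpha s") (auto split: if_splits)
 have "R + (2 * real k + 1) * W + h = R + W + h + 2 * (real k * W)" by (simp add: algebra_simps)
 moreover have "0 <= real k * W" using R by simp
 ultimately have RW: "R + W <= l" using R(4,5) by linarith
 note p = period[OF Suc.prems(3,4,5) beta(1) taubeta beta(3) alpha(1) Suc.prems(7) alpha(2,3) R(1,2) RW]
 have "s <= tau (R + W + (l - (R + W)))"
 proof (rule Suc.IH[where tau = "%y. tau (R + W + y)" and w = "%y. w (R + W + y)" and l = "l - (R + W)"])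
  show "T_in D alpha beta (tau (R + W + 0)) s k <= ereal (l - (R + W))"
   using R p by (auto simp: T_in_def algebra_simps)
  show "ereal (l - (R + W)) <= T_out D alpha beta (tau (R + W + 0)) s k"
   using R p Suc.prems(2) by (cases "hint f D s beta") (auto simp: T_out_def algebra_simps)
 qed (use p alpha beta Suc.prems RW in auto)
 thus ?case by simp
qed

text \<open>Each half period lasts at least \<open>c\<close>, so \<open>N\<close> bounds the number
  of periods that fit into \<open>l\<close>; this makes the induction on \<open>N\<close>
  end.\<close>

lemma excursion_conv:
 assumes c: "0 < c" "ereal c <= hint f D alpha beta" and beta: "beta : I" "s < beta" "V beta = D"
  and alpha: "alpha : I" "V alpha = D" "!!x. alpha < x ==> x < beta ==> D < V x"
 shows "sol {0..l} tau w ==> 0 < w 0 | w 0 = 0 & 0 < dV (tau 0) ==> V (tau 0) - (w 0)\<^sup>2 = D ==> 0 <= l ==>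
  alpha <= tau 0 ==> tau 0 < s ==> s <= tau l ==> l < real N * c ==>
  EX k. T_in D alpha beta (tau 0) s k <= ereal l & ereal l <= T_out D alpha beta (tau 0) s k"
proof (induction N arbitrary: tau w l)
 case (Suc N)
 have taubeta: "tau 0 < beta" using Suc.prems beta by simp
 have VD: "D < V x" if "tau 0 < x" "x < beta" for x using alpha(3)[of x] Suc.prems(5) that by simp
 note e0 = excursion0[OF Suc.prems(1,2,3) beta(1) Suc.prems(6) beta(2,3) VD Suc.prems(4)]
 show ?case
 proof (cases "ereal l <= hint f D (tau 0) beta")
  case True
  have "hint f D (tau 0) beta <= hint f D (tau 0) beta + hint f D s beta" by (simp add: ereal_le_add_self)
  thus ?thesis
   using e0(1)[OF _ _ True] Suc.prems(7) True
   by (intro exI[of _ 0]) (auto simp: T_in_def T_out_def zero_ereal_def[symmetric] intro: order_trans)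
 next
  case lt: False
  then obtain R where R: "hint f D (tau 0) beta = ereal R" "R < l" "0 <= R"
   using hint_nonneg[of D "tau 0" beta] by (cases "hint f D (tau 0) beta") auto
  show ?thesis
  proof (cases "ereal l <= hint f D (tau 0) beta + hint f D alpha beta")
   case True
   have "ereal l <= hint f D (tau 0) beta + hint f D s beta"
    using e0(2)[of alpha] lt True alpha Suc.prems by simp
   moreover have "hint f D (tau 0) s <= hint f D (tau 0) beta"
    using solD(1)[OF Suc.prems(1), of 0] Suc.prems(4) beta by (intro hint_mono I_bounds) auto
   ultimately show ?thesis
    using lt by (intro exI[of _ 0]) (auto simp: T_in_def T_out_def zero_ereal_def[symmetric])
  next
   case False
   then obtain W where W: "hint f D alpha beta = ereal W" "R + W < l"
    using R c by (cases "hint f D alpha beta") auto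
   note p = period[OF Suc.prems(1,2,3) beta(1) taubeta beta(3) alpha(1) Suc.prems(5) alpha(2,3) R(1) W(1) less_imp_le[OF W(2)]]
   have "EX k. T_in D alpha beta (tau (R + W + 0)) s k <= ereal (l - (R + W)) &
    ereal (l - (R + W)) <= T_out D alpha beta (tau (R + W + 0)) s k"
   proof (rule Suc.IH[where tau = "%y. tau (R + W + y)" and w = "%y. w (R + W + y)" and l = "l - (R + W)"])
    show "l - (R + W) < real N * c" using Suc.prems(8) R W c by (simp add: algebra_simps)
    show "tau (R + W + 0) < s" using p Suc.prems by simp
   qed (use p W alpha Suc.prems in auto)
   then obtain k where k: "T_in D alpha beta alpha s k <= ereal (l - (R + W))" "ereal (l - (R + W)) <= T_out D alpha beta alpha s k"
    using p by auto
   have "T_in D alpha beta (tau 0) s (Suc k) <= ereal l"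
    using k(1) R W by (cases "k = 0"; cases "hint f D alpha s") (auto simp: T_in_def algebra_simps)
   moreover have "ereal l <= T_out D alpha beta (tau 0) s (Suc k)"
    using k(2) R W by (cases "hint f D s beta") (auto simp: T_out_def algebra_simps)
   ultimately show ?thesis by blast
  qed
 qed
qed simp

end

subsection \<open>Trajectories oscillating between the ends\<close>

text \<open>The situation in which Condition (R) is meaningful: \<open>V\<close> tends to its
  unattained infimum along both ends, so every energy above \<open>m\<close> and below
  \<open>V t\<close> has a turning point on each side of \<open>t\<close>.\<close>

locale well = warp a b f for a b :: ereal and f :: "real => real" +
 fixes m :: real
 assumes mV: "x : base_interval a b ==> m < invsq f x"
  and mb: "m_b b f = ereal m" and ma: "m_a a f = ereal m"
begin

lemma well_reflect: "well (- b) (- a) (mirror f) m"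
proof -
 interpret R: warp "- b" "- a" "mirror f" by (rule warp_reflect)
 show ?thesis
  by unfold_locales (use mV ma mb m_a_reflect[of a f] m_a_reflect[of "- b" "mirror f"]
   in "auto simp: I_reflect invsq_reflect")
qed

lemma m_inf_eq: "m_inf a b f = ereal m"
 using m_inf_le_m_b mb mV by (intro antisym m_inf_ge) (auto simp: less_imp_le)

lemma turning:
 assumes t: "t : I" "m < D" "D < V t"
 obtains alpha beta where "alpha : I" "beta : I" "alpha < t" "t < beta" "V alpha = D" "V beta = D"
  "!!s. alpha < s ==> s < beta ==> D < V s" "b_star a b f t D = ereal beta" "a_star a b f t D = ereal alpha"
proof -
 have right: "EX beta:base_interval a b. t < beta & invsq f beta = D & (ALL s. t <= s & s < beta --> D < invsq f s) & b_star a b f t D = ereal beta"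
  if W: "warp a b f" and mb: "m_b b f = ereal m" and t: "t : base_interval a b" "D < invsq f t" for a b f t
 proof -
  interpret W: warp a b f by (rule W)
  from t show ?thesis
  proof (cases rule: W.b_star_cases)
   case exit
   have "m_b b f < ereal D" using mb assms(2) by simp
   then obtain x where "t < x" "x : W.I" "ereal (invsq f x) < ereal D" by (rule W.m_b_lessD[OF _ t(1)])
   thus ?thesis using exit(1)[of x] by simp
  qed blast
 qed
 obtain beta where beta: "beta : I" "t < beta" "V beta = D" "ALL s. t <= s & s < beta --> D < V s" "b_star a b f t D = ereal beta"
  using right[OF warp_axioms mb t(1,3)] by blast
 obtain alpha' where alpha': "alpha' : base_interval (- b) (- a)" "- t < alpha'" "invsq (mirror f) alpha' = D"
  "ALL s. - t <= s & s < alpha' --> D < invsq (mirror f) s" "b_star (- b) (- a) (mirror f) (- t) D = ereal alpha'"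
  using right[OF warp_reflect, of "- t"] ma t by (auto simp: m_a_reflect[symmetric] I_reflect invsq_reflect)
 show thesis
 proof (rule that[of "- alpha'" beta])
  show "D < V s" if "- alpha' < s" "s < beta" for s
   using beta(4)[rule_format, of s] alpha'(4)[rule_format, of "- s"] that by (cases "t <= s") (auto simp: invsq_reflect)
  show "a_star a b f t D = ereal (- alpha')" using a_star_reflect[OF t(1), of D] alpha'(5) by simp
 qed (use beta alpha' in "auto simp: I_reflect invsq_reflect")
qed

text \<open>Continuity in the extended reals, the value infinity included. The lower estimate needs
  only a compact part of the way. For the upper one the limit is finite, so the turning point is not
  critical, and \<open>near_turn\<close> controls the rest of the way uniformly.\<close>

lemma R_cont:
 assumes t: "t : I" "m < D0" "D0 < V t"
 shows "((%D. hint f D t (b_star a b f t D)) \<longlongrightarrow> hint f D0 t (b_star a b f t D0)) (nhds D0)"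
proof -
 obtain alpha beta where beta: "alpha : I" "beta : I" "alpha < t" "t < beta" "V alpha = D0" "V beta = D0"
  "!!s. alpha < s ==> s < beta ==> D0 < V s" "b_star a b f t D0 = ereal beta" "a_star a b f t D0 = ereal alpha"
  by (rule turning[OF t]) (rule that)
 have Db: "a <= ereal t" "ereal beta <= b" using t beta by (auto intro!: I_bounds)
 have evm: "\<forall>\<^sub>F D in nhds D0. D : {m<..}" by (rule eventually_nhds_in_open) (use t in auto)
 have sub: "{t..v} <= I" if "v < beta" for v using sub_I[OF t(1) beta(2)] that by auto
 have evV: "\<forall>\<^sub>F D in nhds D0. ALL x:{t..v}. D < V x" if "t <= v" "v < beta" for v
  by (rule V_lower_nhds[OF that(1) sub[OF that(2)]]) (use that beta in auto)
 show ?thesis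
  unfolding beta(8)
 proof (rule order_tendstoI)
  fix r assume r: "r < hint f D0 t beta"
  have "max 0 r < hint f D0 t beta"
   using r hint_pos[OF Db, of D0] beta by (auto simp: base_interval_def)
  then obtain u v where uv: "ereal t < ereal u" "u < v" "ereal v < ereal beta" "\<forall>\<^sub>F D in nhds D0. max 0 r < hint f D u v"
   by (rule hint_lsc[OF Db _ _ , rotated 2]) (use beta in "auto simp: base_interval_def")
  have tv: "t <= v" "v < beta" using uv by auto
  show "\<forall>\<^sub>F D in nhds D0. r < hint f D t (b_star a b f t D)"
   using uv(4) evm evV[OF tv]
  proof (eventually_elim)
   case (elim D)
   have Dt: "m < D" "D < V t" using elim uv by auto
   from t(1) Dt obtain beta' where beta': "beta' : I" "t < beta'" "V beta' = D" "b_star a b f t D = ereal beta'"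
    by (rule turning) (rule that; assumption)
   have "v < beta'" using elim(3) beta'(2,3) by (cases "beta' <= v") auto
   hence "hint f D u v <= hint f D t beta'" using uv t beta' by (intro hint_mono I_bounds) auto
   thus ?case using elim(1) beta'(4) by auto
  qed
 next
  fix r assume "hint f D0 t beta < r"
  then obtain r' where r': "hint f D0 t beta < ereal r'" "ereal r' < r" using ereal_dense2 by blast
  then obtain R0 where R0: "hint f D0 t beta = ereal R0" "R0 < r'"
   using hint_nonneg[of D0 t beta] by (cases "hint f D0 t beta") auto
  define e where "e = (r' - R0) / 2"
  have e: "0 < e" "R0 + e + e = r'" using R0 by (auto simp: e_def field_simps)
  have VD: "D0 < V s" if "t < s" "s < beta" for s using beta that by simp
  have "dV beta <= 0" by (rule turning_deriv_le[OF beta(2,6,4) VD])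
  moreover have "dV beta ~= 0" using hint_degenerate_infinite[OF beta(2,6) _ t(1) beta(4) VD] R0 by auto
  ultimately have dV: "dV beta < 0" by simp
  define k M where "k = - dV beta / 2" and "M = V beta + 1"
  have k: "0 < k" "dV beta < - k" using dV by (auto simp: k_def)
  have oI: "open I" by (rule open_base_interval)
  have cV: "(V \<longlongrightarrow> V beta) (nhds beta)" "(dV \<longlongrightarrow> dV beta) (nhds beta)"
   using V_cont[OF order_refl] dV_cont[OF order_refl] beta(2) oI
   by (auto simp: continuous_on_eq_continuous_at isCont_def tendsto_at_iff_tendsto_nhds)
  have "((%y. 2 * M / k * sqrt (V y - D0)) \<longlongrightarrow> 2 * M / k * sqrt (V beta - D0)) (nhds beta)"
   by (intro tendsto_intros cV)
  hence "\<forall>\<^sub>F y in nhds beta. 2 * M / k * sqrt (V y - D0) < e"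
   by (rule order_tendstoD) (use e beta(6) in simp)
  moreover have "\<forall>\<^sub>F y in nhds beta. dV y < - k" by (rule order_tendstoD(2)[OF cV(2) k(2)])
  moreover have "\<forall>\<^sub>F y in nhds beta. V y < M" by (rule order_tendstoD(2)[OF cV(1)]) (simp add: M_def)
  moreover have "\<forall>\<^sub>F y in nhds beta. y : I" by (rule eventually_nhds_in_open[OF oI beta(2)])
  ultimately have "\<forall>\<^sub>F y in nhds beta. 2 * M / k * sqrt (V y - D0) < e & dV y < - k & V y < M & y : I"
   by eventually_elim simp
  then obtain d where d: "0 < d" "!!y. dist y beta < d ==> 2 * M / k * sqrt (V y - D0) < e & dV y < - k & V y < M & y : I"
   unfolding eventually_nhds_metric by blast
  define x v where "x = max ((t + beta) / 2) (beta - d / 2)" and "v = beta + d / 2"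
  have x: "t < x" "x < beta" "beta < v" using beta(4) d(1) by (auto simp: x_def v_def less_max_iff_disj)
  have near: "2 * M / k * sqrt (V y - D0) < e & dV y < - k & V y < M & y : I" if "y : {x..v}" for y
   using that d(1) by (intro d(2)) (auto simp: dist_real_def x_def v_def abs_le_iff)
  \<comment> \<open>A value of \<open>V\<close> below \<open>D0\<close> just beyond
    \<open>beta\<close> traps the turning points of all nearby energies between \<open>x\<close> and
    \<open>v\<close>, where the bounds on \<open>V\<close> and \<open>V'\<close> hold.\<close>
  have "V v < V beta"
  proof (rule DERIV_neg_imp_decreasing[OF x(3)])
   fix y assume "beta <= y" "y <= v"
   thus "EX d. (V has_real_derivative d) (at y) & d < 0"
    using near[of y] x k V_deriv[of y] by (intro exI[of _ "dV y"]) auto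
  qed
  hence "\<forall>\<^sub>F D in nhds D0. D : {V v<..}" by (intro eventually_nhds_in_open) (use beta in auto)
  moreover have "((%D. hint f D t x) \<longlongrightarrow> hint f D0 t x) (nhds D0)"
   by (rule hint_tendsto) (use x sub beta in auto)
  hence "\<forall>\<^sub>F D in nhds D0. hint f D t x < ereal (R0 + e)"
  proof (rule order_tendstoD)
   have "hint f D0 t x <= hint f D0 t beta" using Db x by (intro hint_mono) auto
   also have "... < ereal (R0 + e)" using R0 e by simp
   finally show "hint f D0 t x < ereal (R0 + e)" .
  qed
  moreover have "((%D. 2 * M / k * sqrt (V x - D)) \<longlongrightarrow> 2 * M / k * sqrt (V x - D0)) (nhds D0)"
   by (intro tendsto_intros filterlim_ident)
  hence "\<forall>\<^sub>F D in nhds D0. 2 * M / k * sqrt (V x - D) < e"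
   by (rule order_tendstoD) (use near[of x] x in auto)
  ultimately show "\<forall>\<^sub>F D in nhds D0. hint f D t (b_star a b f t D) < r"
   using evm evV[OF less_imp_le[OF x(1)] x(2)]
  proof eventually_elim
   case (elim D)
   have Dt: "m < D" "D < V t" using elim x by auto
   from t(1) Dt obtain alpha' beta' where beta': "alpha' < t" "beta' : I" "t < beta'" "V beta' = D" "b_star a b f t D = ereal beta'"
    "!!s. alpha' < s ==> s < beta' ==> D < V s"
    by (rule turning) (rule that; assumption)
   have xbeta: "x < beta'" using elim(5) beta'(3,4) by (cases "beta' <= x") auto
   have betav: "beta' <= v" using beta'(6)[of v] beta'(1) elim(1) x by (cases "v < beta'") auto
   have "hint f D x beta' <= ereal (2 * M / k * sqrt (V x - D))"
    by (rule near_turn[OF xbeta _ beta'(4) k(1)]) (use near betav in "auto simp: less_imp_le")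
   also have "... < ereal e" using elim(3) by simp
   finally have "hint f D x beta' < ereal e" .
   moreover have "hint f D t beta' = hint f D t x + hint f D x beta'"
    by (rule hint_add) (use t beta' x xbeta in "auto intro!: I_bounds")
   ultimately have "hint f D t beta' < ereal r'" using elim(2) e(2)
    by (cases "hint f D t x"; cases "hint f D x beta'") auto
   thus ?case using beta'(5) r'(2) by simp
  qed
 qed
qed

lemma L_cont:
 assumes t: "t : I" "m < D0" "D0 < V t"
 shows "((%D. hint f D (a_star a b f t D) t) \<longlongrightarrow> hint f D0 (a_star a b f t D0) t) (nhds D0)"
proof -
 interpret R: well "- b" "- a" "mirror f" m by (rule well_reflect)
 have "((%D. hint (mirror f) D (- t) (b_star (- b) (- a) (mirror f) (- t) D)) \<longlongrightarrow>
   hint (mirror f) D0 (- t) (b_star (- b) (- a) (mirror f) (- t) D0)) (nhds D0)"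
  using R.R_cont[of "- t" D0] t by (simp add: I_reflect invsq_reflect)
 moreover have "\<forall>\<^sub>F D in nhds D0. D : {..<V t}" by (rule eventually_nhds_in_open) (use t in auto)
 hence "\<forall>\<^sub>F D in nhds D0. hint f D (a_star a b f t D) t
   = hint (mirror f) D (- t) (b_star (- b) (- a) (mirror f) (- t) D)"
  by eventually_elim (use hint_reflect'(1)[OF t(1)] in simp)
 ultimately show ?thesis
  unfolding hint_reflect'(1)[OF t(1,3)] by (subst tendsto_cong) auto
qed

text \<open>The expressions under the limits in \<open>r_i\<close> and, below, \<open>r_s\<close>.
  They are the times of arrival beyond \<open>s\<close> and of departure after \<open>n\<close>
  turns; for odd \<open>n\<close> the trajectory starts by falling.\<close>

definition rT :: "real => nat => real => real => ereal" where
 "rT t n s D = (if n = 0 then hint f D t s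
  else E_int a b f t n D + ereal (real n - 1) * W_int a b f t D + hint f D (a_star a b f t D) s)"

definition rS :: "real => nat => real => real => ereal" where
 "rS t n s D = E_int a b f t n D + ereal (real n) * W_int a b f t D + hint f D s (b_star a b f t D)"

text \<open>The moving limit \<open>a_star\<close> is split off at \<open>t\<close>, where
  \<open>L_cont\<close> applies. The summands are nonnegative, so their limits may be added in the
  extended reals.\<close>

lemma rT_cont:
 assumes t: "t : I" "s : I" "t < s" and D0: "m < D0" "!!x. x : {t..s} ==> D0 < V x"
 shows "((%D. rT t n s D) \<longlongrightarrow> rT t n s D0) (nhds D0)"
proof -
 have st: "t <= s" "{t..s} <= I" using t sub_I by auto
 have hs: "((%D. hint f D t s) \<longlongrightarrow> hint f D0 t s) (nhds D0)" by (rule hint_tendsto[OF st D0(2)])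
 have D0t: "D0 < V t" using D0(2) t by simp
 note R = R_cont[OF t(1) D0(1) D0t] and L = L_cont[OF t(1) D0(1) D0t]
 have nn: "hint f D u v ~= - \<infinity>" for D u v using hint_nonneg[of D u v] by (cases "hint f D u v") auto
 have W: "((%D. W_int a b f t D) \<longlongrightarrow> W_int a b f t D0) (nhds D0)"
  unfolding W_int_def R_int_def L_int_def by (rule tendsto_add_ereal_nonneg[OF nn nn L R])
 have W0: "0 <= W_int a b f t D" for D by (simp add: W_int_def R_int_def L_int_def)
 have E: "((%D. E_int a b f t n D) \<longlongrightarrow> E_int a b f t n D0) (nhds D0)"
  unfolding E_int_def R_int_def L_int_def using R L by simp
 have E0: "0 <= E_int a b f t n D" for D by (simp add: E_int_def R_int_def L_int_def)
 have split: "hint f D (a_star a b f t D) s = hint f D (a_star a b f t D) t + hint f D t s"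
  if Dt: "m < D" "D < V t" for D
 proof -
  from t(1) Dt obtain alpha where "alpha : I" "alpha < t" "a_star a b f t D = ereal alpha"
   by (rule turning) (rule that; assumption)
  thus ?thesis using hint_add[of "ereal alpha" "ereal s" t D] t by (auto intro!: I_bounds)
 qed
 have "\<forall>\<^sub>F D in nhds D0. D : {m<..<V t}" by (rule eventually_nhds_in_open) (use D0 D0t in auto)
 hence ev: "\<forall>\<^sub>F D in nhds D0. hint f D (a_star a b f t D) s = hint f D (a_star a b f t D) t + hint f D t s"
  by eventually_elim (use split in simp)
 have as: "((%D. hint f D (a_star a b f t D) s) \<longlongrightarrow> hint f D0 (a_star a b f t D0) s) (nhds D0)"
  unfolding split[OF D0(1) D0t] by (subst tendsto_cong[OF ev]) (rule tendsto_add_ereal_nonneg[OF nn nn L hs])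
 have nW: "ereal (real n - 1) * W_int a b f t D0 ~= - \<infinity>" if "n ~= 0"
 proof -
  have "0 <= ereal (real n - 1) * W_int a b f t D0" using W0 that by (intro ereal_0_le_mult) (auto simp: zero_ereal_def)
  thus ?thesis by auto
 qed
 show ?thesis
 proof (cases "n = 0")
  case False
  have E1: "E_int a b f t n D0 ~= - \<infinity>" using E0[of D0] by auto
  have "((%D. E_int a b f t n D + ereal (real n - 1) * W_int a b f t D + hint f D (a_star a b f t D) s) \<longlongrightarrow>
   E_int a b f t n D0 + ereal (real n - 1) * W_int a b f t D0 + hint f D0 (a_star a b f t D0) s) (nhds D0)"
   using nW[OF False] E1
   by (intro tendsto_add_ereal_nonneg E as nn tendsto_cmult_ereal W)
    (auto simp: plus_ereal.simps ereal_plus_eq_MInfty)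
  thus ?thesis using False by (simp add: rT_def)
 qed (simp add: rT_def hs)
qed

lemma rTS_eq:
 assumes bs: "b_star a b f t D = ereal beta" "a_star a b f t D = ereal alpha"
  and I: "alpha : I" "beta : I" "alpha < t" "t < beta"
 shows "rT t (2 * k) s D = T_in D alpha beta t s k" "rS t (2 * k) s D = T_out D alpha beta t s k"
  "rT t (Suc (2 * k)) s D = hint f D alpha t + T_in D alpha beta alpha s k"
  "rS t (Suc (2 * k)) s D = hint f D alpha t + T_out D alpha beta alpha s k"
proof -
 have W: "W_int a b f t D = hint f D alpha beta"
  unfolding W_int_def L_int_def R_int_def bs
  by (rule hint_add[symmetric]) (use I in "auto intro!: I_bounds")
 have nn: "0 <= hint f D alpha beta" "0 <= hint f D alpha t" "0 <= hint f D alpha s" "0 <= hint f D s beta" by simp_all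
 show "rT t (2 * k) s D = T_in D alpha beta t s k" "rS t (2 * k) s D = T_out D alpha beta t s k"
  by (simp_all add: rT_def rS_def T_in_def T_out_def E_int_def R_int_def W bs)
 show "rT t (Suc (2 * k)) s D = hint f D alpha t + T_in D alpha beta alpha s k"
  using nn unfolding rT_def T_in_def E_int_def L_int_def W bs
  by (cases "hint f D alpha beta"; cases "hint f D alpha t"; cases "hint f D alpha s"; cases "k = 0")
   (auto simp: algebra_simps zero_ereal_def[symmetric])
 show "rS t (Suc (2 * k)) s D = hint f D alpha t + T_out D alpha beta alpha s k"
  using nn unfolding rS_def T_out_def E_int_def L_int_def W bs
  by (cases "hint f D alpha beta"; cases "hint f D alpha t"; cases "hint f D s beta"; cases "k = 0")
   (auto simp: algebra_simps zero_ereal_def[symmetric])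
qed

text \<open>The bound on the energy keeps the trajectory between two turning points; this is what
  lets \<open>conn_between\<close> join two such trajectories by a continuous family.\<close>

definition reach :: "real => real => real => bool" where
 "reach t l s \<longleftrightarrow> (EX tau w. sol {0..l} tau w & tau 0 = t & s <= tau l & m < V t - (w 0)\<^sup>2)"

lemma confined:
 assumes S: "sol {0..l} tau w" and y: "y : {0..l}" and D: "V (tau 0) - (w 0)\<^sup>2 = D"
  and "alpha < tau 0" "tau 0 < beta" "V alpha = D" "V beta = D"
 shows "tau y : {alpha..beta}"
proof -
 have Sy: "sol {0..y} tau w" by (rule sol_subset[OF S]) (use y in auto)
 have "~ beta < tau y" using sol_cross(1)[OF Sy, of 0 beta] y D assms(5,7) by auto
 moreover have "~ tau y < alpha" using sol_cross_left(1)[OF Sy, of 0 alpha] y D assms(4,6) by auto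
 ultimately show ?thesis by auto
qed

text \<open>For even \<open>n\<close> the start is a rise and excursion \<open>n / 2\<close> is the
  one beyond \<open>s\<close>. For odd \<open>n\<close> the start is a fall to \<open>alpha\<close>,
  from where excursions are counted anew.\<close>

lemma reach_of_times:
 assumes t: "t : I" "s : I" "t < s" and D: "m < D" "!!x. x : {t..s} ==> D < V x" and l: "0 < l"
  and T: "rT t n s D <= ereal l" "ereal l <= rS t n s D"
 shows "reach t l s"
proof -
 have Dt: "D < V t" using D(2) t(3) by simp
 from t(1) D(1) Dt obtain alpha beta where tp: "alpha : I" "beta : I" "alpha < t" "t < beta" "V alpha = D" "V beta = D"
  "!!s. alpha < s ==> s < beta ==> D < V s" "b_star a b f t D = ereal beta" "a_star a b f t D = ereal alpha"
  by (rule turning) (rule that; assumption)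
 have sbeta: "s < beta" using D(2)[of beta] tp(4,6) by (cases "beta <= s") auto
 note eq = rTS_eq[OF tp(8,9,1-4)]
 define w0 where "w0 = (if even n then sqrt (V t - D) else - sqrt (V t - D))"
 have w0: "V t - w0\<^sup>2 = D" "w0 ~= 0" "even n ==> 0 < w0" "odd n ==> w0 < 0" using Dt by (auto simp: w0_def)
 obtain tau w where S: "sol {0..l} tau w" "tau 0 = t" "w 0 = w0"
 proof (rule sol_exists_confined[OF tp(1,2), of t l w0])
  fix Y' tau w assume "0 <= Y'" "sol {0..Y'} tau w" "tau 0 = t" "w 0 = w0"
  thus "tau Y' : {alpha..beta}" using confined[of Y' tau w Y' D alpha beta] w0(1) tp by simp
 qed (use tp l in auto)
 have "s <= tau l"
 proof (cases "even n")
  case True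
  then obtain k where k: "n = 2 * k" by (elim evenE)
  show ?thesis
   by (rule excursion[OF S(1) _ _ _ _ _ tp(2) sbeta tp(6,1,5,7)])
    (use S w0 True l tp t T eq(1,2) k in auto)
 next
  case False
  then obtain k where k: "n = Suc (2 * k)" by (auto elim: oddE)
  have "0 <= T_in D alpha beta alpha s k" by (auto simp: T_in_def intro!: add_nonneg_nonneg ereal_0_le_mult)
  then obtain L where L: "hint f D alpha t = ereal L" "L <= l"
   using T(1) eq(3)[of k s] k hint_nonneg[of D alpha t]
   by (cases "hint f D alpha t"; cases "T_in D alpha beta alpha s k") auto
  have tl: "D < V x" if "alpha < x" "x < tau 0" for x using tp(4) tp(7)[of x] S(2) that by simp
  have hl: "0 <= L" "tau L = alpha" "w L = 0" "0 < dV alpha"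
   by (rule half_left[where L = L, OF S(1) _ _ tp(1) _ tp(5) tl]; use S w0 False tp L in simp)+
  have "s <= tau (L + (l - L))"
  proof (rule excursion[OF sol_shift[OF S(1) hl(1)] _ _ _ _ _ tp(2) sbeta tp(6,1,5,7)])
   show "T_in D alpha beta (tau (L + 0)) s k <= ereal (l - L)"
    using T(1) eq(3)[of k s] k L hl by (cases "T_in D alpha beta alpha s k") auto
   show "ereal (l - L) <= T_out D alpha beta (tau (L + 0)) s k"
    using T(2) eq(4)[of k s] k L hl by (cases "T_out D alpha beta alpha s k") auto
  qed (use hl L tp t in auto)
  thus ?thesis by simp
 qed
 thus ?thesis unfolding reach_def using S w0(1) D(1) by blast
qed

text \<open>The converse of \<open>reach_of_times\<close>. The lower bound \<open>c\<close> on half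
  a period limits the number of turns before \<open>l\<close>; a start that falls is reduced to one
  at rest in \<open>alpha\<close>.\<close>

lemma times_of_sol:
 assumes S: "sol {0..l} tau w" "tau 0 = t" "s < tau l" and t: "t : I" "s : I" "t < s" and l: "0 < l"
  and D: "V t - (w 0)\<^sup>2 = D" "m < D" "D < V t"
  and c: "0 < c" "ereal c <= W_int a b f t D"
 obtains n where "rT t n s D <= ereal l" "ereal l <= rS t n s D"
proof -
 from t(1) D(2,3) obtain alpha beta where tp: "alpha : I" "beta : I" "alpha < t" "t < beta" "V alpha = D" "V beta = D"
  "!!s. alpha < s ==> s < beta ==> D < V s" "b_star a b f t D = ereal beta" "a_star a b f t D = ereal alpha"
  by (rule turning) (rule that; assumption)
 note eq = rTS_eq[OF tp(8,9,1-4)]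
 have sbeta: "s < beta" using confined[OF S(1), of l D alpha beta] S tp D l by auto
 have "W_int a b f t D = hint f D alpha beta"
  unfolding W_int_def L_int_def R_int_def tp(8,9)
  by (rule hint_add[symmetric]) (use tp in "auto intro!: I_bounds")
 with c have c': "ereal c <= hint f D alpha beta" by simp
 obtain N where N: "l / c < real N" using reals_Archimedean2 by blast
 have lN: "x < real N * c" if "x <= l" for x using N c(1) that by (simp add: field_simps)
 note conv = excursion_conv[OF c(1) c' tp(2) sbeta tp(6,1,5)]
 have "w 0 ~= 0" using D by auto
 then consider "0 < w 0" | "w 0 < 0" by linarith
 thus thesis
 proof cases
  case 1
  have "EX k. T_in D alpha beta (tau 0) s k <= ereal l & ereal l <= T_out D alpha beta (tau 0) s k"
   by (rule conv[OF _ S(1)]) (use 1 S D l tp t lN[OF order_refl] in auto)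
  thus thesis using that eq S(2) by metis
 next
  case 2
  have tl: "D < V x" if "alpha < x" "x < tau 0" for x using tp(4) tp(7)[of x] S(2) that by simp
  have "~ ereal l <= hint f D alpha t"
   using run_left_upto(2)[OF S(1) _ tp(1), of l] 2 S D l tp(3) tl t(3) by auto
  then obtain L where L: "hint f D alpha t = ereal L" "L <= l"
   using hint_nonneg[of D alpha t] by (cases "hint f D alpha t") auto
  have hl: "0 <= L" "tau L = alpha" "w L = 0" "0 < dV alpha"
   by (rule half_left[where L = L, OF S(1) _ _ tp(1) _ tp(5) tl]; use S D 2 tp L in simp)+
  have "EX k. T_in D alpha beta (tau (L + 0)) s k <= ereal (l - L) & ereal (l - L) <= T_out D alpha beta (tau (L + 0)) s k"
   by (rule conv[OF _ sol_shift[OF S(1) hl(1)]]) (use hl L S tp t lN[of "l - L"] in auto)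
  then obtain k where k: "T_in D alpha beta alpha s k <= ereal (l - L)" "ereal (l - L) <= T_out D alpha beta alpha s k"
   using hl by auto
  have "rT t (Suc (2 * k)) s D <= ereal l" "ereal l <= rS t (Suc (2 * k)) s D"
   using k L unfolding eq by (cases "T_in D alpha beta alpha s k"; auto; fail)
    (use k L in \<open>cases "T_out D alpha beta alpha s k"; auto simp: eq\<close>)
  thus thesis by (rule that)
 qed
qed

lemma reach_mono:
 assumes "reach t l s" "s' <= s"
 shows "reach t l s'"
proof -
 obtain tau w where "sol {0..l} tau w" "tau 0 = t" "s <= tau l" "m < V t - (w 0)\<^sup>2"
  using assms(1) unfolding reach_def by blast
 thus ?thesis unfolding reach_def using assms(2) by (intro exI[of _ tau] exI[of _ w]) auto
qed

text \<open>All velocities up to the larger of the two given ones have energies above some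
  \<open>D0 > m\<close>, so their trajectories stay between the turning points of \<open>D0\<close>.
  No trajectory escapes, the end point is continuous in the velocity, and the intermediate value
  theorem replaces the shooting argument.\<close>

lemma conn_between:
 assumes t: "t0 : I" and l: "0 < l" and up: "reach t0 l t1" and down: "well.reach (- b) (- a) (mirror f) m (- t0) l (- t1)"
 shows "conn t0 t1 l"
proof -
 interpret R: well "- b" "- a" "mirror f" m by (rule well_reflect)
 obtain tau1 w1 where S1: "sol {0..l} tau1 w1" "tau1 0 = t0" "t1 <= tau1 l" "m < V t0 - (w1 0)\<^sup>2"
  using up unfolding reach_def by blast
 obtain tau2 w2 where S2: "sol {0..l} tau2 w2" "tau2 0 = t0" "tau2 l <= t1" "m < V t0 - (w2 0)\<^sup>2"
 proof -
  obtain tau' w' where "R.sol {0..l} tau' w'" "tau' 0 = - t0" "- t1 <= tau' l" "m < invsq (mirror f) (- t0) - (w' 0)\<^sup>2"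
   using down unfolding R.reach_def by blast
  thus thesis using that[OF sol_reflectD] by (simp add: invsq_reflect)
 qed
 define Q where "Q = max \<bar>w1 0\<bar> \<bar>w2 0\<bar>"
 have "Q\<^sup>2 = (w1 0)\<^sup>2 | Q\<^sup>2 = (w2 0)\<^sup>2" by (auto simp: Q_def max_def)
 hence "m < V t0 - Q\<^sup>2" using S1(4) S2(4) by auto
 then obtain D0 where D0: "m < D0" "D0 < V t0 - Q\<^sup>2" using dense by blast
 have D0': "D0 < V t0" using D0(2) by (smt (verit) zero_le_power2)
 from t D0(1) D0' obtain alpha beta where tp: "alpha : I" "beta : I" "alpha < t0" "t0 < beta" "V alpha = D0" "V beta = D0"
  by (rule turning) (rule that; assumption)
 obtain u v where uv: "u < alpha" "beta < v" "{u..v} <= I"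
  using extend_interval[OF tp(1,2)] tp by (metis less_imp_le less_trans)
 obtain tau w L where fl: "ALL p. tau p 0 = t0" "ALL p. w p 0 = p" "ALL p Y. continuous_on {0..Y} (tau p)" "0 <= L"
  "ALL p p' y. 0 <= y --> \<bar>tau p y - tau p' y\<bar> <= exp (L * y) * \<bar>p - p'\<bar>"
  "ALL p:{- Q..Q}. ALL Y. (ALL y:{0..Y}. tau p y : {u..v}) --> sol {0..Y} (tau p) (w p)"
 proof -
  have uv': "u <= v" "t0 : {u..v}" "0 <= Q" using uv tp by (auto simp: Q_def)
  show thesis using flow_family[OF uv'(1) uv(3) uv'(2,3)] by (elim exE conjE) (rule that; assumption)
 qed
 have S: "sol {0..l} (tau p) (w p)" if p: "p : {- Q..Q}" for p
 proof (rule traj_confined[OF _ uv(1,2)])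
  show "traj u v (tau p) (w p)" unfolding traj_def using fl(3,6) p by blast
  show "tau p 0 : {alpha..beta}" using fl(1) tp by simp
  fix y assume y: "0 <= y" "y <= l" "sol {0..y} (tau p) (w p)"
  have "p\<^sup>2 <= Q\<^sup>2" using p by (intro power2_le_iff_abs_le[THEN iffD2]) (auto simp: abs_le_iff)
  hence D: "D0 < V t0 - p\<^sup>2" using D0 by simp
  have "~ beta < tau p y" using sol_cross(1)[OF y(3), of 0 beta] y tp fl(1,2) D by auto
  moreover have "~ tau p y < alpha" using sol_cross_left(1)[OF y(3), of 0 alpha] y tp fl(1,2) D by auto
  ultimately show "tau p y : {alpha..beta}" by auto
 qed
 have wQ: "w1 0 : {- Q..Q}" "w2 0 : {- Q..Q}" by (auto simp: Q_def)
 have e1: "tau (w1 0) l = tau1 l" by (rule sol_unique_0(1)[OF S[OF wQ(1)] S1(1)]) (use fl S1 l in auto)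
 have e2: "tau (w2 0) l = tau2 l" by (rule sol_unique_0(1)[OF S[OF wQ(2)] S2(1)]) (use fl S2 l in auto)
 have "continuous_on {- Q..Q} (%p. tau p l)"
 proof (rule lipschitz_on_continuous_on)
  show "(exp (L * l))-lipschitz_on {- Q..Q} (%p. tau p l)"
   by (rule lipschitz_onI) (use fl(5) l in "auto simp: dist_real_def")
 qed
 hence "connected ((%p. tau p l) ` {- Q..Q})" by (intro connected_continuous_image) auto
 hence "t1 : (%p. tau p l) ` {- Q..Q}"
  using connectedD_interval[of _ "tau2 l" "tau1 l" t1] e1 e2 wQ S1(3) S2(3) by (metis imageI)
 then obtain p where "p : {- Q..Q}" "tau p l = t1" by auto
 thus ?thesis unfolding conn_def using S fl(1) by blast
qed

end

section \<open>The limits in Condition (R)\<close>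

context warp
begin

lemma to_upper_facts: "to_upper b ~= bot" "s : I ==> eventually (%x. x : I & s <= x) (to_upper b)"
proof -
 show "to_upper b ~= bot"
  by (cases b) (use b_not_MInf in "auto simp: to_upper_def trivial_limit_at_left_real")
 show "eventually (%x. x : I & s <= x) (to_upper b)" if "s : I"
  unfolding eventually_to_upper[OF b_not_MInf]
  using that right_mem[OF that] by (intro exI[of _ s]) (auto simp: base_mem)
qed

text \<open>Every point of \<open>I\<close> is eventually passed along \<open>to_upper b\<close>, so
  a monotone function converges to its supremum. Without convergence \<open>Lim\<close> would be an
  unspecified value.\<close>

lemma Lim_to_upper_mono:
 fixes F :: "real => ereal"
 assumes "!!s s'. s : I ==> s' : I ==> s <= s' ==> F s <= F s'"
 shows "Lim (to_upper b) F = (SUP s\<in>I. F s)"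
proof (rule tendsto_Lim[OF to_upper_facts(1)], rule order_tendstoI)
 fix c assume "c < (SUP s\<in>I. F s)"
 then obtain s where s: "s : I" "c < F s" by (auto simp: less_SUP_iff)
 show "eventually (%x. c < F x) (to_upper b)"
  using to_upper_facts(2)[OF s(1)] by eventually_elim (use assms s in "auto intro: less_le_trans")
next
 fix c assume c: "(SUP s\<in>I. F s) < c"
 obtain s where "s : I" using I_nonempty by blast
 from to_upper_facts(2)[OF this] show "eventually (%x. F x < c) (to_upper b)"
  by eventually_elim (use c in "auto intro: le_less_trans[OF SUP_upper]")
qed

lemma Lim_to_upper_antimono:
 fixes F :: "real => ereal"
 assumes "!!s s'. s : I ==> s' : I ==> s <= s' ==> F s' <= F s"
 shows "Lim (to_upper b) F = (INF s\<in>I. F s)"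
proof (rule tendsto_Lim[OF to_upper_facts(1)], rule order_tendstoI)
 fix c assume "(INF s\<in>I. F s) < c"
 then obtain s where s: "s : I" "F s < c" by (auto simp: INF_less_iff)
 show "eventually (%x. F x < c) (to_upper b)"
  using to_upper_facts(2)[OF s(1)] by eventually_elim (use assms s in "auto intro: le_less_trans")
next
 fix c assume c: "c < (INF s\<in>I. F s)"
 obtain s where "s : I" using I_nonempty by blast
 from to_upper_facts(2)[OF this] show "eventually (%x. c < F x) (to_upper b)"
  by eventually_elim (use c in "auto intro: less_le_trans[OF _ INF_lower]")
qed

end

context well
begin

lemma rT_mono:
 assumes "t : I" "s : I" "s' : I" "s <= s'" "D < V t"
 shows "rT t n s D <= rT t n s' D" "rS t n s' D <= rS t n s D"
proof -
 have "- b_star (- b) (- a) (mirror f) (- t) D >= a"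
 proof -
  interpret R: warp "- b" "- a" "mirror f" by (rule warp_reflect)
  have "b_star (- b) (- a) (mirror f) (- t) D <= - a"
   using R.b_star_le[of "- t" D] assms(1) by (simp add: I_reflect)
  thus ?thesis by (metis ereal_minus_le_minus ereal_uminus_uminus)
 qed
 hence "a <= a_star a b f t D" using a_star_reflect[OF assms(1)] by simp
 hence "hint f D (a_star a b f t D) s <= hint f D (a_star a b f t D) s'"
  using assms by (intro hint_mono I_bounds) auto
 moreover have "hint f D t s <= hint f D t s'" using assms by (intro hint_mono I_bounds) auto
 ultimately show "rT t n s D <= rT t n s' D" by (auto simp: rT_def intro: add_left_mono)
 show "rS t n s' D <= rS t n s D"
  unfolding rS_def using assms b_star_le[OF assms(1), of D] by (intro add_left_mono hint_mono I_bounds) auto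
qed

lemma ev_below: "eventually (%D. m < D & (ALL x:{u..v}. D < V x)) (at_right m)" if "u : I" "v : I"
proof -
 have "eventually (%D. ALL x:{min u v..max u v}. D < V x) (nhds m)"
  by (rule V_lower_nhds) (use that sub_I[of "min u v" "max u v"] mV in "auto simp: min_def max_def split: if_splits")
 hence "eventually (%D. ALL x:{u..v}. D < V x) (at_right m)"
  by (auto simp: eventually_at_filter elim!: eventually_mono)
 thus ?thesis using eventually_at_right_less[of m] by eventually_elim auto
qed

lemma r_eq:
 assumes t: "t : I"
 shows "r_i a b f t n = (SUP s\<in>I. Liminf (at_right m) (rT t n s))"
  and "r_s a b f t n = (INF s\<in>I. Limsup (at_right m) (rS t n s))"
proof -
 have ev: "eventually (%D. D < V t) (at_right m)" using ev_below[OF t t] by eventually_elim auto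
 have "r_i a b f t n = Lim (to_upper b) (%s. Liminf (at_right m) (rT t n s))"
  by (simp add: r_i_def rT_def[abs_def] m_inf_eq)
 also have "... = (SUP s\<in>I. Liminf (at_right m) (rT t n s))"
  by (rule Lim_to_upper_mono, rule Liminf_mono) (use ev in "eventually_elim; use rT_mono(1)[OF t] in simp")
 finally show "r_i a b f t n = (SUP s\<in>I. Liminf (at_right m) (rT t n s))" .
 have "r_s a b f t n = Lim (to_upper b) (%s. Limsup (at_right m) (rS t n s))"
  by (simp add: r_s_def rS_def[abs_def] m_inf_eq)
 also have "... = (INF s\<in>I. Limsup (at_right m) (rS t n s))"
  by (rule Lim_to_upper_antimono, rule Limsup_mono) (use ev in "eventually_elim; use rT_mono(2)[OF t] in simp")
 finally show "r_s a b f t n = (INF s\<in>I. Limsup (at_right m) (rS t n s))" .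
qed

lemma rT_shift:
 assumes t: "t : I" "s : I" "s' : I" "t < s" "s <= s'" and D: "m < D" "!!x. x : {t..s'} ==> D < V x"
 shows "rT t n s' D = rT t n s D + hint f D s s'" "rS t n s D = rS t n s' D + hint f D s s'"
  "rT t n s D <= rS t n s D"
proof -
 have Dt: "D < V t" using D(2) t by simp
 from t(1) D(1) Dt obtain alpha beta where tp: "alpha : I" "beta : I" "alpha < t" "t < beta" "V alpha = D" "V beta = D"
  "!!s. alpha < s ==> s < beta ==> D < V s" "b_star a b f t D = ereal beta" "a_star a b f t D = ereal alpha"
  by (rule turning) (rule that; assumption)
 have sbeta: "s' < beta" using D(2)[of beta] tp(4,6) by (cases "beta <= s'") auto
 have 1: "hint f D t s' = hint f D t s + hint f D s s'" "hint f D alpha s' = hint f D alpha s + hint f D s s'"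
  "hint f D s beta = hint f D s s' + hint f D s' beta" "hint f D t beta = hint f D t s + hint f D s beta"
  "hint f D alpha beta = hint f D alpha s + hint f D s beta" "hint f D alpha beta = hint f D alpha t + hint f D t beta"
  by (rule hint_add; use t tp sbeta in "auto intro!: I_bounds")+
 show "rT t n s' D = rT t n s D + hint f D s s'" "rS t n s D = rS t n s' D + hint f D s s'"
  unfolding rT_def rS_def tp(8,9) 1(1,2,3) by (simp_all add: ac_simps)
 show "rT t n s D <= rS t n s D"
 proof (cases "n = 0")
  case True
  have "hint f D t s <= hint f D t beta + hint f D s beta"
   unfolding 1(4) by (simp add: add.assoc ereal_le_add_self)
  thus ?thesis using True by (simp add: rT_def rS_def E_int_def R_int_def tp(8) zero_ereal_def[symmetric])
 next
  case False
  define W where "W = W_int a b f t D"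
  have "W = hint f D alpha beta" using 1(6) by (simp add: W_def W_int_def L_int_def R_int_def tp(8,9))
  hence W: "hint f D alpha s <= W" "0 <= W" unfolding 1(5) by (simp_all add: ereal_le_add_self)
  have "ereal (real n) * W = ereal (real n - 1) * W + W"
   using W(2) False by (cases W) (auto simp: algebra_simps)
  moreover have "E_int a b f t n D + ereal (real n - 1) * W + hint f D alpha s
    <= E_int a b f t n D + ereal (real n - 1) * W + W + hint f D s beta"
   using W(1) by (metis add_left_mono add_increasing2 add.right_neutral add_mono hint_nonneg)
  ultimately show ?thesis using False by (simp add: rT_def rS_def tp(8,9) W_def[symmetric] ac_simps)
 qed
qed

text \<open>Moving from \<open>s'\<close> back to \<open>s\<close> gains at least
  \<open>g > 0\<close> for all energies near \<open>m\<close>, which turns the weak inequalities for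
  \<open>r_i\<close> and \<open>r_s\<close> into strict ones: some energy arrives before
  \<open>l\<close>, some energy departs after \<open>l\<close>. These may differ; on the segment
  between them either the second already arrives in time, or by continuity some energy arrives
  exactly at \<open>l\<close>.\<close>

lemma reach_R:
 assumes t: "t : I" "s : I" "t < s" and l: "0 < l" and R: "r_i a b f t n <= ereal l" "ereal l <= r_s a b f t n"
 shows "reach t l s"
proof -
 obtain s' where s': "s < s'" "s' : I" by (rule next_in_I[OF t(2)])
 obtain g where g: "hint f m s s' = ereal g" by (rule hint_finite[OF t(2) s'(2), of m]) (use s' mV sub_I[OF t(2) s'(2)] in auto)
 have Vs: "m < V x" if "x : base_interval s s'" for x
  using that by (intro mV I_between[OF t(2) s'(2)]) (auto simp: base_interval_def)
 have "0 < hint f m s s'" by (rule hint_pos[OF I_bounds(1)[OF t(2)] I_bounds(2)[OF s'(2)] _ Vs]) (use s' in simp)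
 hence g0: "0 < g" using g by simp
 define P where "P D \<longleftrightarrow> m < D & (ALL x:{t..s'}. D < V x)" for D
 have evP: "eventually P (at_right m)" unfolding P_def by (rule ev_below[OF t(1) s'(2)])
 have gap: "ereal g <= hint f D s s'" if "P D" for D
  unfolding g[symmetric]
  by (rule hint_mono_D) (use that t s' in "auto intro!: I_bounds simp: P_def base_interval_def")
 have sh: "rT t n s' D = rT t n s D + hint f D s s'" "rS t n s D = rS t n s' D + hint f D s s'" "rT t n s D <= rS t n s D"
  if "P D" for D
  by (rule rT_shift; use that t s' in "auto simp: P_def")+
 have "Liminf (at_right m) (rT t n s') <= ereal l"
  using R(1) SUP_upper[OF s'(2), of "%s. Liminf (at_right m) (rT t n s)"] unfolding r_eq[OF t(1)] by (rule order_trans[rotated])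
 have "EX D. P D & rT t n s D < ereal l"
 proof (rule ccontr)
  assume n: "~ ?thesis"
  have "eventually (%D. ereal (l + g) <= rT t n s' D) (at_right m)"
   using evP
  proof eventually_elim
   case (elim D)
   have "ereal l + ereal g <= rT t n s D + hint f D s s'" by (rule add_mono) (use n elim gap in "auto simp: not_less")
   thus ?case using sh(1)[OF elim] by simp
  qed
  hence "ereal (l + g) <= Liminf (at_right m) (rT t n s')" by (rule Liminf_bounded)
  hence "ereal (l + g) <= ereal l" using \<open>Liminf (at_right m) (rT t n s') <= ereal l\<close> by (rule order_trans)
  thus False using g0 by simp
 qed
 then obtain D1 where D1: "P D1" "rT t n s D1 < ereal l" by blast
 have ls: "ereal l <= Limsup (at_right m) (rS t n s')"
  using R(2) INF_lower[OF s'(2), of "%s. Limsup (at_right m) (rS t n s)"] unfolding r_eq[OF t(1)] by (rule order_trans)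
 have "EX D. P D & ereal l < rS t n s D"
 proof (rule ccontr)
  assume n: "~ ?thesis"
  have "eventually (%D. rS t n s' D <= ereal (l - g)) (at_right m)"
   using evP
  proof eventually_elim
   case (elim D)
   have "rS t n s' D + hint f D s s' <= ereal l" using n elim sh(2) by (auto simp: not_less)
   thus ?case using gap[OF elim] by (cases "rS t n s' D"; cases "hint f D s s'") auto
  qed
  hence "Limsup (at_right m) (rS t n s') <= ereal (l - g)" by (rule Limsup_bounded)
  hence "ereal l <= ereal (l - g)" using ls by (rule order_trans[rotated])
  thus False using g0 by simp
 qed
 then obtain D2 where D2: "P D2" "ereal l < rS t n s D2" by blast
 have "EX D. P D & rT t n s D <= ereal l & ereal l <= rS t n s D"
 proof (cases "rT t n s D2 <= ereal l")
  case True
  thus ?thesis using D2 by (auto intro: less_imp_le)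
 next
  case False
  have Pb: "P D" if "D : closed_segment D1 D2" for D
   using that D1(1) D2(1) by (auto simp: P_def closed_segment_eq_real_ivl split: if_splits)
  have "continuous_on (closed_segment D1 D2) (rT t n s)"
   unfolding continuous_on_def
  proof
   fix D assume "D : closed_segment D1 D2"
   hence "P D" by (rule Pb)
   hence "((%D. rT t n s D) \<longlongrightarrow> rT t n s D) (nhds D)"
    using t s' by (intro rT_cont) (auto simp: P_def)
   thus "(rT t n s \<longlongrightarrow> rT t n s D) (at D within closed_segment D1 D2)"
    by (rule tendsto_mono[rotated]) (simp add: at_within_def inf.coboundedI1)
  qed
  hence "connected (rT t n s ` closed_segment D1 D2)" by (rule connected_continuous_image) simp
  hence "ereal l : rT t n s ` closed_segment D1 D2"
   using D1(2) False connectedD_interval[of _ "rT t n s D1" "rT t n s D2"] by (metis ends_in_segment imageI less_imp_le nle_le)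
  then obtain D where "D : closed_segment D1 D2" "rT t n s D = ereal l" by auto
  thus ?thesis using Pb sh(3) by (metis order_refl)
 qed
 then obtain D where D: "P D" "rT t n s D <= ereal l" "ereal l <= rS t n s D" by blast
 thus ?thesis
  by (intro reach_of_times[OF t _ _ l D(2,3)]) (use s' in "auto simp: P_def")
qed

text \<open>The energy \<open>m\<close> passes \<open>s\<close> before \<open>l\<close> and does not
  get to \<open>b\<close> by then. An energy slightly above \<open>m\<close> inherits both, and its
  turning point lies far enough out for the case \<open>n = 0\<close>.\<close>

lemma reach_short:
 assumes t: "t : I" "s : I" "t < s" and l: "hint f m t s < ereal l" "ereal l < hint f m t b"
 shows "reach t l s"
proof -
 have l0: "0 < l" using l(1) hint_nonneg[of m t s] by (meson ereal_less(2) le_less_trans)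
 have tb: "a <= ereal t" using t by (auto intro!: I_bounds)
 obtain u v where uv: "ereal t < ereal u" "u < v" "ereal v < b" "\<forall>\<^sub>F D in nhds m. ereal l < hint f D u v"
  by (rule hint_lsc[OF tb order_refl _ _ l(2)]) (use l0 right_in_I[OF t(1)] in "auto intro: mV")
 have vI: "v : I" using right_mem[OF t(1) _ uv(3)] uv by simp
 have "((%D. hint f D t s) \<longlongrightarrow> hint f m t s) (nhds m)"
  by (rule hint_tendsto) (use t sub_I[OF t(1,2)] mV in auto)
 hence "\<forall>\<^sub>F D in nhds m. hint f D t s < ereal l" using l(1) by (rule order_tendstoD)
 with uv(4) have "\<forall>\<^sub>F D in nhds m. ereal l < hint f D u v & hint f D t s < ereal l" by eventually_elim simp
 hence "\<forall>\<^sub>F D in at_right m. ereal l < hint f D u v & hint f D t s < ereal l"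
  by (auto simp: eventually_at_filter elim!: eventually_mono)
 with ev_below[OF t(1) max_I[OF t(2) vI]]
 have "\<forall>\<^sub>F D in at_right m. (m < D & (ALL x:{t..max s v}. D < V x)) & ereal l < hint f D u v & hint f D t s < ereal l"
  by eventually_elim simp
 then obtain D where D: "m < D" "!!x. x : {t..max s v} ==> D < V x" "ereal l < hint f D u v" "hint f D t s < ereal l"
  using eventually_happens'[OF trivial_limit_at_right_real] by blast
 have Dt: "D < V t" using D(2) t by simp
 from t(1) D(1) Dt obtain beta where beta: "beta : I" "t < beta" "V beta = D" "b_star a b f t D = ereal beta"
  by (rule turning) (rule that; assumption)
 have vbeta: "v < beta" using D(2)[of beta] beta by (cases "beta <= v") (auto simp: le_max_iff_disj)
 show ?thesis
 proof (rule reach_of_times[OF t D(1) _ l0, of 0])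
  show "rT t 0 s D <= ereal l" using D(4) by (simp add: rT_def less_imp_le)
  have "ereal l <= hint f D u v" using D(3) by simp
  also have "... <= hint f D t beta" using t beta uv vbeta by (intro hint_mono I_bounds) auto
  also have "... <= rS t 0 s D"
   by (simp add: rS_def E_int_def R_int_def beta(4) zero_ereal_def[symmetric] ereal_le_add_self)
  finally show "ereal l <= rS t 0 s D" .
 qed (use D(2) in auto)
qed

end

context warp
begin

text \<open>With the energy below all values of \<open>V\<close> the velocity cannot vanish, and the
  mean value theorem fixes its sign.\<close>

lemma sol_no_turn:
 assumes S: "sol {0..l} tau w" and l: "0 < l" and lt: "tau 0 < tau l" and D: "V (tau 0) - (w 0)\<^sup>2 = D" "!!x. x : I ==> D < V x"
 shows "hint f D (tau 0) (tau l) = ereal l" "!!y. y : {0..l} ==> 0 < w y"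
proof -
 have nz: "w y ~= 0" if "y : {0..l}" for y
  using sol_D[OF S that, of 0] D(1) D(2)[OF solD(1)[OF S that]] l by auto
 obtain z where z: "z : {0<..<l}" "tau l - tau 0 = (l - 0) * (w z / V (tau z))"
 proof -
  have "EX z:{0<..<l}. tau l - tau 0 = (w z / V (tau z)) * (l - 0)"
   by (rule mvt_simple[OF l, of tau "%z. (*) (w z / V (tau z))"])
    (use solD(2)[OF S] in "simp add: has_field_derivative_def")
  thus thesis using that by (metis mult.commute)
 qed
 have "0 < w z / V (tau z)" using z(2) lt l by (smt (verit) mult_nonneg_nonpos)
 moreover have "0 < V (tau z)" using z(1) by (intro V_pos solD(1)[OF S]) auto
 ultimately have wz: "0 < w z" by (simp add: zero_less_divide_iff)
 show pos: "0 < w y" if y: "y : {0..l}" for y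
 proof (rule ccontr)
  assume "~ 0 < w y"
  hence "0 : w ` {0..l}"
   using connectedD_interval[OF connected_continuous_image[OF sol_continuous(2)[OF S] connected_Icc], of "w y" "w z" 0] y z wz
   by auto
  thus False using nz by force
 qed
 show "hint f D (tau 0) (tau l) = ereal l"
  using sol_time_closed[OF S _ pos, of 0] l D(1) by simp
qed

end

context well
begin

abbreviation "R_right t diam == real_Icc (r_i a b f t 0) diam <= (\<Union>n. real_Icc (r_i a b f t n) (r_s a b f t n))"

lemma rT0_Liminf:
 assumes "t : I" "s : I"
 shows "Liminf (at_right m) (rT t 0 s) = hint f m t s"
proof (rule lim_imp_Liminf)
 show "(rT t 0 s \<longlongrightarrow> hint f m t s) (at_right m)"
 proof (cases "t <= s")
  case True
  hence "((%D. hint f D t s) \<longlongrightarrow> hint f m t s) (nhds m)"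
   by (rule hint_tendsto) (use sub_I[OF assms] mV in auto)
  thus ?thesis
   unfolding rT_def[abs_def] by (simp add: tendsto_mono[rotated] at_within_def inf.coboundedI1)
 qed (simp add: rT_def[abs_def])
qed simp

text \<open>If the next point at hand is too far, the trajectory of energy \<open>m\<close> is
  followed for the time \<open>l / 2\<close>.\<close>

lemma small_step:
 assumes t: "t : I" and l: "0 < l"
 obtains s where "s : I" "t < s" "hint f m t s < ereal l"
proof -
 obtain v where v: "t < v" "v : I" by (rule next_in_I[OF t])
 have VD: "m < V x" if "t < x" "x < v" for x using that by (intro mV I_between[OF t v(2)]) auto
 show thesis
 proof (cases "hint f m t v < ereal l")
  case False
  define w0 where "w0 = sqrt (V t - m)"
  have w0: "0 < w0" "V t - w0\<^sup>2 = m" using mV[OF t] by (auto simp: w0_def)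
  have half: "ereal (l / 2) <= hint f m t v" using False l by (cases "hint f m t v") auto
  obtain tau w where S: "sol {0..l / 2} tau w" "tau 0 = t" "w 0 = w0"
   by (rule reach_right[OF t v(2,1), of w0 "l / 2"]) (use w0 VD l half in auto)
  have r: "tau (l / 2) : {t..v}" "hint f m t (tau (l / 2)) = ereal (l / 2)"
   using run_right_upto(2,3)[OF S(1) _ v(2), of "l / 2"] S w0 v(1) VD half l by auto
  hence "t < tau (l / 2)" using l by (cases "tau (l / 2) = t") auto
  thus thesis using that[of "tau (l / 2)"] r l I_between[OF t v(2)] by auto
 qed (use that v in blast)
qed

text \<open>If \<open>l\<close> is less than the time from \<open>t0\<close> to \<open>b\<close> at
  the energy \<open>m\<close>, an energy slightly above \<open>m\<close> is still on its way to
  \<open>b\<close>, and by \<open>nd\<close> it has \<open>t1\<close> behind it. Otherwise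
  \<open>l\<close> is at least \<open>r_i\<close> for \<open>n = 0\<close>, and the covering in
  Condition (R) supplies an \<open>n\<close>.\<close>

lemma reach_all:
 assumes t: "t0 : I" "t1 : I" and l: "0 < l" "ereal l <= diam" and R: "R_right t0 diam"
  and nd: "~ (t0 < t1 & ereal l <= hint f m t0 t1)"
 shows "reach t0 l t1"
proof (cases "ereal l < hint f m t0 b")
 case True
 show ?thesis
 proof (cases "t0 < t1")
  case lt: True
  thus ?thesis using nd True by (intro reach_short[OF t lt]) auto
 next
  case False
  obtain s where s: "s : I" "t0 < s" "hint f m t0 s < ereal l" by (rule small_step[OF t(1) l(1)])
  show ?thesis by (rule reach_mono[OF reach_short[OF t(1) s(1,2,3) True]]) (use False s in simp)
 qed
next
 case False
 have "r_i a b f t0 0 <= hint f m t0 b"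
  unfolding r_eq[OF t(1)]
 proof (rule SUP_least)
  fix s assume s: "s : I"
  show "Liminf (at_right m) (rT t0 0 s) <= hint f m t0 b"
   unfolding rT0_Liminf[OF t(1) s] using t(1) s by (intro hint_mono I_bounds) auto
 qed
 hence "l : real_Icc (r_i a b f t0 0) diam" using False l by (auto simp: real_Icc_def)
 then obtain n where n: "r_i a b f t0 n <= ereal l" "ereal l <= r_s a b f t0 n"
  using R by (auto simp: real_Icc_def)
 obtain s where s: "max t0 t1 < s" "s : I" by (rule next_in_I[OF max_I[OF t]])
 show ?thesis by (rule reach_mono[OF reach_R[OF t(1) s(2) _ l(1) n]]) (use s in auto)
qed

text \<open>If the direct passage at the energy \<open>m\<close> takes at least \<open>l\<close>,
  some energy \<open>D <= m\<close> takes exactly \<open>l\<close>. Otherwise both sides of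
  \<open>t1\<close> are reached at the time \<open>l\<close> with energies above \<open>m\<close>,
  and \<open>conn_between\<close> applies.\<close>

lemma R_imp_conn:
 assumes t: "t0 : I" "t1 : I" and l: "0 < l" "ereal l <= diam"
  and R: "R_right t0 diam" "well.R_right (- b) (- a) (mirror f) (- t0) diam"
 shows "conn t0 t1 l"
proof -
 interpret R: well "- b" "- a" "mirror f" m by (rule well_reflect)
 have t': "- t0 : R.I" "- t1 : R.I" using t by (simp_all add: I_reflect)
 have hr: "hint (mirror f) m (- t0) (- t1) = hint f m t1 t0"
  using hint_reflect[of "ereal t1" "ereal t0" m] t by (simp add: I_bounds)
 consider "t0 < t1 & ereal l <= hint f m t0 t1" | "t1 < t0 & ereal l <= hint f m t1 t0"
  | "~ (t0 < t1 & ereal l <= hint f m t0 t1)" "~ (- t0 < - t1 & ereal l <= hint (mirror f) m (- t0) (- t1))"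
  using hr by auto
 thus ?thesis
 proof cases
  case 1
  obtain tau w where "sol {0..l} tau w" "tau 0 = t0" "tau l = t1"
   by (rule direct_right[OF t _ l(1), of m]) (use 1 mV sub_I[OF t] in auto)
  thus ?thesis unfolding conn_def by blast
 next
  case 2
  obtain tau w where "R.sol {0..l} tau w" "tau 0 = - t0" "tau l = - t1"
   by (rule R.direct_right[OF t' _ l(1), of m]) (use 2 hr R.mV R.sub_I[OF t'] in auto)
  hence "R.conn (- t0) (- t1) l" unfolding R.conn_def by blast
  thus ?thesis by (simp add: conn_reflect)
 next
  case 3
  show ?thesis
   by (rule conn_between[OF t(1) l(1) reach_all[OF t l R(1) 3(1)] R.reach_all[OF t' l R(2) 3(2)]])
 qed
qed

text \<open>If \<open>l\<close> is in none of the intervals, then for each \<open>n\<close> no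
  energy close to \<open>m\<close> is near \<open>b\<close> at the time \<open>l\<close> after
  \<open>n\<close> turns. Only finitely many \<open>n\<close> matter, since every half period lasts
  at least \<open>w0\<close>; so one neighbourhood of \<open>b\<close> serves for all of them, and
  its points cannot be joined with \<open>t\<close> in a time close to \<open>l\<close>.\<close>

lemma conn_imp_R:
 assumes t: "t : I" and conn: "!!u l. u : I ==> 0 < l ==> ereal l < diam ==> conn t u l"
 shows "R_right t diam"
proof
 fix l assume "l : real_Icc (r_i a b f t 0) diam"
 hence l: "r_i a b f t 0 <= ereal l" "ereal l <= diam" by (auto simp: real_Icc_def)
 have lim0: "hint f m t s <= r_i a b f t 0" if "s : I" for s
  unfolding r_eq[OF t] rT0_Liminf[OF t that, symmetric] using that by (rule SUP_upper)
 show "l : (\<Union>n. real_Icc (r_i a b f t n) (r_s a b f t n))"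
 proof (rule ccontr)
  assume "~ ?thesis"
  hence no: "ereal l < r_i a b f t n | r_s a b f t n < ereal l" for n
   by (auto simp: real_Icc_def not_le)
  \<comment> \<open>With this, \<open>l\<close> outside the interval for \<open>n = 0\<close> and at
    least its left end forces \<open>r_i < l\<close> strictly, which leaves room for a time slightly
    below \<open>l\<close>.\<close>
  have "r_i a b f t 0 <= r_s a b f t 0"
   unfolding r_eq[OF t]
  proof (rule INF_greatest, rule SUP_least)
   fix s s' assume s: "s : I" "s' : I"
   obtain u where u: "max t (max s s') < u" "u : I" by (rule next_in_I[OF max_I[OF t max_I[OF s]]])
   have ev: "eventually (%D. m < D & (ALL x:{t..u}. D < V x)) (at_right m)" by (rule ev_below[OF t u(2)])
   have "Liminf (at_right m) (rT t 0 s') <= Liminf (at_right m) (rS t 0 s)"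
   proof (rule Liminf_mono)
    show "eventually (%D. rT t 0 s' D <= rS t 0 s D) (at_right m)"
     using ev
    proof eventually_elim
     case (elim D)
     have "rT t 0 s' D <= rT t 0 u D" using elim t s u by (intro rT_mono) auto
     also have "... <= rS t 0 u D" by (rule rT_shift(3)[OF t u(2,2)]) (use elim u in auto)
     also have "... <= rS t 0 s D" using elim t s u by (intro rT_mono) auto
     finally show ?case .
    qed
   qed
   also have "... <= Limsup (at_right m) (rS t 0 s)" by (rule Liminf_le_Limsup) simp
   finally show "Liminf (at_right m) (rT t 0 s') <= Limsup (at_right m) (rS t 0 s)" .
  qed
  hence l0: "r_i a b f t 0 < ereal l" using no[of 0] l(1) by auto
  have "EX s:I. ereal l < Liminf (at_right m) (rT t n s) | Limsup (at_right m) (rS t n s) < ereal l" for n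
   using no[of n] unfolding r_eq[OF t] less_SUP_iff INF_less_iff by blast
  then obtain sig where sig: "!!n. sig n : I"
   "!!n. ereal l < Liminf (at_right m) (rT t n (sig n)) | Limsup (at_right m) (rS t n (sig n)) < ereal l"
   by metis
  \<comment> \<open>A bound \<open>c\<close> strictly below \<open>l\<close> is kept for the
    departure times, because the contradiction is drawn at a time \<open>l' < l\<close>. For the
    arrival times \<open>l\<close> itself will do.\<close>
  have "EX c<l. eventually (%D. ALL s:I. sig n <= s --> ereal l < rT t n s D | rS t n s D < ereal c) (at_right m)" for n
   using sig(2)[of n]
  proof
   have evt: "eventually (%D. D < V t) (at_right m)" using ev_below[OF t t] by eventually_elim auto
   {
    assume "ereal l < Liminf (at_right m) (rT t n (sig n))"
    hence "eventually (%D. ereal l < rT t n (sig n) D) (at_right m)" by (rule less_LiminfD)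
    with evt have "eventually (%D. ALL s:I. sig n <= s --> ereal l < rT t n s D | rS t n s D < ereal (l - 1)) (at_right m)"
     by eventually_elim (use rT_mono(1)[OF t sig(1)] in "auto intro: less_le_trans")
    thus ?thesis by (intro exI[of _ "l - 1"]) simp
   }
   assume "Limsup (at_right m) (rS t n (sig n)) < ereal l"
   then obtain c where c: "Limsup (at_right m) (rS t n (sig n)) < ereal c" "ereal c < ereal l" using ereal_dense2 by blast
   hence "eventually (%D. rS t n (sig n) D < ereal c) (at_right m)" by (intro Limsup_lessD)
   with evt have "eventually (%D. ALL s:I. sig n <= s --> ereal l < rT t n s D | rS t n s D < ereal c) (at_right m)"
    by eventually_elim (use rT_mono(2)[OF t sig(1)] in "blast intro: le_less_trans")
   thus ?thesis using c(2) by auto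
  qed
  hence "ALL n. EX c. c < l &
    eventually (%D. ALL s:I. sig n <= s --> ereal l < rT t n s D | rS t n s D < ereal c) (at_right m)" by simp
  from choice[OF this] obtain c where c': "ALL n. c n < l &
    eventually (%D. ALL s:I. sig n <= s --> ereal l < rT t n s D | rS t n s D < ereal (c n)) (at_right m)" ..
  note c = c'[rule_format, THEN conjunct1] c'[rule_format, THEN conjunct2]
  obtain u where u: "t < u" "u : I" by (rule next_in_I[OF t])
  have Vtu: "m < V x" if "x : base_interval t u" for x
   using that by (intro mV I_between[OF t u(2)]) (auto simp: base_interval_def)
  obtain w0 where w0: "hint f m t u = ereal w0" by (rule hint_finite[OF t u(2), of m]) (use u mV sub_I[OF t u(2)] in auto)
  have w0pos: "0 < w0" using hint_pos[OF I_bounds(1)[OF t] I_bounds(2)[OF u(2)] _ Vtu] u w0 by simp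
  \<comment> \<open>A trajectory that has made more than \<open>N + 1\<close> turns has spent more
    than \<open>l\<close> on them.\<close>
  obtain N where N: "l / w0 < real N" using reals_Archimedean2 by blast
  define s where "s = Max (insert u (sig ` {..Suc N}))"
  have s: "s : I" "t < s" "!!n. n <= Suc N ==> sig n <= s"
  proof -
   have "s : insert u (sig ` {..Suc N})" unfolding s_def by (rule Max_in) auto
   thus "s : I" using sig(1) u by auto
   have "u <= s" unfolding s_def by (rule Max_ge) auto
   thus "t < s" using u by simp
   show "sig n <= s" if "n <= Suc N" for n unfolding s_def by (rule Max_ge) (use that in auto)
  qed
  have us: "u <= s" unfolding s_def by (rule Max_ge) auto
  define c' where "c' = Max (c ` {..Suc N})"
  have c': "c' < l" "!!n. n <= Suc N ==> c n <= c'" using c(1) by (auto simp: c'_def)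
  have "eventually (%D. ALL n:{..Suc N}. ALL s:I. sig n <= s --> ereal l < rT t n s D | rS t n s D < ereal (c n)) (at_right m)"
   by (rule eventually_ball_finite) (use c(2) in auto)
  with ev_below[OF t s(1)]
  have "eventually (%D. (m < D & (ALL x:{t..s}. D < V x)) &
    (ALL n:{..Suc N}. ALL s:I. sig n <= s --> ereal l < rT t n s D | rS t n s D < ereal (c n))) (at_right m)"
   by eventually_elim simp
  then obtain e where e: "m < e" "!!D. m < D ==> D < e ==> (ALL x:{t..s}. D < V x) &
    (ALL n:{..Suc N}. ALL s:I. sig n <= s --> ereal l < rT t n s D | rS t n s D < ereal (c n))"
   unfolding eventually_at_right_field by blast
  obtain s' where s': "s < s'" "s' : I" "ereal (V s') < ereal e"
   by (rule m_b_lessD[OF _ s(1), of "ereal e"]) (use mb e in simp)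
  \<comment> \<open>The time \<open>l'\<close> must exceed all departure bounds and the time of
    direct passage at the energy \<open>m\<close>. It is strictly below \<open>l\<close> because
    connectedness is assumed only for times below the diameter, which \<open>l\<close> may
    equal.\<close>
  have "max (ereal c') (r_i a b f t 0) < ereal l" using c' l0 by simp
  then obtain l' where l': "max (ereal c') (r_i a b f t 0) < ereal l'" "ereal l' < ereal l" using ereal_dense2 by blast
  have "hint f m t s' <= r_i a b f t 0" by (rule lim0[OF s'(2)])
  hence hl: "hint f m t s' < ereal l'" using l' by (auto intro: le_less_trans)
  have l'0: "0 < l'" using hl hint_nonneg[of m t s'] by (meson ereal_less(2) le_less_trans)
  have "ereal l' < diam" using l'(2) l(2) by (rule less_le_trans)
  then obtain tau w where S: "sol {0..l'} tau w" "tau 0 = t" "tau l' = s'"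
   using conn[OF s'(2) l'0] unfolding conn_def by blast
  define D where "D = V t - (w 0)\<^sup>2"
  have lt: "tau 0 < tau l'" using S s s' by simp
  have "D <= V s'" using sol_D[OF S(1), of l' 0] S l'0 by (simp add: D_def) (metis diff_ge_0_iff_ge zero_le_power2)
  hence De: "D < e" using s'(3) by simp
  \<comment> \<open>With \<open>D <= m\<close> the trajectory would never turn and would be at
    \<open>s'\<close> already after a time of at most \<open>hint f m t s' < l'\<close>.\<close>
  have mD: "m < D"
  proof (rule ccontr)
   assume "~ m < D"
   hence DV: "D < V x" if "x : I" for x using mV[OF that] by simp
   have "hint f D t s' = ereal l'" using sol_no_turn(1)[OF S(1) l'0 lt _ DV] S by (simp add: D_def)
   moreover have "hint f D t s' <= hint f m t s'"
    by (rule hint_mono_D) (use \<open>~ m < D\<close> t s' s mV I_between[OF t s'(2)] in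
     \<open>auto intro!: I_bounds simp: base_interval_def\<close>)
   ultimately show False using hl by simp
  qed
  note eD = e(2)[OF mD De]
  have Dt: "D < V t" using eD s by auto
  have DV: "D < V x" if "x : base_interval t u" for x
   using eD that us by (auto simp: base_interval_def)
  have W: "ereal w0 <= W_int a b f t D"
  proof -
   from t mD Dt obtain alpha beta where beta: "beta : I" "V beta = D" "t < beta" "b_star a b f t D = ereal beta"
    by (rule turning) (rule that; assumption)
   have "u <= beta" using eD beta us by (cases "beta < u") force+
   hence "hint f D t u <= R_int a b f t D"
    unfolding R_int_def beta(4) using t beta by (intro hint_mono I_bounds) auto
   also have "... <= W_int a b f t D" by (simp add: W_int_def L_int_def add_increasing)
   finally have "hint f D t u <= W_int a b f t D" .
   moreover have "hint f m t u <= hint f D t u"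
    by (rule hint_mono_D[OF I_bounds(1)[OF t] I_bounds(2)[OF u(2)] _ DV]) (use mD in auto)
   ultimately show ?thesis using w0 by simp
  qed
  obtain n where n: "rT t n s D <= ereal l'" "ereal l' <= rS t n s D"
   by (rule times_of_sol[OF S(1,2) _ t s(1,2) l'0 _ mD Dt w0pos W]) (use S s' D_def in auto)
  have "n <= Suc N"
  proof (cases "n = 0")
   case False
   have "ereal (real n - 1) * ereal w0 <= ereal (real n - 1) * W_int a b f t D"
    using W False by (intro ereal_mult_left_mono) auto
   also have "... <= rT t n s D"
    using False by (simp add: rT_def E_int_def R_int_def L_int_def add_increasing add_increasing2)
   finally have "(real n - 1) * w0 <= l" using n(1) l'(2) by (simp add: order_trans[of _ "rT t n s D"] less_imp_le)
    (meson ereal_less_eq(3) less_imp_le order_trans)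
   hence "real n - 1 <= l / w0" using w0pos by (simp add: field_simps)
   thus ?thesis using N by linarith
  qed simp
  hence "ereal l < rT t n s D | rS t n s D < ereal (c n)" "c n <= c'" using eD s c'(2) by auto
  thus False
  proof (elim disjE)
   assume "ereal l < rT t n s D"
   thus False using n(1) l'(2) by (cases "rT t n s D") auto
  next
   assume "c n <= c'" "rS t n s D < ereal (c n)"
   hence "rS t n s D < ereal l'" using l'(1) by (metis ereal_less_eq(3) less_le_trans less_trans max.strict_boundedE)
   thus False using n(2) by simp
  qed
 qed
qed

section \<open>Reflection of Condition (R) and the equivalence with solvability\<close>

lemma l_reflect:
 assumes t: "t : I"
 shows "l_i a b f t n = r_i (- b) (- a) (mirror f) (- t) n" "l_s a b f t n = r_s (- b) (- a) (mirror f) (- t) n"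
proof -
 interpret R: well "- b" "- a" "mirror f" m by (rule well_reflect)
 have t': "- t : R.I" using t by (simp add: I_reflect)
 have Lim: "Lim (to_lower a) F = Lim (to_upper (- a)) G" if "!!s. s : I ==> F s = G (- s)" for F G :: "real => ereal"
 proof -
  have "eventually (%s. s : I) (to_lower a)"
   using R.to_upper_facts(2)[OF t'] unfolding to_upper_reflect eventually_filtermap
   by eventually_elim (simp add: I_reflect)
  hence "(F \<longlongrightarrow> l) (to_lower a) \<longleftrightarrow> (G \<longlongrightarrow> l) (to_upper (- a))" for l
   unfolding to_upper_reflect filterlim_filtermap by (intro tendsto_cong) (auto elim!: eventually_mono simp: that)
  thus ?thesis unfolding t2_space_class.Lim_def by simp
 qed
 have ev: "eventually (%D. D < V t) (at_right m)" using ev_below[OF t t] by eventually_elim auto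
 have eq: "G_int a b f t n D = E_int (- b) (- a) (mirror f) (- t) n D"
  "W_int a b f t D = W_int (- b) (- a) (mirror f) (- t) D"
  "hint f D s t = hint (mirror f) D (- t) (- s)"
  "hint f D s (b_star a b f t D) = hint (mirror f) D (a_star (- b) (- a) (mirror f) (- t) D) (- s)"
  "hint f D (a_star a b f t D) s = hint (mirror f) D (- s) (b_star (- b) (- a) (mirror f) (- t) D)"
  if D: "D < V t" and s: "s : I" for D s
 proof -
  note h = hint_reflect'(1,3)[OF t D]
  show "G_int a b f t n D = E_int (- b) (- a) (mirror f) (- t) n D"
   "W_int a b f t D = W_int (- b) (- a) (mirror f) (- t) D"
   by (simp_all add: G_int_def E_int_def W_int_def R_int_def L_int_def h add.commute)
  show "hint f D s t = hint (mirror f) D (- t) (- s)"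
   using hint_reflect[OF I_bounds(1)[OF s] I_bounds(2)[OF t], of D] by simp
  show "hint f D s (b_star a b f t D) = hint (mirror f) D (a_star (- b) (- a) (mirror f) (- t) D) (- s)"
   using hint_reflect[OF I_bounds(1)[OF s] b_star_le[OF t], of D D] R.a_star_reflect[OF t', of D] by simp
  have "a <= a_star a b f t D"
   using R.b_star_le[OF t', of D] a_star_reflect[OF t, of D] by (metis ereal_minus_le_minus ereal_uminus_uminus)
  thus "hint f D (a_star a b f t D) s = hint (mirror f) D (- s) (b_star (- b) (- a) (mirror f) (- t) D)"
   using hint_reflect[OF _ I_bounds(2)[OF s], of "a_star a b f t D" D] a_star_reflect[OF t, of D] by simp
 qed
 show "l_i a b f t n = r_i (- b) (- a) (mirror f) (- t) n"
  unfolding l_i_def r_i_def m_inf_reflect m_inf_eq real_of_ereal.simps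
  by (rule Lim, rule Liminf_eq, rule eventually_mono[OF ev]) (simp add: eq)
 show "l_s a b f t n = r_s (- b) (- a) (mirror f) (- t) n"
  unfolding l_s_def r_s_def m_inf_reflect m_inf_eq real_of_ereal.simps
  by (rule Lim, rule Limsup_eq, rule eventually_mono[OF ev]) (simp add: eq)
qed

lemma condition_R_iff:
 "condition_R a b f diam \<longleftrightarrow> (ALL t:I. R_right t diam & well.R_right (- b) (- a) (mirror f) (- t) diam)"
 unfolding condition_R_def using mV by (simp add: m_inf_eq ma mb l_reflect)

lemma condition_R_iff_conn:
 "condition_R a b f diam \<longleftrightarrow> (ALL t:I. ALL u:I. ALL l. 0 < l & ereal l < diam --> conn t u l)" (is "_ \<longleftrightarrow> ?C")
 and condition_R_conn: "condition_R a b f diam ==> t : I ==> u : I ==> 0 < l ==> ereal l <= diam ==> conn t u l"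
proof -
 interpret R: well "- b" "- a" "mirror f" m by (rule well_reflect)
 show *: "conn t u l" if "condition_R a b f diam" "t : I" "u : I" "0 < l" "ereal l <= diam" for t u l
  using that unfolding condition_R_iff by (intro R_imp_conn) auto
 have "condition_R a b f diam" if C: ?C
  unfolding condition_R_iff
 proof (intro ballI conjI)
  fix t assume t: "t : I"
  show "R_right t diam" by (rule conn_imp_R[OF t]) (use C t in auto)
  have t': "- t : R.I" using t by (simp add: I_reflect)
  show "R.R_right (- t) diam"
  proof (rule R.conn_imp_R[OF t'])
   fix u l assume "u : R.I" "0 < l" "ereal l < diam"
   hence "conn t (- u) l" using C t by (simp add: I_reflect)
   thus "R.conn (- t) u l" using conn_reflect[of t "- u" l] by simp
  qed
 qed
 thus "condition_R a b f diam \<longleftrightarrow> ?C" using * by (auto intro: less_imp_le)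
qed

end

context warp
begin

lemma close_some:
 "rel_min_b a b f --> close_b a b f (SOME c. close_b a b f c)"
 "rel_min_b (- b) (- a) (mirror f) --> close_b (- b) (- a) (mirror f) (- (SOME c. close_a a b f c))"
proof -
 show "rel_min_b a b f --> close_b a b f (SOME c. close_b a b f c)"
  using rel_min_b_close by (auto intro: someI_ex)
 interpret R: warp "- b" "- a" "mirror f" by (rule warp_reflect)
 show "rel_min_b (- b) (- a) (mirror f) --> close_b (- b) (- a) (mirror f) (- (SOME c. close_a a b f c))"
 proof
  assume "rel_min_b (- b) (- a) (mirror f)"
  then obtain c where "close_b (- b) (- a) (mirror f) c" using R.rel_min_b_close by blast
  hence "close_a a b f (- c)" by (simp add: close_a_reflect)
  thus "close_b (- b) (- a) (mirror f) (- (SOME c. close_a a b f c))"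
   unfolding close_a_reflect[symmetric] by (rule someI)
 qed
qed

lemma conn_if_C_or_R:
 assumes CR: "condition_C a b f diam | condition_R a b f diam" and t: "t : I" "u : I" and l: "0 < l" "ereal l <= diam"
 shows "conn t u l"
 using CR
proof
 assume C: "condition_C a b f diam"
 interpret R: warp "- b" "- a" "mirror f" by (rule warp_reflect)
 show ?thesis
 proof (rule C_imp_conn[OF _ _ _ _ t l])
  show "Cb diam (SOME c. close_b a b f c)" "R.Cb diam (- (SOME c. close_a a b f c))"
   using C unfolding condition_C_iff by auto
  show "rel_min_b a b f --> close_b a b f (SOME c. close_b a b f c)"
   by (rule close_some(1))
  show "rel_min_b (- b) (- a) (mirror f) --> close_b (- b) (- a) (mirror f) (- (SOME c. close_a a b f c))"
   by (rule close_some(2))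
 qed
next
 assume R: "condition_R a b f diam"
 hence e: "ALL x:I. m_inf a b f < ereal (V x)" "m_a a f = m_inf a b f" "m_b b f = m_inf a b f"
  unfolding condition_R_def by auto
 have mu: "ereal mu = m_b b f" using e t by (intro mu_eq[OF t(1)]) auto
 have "mu < V x" if "x : I" for x using that e by (intro mu_less_iff(1)[OF mu, THEN iffD1]) simp
 then interpret well a b f mu
  by unfold_locales (use e mu in simp_all)
 show ?thesis by (rule condition_R_conn[OF R t l])
qed

text \<open>If \<open>V > m\<close> everywhere and \<open>m_a = m_b = m\<close>, the time conditions
  are equivalent to (R). In all other cases a failure of (C) at either end produces a point that
  cannot be joined to itself in some time below the diameter.\<close>

lemma C_or_R_if_conn:
 assumes conn: "!!t u l. t : I ==> u : I ==> 0 < l ==> ereal l < diam ==> conn t u l"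
 shows "condition_C a b f diam | condition_R a b f diam"
proof (cases "(ALL x:I. m_inf a b f < ereal (V x)) & m_a a f = m_inf a b f & m_b b f = m_inf a b f")
 case True
 obtain t where t: "t : I" using I_nonempty by blast
 have mu: "ereal mu = m_b b f" using True t by (intro mu_eq[OF t]) auto
 have "mu < V x" if "x : I" for x using that True by (intro mu_less_iff(1)[OF mu, THEN iffD1]) simp
 then interpret well a b f mu
  by unfold_locales (use True mu in simp_all)
 show ?thesis using conn condition_R_iff_conn[of diam] by blast
next
 case ne: False
 interpret R: warp "- b" "- a" "mirror f" by (rule warp_reflect)
 have "Cb diam (SOME c. close_b a b f c)"
 proof (rule ccontr)
  assume n: "~ ?thesis"
  have "rel_min_b a b f --> close_b a b f (SOME c. close_b a b f c)"
   by (rule close_some(1))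
  from n this ne obtain t l where "t : I" "0 < l" "ereal l < diam" "~ conn t t l" by (rule not_Cb_not_conn)
  thus False using conn by blast
 qed
 moreover have "R.Cb diam (- (SOME c. close_a a b f c))"
 proof (rule ccontr)
  assume n: "~ ?thesis"
  have cl: "rel_min_b (- b) (- a) (mirror f) --> close_b (- b) (- a) (mirror f) (- (SOME c. close_a a b f c))"
   by (rule close_some(2))
  have "~ ((ALL x:R.I. m_inf (- b) (- a) (mirror f) < ereal (invsq (mirror f) x)) &
    m_a (- b) (mirror f) = m_inf (- b) (- a) (mirror f) & m_b (- a) (mirror f) = m_inf (- b) (- a) (mirror f))"
  proof
   assume *: "(ALL x:R.I. m_inf (- b) (- a) (mirror f) < ereal (invsq (mirror f) x)) &
    m_a (- b) (mirror f) = m_inf (- b) (- a) (mirror f) & m_b (- a) (mirror f) = m_inf (- b) (- a) (mirror f)"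
   have "m_inf a b f < ereal (V x)" if "x : I" for x
    using *[THEN conjunct1, rule_format, of "- x"] that by (simp add: I_reflect invsq_reflect m_inf_reflect)
   thus False using * ne m_a_reflect[of a f] m_a_reflect[of "- b" "mirror f"] by (simp add: m_inf_reflect)
  qed
  from n cl this obtain t l where "t : R.I" "0 < l" "ereal l < diam" "~ R.conn t t l" by (rule R.not_Cb_not_conn)
  thus False using conn[of "- t" "- t" l] conn_reflect[of "- t" "- t" l] by (simp add: I_reflect)
 qed
 ultimately show ?thesis unfolding condition_C_iff by blast
qed

subsection \<open>Causal curves and geodesics\<close>

text \<open>Strictness comes from the compact middle third, where the integrands are continuous.
  Near the ends \<open>V - D'\<close> may vanish, so only the weak inequality is used there;
  \<open>fin\<close> keeps the strict inequality alive when the parts are added.\<close>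

lemma hint_strict_mono_D:
 assumes t: "t : I" "u : I" "t < u" and D: "D < D'" "!!x. t < x ==> x < u ==> D' < V x" and fin: "hint f D' t u ~= \<infinity>"
 shows "hint f D t u < hint f D' t u"
proof -
 define p q where "p = (2 * t + u) / 3" and "q = (t + 2 * u) / 3"
 have pq: "t < p" "p < q" "q < u" using t(3) by (auto simp: p_def q_def)
 have I: "a <= ereal t" "ereal u <= b" using t by (auto intro!: I_bounds)
 have add: "hint f E t u = hint f E t p + hint f E p q + hint f E q u" for E
 proof -
  have "hint f E t u = hint f E t q + hint f E q u" by (rule hint_add) (use I pq in auto)
  moreover have "hint f E t q = hint f E t p + hint f E p q"
   by (rule hint_add) (use I pq in \<open>auto intro: order_trans[of _ "ereal u"]\<close>)
  ultimately show ?thesis by simp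
 qed
 have sub: "{p..q} <= I" using sub_I[OF t(1,2)] pq by auto
 have DV: "D' < V x" "D < V x" if "x : {p..q}" for x using D(1) D(2)[of x] that pq by auto
 have "integral {p..q} (h D) < integral {p..q} (h D')"
 proof (rule integral_less_real)
  show "h D x < h D' x" if "x : {p<..<q}" for x
  proof -
   have "D' < V x" "0 < f x" using D(2)[of x] that pq sub f_pos[of x] by (auto simp: subset_iff)
   thus ?thesis using D(1) unfolding h_def by (intro divide_strict_left_mono mult_strict_left_mono mult_pos_pos) auto
  qed
 qed (use pq in "auto intro!: h_continuous_on sub DV")
 hence "hint f D p q < hint f D' p q"
  using hint_compact[OF _ sub DV(2)] hint_compact[OF _ sub DV(1)] pq by simp
 moreover have "hint f D t p <= hint f D' t p" "hint f D q u <= hint f D' q u"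
  by (rule hint_mono_D; use I pq D in \<open>auto simp: base_interval_def intro: order_trans[of _ "ereal u"] order_trans[of a "ereal t"]\<close>)+
 moreover have "A + B + C < A' + B' + C'" if le: "A <= A'" "B < B'" "C <= C'" "A' + B' + C' ~= \<infinity>" "0 <= A" "0 <= B" "0 <= C"
  for A B C A' B' C' :: ereal
 proof -
  obtain p' q' r' where e: "A' = ereal p'" "B' = ereal q'" "C' = ereal r'"
   using le by (cases A'; cases B'; cases C') auto
  obtain p where "A = ereal p" using le e by (cases A) auto
  moreover obtain q where "B = ereal q" using le e by (cases B) auto
  moreover obtain r where "C = ereal r" using le e by (cases C) auto
  ultimately show ?thesis using le e by simp
 qed
 ultimately show ?thesis using fin unfolding add[of D] add[of D'] by simp
qed

text \<open>A competing trajectory of energy \<open>D'\<close> may turn, but in any case its direct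
  time is at most \<open>l\<close>, whence \<open>D' <= D\<close> by strict monotonicity. So it does
  not turn after all, its direct time equals \<open>l\<close>, and \<open>D' = D\<close>.\<close>

lemma causal_sol_right:
 assumes t: "t0 : I" "t1 : I" "t0 < t1" and l: "0 < l" "ereal l <= hint f 0 t0 t1"
 shows "EX tau w. sol {0..l} tau w & tau 0 = t0 & tau l = t1 & V t0 - (w 0)\<^sup>2 <= 0 &
  (ALL tau' w'. sol {0..l} tau' w' & tau' 0 = t0 & tau' l = t1 --> (ALL y:{0..l}. tau' y = tau y))"
proof -
 obtain tau w where S: "sol {0..l} tau w" "tau 0 = t0" "tau l = t1" "V t0 - (w 0)\<^sup>2 <= 0"
  by (rule direct_right[OF t l(1) _ l(2)]) (use V_pos sub_I[OF t(1,2)] in auto)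
 define D where "D = V t0 - (w 0)\<^sup>2"
 have DV: "D < V x" if "x : I" for x using V_pos[OF that] S(4) by (simp add: D_def)
 have n: "hint f D t0 t1 = ereal l" "0 < w 0"
  using sol_no_turn[OF S(1) l(1) _ _ DV] S t(3) l(1) by (auto simp: D_def)
 have "tau' y = tau y" if S': "sol {0..l} tau' w'" "tau' 0 = t0" "tau' l = t1" and y: "y : {0..l}" for tau' w' y
 proof -
  define D' where "D' = V t0 - (w' 0)\<^sup>2"
  have c: "D' < V x" if "t0 < x" "x < t1" for x
   using sol_cross(1)[OF S'(1), of 0 x] S' l t that by (simp add: D'_def)
  have le: "hint f D' t0 t1 <= ereal l"
   using sol_cross(2)[OF S'(1), of 0] S' l t by (simp add: D'_def)
  hence "hint f D' t0 t1 ~= \<infinity>" by auto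
  hence "~ D < D'" using hint_strict_mono_D[OF t _ c, of D] n(1) le by auto
  hence D': "D' <= D" by simp
  have DV': "D' < V x" if "x : I" for x using DV[OF that] D' by simp
  have n': "hint f D' t0 t1 = ereal l" "0 < w' 0"
   using sol_no_turn[OF S'(1) l(1) _ _ DV'] S' t(3) l(1) by (auto simp: D'_def)
  have "~ D' < D"
  proof
   assume "D' < D"
   hence "hint f D' t0 t1 < hint f D t0 t1"
    by (rule hint_strict_mono_D[OF t]) (use DV n I_between[OF t(1,2)] in auto)
   thus False using n(1) n'(1) by simp
  qed
  hence "(w 0)\<^sup>2 = (w' 0)\<^sup>2" using D' by (simp add: D_def D'_def)
  hence "w' 0 = w 0" using n(2) n'(2) by (simp add: power2_eq_iff)
  thus ?thesis using sol_unique_0(1)[OF S'(1) S(1)] S' S y by simp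
 qed
 thus ?thesis using S by blast
qed

lemma causal_sol:
 assumes t: "t0 : I" "t1 : I" and l: "0 < l" "ereal l <= hint f 0 (min t0 t1) (max t0 t1)"
 shows "EX tau w. sol {0..l} tau w & tau 0 = t0 & tau l = t1 & V t0 - (w 0)\<^sup>2 <= 0 &
  (ALL tau' w'. sol {0..l} tau' w' & tau' 0 = t0 & tau' l = t1 --> (ALL y:{0..l}. tau' y = tau y))"
proof -
 consider "t0 < t1" | "t1 < t0" | "t0 = t1" by linarith
 thus ?thesis
 proof cases
  case 1
  thus ?thesis using causal_sol_right[OF t] l by (simp add: min_def max_def)
 next
  case 2
  interpret R: warp "- b" "- a" "mirror f" by (rule warp_reflect)
  have "hint (mirror f) 0 (- t0) (- t1) = hint f 0 t1 t0"
   using hint_reflect[of "ereal t1" "ereal t0" 0] t by (simp add: I_bounds)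
  hence "EX tau w. R.sol {0..l} tau w & tau 0 = - t0 & tau l = - t1 & invsq (mirror f) (- t0) - (w 0)\<^sup>2 <= 0 &
   (ALL tau' w'. R.sol {0..l} tau' w' & tau' 0 = - t0 & tau' l = - t1 --> (ALL y:{0..l}. tau' y = tau y))"
   using t l 2 by (intro R.causal_sol_right) (simp_all add: I_reflect min_def max_def)
  then obtain tau w where R: "R.sol {0..l} tau w" "tau 0 = - t0" "tau l = - t1" "invsq (mirror f) (- t0) - (w 0)\<^sup>2 <= 0"
   "ALL tau' w'. R.sol {0..l} tau' w' & tau' 0 = - t0 & tau' l = - t1 --> (ALL y:{0..l}. tau' y = tau y)"
   by (elim exE conjE) (rule that; assumption)
  have u: "ALL tau' w'. sol {0..l} tau' w' & tau' 0 = t0 & tau' l = t1 --> (ALL y:{0..l}. tau' y = - tau y)"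
  proof (intro allI impI ballI, elim conjE)
   fix tau' w' y assume *: "sol {0..l} tau' w'" "tau' 0 = t0" "tau' l = t1" "y : {0..l}"
   have "- tau' y = tau y"
    using R(5)[rule_format, of "%y. - tau' y" "%y. - w' y" y] sol_reflect[OF *(1)] *(2-4) by simp
   thus "tau' y = - tau y" by simp
  qed
  have "V t0 - (- w 0)\<^sup>2 <= 0" using R(4) by (simp add: invsq_def)
  thus ?thesis
   by (intro exI[of _ "%y. - tau y"] exI[of _ "%y. - w y"] conjI)
    (rule sol_reflectD[OF R(1)], simp add: R(2), simp add: R(3), assumption, rule u)
 qed (use l in simp)
qed

end

context convex_grw
begin

lemma vertical_non_spacelike:
 assumes "t0 : I" "t1 : I" "x : pts X"
 shows "non_spacelike_on G {0..1} (%t. (t0 + t * (t1 - t0), x))"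
 unfolding non_spacelike_on_def
proof
 fix t :: real assume t: "t : {0..1}"
 have "smooth_curve G {0..1} (%t. (t0 + t * (t1 - t0), x))"
  using vertical_geodesic[OF assms] by (simp add: geodesic_joins_def geodesic_def)
 moreover have "velocity_sq X (%t. x) {0..1} t = 0"
  using geodesic_joins_speed(1)[OF constant_geodesic assms(3,3) t] assms(3) by (simp add: rd_refl)
 ultimately show "velocity_sq G (%t. (t0 + t * (t1 - t0), x)) {0..1} t <= 0"
  using grw_velocity_sq[OF _ _ t, of "%t. (t0 + t * (t1 - t0), x)"] by simp
qed

text \<open>Over distinct fiber points a geodesic is determined by its trajectory and its
  parametrization. The former is unique by \<open>causal_sol\<close>, the latter because the
  integral \<open>P\<close> is strictly increasing.\<close>

lemma causal_geodesic:
 assumes t: "t0 : I" "t1 : I" and x: "x0 : pts X" "x1 : pts X"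
  and le: "ereal (rd x0 x1) <= hint f 0 (min t0 t1) (max t0 t1)"
 shows "EX gamma. only_geodesic_joining G gamma (t0, x0) (t1, x1) & non_spacelike_on G {0..1} gamma"
proof (cases "rd x0 x1 = 0")
 case True
 hence e: "x1 = x0" using rd_eq_0[OF x] by simp
 have "sig t = (t0 + t * (t1 - t0), x0)" if j: "geodesic_joins G sig (t0, x0) (t1, x0)" and t: "t : {0..1}" for sig t
  using j
 proof (cases rule: grw_geodesic_cases)
  case vertical
  thus ?thesis using t by blast
 next
  case graph
  thus ?thesis using True e by simp
 qed
 thus ?thesis
  unfolding only_geodesic_joining_def e
  using vertical_geodesic[OF t x(1)] vertical_non_spacelike[OF t x(1)] by blast
next
 case False
 define l where "l = rd x0 x1"
 have l: "0 < l" using False rd_nonneg[OF x] by (simp add: l_def)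
 obtain tau w where S: "sol {0..l} tau w" "tau 0 = t0" "tau l = t1" "V t0 - (w 0)\<^sup>2 <= 0"
  and u: "!!tau' w' y. sol {0..l} tau' w' ==> tau' 0 = t0 ==> tau' l = t1 ==> y : {0..l} ==> tau' y = tau y"
  using causal_sol[OF t l] le unfolding l_def by blast
 obtain gamma k where g: "geodesic_joins G gamma (t0, x0) (t1, x1)" "0 < k"
  "!!t. t : {0..1} ==> velocity_sq G gamma {0..1} t = k * (V t0 - (w 0)\<^sup>2)"
  using sol_imp_geodesic[OF x l[unfolded l_def] S(1)[unfolded l_def]] S(2,3) unfolding l_def by metis
 define P where "P r = integral {0..r} (%u. 1 / V (tau (l * u)))" for r
 obtain sig where sig: "geodesic_joins X sig x0 x1" by (rule the_geodesic[OF x])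
 have lu: "l * u : {0..l}" if "u : {0..1}" for u using that l mult_left_le[of u l] by auto
 have cont: "continuous_on {0..1} (%u. 1 / V (tau (l * u)))"
 proof (intro continuous_on_divide continuous_on_const ballI)
  have "continuous_on {0..1} (%u. tau (l * u))"
   by (rule continuous_on_compose2[OF sol_continuous(1)[OF S(1)] continuous_on_mult_left[OF continuous_on_id]])
    (use lu in auto)
  thus "continuous_on {0..1} (%u. V (tau (l * u)))"
   by (rule continuous_on_compose2[OF V_cont[OF order_refl]]) (use solD(1)[OF S(1) lu] in auto)
  show "V (tau (l * u)) ~= 0" if "u : {0..1}" for u using V_pos[OF solD(1)[OF S(1) lu[OF that]]] by simp
 qed
 have P: "P r < P s" if "0 <= r" "r < s" "s <= 1" for r s
 proof -
  have c: "continuous_on {0..s} (%u. 1 / V (tau (l * u)))" "continuous_on {r..s} (%u. 1 / V (tau (l * u)))"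
   by (rule continuous_on_subset[OF cont]; use that in auto)+
  have "P s = P r + integral {r..s} (%u. 1 / V (tau (l * u)))"
   unfolding P_def by (rule Henstock_Kurzweil_Integration.integral_combine[symmetric])
    (use that in "auto intro: integrable_continuous_real c")
  moreover have "integral {r..s} (%u. 0) < integral {r..s} (%u. 1 / V (tau (l * u)))"
   by (rule integral_less_real)
    (use that c V_pos[OF solD(1)[OF S(1) lu]] in auto)
  ultimately show ?thesis by simp
 qed
 have form: "EX phi. phi : {0..1} & P phi = t * P 1 & gamma' t = (tau (l * phi), sig phi)"
  if j: "geodesic_joins G gamma' (t0, x0) (t1, x1)" and t: "t : {0..1}" for gamma' t
  using j
 proof (cases rule: grw_geodesic_cases)
  case vertical
  thus ?thesis using False x by (simp add: rd_refl)
 next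
  case (graph tau' w' phi)
  have e: "tau' y = tau y" if "y : {0..l}" for y using u[of tau' w'] graph(2-4) that unfolding l_def by blast
  have "integral {0..r} (%u. 1 / V (tau' (l * u))) = P r" if "r : {0..1}" for r
   unfolding P_def by (rule integral_cong) (use e[OF lu] that in auto)
  hence "P (phi t) = t * P 1" using graph(7)[OF t] graph(5)[OF t] unfolding l_def[symmetric] by simp
  thus ?thesis using graph(5)[OF t] graph(6)[OF sig t] e[OF lu[OF graph(5)[OF t]]] unfolding l_def[symmetric] by auto
 qed
 have same: "gamma' t = gamma t" if j: "geodesic_joins G gamma' (t0, x0) (t1, x1)" and t: "t : {0..1}" for gamma' t
 proof -
  obtain phi where 1: "phi : {0..1}" "P phi = t * P 1" "gamma' t = (tau (l * phi), sig phi)" using form[OF j t] by blast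
  obtain psi where 2: "psi : {0..1}" "P psi = t * P 1" "gamma t = (tau (l * psi), sig psi)" using form[OF g(1) t] by blast
  have "phi = psi" using P[of phi psi] P[of psi phi] 1 2 by (cases phi psi rule: linorder_cases) auto
  thus ?thesis using 1 2 by simp
 qed
 have "k * (V t0 - (w 0)\<^sup>2) <= 0" using g(2) S(4) by (simp add: mult_nonneg_nonpos)
 thus ?thesis
  unfolding only_geodesic_joining_def non_spacelike_on_def
  by (intro exI[of _ gamma] conjI allI impI ballI g(1) same) (simp_all only: g(3))
qed

end

section \<open>Causal curves and the travel time at energy zero\<close>

lemma piece_around:
 assumes P: "finite P" "{0, 1} <= P" "P <= {0..1::real}" and x: "x : {0..1}"
 obtains s t where "s : P" "t : P" "s < t" "P \<inter> {s<..<t} = {}" "x : {s..t}"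
proof (cases "x = 1")
 case True
 define s where "s = Max (P - {1})"
 have f: "finite (P - {1})" "P - {1} ~= {}" using P by auto
 have "s : P - {1}" unfolding s_def by (rule Max_in[OF f])
 hence s: "s : P" "s < 1" using P(3) by (auto simp: less_le)
 moreover have "P \<inter> {s<..<1} = {}" using Max_ge[OF f(1)] by (force simp: s_def)
 ultimately show thesis using True P by (intro that[of s 1]) auto
next
 case False
 define s t where "s = Max {p : P. p <= x}" and "t = Min {p : P. x < p}"
 have f: "finite {p : P. p <= x}" "{p : P. p <= x} ~= {}" "finite {p : P. x < p}" "{p : P. x < p} ~= {}"
  using P x False by (auto simp: less_le)
 have s: "s : {p : P. p <= x}" unfolding s_def by (rule Max_in[OF f(1,2)])
 have t: "t : {p : P. x < p}" unfolding t_def by (rule Min_in[OF f(3,4)])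
 have "P \<inter> {s<..<t} = {}"
  using Max_ge[OF f(1)] Min_le[OF f(3)] unfolding s_def[symmetric] t_def[symmetric] by force
 thus thesis using s t by (intro that[of s t]) auto
qed

lemma piecewiseE:
 assumes "piecewise Q"
 obtains P where "finite P" "{0, 1} <= P" "P <= {0..1}"
  "ALL s:P. ALL t:P. s < t & P \<inter> {s<..<t} = {} --> Q {s..t}"
 using assms unfolding piecewise_def by (elim exE conjE) (rule that; assumption)

context convex_grw
begin

lemma velocity_sq_X_nonneg:
 assumes "xi t : pts X"
 shows "0 <= velocity_sq X xi S t"
 unfolding velocity_sq_def Let_def using chart_at[OF assms] by (intro met_nonneg) auto

lemma rd_le_curve_length:
 assumes "piecewise (%S. smooth_curve X S xi)" "!!t. t : {0..1} ==> xi t : pts X"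
 shows "rd (xi 0) (xi 1) <= curve_length X xi"
 unfolding riemannian_dist_def
proof (rule cInf_lower)
 have nn: "0 <= curve_length X gamma" if g: "piecewise (%S. smooth_curve X S gamma)" for gamma
 proof -
  obtain P where P: "finite P" "{0, 1} <= P" "P <= {0..1}"
   "ALL s:P. ALL t:P. s < t & P \<inter> {s<..<t} = {} --> smooth_curve X {s..t} gamma"
   by (rule piecewiseE[OF g])
  have "gamma t : pts X" if t: "t : {0..1}" for t
  proof -
   obtain s s' where s: "s : P" "s' : P" "s < s'" "P \<inter> {s<..<s'} = {}" "t : {s..s'}"
    by (rule piece_around[OF P(1-3) t])
   hence "smooth_curve X {s..s'} gamma" using P(4)[rule_format, OF s(1,2)] by simp
   thus ?thesis using s(5) unfolding smooth_curve_def by (auto simp: image_subset_iff)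
  qed
  hence "0 <= sqrt (velocity_sq X gamma {0..1} t)" if "t : {0..1}" for t
   using that by (simp add: velocity_sq_X_nonneg)
  \<comment> \<open>If the speed is not integrable, the integral has the default value 0, so the
    length is nonnegative in either case.\<close>
  thus ?thesis unfolding curve_length_def
   by (cases "(%t. sqrt (velocity_sq X gamma {0..1} t)) integrable_on {0..1}")
    (auto intro: Henstock_Kurzweil_Integration.integral_nonneg simp: not_integrable_integral)
 qed
 show "bdd_below {curve_length X gamma |gamma. piecewise (%S. smooth_curve X S gamma) & gamma 0 = xi 0 & gamma 1 = xi 1}"
  by (rule bdd_belowI[of _ 0]) (use nn in auto)
qed (use assms in blast)

text \<open>A future-pointing non-spacelike velocity has \<open>f * speed <= tau'\<close>, and
  \<open>h 0\<close> is \<open>1 / f\<close>. So the speed of the fiber component is dominated by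
  the derivative of the travel time at energy 0 along the curve.\<close>

lemma causal_curve_bound:
 assumes gamma: "future_causal_curve G gamma" "gamma 0 = (t0, x0)" "gamma 1 = (t1, x1)"
 shows "t0 <= t1" "ereal (rd x0 x1) <= hint f 0 t0 t1"
proof -
 define tau xi where "tau = (%t. fst (gamma t))" and "xi = (%t. snd (gamma t))"
 obtain P where P: "finite P" "{0, 1} <= P" "P <= {0..1}"
  "ALL s:P. ALL t:P. s < t & P \<inter> {s<..<t} = {} -->
   smooth_curve G {s..t} gamma & non_spacelike_on G {s..t} gamma & future_pointing_on G {s..t} gamma"
  by (rule piecewiseE[OF gamma(1)[unfolded future_causal_curve_def]])
 have sm: "smooth_curve X {s..t} xi" "continuous_on {s..t} tau" "!!r. r : {s..t} ==> tau r : I"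
  if "s : P" "t : P" "s < t" "P \<inter> {s<..<t} = {}" for s t
 proof -
  have "smooth_curve G {s..t} gamma" using P(4)[rule_format, OF that(1,2)] that(3,4) by simp
  note g = this[unfolded grw_smooth_curve_iff]
  show "smooth_curve X {s..t} xi" "continuous_on {s..t} tau" unfolding tau_def xi_def by (simp_all only: g)
  show "tau r : I" if "r : {s..t}" for r unfolding tau_def by (rule g[THEN conjunct1, rule_format, OF that])
 qed
 have xipw: "piecewise (%S. smooth_curve X S xi)"
  unfolding piecewise_def by (intro exI[of _ P] conjI ballI impI P(1-3), elim conjE, rule sm(1))
 have xip: "xi t : pts X" and tauI: "tau t : I" if t: "t : {0..1}" for t
 proof -
  obtain s s' where s: "s : P" "s' : P" "s < s'" "P \<inter> {s<..<s'} = {}" "t : {s..s'}"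
   by (rule piece_around[OF P(1-3) t])
  show "tau t : I" by (rule sm(3)[OF s])
  show "xi t : pts X" using sm(1)[OF s(1-4)] s(5) unfolding smooth_curve_def by (auto simp: image_subset_iff)
 qed
 define Q where "Q = {z : P \<times> P. fst z < snd z & P \<inter> {fst z<..<snd z} = {}}"
 have "continuous_on (\<Union>z\<in>Q. {fst z..snd z}) tau"
  by (rule continuous_on_closed_Union) (use P(1) sm(2) in "auto simp: Q_def")
 moreover have "{0..1} <= (\<Union>z\<in>Q. {fst z..snd z})"
 proof
  fix t :: real assume t: "t : {0..1}"
  obtain s s' where s: "s : P" "s' : P" "s < s'" "P \<inter> {s<..<s'} = {}" "t : {s..s'}"
   by (rule piece_around[OF P(1-3) t])
  thus "t : (\<Union>z\<in>Q. {fst z..snd z})" unfolding Q_def by (intro UN_I[of "(s, s')"]) auto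
 qed
 ultimately have c: "continuous_on {0..1} tau" by (rule continuous_on_subset)
 have "EX d. (tau has_real_derivative d) (at t) & 0 < d & sqrt (velocity_sq X xi {0..1} t) <= d * h 0 (tau t)"
  if t: "t : {0<..<1} - P" for t
 proof -
  have t': "t : {0..1}" using t by auto
  obtain s s' where s: "s : P" "s' : P" "s < s'" "P \<inter> {s<..<s'} = {}" "t : {s..s'}"
   by (rule piece_around[OF P(1-3) t'])
  have st: "s < t" "t < s'" using s t by (auto simp: less_le)
  have w: "at t within {s..s'} = at t" "at t within {0..1} = at t" using st t by (simp_all add: at_within_Icc_at)
  have g: "smooth_curve G {s..s'} gamma" "velocity_sq G gamma {s..s'} t <= 0" "future_pointing_on G {s..s'} gamma"
   using P(4)[rule_format, OF s(1,2)] s(3-5) by (auto simp: non_spacelike_on_def)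
  define d where "d = vector_derivative tau (at t within {s..s'})"
  have d: "(tau has_real_derivative d) (at t)"
   using grw_fst_derivative[OF g(1) s(3,5)] w(1) by (simp add: d_def tau_def)
  \<comment> \<open>At interior points of a piece, derivatives within the piece and within
    \<open>{0..1}\<close> are both two-sided, so this speed is the one that enters
    \<open>curve_length\<close>.\<close>
  have vs: "velocity_sq X xi {s..s'} t = velocity_sq X xi {0..1} t"
   by (simp add: velocity_sq_def velocity_def w)
  have i: "chart_at X (xi t) : ind X" "xi t : cdom X (chart_at X (xi t))" using chart_at[OF xip[OF t']] by auto
  have z: "met X (chart_at X (xi t)) (crd X (chart_at X (xi t)) (xi t)) v 0 = 0" for v
   using met_scale_right[OF i(1), of "crd X (chart_at X (xi t)) (xi t)" v 0 0] i(2) by simp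
  have ca: "chart_at G (gamma t) = chart_at X (xi t)" using chart_at_grw[of "gamma t"] tauI[OF t'] by (simp add: tau_def xi_def)
  have "met G (chart_at G (gamma t)) (crd G (chart_at G (gamma t)) (gamma t)) (velocity G (chart_at G (gamma t)) gamma {s..s'} t) (1, 0) < 0"
   using g(3) s(5) unfolding future_pointing_on_def Let_def by blast
  hence d0: "0 < d"
   using grw_velocity[OF g(1) s(3,5) i(1)] i(2) z
   unfolding ca grw_simps by (simp add: d_def tau_def xi_def)
  have ft: "0 < f (tau t)" by (rule f_pos[OF tauI[OF t']])
  have "(f (tau t))\<^sup>2 * velocity_sq X xi {0..1} t <= d\<^sup>2"
   using g(2) grw_velocity_sq[OF g(1) s(3,5)] vs by (simp add: d_def tau_def xi_def)
  hence "sqrt ((f (tau t))\<^sup>2 * velocity_sq X xi {0..1} t) <= d" using d0 by (intro real_le_lsqrt) auto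
  hence "f (tau t) * sqrt (velocity_sq X xi {0..1} t) <= d" using ft by (simp add: real_sqrt_mult)
  hence "sqrt (velocity_sq X xi {0..1} t) <= d / f (tau t)" using ft by (simp add: pos_le_divide_eq mult.commute)
  moreover have "h 0 (tau t) = 1 / f (tau t)"
   using ft by (simp add: h_def invsq_def real_sqrt_divide power2_eq_square)
  ultimately show ?thesis using d d0 by (intro exI[of _ d]) simp
 qed
 hence "ALL t:{0<..<1} - P. EX d. (tau has_real_derivative d) (at t) & 0 < d &
   sqrt (velocity_sq X xi {0..1} t) <= d * h 0 (tau t)" by (intro ballI)
 from bchoice[OF this] obtain d where d': "ALL t:{0<..<1} - P. (tau has_real_derivative d t) (at t) & 0 < d t &
   sqrt (velocity_sq X xi {0..1} t) <= d t * h 0 (tau t)" ..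
 note d = d'[rule_format]
 have e: "t0 = tau 0" "t1 = tau 1" "x0 = xi 0" "x1 = xi 1" using gamma by (simp_all add: tau_def xi_def)
 define g where "g t = sqrt (velocity_sq X xi {0..1} t)" for t
 have P01: "{0..1} - P = {0<..<1} - P" using P(2) by (auto simp: less_le)
 have "(d has_integral tau 1 - tau 0) {0..1}"
  by (rule fundamental_theorem_of_calculus_interior_strong[OF P(1)])
   (use d c in "auto simp: real_vector_derivative[symmetric]")
 \<comment> \<open>At the break points \<open>d\<close> is unspecified; its values there are
   overwritten before signs are compared.\<close>
 hence "((%t. if t : P then 0 else d t) has_integral tau 1 - tau 0) {0..1}"
  by (rule has_integral_spike_finite[OF P(1), rotated]) simp
 hence "0 <= tau 1 - tau 0"
 proof (rule has_integral_nonneg)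
  show "0 <= (if t : P then 0 else d t)" if "t : {0..1}" for t
   using d[of t] that unfolding P01[symmetric] by (cases "t : P") (simp_all add: less_imp_le)
 qed
 thus le: "t0 <= t1" by (simp add: e)
 obtain u v where uv: "u <= v" "tau ` {0..1} = {u..v}"
  using connected_compact_interval_1[THEN iffD1, of "tau ` {0..1}"] connected_continuous_image[OF c] compact_continuous_image[OF c]
  by (metis atLeastatMost_empty_iff connected_Icc compact_Icc image_is_empty zero_less_one_class.zero_le_one)
 have uvI: "{u..v} <= I" unfolding uv(2)[symmetric] using tauI by (rule image_subsetI)
 have hc: "continuous_on {u..v} (h 0)" by (rule h_continuous_on[OF uvI]) (use uvI V_pos in auto)
 have tauuv: "tau t : {u..v}" if "t : {0..1}" for t unfolding uv(2)[symmetric] using that by (rule imageI)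
 define F where "F t = integral {u..tau t} (h 0)" for t
 have Fd: "((%s. integral {u..s} (h 0)) has_real_derivative h 0 s) (at s within {u..v})" if "s : {u..v}" for s
  by (rule indefinite_integral_DERIV[OF hc that])
 have "((%t. d t * h 0 (tau t)) has_integral F 1 - F 0) {0..1}"
 proof (rule fundamental_theorem_of_calculus_interior_strong[OF P(1)])
  fix t assume t: "t : {0<..<1} - P"
  hence t': "t : {0..1}" by auto
  have "(F has_real_derivative h 0 (tau t) * d t) (at t within {0..1})"
   unfolding F_def
   by (rule DERIV_chain_within[where h = tau and T = "{u..v}", OF Fd[OF tauuv[OF t']] has_field_derivative_at_within[OF d[OF t, THEN conjunct1]]])
    (use uv in simp)
  thus "(F has_vector_derivative d t * h 0 (tau t)) (at t)"
   using t by (simp add: at_within_Icc_at real_vector_derivative[symmetric] mult.commute)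
 next
  have "continuous_on {u..v} (%s. integral {u..s} (h 0))"
   using Fd by (meson DERIV_continuous continuous_on_eq_continuous_within)
  thus "continuous_on {0..1} F" unfolding F_def by (rule continuous_on_compose2[OF _ c]) (use uv in simp)
 qed simp
 hence k: "((%t. if t : P then g t else d t * h 0 (tau t)) has_integral F 1 - F 0) {0..1}"
  by (rule has_integral_spike_finite[OF P(1), rotated]) simp
 have gk: "g t <= (if t : P then g t else d t * h 0 (tau t))" if "t : {0..1}" for t
  using d[of t] that unfolding P01[symmetric] g_def by (cases "t : P") simp_all
 have g0: "0 <= g t" if "t : {0..1}" for t using velocity_sq_X_nonneg[where xi = xi and t = t, OF xip[OF that]] by (simp add: g_def)
 \<comment> \<open>If the speed were not integrable, the length would be 0 by default, and the bound
   would hold since \<open>F 1 >= F 0\<close>.\<close>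
 have "curve_length X xi <= F 1 - F 0"
 proof (cases "g integrable_on {0..1}")
  case True
  hence "integral {0..1} g <= F 1 - F 0" using has_integral_le[OF integrable_integral k] gk by blast
  thus ?thesis by (simp add: curve_length_def g_def[abs_def])
 next
  case False
  hence "curve_length X xi = 0" by (simp add: curve_length_def g_def[abs_def] not_integrable_integral)
  moreover have "0 <= F 1 - F 0" by (rule has_integral_nonneg[OF k order_trans[OF g0 gk]])
  ultimately show ?thesis by simp
 qed
 moreover have "F 1 - F 0 = integral {t0..t1} (h 0)"
 proof -
  have "integral {u..t0} (h 0) + integral {t0..t1} (h 0) = integral {u..t1} (h 0)"
   by (rule Henstock_Kurzweil_Integration.integral_combine[OF _ le])
    (use tauuv[of 0] tauuv[of 1] in "auto simp: e intro!: integrable_continuous_real continuous_on_subset[OF hc]")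
  thus ?thesis by (simp add: F_def e)
 qed
 moreover have "{t0..t1} <= I" using uvI tauuv[of 0] tauuv[of 1] by (auto simp: e)
 hence "hint f 0 t0 t1 = ereal (integral {t0..t1} (h 0))" by (intro hint_compact[OF le]) (use V_pos in auto)
 ultimately show "ereal (rd x0 x1) <= hint f 0 t0 t1"
  using rd_le_curve_length[OF xipw xip] by (simp add: e)
qed

lemma rd_sym:
 assumes "p : pts X" "q : pts X"
 shows "rd p q = rd q p"
proof -
 obtain sig where sig: "geodesic_joins X sig p q" by (rule the_geodesic[OF assms])
 have im: "1 + (- 1) * t : {0..1}" if "t : {0..1}" for t :: real using that by auto
 note G = geodesic_reparametrize_affine[OF _ im, of sig]
 have "geodesic_joins X (%t. sig (1 + (- 1) * t)) q p" using G(1) sig by (simp add: geodesic_joins_def)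
 from geodesic_joins_speed(1)[OF this assms(2,1), of 0]
 have "(rd q p)\<^sup>2 = velocity_sq X sig {0..1} 1" using G(2)[of 0] sig by (simp add: geodesic_joins_def)
 also have "... = (rd p q)\<^sup>2" by (rule geodesic_joins_speed(1)[OF sig assms]) simp
 finally show ?thesis using rd_nonneg[OF assms] rd_nonneg[OF assms(2,1)] by simp
qed

lemma geodesic_joins_iff:
 assumes t: "t0 : I" "t1 : I" and x: "x0 : pts X" "x1 : pts X"
 shows "(EX gamma. geodesic_joins G gamma (t0, x0) (t1, x1)) \<longleftrightarrow> (0 < rd x0 x1 --> conn t0 t1 (rd x0 x1))" (is "?L \<longleftrightarrow> ?R")
proof
 assume ?L
 then obtain gamma where "geodesic_joins G gamma (t0, x0) (t1, x1)" by blast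
 thus ?R
 proof (cases rule: grw_geodesic_cases)
  case vertical
  thus ?thesis using x by (simp add: rd_refl)
 next
  case graph
  thus ?thesis unfolding conn_def by blast
 qed
next
 assume R: ?R
 show ?L
 proof (cases "0 < rd x0 x1")
  case True
  then obtain tau w where "sol {0..rd x0 x1} tau w" "tau 0 = t0" "tau (rd x0 x1) = t1" using R unfolding conn_def by blast
  thus ?thesis using sol_imp_geodesic[OF x True] by metis
 next
  case False
  hence "x0 = x1" using rd_eq_0[OF x] rd_nonneg[OF x] by simp
  thus ?thesis using vertical_geodesic[OF t x(1)] by blast
 qed
qed

lemma connected_iff:
 "geodesically_connected G \<longleftrightarrow> condition_C a b f (riemannian_diam X) | condition_R a b f (riemannian_diam X)"
proof -
 have le: "ereal (rd p q) <= riemannian_diam X" if "p : pts X" "q : pts X" for p q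
  unfolding riemannian_diam_def using that by (intro SUP_upper2[OF that(1)] SUP_upper2[OF that(2)]) simp
 have "geodesically_connected G \<longleftrightarrow>
  (ALL t0:I. ALL x0:pts X. ALL t1:I. ALL x1:pts X. EX gamma. geodesic_joins G gamma (t0, x0) (t1, x1))"
  unfolding geodesically_connected_def grw_simps by (simp only: ball_simps split_paired_Ball_Sigma | blast)+
 also have "... \<longleftrightarrow> (ALL x0:pts X. ALL x1:pts X. 0 < rd x0 x1 --> (ALL t0:I. ALL t1:I. conn t0 t1 (rd x0 x1)))"
  using geodesic_joins_iff by blast
 also have "... \<longleftrightarrow> condition_C a b f (riemannian_diam X) | condition_R a b f (riemannian_diam X)" (is "?L \<longleftrightarrow> ?R")
 proof
  assume L: ?L
  show ?R
  proof (rule C_or_R_if_conn)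
   fix t u l assume t: "t : I" "u : I" and l: "0 < l" "ereal l < riemannian_diam X"
   \<comment> \<open>The supremum in the diameter need not be attained, so distances are found for
     lengths strictly below it; \<open>C_or_R_if_conn\<close> asks for exactly these.\<close>
   obtain p q where pq: "p : pts X" "q : pts X" "l < rd p q"
    using l(2) unfolding riemannian_diam_def less_SUP_iff by auto
   obtain q' where "q' : pts X" "rd p q' = l" by (rule shorter_distances[OF pq(1,2), of l]) (use l pq in auto)
   thus "conn t u l" using L pq(1) t l(1) by blast
  qed
 next
  assume R: ?R
  show ?L using conn_if_C_or_R[OF R] le by blast
 qed
 finally show ?thesis .
qed

end

theorem theorem2:
  fixes X :: "('i, 'm::{t2_space, second_countable_topology}, 'e::euclidean_space) srmfd"
    and a b :: ereal
    and f :: "real \<Rightarrow> real"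
  assumes "riemannian_manifold X"
    and "pts X \<noteq> {}"
    and "connected (pts X)"
    and "a < b"
    and "smooth_on f (base_interval a b)"
    and "\<forall>\<tau>\<in>base_interval a b. f \<tau> > 0"
    and "strongly_convex X"
  shows "(\<forall>z\<in>pts (grw a b f X). \<forall>z'\<in>pts (grw a b f X). causally_related (grw a b f X) z z' \<longrightarrow>
            (\<exists>\<gamma>. only_geodesic_joining (grw a b f X) \<gamma> z z' \<and>
                 non_spacelike_on (grw a b f X) {0..1} \<gamma>)) \<and>
         (geodesically_connected (grw a b f X) \<longleftrightarrow>
            condition_C a b f (riemannian_diam X) \<or> condition_R a b f (riemannian_diam X))"
proof -
 interpret convex_grw X a b f
  by unfold_locales (use assms in auto)
 have "EX gamma. only_geodesic_joining G gamma z z' & non_spacelike_on G {0..1} gamma"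
  if z: "z : pts G" "z' : pts G" and c: "causally_related G z z'" for z z'
 proof -
  obtain t0 x0 t1 x1 where e: "z = (t0, x0)" "z' = (t1, x1)" by (cases z; cases z') auto
  have pts: "t0 : I" "t1 : I" "x0 : pts X" "x1 : pts X" using z by (auto simp: e)
  obtain gamma where gamma: "future_causal_curve G gamma" "(gamma 0 = z & gamma 1 = z') | (gamma 0 = z' & gamma 1 = z)"
   using c unfolding causally_related_def by blast
  have "ereal (rd x0 x1) <= hint f 0 (min t0 t1) (max t0 t1)"
   using gamma(2)
  proof
   assume "gamma 0 = z & gamma 1 = z'"
   thus ?thesis using causal_curve_bound[OF gamma(1), of t0 x0 t1 x1] by (simp add: e)
  next
   assume "gamma 0 = z' & gamma 1 = z"
   thus ?thesis using causal_curve_bound[OF gamma(1), of t1 x1 t0 x0] rd_sym[OF pts(3,4)] by (simp add: e)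
  qed
  thus ?thesis unfolding e by (rule causal_geodesic[OF pts])
 qed
 thus ?thesis using connected_iff by blast
qed

end
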